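(* Assume that $\phi$ is radial (i.e. $\phi(z)$ depends only on $|z|$). Then for any $\ell\in\mathbb{N}$ and any two $\ell$-tuples $\mathfrak{p}=(p_1,\dots,p_\ell)$ and $\mathfrak{q}=(q_1,\dots,q_\ell)$ of distinct points in $\mathbb{C}$, $$\int_{\mathrm{Conf}(\mathbb{C})}\Gamma_{\mathfrak{p},\mathfrak{q}}(\mathscr{X})\,d\mathbb{P}_\Pi^{\mathfrak{q}}(\mathscr{X})=\frac{\det_{i,j=1}^\ell(\Pi(p_i,p_j))}{\det_{i,j=1}^\ell(\Pi(q_i,q_j))}\prod_{1\le i<j\le\ell}\Big|\frac{q_i-q_j}{p_i-p_j}\Big|^2.$$
   Context: A configuration on $\mathbb{C}$ is a locally finite subset $\mathscr{X}\subset\mathbb{C}$; $\mathrm{Conf}(\mathbb{C})$ is the space of configurations with its Borel $\sigma$-algebra, generated by the counting variables of bounded Borel sets. $\lambda$ is Lebesgue measure on $\mathbb{C}$. $\phi:\mathbb{C}\to\mathbb{R}$ is a fixed $C^2$ function such that $m\le\Delta\phi\le M$ for some constants $m,M>0$ ($\Delta$ the Euclidean Laplacian); $d\lambda_\phi(z)=e^{-2\phi(z)}d\lambda(z)$. $\mathscr{F}_\phi$ is the Hilbert space of holomorphic functions on $\mathbb{C}$ belonging to $L^2(\mathbb{C},\lambda_\phi)$, and $\Pi$ is its reproducing kernel. For a kernel $K$ of an orthogonal projection on $L^2(\mathbb{C},\lambda_\phi)$, $\mathbb{P}_K$ is the determinantal point process whose $k$-th correlation function with respect to $\lambda_\phi$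 is $\det(K(x_i,x_j))_{i,j=1}^k$. Set $K^{q}(x,y)=K(x,y)-K(x,q)K(q,y)/K(q,q)$, and $K^{\mathfrak{q}}=(\cdots(K^{q_1})^{q_2}\cdots)^{q_\ell}$ for a tuple $\mathfrak{q}$ of distinct points. $\mathbb{P}_\Pi^{\mathfrak{q}}$ is the reduced Palm measure of $\mathbb{P}_\Pi$ at $\mathfrak{q}$; it equals $\mathbb{P}_{\Pi^{\mathfrak{q}}}$. For radial $\phi$, $\Gamma_{\mathfrak{p},\mathfrak{q}}(\mathscr{X})=\lim_{R\to\infty}\prod_{x\in\mathscr{X}:|x|\le R}\prod_{i=1}^\ell\big|\frac{x-p_i}{x-q_i}\big|^2$, the limit being taken in $L^1(\mathrm{Conf}(\mathbb{C}),\mathbb{P}_\Pi^{\mathfrak{q}})$, where it exists. *)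

theory Defs
  imports
    "HOL-Probability.Probability"
    "HOL-Complex_Analysis.Complex_Analysis"
    "Jordan_Normal_Form.Determinant"
begin

definition C1_fun :: "(complex \<Rightarrow> real) \<Rightarrow> bool" where
  "C1_fun f \<longleftrightarrow> (\<forall>z. f differentiable (at z)) \<and>
     (\<forall>v. continuous_on UNIV (\<lambda>z. frechet_derivative f (at z) v))"

definition C2_fun :: "(complex \<Rightarrow> real) \<Rightarrow> bool" where
  "C2_fun f \<longleftrightarrow> C1_fun f \<and> (\<forall>v. C1_fun (\<lambda>z. frechet_derivative f (at z) v))"

text \<open>Here \<open>Basis = {1, \<i>}\<close>, so this is the Euclidean Laplacian on the plane.\<close>

definition laplacian :: "(complex \<Rightarrow> real) \<Rightarrow> complex \<Rightarrow> real" where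
  "laplacian f z =
     (\<Sum>b\<in>Basis. frechet_derivative (\<lambda>w. frechet_derivative f (at w) b) (at z) b)"

definition radial :: "(complex \<Rightarrow> real) \<Rightarrow> bool" where
  "radial f \<longleftrightarrow> (\<forall>z w. cmod z = cmod w \<longrightarrow> f z = f w)"

definition lam :: "(complex \<Rightarrow> real) \<Rightarrow> complex measure" where
  "lam \<phi> = density lborel (\<lambda>z. ennreal (exp (- 2 * \<phi> z)))"


definition fock_space :: "(complex \<Rightarrow> real) \<Rightarrow> (complex \<Rightarrow> complex) set" where
  "fock_space \<phi> = {f. f holomorphic_on UNIV \<and> integrable (lam \<phi>) (\<lambda>z. (cmod (f z))\<^sup>2)}"

text \<open>
  With the inner product \<open>\<langle>f, g\<rangle> = \<integral> f \<cdot> cnj g\<close>, the kernel function at \<open>w\<close> is \<open>\<lambda>z. K z w\<close>.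
  These conditions determine \<open>K\<close> uniquely.
\<close>

definition is_reproducing_kernel ::
    "(complex \<Rightarrow> real) \<Rightarrow> (complex \<Rightarrow> complex \<Rightarrow> complex) \<Rightarrow> bool" where
  "is_reproducing_kernel \<phi> K \<longleftrightarrow>
     (\<forall>w. (\<lambda>z. K z w) \<in> fock_space \<phi>) \<and>
     (\<forall>f\<in>fock_space \<phi>. \<forall>w. f w = (\<integral>z. f z * cnj (K z w) \<partial>lam \<phi>))"


definition Conf :: "complex set set" where
  "Conf = {X. \<forall>B. bounded B \<longrightarrow> finite (X \<inter> B)}"

definition conf_space :: "complex set measure" where
  "conf_space = sigma Conf
     {{X \<in> Conf. card (X \<inter> B) = n} | B n. bounded B \<and> B \<in> sets borel}"

text \<open>
  A \<open>k\<close>-tuple is an extensional function on \<open>{..<k}\<close>, i.e. a point of the product space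
  \<open>\<Pi>\<^sub>M i\<in>{..<k}. borel\<close>.
\<close>

abbreviation tuple_space :: "nat \<Rightarrow> (nat \<Rightarrow> complex) measure" where
  "tuple_space k \<equiv> (\<Pi>\<^sub>M i\<in>{..<k}. borel)"

definition distinct_tuples :: "nat \<Rightarrow> complex set \<Rightarrow> (nat \<Rightarrow> complex) set" where
  "distinct_tuples k A = {x \<in> {..<k} \<rightarrow>\<^sub>E A. inj_on x {..<k}}"

text \<open>
  \<open>\<rho>\<close> is the \<open>k\<close>-th correlation function of \<open>P\<close> with respect to \<open>lam \<phi>\<close>; the integral over the
  counting measure is the sum of \<open>f\<close> over all \<open>k\<close>-tuples of distinct points of the configuration.
\<close>

definition has_correlation ::
    "(complex \<Rightarrow> real) \<Rightarrow> complex set measure \<Rightarrow> nat \<Rightarrow> ((nat \<Rightarrow> complex) \<Rightarrow> real) \<Rightarrow> bool" where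
  "has_correlation \<phi> P k \<rho> \<longleftrightarrow>
     (\<forall>f \<in> borel_measurable (tuple_space k).
        (\<integral>\<^sup>+X. (\<integral>\<^sup>+x. f x \<partial>count_space (distinct_tuples k X)) \<partial>P) =
        (\<integral>\<^sup>+x. f x * ennreal (\<rho> x) \<partial>(\<Pi>\<^sub>M i\<in>{..<k}. lam \<phi>)))"

definition kernel_det ::
    "(complex \<Rightarrow> complex \<Rightarrow> complex) \<Rightarrow> nat \<Rightarrow> (nat \<Rightarrow> complex) \<Rightarrow> complex" where
  "kernel_det K k x = Determinant.det (Matrix.mat k k (\<lambda>(i, j). K (x i) (x j)))"

text \<open>
  The kernel of an orthogonal projection is Hermitian and positive semidefinite, so that its
  \<^const>\<open>kernel_det\<close> is a nonnegative real number and taking \<^const>\<open>Re\<close> loses nothing.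
\<close>

definition is_dpp ::
    "(complex \<Rightarrow> real) \<Rightarrow> (complex \<Rightarrow> complex \<Rightarrow> complex) \<Rightarrow> complex set measure \<Rightarrow> bool" where
  "is_dpp \<phi> K P \<longleftrightarrow> prob_space P \<and> sets P = sets conf_space \<and>
     (\<forall>k. has_correlation \<phi> P k (\<lambda>x. Re (kernel_det K k x)))"


fun palm_kernel ::
    "(complex \<Rightarrow> complex \<Rightarrow> complex) \<Rightarrow> (nat \<Rightarrow> complex) \<Rightarrow> nat \<Rightarrow> complex \<Rightarrow> complex \<Rightarrow> complex" where
  "palm_kernel K q 0 = K"
| "palm_kernel K q (Suc n) = (\<lambda>x y. palm_kernel K q n x y -
     palm_kernel K q n x (q n) * palm_kernel K q n (q n) y / palm_kernel K q n (q n) (q n))"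

text \<open>
  \<open>Q\<close> is a version of the reduced Palm measures of order \<open>l\<close> of a process \<open>P\<close> with \<open>l\<close>-th
  correlation function \<open>\<rho>\<close>: it disintegrates the reduced Campbell measure of \<open>P\<close>.  This
  determines \<open>Q x\<close> only for \<open>\<rho> d(lam \<phi>)\<^sup>l\<close>-almost every tuple \<open>x\<close>.
\<close>

definition is_reduced_palm ::
    "(complex \<Rightarrow> real) \<Rightarrow> complex set measure \<Rightarrow> nat \<Rightarrow> ((nat \<Rightarrow> complex) \<Rightarrow> real) \<Rightarrow>
     ((nat \<Rightarrow> complex) \<Rightarrow> complex set measure) \<Rightarrow> bool" where
  "is_reduced_palm \<phi> P l \<rho> Q \<longleftrightarrow>
     has_correlation \<phi> P l \<rho> \<and>
     Q \<in> measurable (tuple_space l) (prob_algebra conf_space) \<and>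
     (\<forall>F \<in> borel_measurable (tuple_space l \<Otimes>\<^sub>M conf_space).
        (\<integral>\<^sup>+X. (\<integral>\<^sup>+x. F (x, X - x ` {..<l}) \<partial>count_space (distinct_tuples l X)) \<partial>P) =
        (\<integral>\<^sup>+x. (\<integral>\<^sup>+X. F (x, X) \<partial>Q x) * ennreal (\<rho> x) \<partial>(\<Pi>\<^sub>M i\<in>{..<l}. lam \<phi>)))"

text \<open>
  The reduced Palm measures of the determinantal process \<open>P\<close> with kernel \<open>K\<close>, in the version
  that is defined at every tuple of distinct points: \<open>Q x\<close> is the determinantal process with
  kernel \<open>palm_kernel K x l\<close>.
\<close>

definition is_dpp_palm ::
    "(complex \<Rightarrow> real) \<Rightarrow> (complex \<Rightarrow> complex \<Rightarrow> complex) \<Rightarrow> complex set measure \<Rightarrow> nat \<Rightarrow>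
     ((nat \<Rightarrow> complex) \<Rightarrow> complex set measure) \<Rightarrow> bool" where
  "is_dpp_palm \<phi> K P l Q \<longleftrightarrow>
     is_reduced_palm \<phi> P l (\<lambda>x. Re (kernel_det K l x)) Q \<and>
     (\<forall>x\<in>distinct_tuples l UNIV. is_dpp \<phi> (palm_kernel K x l) (Q x))"


definition partial_Gamma ::
    "nat \<Rightarrow> (nat \<Rightarrow> complex) \<Rightarrow> (nat \<Rightarrow> complex) \<Rightarrow> real \<Rightarrow> complex set \<Rightarrow> real" where
  "partial_Gamma l p q R X =
     (\<Prod>x\<in>{x\<in>X. cmod x \<le> R}. \<Prod>i<l. (cmod ((x - p i) / (x - q i)))\<^sup>2)"

definition L1_limit :: "'a measure \<Rightarrow> (real \<Rightarrow> 'a \<Rightarrow> real) \<Rightarrow> ('a \<Rightarrow> real) \<Rightarrow> bool" where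
  "L1_limit M f g \<longleftrightarrow> (\<forall>R. integrable M (f R)) \<and> integrable M g \<and>
     ((\<lambda>R. \<integral>x. \<bar>f R x - g x\<bar> \<partial>M) \<longlongrightarrow> 0) at_top"

text \<open>\<open>G\<close> is a representative of \<open>\<Gamma>\<^bsub>p,q\<^esub>\<close>, which is an element of \<open>L\<^sup>1(M)\<close>.\<close>

definition is_Gamma ::
    "complex set measure \<Rightarrow> nat \<Rightarrow> (nat \<Rightarrow> complex) \<Rightarrow> (nat \<Rightarrow> complex) \<Rightarrow>
     (complex set \<Rightarrow> real) \<Rightarrow> bool" where
  "is_Gamma M l p q G \<longleftrightarrow> L1_limit M (partial_Gamma l p q) G"

end

theory Submission
  imports Defs
begin

text \<open>
  For radial \<open>\<phi>\<close> the monomials are orthogonal, so \<open>K\<close> is the limit of the kernels \<open>KN N\<close> of the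
  \<open>N\<close> first monomials, whose Palm processes have density \<open>\<prod>|x\<^sub>i - q\<^sub>a|\<^sup>2 |Vandermonde|\<^sup>2\<close>.
  With \<open>h(x) = \<prod>(x - p\<^sub>a)/(x - q\<^sub>a)\<close>, the expectation of \<open>\<prod>|h(x\<^sub>i)|\<^sup>2\<close> at level \<open>N\<close> turns the
  density at \<open>q\<close> into the density at \<open>p\<close>, hence is the quotient of the two normalizations; these are
  Gram determinants that are computed by \<open>det K(p\<^sub>i, p\<^sub>j)\<close> and Vandermonde factors.
  To replace \<open>h\<close> by its truncation to \<open>|x| \<le> R\<close> uniformly in \<open>N\<close>, one writes the truncation as \<open>h w\<^sub>R\<close>
  where \<open>w\<^sub>R\<close> is \<open>1\<close> inside the disc and analytic at infinity with value \<open>1\<close> outside. In the monomial basis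
  the matrix of \<open>w\<^sub>R\<close> is triangular, so the mean of \<open>\<prod>w\<^sub>R\<close> over the \<open>N\<close>-point process is exactly \<open>1\<close>, while
  Hadamard's inequality bounds the mean of \<open>\<prod>|w\<^sub>R|\<^sup>2\<close> by \<open>1 + o(1)\<close>; passing to the Palm process at \<open>p\<close>
  costs a factor \<open>1 + o(1)\<close>, since \<open>w\<^sub>R\<close> is uniformly close to \<open>1\<close>. So \<open>\<prod>w\<^sub>R\<close> is close to \<open>1\<close> in \<open>L\<^sup>2\<close>, the square
  roots of the partial products form an \<open>L\<^sup>2\<close> Cauchy family, and the limit \<open>N \<rightarrow> \<infinity>\<close> can be taken.
\<close>

section \<open>Determinants\<close>

text \<open>In general the factors of h differ from 1 by about 1/|x|, while about R^2 points lie in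
  |x| <= R. No absolute convergence is available, and the product over all points has a meaning only
  for the N-point processes. There it is the common reference for truncations at two radii; only
  inequalities between truncations, which involve finitely many points, pass to the limit in N. So
  every bound must be uniform in N. Perturbations are therefore measured by quotients of Gram
  determinants: removing l functions one by one costs a factor that depends on l and sup |w_R - 1|
  alone. The bounds on the Laplacian enter through \<open>XX r\<close> = r phi'(r). Under the
  density proportional to |z|^(2i) exp(-2 phi) it has mean i + 1 and variance of order i, so the
  monomial of index i lives near the circle where \<open>XX\<close> is i + 1. The transition at
  index \<open>XX R\<close> has width of order R, against about R^2 indices; this leaves room for a
  window of width R^(3/2) whose contribution still tends to 0. The poles of h at the points q_a are
  harmless because the diagonal of the Palm kernel vanishes there to second order, again uniformly
  in N.\<close>

definition dt :: "nat \<Rightarrow> (nat \<Rightarrow> nat \<Rightarrow> 'a) \<Rightarrow> 'a :: comm_ring_1" where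
  "dt n f = Determinant.det (Matrix.mat n n (\<lambda>(i, j). f i j))"

lemma dt_leibniz:
  "dt n f = (\<Sum>\<sigma> | \<sigma> permutes {..<n}. of_int (sign \<sigma>) * (\<Prod>i<n. f i (\<sigma> i)))"
proof -
  have "(\<Prod>i<n. Matrix.mat n n (\<lambda>(i, j). f i j) $$ (i, \<sigma> i)) = (\<Prod>i<n. f i (\<sigma> i))"
    if "\<sigma> permutes {..<n}" for \<sigma>
    using permutes_in_image[OF that] by (intro prod.cong) auto
  then show ?thesis
    unfolding dt_def det_def'[OF mat_carrier] atLeast0LessThan
    by (intro sum.cong) simp_all
qed

lemma dt_cong:
  assumes "\<And>i j. i < n \<Longrightarrow> j < n \<Longrightarrow> f i j = g i j"
  shows "dt n f = dt n g"
  unfolding dt_def using assms by (intro arg_cong[where f = Determinant.det]) (auto intro!: eq_matI)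

lemma dt_0 [simp]: "dt 0 f = 1"
  by (simp add: dt_leibniz)

lemma dt_transpose: "dt n (\<lambda>i j. f j i) = dt n f"
proof -
  have "transpose_mat (Matrix.mat n n (\<lambda>(i, j). f i j)) = Matrix.mat n n (\<lambda>(i, j). f j i)"
    by (intro eq_matI) auto
  then show ?thesis
    unfolding dt_def by (metis det_transpose mat_carrier)
qed

lemma dt_mult: "dt n (\<lambda>i j. \<Sum>k<n. f i k * g k j) = dt n f * dt n g"
proof -
  have "Matrix.mat n n (\<lambda>(i, j). f i j) * Matrix.mat n n (\<lambda>(i, j). g i j) =
      Matrix.mat n n (\<lambda>(i, j). \<Sum>k<n. f i k * g k j)"
    by (intro eq_matI) (auto simp: scalar_prod_def atLeast0LessThan intro!: sum.cong)
  then show ?thesis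
    unfolding dt_def by (metis det_mult mat_carrier)
qed

lemma dt_lower_triangular:
  assumes "\<And>i j. i < j \<Longrightarrow> j < n \<Longrightarrow> f i j = 0"
  shows "dt n f = (\<Prod>i<n. f i i)"
  unfolding dt_def
  by (subst det_lower_triangular[of n])
    (auto simp: assms diag_mat_def prod.list_conv_set_nth intro!: prod.cong)

lemma dt_cnj: "dt n (\<lambda>i j. cnj (f i j)) = cnj (dt n f)"
  by (simp add: dt_leibniz)

lemma tendsto_dt:
  fixes f :: "'b \<Rightarrow> nat \<Rightarrow> nat \<Rightarrow> complex"
  assumes "\<And>i j. i < n \<Longrightarrow> j < n \<Longrightarrow> ((\<lambda>x. f x i j) \<longlongrightarrow> g i j) F"
  shows "((\<lambda>x. dt n (f x)) \<longlongrightarrow> dt n g) F"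
  unfolding dt_leibniz
proof (intro tendsto_intros)
  fix \<sigma> i assume "\<sigma> \<in> {\<sigma>. \<sigma> permutes {..<n}}" "i \<in> {..<n}"
  then show "((\<lambda>x. f x i (\<sigma> i)) \<longlongrightarrow> g i (\<sigma> i)) F"
    using assms permutes_in_image[of \<sigma> "{..<n}" i] by auto
qed

lemma measurable_dt:
  fixes f :: "'b \<Rightarrow> nat \<Rightarrow> nat \<Rightarrow> complex"
  assumes "\<And>i j. i < n \<Longrightarrow> j < n \<Longrightarrow> (\<lambda>x. f x i j) \<in> borel_measurable M"
  shows "(\<lambda>x. dt n (f x)) \<in> borel_measurable M"
  unfolding dt_leibniz
proof (intro borel_measurable_sum borel_measurable_times borel_measurable_prod
    borel_measurable_const)
  fix \<sigma> i assume "\<sigma> \<in> {\<sigma>. \<sigma> permutes {..<n}}" "i \<in> {..<n}"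
  then show "(\<lambda>x. f x i (\<sigma> i)) \<in> borel_measurable M"
    using assms permutes_in_image[of \<sigma> "{..<n}" i] by auto
qed

lemma dt_eq_0_of_equal_rows:
  assumes "i < n" "j < n" "i \<noteq> j" "\<And>k. k < n \<Longrightarrow> f i k = f j k"
  shows "dt n f = 0"
  unfolding dt_def
  by (rule det_identical_rows[of _ n i j]) (use assms in \<open>auto intro!: eq_vecI\<close>)

text \<open>Rows and columns are permuted alike, so the sign enters twice and cancels. This is what
  makes a principal minor depend only on its set of indices.\<close>

lemma dt_permute:
  fixes f :: "nat \<Rightarrow> nat \<Rightarrow> 'a :: comm_ring_1"
  assumes "\<sigma> permutes {..<n}"
  shows "dt n (\<lambda>i j. f (\<sigma> i) (\<sigma> j)) = dt n f"
proof -
  have \<sigma>: "\<sigma> permutes {0..<n}" using assms by (simp add: atLeast0LessThan)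
  have row: "dt n (\<lambda>i j. g (\<sigma> i) j) = of_int (sign \<sigma>) * dt n g" for g :: "nat \<Rightarrow> nat \<Rightarrow> 'a"
  proof -
    have "Matrix.mat n n (\<lambda>(i, j). Matrix.mat n n (\<lambda>(i, j). g i j) $$ (\<sigma> i, j)) =
        Matrix.mat n n (\<lambda>(i, j). g (\<sigma> i) j)"
      using permutes_in_image[OF \<sigma>] by (intro eq_matI) auto
    then show ?thesis
      unfolding dt_def using det_permute_rows[OF mat_carrier \<sigma>, of "\<lambda>(i, j). g i j"] by simp
  qed
  have "dt n (\<lambda>i j. f (\<sigma> i) (\<sigma> j)) = of_int (sign \<sigma>) * dt n (\<lambda>i j. f i (\<sigma> j))"
    by (rule row)
  also have "dt n (\<lambda>i j. f i (\<sigma> j)) = dt n (\<lambda>i j. f j (\<sigma> i))"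
    by (rule dt_transpose)
  also have "\<dots> = of_int (sign \<sigma>) * dt n (\<lambda>i j. f j i)"
    by (rule row)
  also have "dt n (\<lambda>i j. f j i) = dt n f" by (rule dt_transpose)
  finally have "dt n (\<lambda>i j. f (\<sigma> i) (\<sigma> j)) = of_int (sign \<sigma>) * (of_int (sign \<sigma>) * dt n f)" .
  moreover have "of_int (sign \<sigma>) * of_int (sign \<sigma>) = (1 :: 'a)"
    by (metis of_int_1 of_int_mult sign_idempotent)
  ultimately show ?thesis by (simp flip: mult.assoc)
qed

text \<open>The vector \<open>y\<close> is the first column of the adjugate, which exists for
  singular matrices as well. For a Gram matrix it represents a function orthogonal to all basis
  functions but the first, and \<open>y 0\<close> is the complementary minor. Quotients of
  successive Gram determinants are read off from it.\<close>

lemma dt_first_cofactors: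
  obtains y where "y 0 = dt n (\<lambda>i j. f (Suc i) (Suc j))"
    "\<And>i. i < Suc n \<Longrightarrow> (\<Sum>j<Suc n. f i j * y j) = (if i = 0 then dt (Suc n) f else 0)"
proof -
  define A where "A = Matrix.mat (Suc n) (Suc n) (\<lambda>(i, j). f i j)"
  have A: "A \<in> carrier_mat (Suc n) (Suc n)" by (simp add: A_def)
  define y where "y j = adj_mat A $$ (j, 0)" for j
  have "mat_delete A 0 0 = Matrix.mat n n (\<lambda>(i, j). f (Suc i) (Suc j))"
    unfolding mat_delete_def A_def by (intro eq_matI) auto
  then have "y 0 = dt n (\<lambda>i j. f (Suc i) (Suc j))"
    by (simp add: y_def adj_mat_def A_def cofactor_def dt_def)
  moreover have "(\<Sum>j<Suc n. f i j * y j) = (if i = 0 then dt (Suc n) f else 0)" if "i < Suc n" for i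
  proof -
    have "(A * adj_mat A) $$ (i, 0) = (\<Sum>j<Suc n. f i j * y j)"
      using that adj_mat(1)[OF A] unfolding y_def
      by (subst index_mult_mat)
        (auto simp: A_def scalar_prod_def atLeast0LessThan simp del: sum.lessThan_Suc
              intro!: sum.cong)
    moreover have "(A * adj_mat A) $$ (i, 0) = (if i = 0 then dt (Suc n) f else 0)"
      unfolding adj_mat(2)[OF A] using that by (simp add: dt_def A_def)
    ultimately show ?thesis by simp
  qed
  ultimately show ?thesis using that by blast
qed

lemma dt_inverse:
  fixes f :: "nat \<Rightarrow> nat \<Rightarrow> 'a :: field"
  assumes "dt n f \<noteq> 0"
  obtains X where "\<And>i j. i < n \<Longrightarrow> j < n \<Longrightarrow> (\<Sum>k<n. f i k * X k j) = (if i = j then 1 else 0)"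
    "\<And>i j. i < n \<Longrightarrow> j < n \<Longrightarrow> (\<Sum>k<n. X i k * f k j) = (if i = j then 1 else 0)"
proof -
  define A where "A = Matrix.mat n n (\<lambda>(i, j). f i j)"
  have A: "A \<in> carrier_mat n n" by (simp add: A_def)
  have d: "Determinant.det A = dt n f" by (simp add: dt_def A_def)
  define X where "X i j = adj_mat A $$ (i, j) / dt n f" for i j
  note adj = adj_mat[OF A]
  have "(\<Sum>k<n. f i k * X k j) = (if i = j then 1 else 0)" if "i < n" "j < n" for i j
  proof -
    have "(A * adj_mat A) $$ (i, j) = (\<Sum>k<n. f i k * adj_mat A $$ (k, j))"
      using that adj(1)
      by (subst index_mult_mat) (auto simp: A_def scalar_prod_def atLeast0LessThan intro!: sum.cong)
    then have "(\<Sum>k<n. f i k * adj_mat A $$ (k, j)) = (if i = j then dt n f else 0)"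
      unfolding adj(2) d using that by (cases "i = j") auto
    then show ?thesis
      using assms by (simp add: X_def sum_divide_distrib[symmetric])
  qed
  moreover have "(\<Sum>k<n. X i k * f k j) = (if i = j then 1 else 0)" if "i < n" "j < n" for i j
  proof -
    have "(adj_mat A * A) $$ (i, j) = (\<Sum>k<n. adj_mat A $$ (i, k) * f k j)"
      using that adj(1)
      by (subst index_mult_mat) (auto simp: A_def scalar_prod_def atLeast0LessThan intro!: sum.cong)
    then have "(\<Sum>k<n. adj_mat A $$ (i, k) * f k j) = (if i = j then dt n f else 0)"
      unfolding adj(3) d using that by (cases "i = j") auto
    then show ?thesis
      using assms by (simp add: X_def sum_divide_distrib[symmetric])
  qed
  ultimately show ?thesis using that by blast
qed

lemma dt_block_lower_zero:
  fixes f :: "nat \<Rightarrow> nat \<Rightarrow> 'a :: idom"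
  assumes "\<And>i. i < n \<Longrightarrow> f (Suc i) 0 = 0"
  shows "dt (Suc n) f = f 0 0 * dt n (\<lambda>i j. f (Suc i) (Suc j))"
proof -
  define A where "A = Matrix.mat (Suc n) (Suc n) (\<lambda>(i, j). f i j)"
  have A: "A \<in> carrier_mat (Suc n) (Suc n)" by (simp add: A_def)
  have "mat_delete A 0 0 = Matrix.mat n n (\<lambda>(i, j). f (Suc i) (Suc j))"
    unfolding mat_delete_def A_def by (intro eq_matI) auto
  then have c: "cofactor A 0 0 = dt n (\<lambda>i j. f (Suc i) (Suc j))"
    by (simp add: cofactor_def dt_def)
  have "dt (Suc n) f = (\<Sum>i<Suc n. A $$ (i, 0) * cofactor A i 0)"
    unfolding dt_def A_def[symmetric] by (rule laplace_expansion_column[OF A]) simp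
  also have "\<dots> = A $$ (0, 0) * cofactor A 0 0 + (\<Sum>i<n. A $$ (Suc i, 0) * cofactor A (Suc i) 0)"
    by (rule sum.lessThan_Suc_shift)
  also have "(\<Sum>i<n. A $$ (Suc i, 0) * cofactor A (Suc i) 0) = 0"
    using assms by (intro sum.neutral) (auto simp: A_def)
  finally show ?thesis unfolding c by (simp add: A_def)
qed

text \<open>The entries on the right have the form of one step of \<open>palm_kernel\<close>; this
  is how determinants of a kernel become products of its Palm values.\<close>

lemma dt_schur_complement:
  fixes f :: "nat \<Rightarrow> nat \<Rightarrow> 'a :: field"
  assumes "f 0 0 \<noteq> 0"
  shows "dt (Suc n) f = f 0 0 * dt n (\<lambda>i j. f (Suc i) (Suc j) - f (Suc i) 0 * f 0 (Suc j) / f 0 0)"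
proof -
  \<comment> \<open>\<open>L\<close> subtracts \<open>f i 0 / f 0 0\<close> times row 0 from every
    later row i.\<close>
  define L where "L i k = (if k = i then 1 else if k = 0 then - f i 0 / f 0 0 else 0)" for i k :: nat
  have 1: "dt (Suc n) L = 1"
    by (subst dt_lower_triangular) (auto simp: L_def)
  have L: "(\<Sum>k<Suc n. L i k * f k j) = (if i = 0 then f 0 j else f i j - f i 0 / f 0 0 * f 0 j)"
    if "i < Suc n" for i j
  proof (cases "i = 0")
    case True
    then have "(\<Sum>k<Suc n. L i k * f k j) = (\<Sum>k<Suc n. if k = 0 then f 0 j else 0)"
      by (intro sum.cong) (auto simp: L_def)
    then show ?thesis using True by (simp add: sum.delta)
  next
    case False
    have "(\<Sum>k<Suc n. L i k * f k j) =
        (\<Sum>k<Suc n. (if k = i then f i j else 0) + (if k = 0 then - f i 0 / f 0 0 * f 0 j else 0))"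
      using False by (intro sum.cong) (auto simp: L_def)
    then show ?thesis using False that by (simp add: sum.distrib sum.delta del: sum.lessThan_Suc)
  qed
  have "dt (Suc n) f = dt (Suc n) L * dt (Suc n) f" using 1 by simp
  also have "\<dots> = dt (Suc n) (\<lambda>i j. \<Sum>k<Suc n. L i k * f k j)"
    by (rule dt_mult[symmetric])
  also have "\<dots> = f 0 0 * dt n (\<lambda>i j. f (Suc i) (Suc j) - f (Suc i) 0 * f 0 (Suc j) / f 0 0)"
    using assms L[of "Suc _"] L[of 0]
    by (subst dt_block_lower_zero) (auto intro!: dt_cong simp del: sum.lessThan_Suc)
  finally show ?thesis .
qed

text \<open>Multilinearity in the rows: \<open>S\<close> is the set of rows taken from
  \<open>f\<close>.\<close>

lemma dt_add_expand:
  "dt n (\<lambda>i j. f i j + g i j) = (\<Sum>S\<in>Pow {..<n}. dt n (\<lambda>i j. if i \<in> S then f i j else g i j))"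
proof -
  have "dt n (\<lambda>i j. f i j + g i j) = (\<Sum>\<sigma> | \<sigma> permutes {..<n}. \<Sum>S\<in>Pow {..<n}.
      of_int (sign \<sigma>) * ((\<Prod>i\<in>S. f i (\<sigma> i)) * (\<Prod>i\<in>{..<n} - S. g i (\<sigma> i))))"
    unfolding dt_leibniz by (subst prod_add) (auto simp: sum_distrib_left)
  also have "\<dots> = (\<Sum>S\<in>Pow {..<n}. \<Sum>\<sigma> | \<sigma> permutes {..<n}.
      of_int (sign \<sigma>) * ((\<Prod>i\<in>S. f i (\<sigma> i)) * (\<Prod>i\<in>{..<n} - S. g i (\<sigma> i))))"
    by (rule sum.swap)
  also have "\<dots> = (\<Sum>S\<in>Pow {..<n}. dt n (\<lambda>i j. if i \<in> S then f i j else g i j))"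
    unfolding dt_leibniz
  proof (intro sum.cong refl arg_cong2[where f = times])
    fix S \<sigma> assume "S \<in> Pow {..<n}"
    then have S: "S \<subseteq> {..<n}" by simp
    have "(\<Prod>i<n. if i \<in> S then f i (\<sigma> i) else g i (\<sigma> i)) =
        (\<Prod>i\<in>{..<n} - S. if i \<in> S then f i (\<sigma> i) else g i (\<sigma> i)) *
        (\<Prod>i\<in>S. if i \<in> S then f i (\<sigma> i) else g i (\<sigma> i))"
      by (rule prod.subset_diff[OF S]) simp
    then show "(\<Prod>i\<in>S. f i (\<sigma> i)) * (\<Prod>i\<in>{..<n} - S. g i (\<sigma> i)) =
        (\<Prod>i<n. if i \<in> S then f i (\<sigma> i) else g i (\<sigma> i))"
      by (simp add: mult.commute)
  qed
  finally show ?thesis .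
qed

text \<open>Cofactor expansion removes an index at the front, so the identity rows are moved there
  by reversing the order of all indices.\<close>

lemma dt_identity_tail:
  fixes f :: "nat \<Rightarrow> nat \<Rightarrow> 'a :: idom"
  shows "dt (k + m) (\<lambda>i j. if i < k then f i j else if i = j then 1 else 0) = dt k f"
proof -
  \<comment> \<open>The version with the identity rows in front; transposing makes the first column
    vanish below its top entry.\<close>
  have *: "dt (m + k) (\<lambda>i j. if i < m then (if i = j then 1 else 0) else g i j) =
      dt k (\<lambda>i j. g (m + i) (m + j))" for g :: "nat \<Rightarrow> nat \<Rightarrow> 'a" and m
  proof (induction m arbitrary: g)
    case (Suc m)
    let ?f = "\<lambda>i j. if i < Suc m then (if i = j then 1 else 0) else g i j"
    have "dt (Suc m + k) ?f = dt (Suc (m + k)) (\<lambda>i j. ?f j i)"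
      by (subst dt_transpose) simp
    also have "\<dots> = dt (m + k) (\<lambda>i j. ?f (Suc j) (Suc i))"
      by (subst dt_block_lower_zero) auto
    also have "\<dots> = dt (m + k) (\<lambda>i j. ?f (Suc i) (Suc j))"
      by (rule dt_transpose)
    also have "\<dots> = dt (m + k) (\<lambda>i j. if i < m then (if i = j then 1 else 0) else g (Suc i) (Suc j))"
      by (rule dt_cong) auto
    also have "\<dots> = dt k (\<lambda>i j. g (Suc m + i) (Suc m + j))"
      by (subst Suc.IH) simp
    finally show ?case .
  qed simp
  define \<sigma> where "\<sigma> i = (if i < k + m then k + m - 1 - i else i)" for i
  have \<sigma>: "\<sigma> permutes {..<k + m}"
    by (rule bij_imp_permutes[OF bij_betw_byWitness[where f' = \<sigma>]]) (auto simp: \<sigma>_def)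
  \<comment> \<open>Within the remaining block of size k the reversal is undone by
    \<open>\<tau>\<close>.\<close>
  define \<tau> where "\<tau> i = (if i < k then k - 1 - i else i)" for i
  have \<tau>: "\<tau> permutes {..<k}"
    by (rule bij_imp_permutes[OF bij_betw_byWitness[where f' = \<tau>]]) (auto simp: \<tau>_def)
  have "dt (k + m) (\<lambda>i j. if i < k then f i j else if i = j then 1 else 0) =
    dt (k + m) (\<lambda>i j. if \<sigma> i < k then f (\<sigma> i) (\<sigma> j) else if \<sigma> i = \<sigma> j then 1 else 0)"
    by (rule dt_permute[OF \<sigma>, symmetric])
  also have "\<dots> = dt (m + k) (\<lambda>i j. if i < m then (if i = j then 1 else 0) else f (\<sigma> i) (\<sigma> j))"
    by (subst add.commute, rule dt_cong) (auto simp: \<sigma>_def)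
  also have "\<dots> = dt k (\<lambda>i j. f (\<sigma> (m + i)) (\<sigma> (m + j)))"
    by (rule *)
  also have "\<dots> = dt k (\<lambda>i j. f (\<tau> i) (\<tau> j))"
    by (rule dt_cong) (auto simp: \<sigma>_def \<tau>_def intro!: arg_cong2[where f = f])
  also have "\<dots> = dt k f" by (rule dt_permute[OF \<tau>])
  finally show ?thesis .
qed

section \<open>Tuples of distinct points\<close>

text \<open>\<open>distinct_tuples\<close> with a polymorphic point type: the same counting is
  applied to configurations and to tuples of indices.\<close>

definition inj_tuples :: "nat \<Rightarrow> 'a set \<Rightarrow> (nat \<Rightarrow> 'a) set" where
  "inj_tuples k A = {x \<in> {..<k} \<rightarrow>\<^sub>E A. inj_on x {..<k}}"

lemma distinct_tuples_eq_inj_tuples: "distinct_tuples = inj_tuples"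
  by (simp add: fun_eq_iff distinct_tuples_def inj_tuples_def)

lemma finite_inj_tuples: "finite A \<Longrightarrow> finite (inj_tuples k A)"
  by (auto simp: inj_tuples_def intro!: finite_PiE intro: finite_subset)

lemma card_inj_tuples_onto:
  assumes "S \<subseteq> A" "finite A" "card S = k"
  shows "card {x \<in> inj_tuples k A. x ` {..<k} = S} = fact k"
proof -
  have S: "finite S" using assms finite_subset by auto
  have "{x \<in> inj_tuples k A. x ` {..<k} = S} = {x \<in> {..<k} \<rightarrow>\<^sub>E S. inj_on x {..<k}}"
  proof (intro equalityI subsetI)
    fix x assume x: "x \<in> {x \<in> {..<k} \<rightarrow>\<^sub>E S. inj_on x {..<k}}"
    then have "x ` {..<k} \<subseteq> S" by auto
    moreover have "card (x ` {..<k}) = card S" using x assms by (simp add: card_image)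
    ultimately have "x ` {..<k} = S" using S by (simp add: card_subset_eq)
    then show "x \<in> {x \<in> inj_tuples k A. x ` {..<k} = S}"
      using x assms(1) by (auto simp: inj_tuples_def PiE_iff)
  qed (auto simp: inj_tuples_def PiE_iff)
  then show ?thesis
    using card_inj_on_subset_funcset[of "{..<k}" S "{..<k}"] S assms(3)
    by (simp add: fact_prod_rev)
qed

lemma sum_inj_tuples:
  fixes f :: "'a set \<Rightarrow> 'b :: real_algebra_1"
  assumes "finite A"
  shows "(\<Sum>x\<in>inj_tuples k A. f (x ` {..<k})) = fact k * (\<Sum>S | S \<subseteq> A \<and> card S = k. f S)"
proof -
  have "(\<Sum>x\<in>inj_tuples k A. f (x ` {..<k})) =
     (\<Sum>S | S \<subseteq> A \<and> card S = k. \<Sum>x\<in>{x \<in> inj_tuples k A. x ` {..<k} = S}. f (x ` {..<k}))"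
    by (rule sum.group[symmetric])
      (use assms finite_inj_tuples[OF assms] in \<open>auto simp: inj_tuples_def PiE_iff card_image\<close>)
  also have "\<dots> = (\<Sum>S | S \<subseteq> A \<and> card S = k. fact k * f S)"
    using assms by (intro sum.cong refl) (simp add: card_inj_tuples_onto)
  finally show ?thesis by (simp add: sum_distrib_left)
qed

lemma prod_tuple: "x \<in> inj_tuples k A \<Longrightarrow> (\<Prod>i<k. f (x i)) = (\<Prod>a\<in>x ` {..<k}. f a)"
  by (auto simp: inj_tuples_def prod.reindex)

text \<open>The k-th summand is the k-th elementary symmetric polynomial of the values of
  \<open>f\<close>. Written over ordered tuples it can be integrated against correlation functions;
  terms beyond the cardinality are 0, so any larger \<open>m\<close> serves.\<close>

lemma prod_add_one_eq_sum_tuples: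
  fixes f :: "'a \<Rightarrow> 'b :: real_normed_field"
  assumes "finite A" "card A \<le> m"
  shows "(\<Prod>a\<in>A. 1 + f a) = (\<Sum>k\<le>m. (\<Sum>x\<in>inj_tuples k A. \<Prod>i<k. f (x i)) / fact k)"
proof -
  have "(\<Sum>k\<le>m. (\<Sum>x\<in>inj_tuples k A. \<Prod>i<k. f (x i)) / fact k) =
      (\<Sum>k\<le>m. \<Sum>S | S \<subseteq> A \<and> card S = k. \<Prod>a\<in>S. f a)"
  proof (intro sum.cong refl)
    fix k
    have "(\<Sum>x\<in>inj_tuples k A. \<Prod>i<k. f (x i)) = (\<Sum>x\<in>inj_tuples k A. \<Prod>a\<in>x ` {..<k}. f a)"
      by (intro sum.cong refl) (rule prod_tuple)
    then show "(\<Sum>x\<in>inj_tuples k A. \<Prod>i<k. f (x i)) / fact k = (\<Sum>S | S \<subseteq> A \<and> card S = k. \<Prod>a\<in>S. f a)"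
      using assms(1) by (simp add: sum_inj_tuples)
  qed
  also have "\<dots> = (\<Sum>k\<le>m. \<Sum>S\<in>{S \<in> Pow A. card S = k}. \<Prod>a\<in>S. f a)"
    by (intro sum.cong refl) auto
  also have "\<dots> = (\<Sum>S\<in>Pow A. \<Prod>a\<in>S. f a)"
    by (rule sum.group) (use assms in \<open>auto dest: card_mono\<close>)
  also have "\<dots> = (\<Prod>a\<in>A. 1 + f a)"
    using prod_add[OF assms(1), of f "\<lambda>_. 1"] by (simp add: add.commute)
  finally show ?thesis by simp
qed

lemma inj_tuples_empty:
  assumes "finite A" "card A < k"
  shows "inj_tuples k A = {}"
proof -
  have "card A \<ge> k" if "x \<in> inj_tuples k A" for x
    using that assms(1) card_inj[of x "{..<k}" A] by (auto simp: inj_tuples_def PiE_iff)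
  then show ?thesis using assms(2) by fastforce
qed

section \<open>Positive semidefinite matrices\<close>

lemma cauchy_schwarz_aux:
  fixes b :: complex
  assumes "\<And>t. 0 \<le> a + 2 * Re (t * b) + (cmod t)\<^sup>2 * c" and "0 \<le> c"
  shows "(cmod b)\<^sup>2 \<le> a * c"
proof (cases "c = 0")
  case True
  have "b = 0"
  proof (rule ccontr)
    assume "b \<noteq> 0"
    \<comment> \<open>With t = -s cnj b the quadratic form takes the value a - (a + 1) = -1.\<close>
    define s where "s = (a + 1) / (2 * (cmod b)\<^sup>2)"
    have "Re (- of_real s * cnj b * b) = - s * (cmod b)\<^sup>2"
      by (simp add: cmod_power2) (simp add: power2_eq_square algebra_simps)
    then show False
      using assms(1)[of "- of_real s * cnj b"] True \<open>b \<noteq> 0\<close>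
      by (simp add: s_def field_simps)
  qed
  then show ?thesis using True by simp
next
  case False
  then have c: "c > 0" using assms(2) by simp
  \<comment> \<open>Here t = -s cnj b is the minimizer of the quadratic form.\<close>
  define s where "s = 1 / c"
  have "Re (- of_real s * cnj b * b) = - s * (cmod b)\<^sup>2"
    by (simp add: cmod_power2) (simp add: power2_eq_square algebra_simps)
  moreover have "(cmod (- of_real s * cnj b))\<^sup>2 = s\<^sup>2 * (cmod b)\<^sup>2"
    by (simp add: norm_mult power_mult_distrib)
  ultimately have "0 \<le> a + 2 * (- s * (cmod b)\<^sup>2) + s\<^sup>2 * (cmod b)\<^sup>2 * c"
    using assms(1)[of "- of_real s * cnj b"] by simp
  also have "s\<^sup>2 * (cmod b)\<^sup>2 * c = s * (cmod b)\<^sup>2"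
    using c by (simp add: s_def power2_eq_square)
  finally have "s * (cmod b)\<^sup>2 \<le> a" by simp
  then show ?thesis using c by (simp add: s_def field_simps)
qed

text \<open>The conjugate sits on the second index, so that for entries given by integrals of f_i
  cnj f_j the form is the squared norm of the combination with coefficients
  \<open>y\<close>.\<close>

definition psd :: "nat \<Rightarrow> (nat \<Rightarrow> nat \<Rightarrow> complex) \<Rightarrow> bool" where
  "psd n G \<longleftrightarrow> (\<forall>i<n. \<forall>j<n. G j i = cnj (G i j)) \<and>
     (\<forall>y. 0 \<le> Re (\<Sum>i<n. \<Sum>j<n. y i * G i j * cnj (y j)))"

lemma psd_hermitian: "psd n G \<Longrightarrow> i < n \<Longrightarrow> j < n \<Longrightarrow> G j i = cnj (G i j)"
  unfolding psd_def by blast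

lemma psd_Suc:
  assumes "psd (Suc n) G"
  shows "psd n (\<lambda>i j. G (Suc i) (Suc j))"
  unfolding psd_def
proof (intro conjI allI impI)
  fix y :: "nat \<Rightarrow> complex"
  define z where "z i = (case i of 0 \<Rightarrow> 0 | Suc k \<Rightarrow> y k)" for i
  have "(\<Sum>i<Suc n. \<Sum>j<Suc n. z i * G i j * cnj (z j)) =
      (\<Sum>i<n. \<Sum>j<n. y i * G (Suc i) (Suc j) * cnj (y j))"
    by (simp only: sum.lessThan_Suc_shift) (simp add: z_def)
  moreover have "0 \<le> Re (\<Sum>i<Suc n. \<Sum>j<Suc n. z i * G i j * cnj (z j))"
    using assms unfolding psd_def by blast
  ultimately show "0 \<le> Re (\<Sum>i<n. \<Sum>j<n. y i * G (Suc i) (Suc j) * cnj (y j))"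
    by (simp del: sum.lessThan_Suc)
next
  fix i j assume "i < n" "j < n"
  then show "G (Suc j) (Suc i) = cnj (G (Suc i) (Suc j))"
    using assms by (intro psd_hermitian) auto
qed

lemma psd_dt_real:
  assumes "psd n G"
  shows "Im (dt n G) = 0"
proof -
  have "cnj (dt n G) = dt n (\<lambda>i j. G j i)"
    unfolding dt_cnj[symmetric] using psd_hermitian[OF assms] by (intro dt_cong) (rule sym)
  then have "cnj (dt n G) = dt n G" using dt_transpose[of n G] by simp
  then show ?thesis by (metis Reals_cnj_iff complex_is_Real_iff)
qed

lemma psd_cauchy_schwarz:
  assumes "psd n G"
  defines "q \<equiv> \<lambda>x y. \<Sum>i<n. \<Sum>j<n. x i * G i j * cnj (y j)"
  shows "(cmod (q x y))\<^sup>2 \<le> Re (q x x) * Re (q y y)"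
proof (rule cauchy_schwarz_aux)
  have pos: "0 \<le> Re (q z z)" for z using assms(1) unfolding psd_def q_def by blast
  then show "0 \<le> Re (q y y)" .
  have qc: "q y x = cnj (q x y)"
    unfolding q_def cnj_sum complex_cnj_mult
    by (subst sum.swap, intro sum.cong refl) (subst psd_hermitian[OF assms(1)], auto simp: algebra_simps)
  fix t :: complex
  have "q (\<lambda>i. x i + cnj t * y i) (\<lambda>i. x i + cnj t * y i) =
      q x x + t * q x y + cnj t * q y x + cnj t * t * q y y"
    unfolding q_def sum_distrib_left sum.distrib[symmetric]
    by (intro sum.cong refl) (simp add: algebra_simps)
  then have "Re (q (\<lambda>i. x i + cnj t * y i) (\<lambda>i. x i + cnj t * y i)) =
      Re (q x x) + 2 * Re (t * q x y) + (cmod t)\<^sup>2 * Re (q y y)"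
    unfolding qc by (simp add: cmod_power2) (simp add: power2_eq_square algebra_simps)
  moreover have "0 \<le> Re (q (\<lambda>i. x i + cnj t * y i) (\<lambda>i. x i + cnj t * y i))"
    by (rule pos)
  ultimately show "0 \<le> Re (q x x) + 2 * Re (t * q x y) + (cmod t)\<^sup>2 * Re (q y y)" by simp
qed

lemma psd_diag_nonneg:
  assumes "psd n G" "k < n"
  shows "0 \<le> Re (G k k)"
proof -
  define e :: "nat \<Rightarrow> complex" where "e i = (if i = k then 1 else 0)" for i
  have "(\<Sum>i<n. \<Sum>j<n. e i * G i j * cnj (e j)) = (\<Sum>i<n. \<Sum>j<n. if j = k then if i = k then G i j else 0 else 0)"
    by (intro sum.cong) (auto simp: e_def)
  also have "\<dots> = G k k" using assms(2) by (simp add: sum.delta)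
  finally have "(\<Sum>i<n. \<Sum>j<n. e i * G i j * cnj (e j)) = G k k" .
  moreover have "0 \<le> Re (\<Sum>i<n. \<Sum>j<n. e i * G i j * cnj (e j))"
    using assms(1) unfolding psd_def by blast
  ultimately show ?thesis by simp
qed

text \<open>Let d and d' be the determinants of G and of G without its first index, and c the
  conjugated first cofactor vector. The form takes the value d at (e, c) and d' d at (c, c), so the
  Cauchy-Schwarz inequality reads d^2 <= G_00 d' d. Induction bounds d' by the remaining diagonal
  entries.\<close>

lemma psd_hadamard:
  assumes "psd n G"
  shows "0 \<le> Re (dt n G) \<and> Re (dt n G) \<le> (\<Prod>i<n. Re (G i i))"
  using assms
proof (induction n arbitrary: G)
  case (Suc n)
  define G' where "G' i j = G (Suc i) (Suc j)" for i j
  have psd': "psd n G'" unfolding G'_def by (rule psd_Suc[OF Suc.prems])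
  note IH = Suc.IH[OF psd']
  obtain y where y: "y 0 = dt n G'"
    "\<And>i. i < Suc n \<Longrightarrow> (\<Sum>j<Suc n. G i j * y j) = (if i = 0 then dt (Suc n) G else 0)"
    using dt_first_cofactors[of n G] unfolding G'_def by metis
  define q where "q x z = (\<Sum>i<Suc n. \<Sum>j<Suc n. x i * G i j * cnj (z j))" for x z
  \<comment> \<open>Conjugated because the form is conjugate linear in its second argument.\<close>
  define c where "c j = cnj (y j)" for j
  define e :: "nat \<Rightarrow> complex" where "e i = (if i = 0 then 1 else 0)" for i
  have qc: "q x c = x 0 * dt (Suc n) G" for x
  proof -
    have "q x c = (\<Sum>i<Suc n. x i * (\<Sum>j<Suc n. G i j * y j))"
      unfolding q_def c_def sum_distrib_left by (simp add: mult.assoc)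
    also have "\<dots> = (\<Sum>i<Suc n. if i = 0 then x i * dt (Suc n) G else 0)"
      using y(2) by (intro sum.cong) auto
    finally show ?thesis by (simp add: sum.delta del: sum.lessThan_Suc)
  qed
  have qee: "q e e = G 0 0"
    unfolding q_def e_def sum.lessThan_Suc_shift by simp
  define d d' where "d = Re (dt (Suc n) G)" and "d' = Re (dt n G')"
  have d: "dt (Suc n) G = of_real d" "dt n G' = of_real d'"
    using psd_dt_real[OF Suc.prems] psd_dt_real[OF psd'] by (auto simp: d_def d'_def complex_eq_iff)
  have qcc: "q c c = of_real (d' * d)" unfolding qc by (simp add: c_def y(1) d)
  have "0 \<le> Re (q c c)" using Suc.prems unfolding psd_def q_def by blast
  then have dd: "0 \<le> d' * d" by (simp add: qcc)
  have "(cmod (q e c))\<^sup>2 \<le> Re (q e e) * Re (q c c)"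
    using psd_cauchy_schwarz[OF Suc.prems] unfolding q_def by blast
  then have cs: "d\<^sup>2 \<le> Re (G 0 0) * (d' * d)"
    unfolding qee qcc unfolding qc by (simp add: d e_def)
  have d'0: "0 \<le> d'" using IH by (simp add: d'_def)
  have G0: "0 \<le> Re (G 0 0)" by (rule psd_diag_nonneg[OF Suc.prems]) simp
  have le: "Re (G 0 0) * d' \<le> (\<Prod>i<Suc n. Re (G i i))"
    unfolding prod.lessThan_Suc_shift d'_def using IH G0 unfolding G'_def by (intro mult_left_mono) auto
  \<comment> \<open>If d is not 0, the inequality \<open>cs\<close> forces d' > 0, then
    \<open>dd\<close> gives d > 0, and \<open>cs\<close> can be divided by d.\<close>
  have "0 \<le> d \<and> d \<le> Re (G 0 0) * d'"
  proof (cases "d = 0")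
    case False
    then have "d' \<noteq> 0" using cs by auto
    then have "d' > 0" using d'0 by simp
    then have "d > 0" using dd False by (simp add: zero_le_mult_iff)
    then show ?thesis using cs by (simp add: power2_eq_square)
  qed (use G0 d'0 in auto)
  then show ?case using le by (simp add: d_def)
qed simp

lemma dt_psd_of_real: "psd n G \<Longrightarrow> dt n G = complex_of_real (Re (dt n G))"
  by (simp add: complex_eq_iff psd_dt_real)

section \<open>Fredholm expansions of separated kernels\<close>

text \<open>Filling up with rows of the identity turns the minor of a k-tuple into a determinant of
  fixed size that depends only on the image of the tuple, so that sums over tuples become sums over
  subsets.\<close>

lemma dt_principal_minor:
  fixes F :: "nat \<Rightarrow> nat \<Rightarrow> 'a :: idom"
  assumes "m \<in> inj_tuples k {..<n}"
  shows "dt k (\<lambda>i j. F (m i) (m j)) =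
    dt n (\<lambda>i j. if i \<in> m ` {..<k} then F i j else if i = j then 1 else 0)"
proof -
  define S where "S = m ` {..<k}"
  have inj: "inj_on m {..<k}" and sub: "S \<subseteq> {..<n}"
    using assms by (auto simp: inj_tuples_def S_def)
  have cS: "card S = k" using inj by (simp add: S_def card_image)
  then have kn: "k \<le> n" using card_mono[OF _ sub] by simp
  have "card {k..<n} = card ({..<n} - S)"
    using sub cS by (simp add: card_Diff_subset finite_subset)
  then obtain g where g: "bij_betw g {k..<n} ({..<n} - S)"
    using finite_same_card_bij by (metis finite_Diff finite_atLeastLessThan finite_lessThan)
  define \<tau> where "\<tau> i = (if i < k then m i else if i < n then g i else i)" for i
  have "bij_betw \<tau> {..<k} S"
    using inj by (subst bij_betw_cong[of _ \<tau> m]) (auto simp: \<tau>_def S_def bij_betw_def)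
  moreover have "bij_betw \<tau> {k..<n} ({..<n} - S)"
    using g by (subst bij_betw_cong[of _ \<tau> g]) (auto simp: \<tau>_def)
  ultimately have "bij_betw \<tau> ({..<k} \<union> {k..<n}) (S \<union> ({..<n} - S))"
    by (rule bij_betw_combine) auto
  moreover have "{..<k} \<union> {k..<n} = {..<n}" "S \<union> ({..<n} - S) = {..<n}" using kn sub by auto
  ultimately have "bij_betw \<tau> {..<n} {..<n}" by simp
  then have \<tau>: "\<tau> permutes {..<n}" by (rule bij_imp_permutes) (use kn in \<open>auto simp: \<tau>_def\<close>)
  have mem: "\<tau> i \<in> S \<longleftrightarrow> i < k" if "i < n" for i
  proof (cases "i < k")
    case False
    then have "g i \<in> {..<n} - S" using g that by (auto simp: bij_betw_def)
    then show ?thesis using False that by (simp add: \<tau>_def)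
  qed (auto simp: \<tau>_def S_def)
  have "dt n (\<lambda>i j. if i \<in> S then F i j else if i = j then 1 else 0) =
      dt n (\<lambda>i j. if \<tau> i \<in> S then F (\<tau> i) (\<tau> j) else if \<tau> i = \<tau> j then 1 else 0)"
    by (rule dt_permute[OF \<tau>, symmetric])
  also have "\<dots> = dt n (\<lambda>i j. if i < k then F (m i) (\<tau> j) else if i = j then 1 else 0)"
  proof (rule dt_cong)
    fix i j assume "i < n" "j < n"
    then show "(if \<tau> i \<in> S then F (\<tau> i) (\<tau> j) else if \<tau> i = \<tau> j then 1 else 0) =
        (if i < k then F (m i) (\<tau> j) else if i = j then 1 else 0)"
      using mem[of i] inj_eq[OF permutes_inj[OF \<tau>], of i j] by (cases "i < k") (simp_all add: \<tau>_def[of i])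
  qed
  also have "\<dots> = dt (k + (n - k)) (\<lambda>i j. if i < k then F (m i) (\<tau> j) else if i = j then 1 else 0)"
    using kn by simp
  also have "\<dots> = dt k (\<lambda>i j. F (m i) (\<tau> j))"
    by (rule dt_identity_tail)
  also have "\<dots> = dt k (\<lambda>i j. F (m i) (m j))"
    by (rule dt_cong) (simp add: \<tau>_def)
  finally show ?thesis by (simp add: S_def)
qed

text \<open>A repetition gives two equal rows. Arbitrary tuples are what product integrals produce,
  injective ones are what subsets count.\<close>

lemma sum_PiE_dt_eq_sum_inj_tuples:
  "(\<Sum>m\<in>{..<k} \<rightarrow>\<^sub>E {..<n :: nat}. dt k (\<lambda>i j. F (m i) (m j))) =
   (\<Sum>m\<in>inj_tuples k {..<n}. dt k (\<lambda>i j. F (m i) (m j)))"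
proof (rule sum.mono_neutral_right)
  show "\<forall>m\<in>({..<k} \<rightarrow>\<^sub>E {..<n}) - inj_tuples k {..<n}. dt k (\<lambda>i j. F (m i) (m j)) = 0"
  proof
    fix m assume "m \<in> ({..<k} \<rightarrow>\<^sub>E {..<n}) - inj_tuples k {..<n}"
    then obtain i j where "i < k" "j < k" "i \<noteq> j" "m i = m j"
      by (auto simp: inj_tuples_def inj_on_def)
    then show "dt k (\<lambda>i j. F (m i) (m j)) = 0"
      by (intro dt_eq_0_of_equal_rows[of i k j]) auto
  qed
qed (auto simp: inj_tuples_def intro!: finite_PiE)

text \<open>The Fredholm expansion of det(I + F): the rows taken from \<open>F\<close> form a set,
  and each k-set is the image of k! tuples.\<close>

lemma dt_identity_plus:
  fixes F :: "nat \<Rightarrow> nat \<Rightarrow> complex"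
  shows "dt n (\<lambda>i j. F i j + (if i = j then 1 else 0)) =
    (\<Sum>k\<le>n. (\<Sum>m\<in>{..<k} \<rightarrow>\<^sub>E {..<n}. dt k (\<lambda>i j. F (m i) (m j))) / fact k)"
proof -
  define f where "f S = dt n (\<lambda>i j. if i \<in> S then F i j else if i = j then 1 else 0)" for S
  have "dt n (\<lambda>i j. F i j + (if i = j then 1 else 0)) = (\<Sum>S\<in>Pow {..<n}. f S)"
    unfolding dt_add_expand f_def ..
  also have "\<dots> = (\<Sum>k\<le>n. \<Sum>S\<in>{S \<in> Pow {..<n}. card S = k}. f S)"
    by (rule sum.group[symmetric]) (auto dest: card_mono[rotated])
  also have "\<dots> = (\<Sum>k\<le>n. (\<Sum>m\<in>{..<k} \<rightarrow>\<^sub>E {..<n}. dt k (\<lambda>i j. F (m i) (m j))) / fact k)"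
  proof (intro sum.cong refl)
    fix k
    have "(\<Sum>m\<in>{..<k} \<rightarrow>\<^sub>E {..<n}. dt k (\<lambda>i j. F (m i) (m j))) = (\<Sum>m\<in>inj_tuples k {..<n}. f (m ` {..<k}))"
      unfolding sum_PiE_dt_eq_sum_inj_tuples f_def by (intro sum.cong refl dt_principal_minor)
    also have "\<dots> = fact k * (\<Sum>S | S \<subseteq> {..<n} \<and> card S = k. f S)"
      by (rule sum_inj_tuples) simp
    also have "{S. S \<subseteq> {..<n} \<and> card S = k} = {S \<in> Pow {..<n}. card S = k}" by auto
    finally show "(\<Sum>S\<in>{S \<in> Pow {..<n}. card S = k}. f S) =
        (\<Sum>m\<in>{..<k} \<rightarrow>\<^sub>E {..<n}. dt k (\<lambda>i j. F (m i) (m j))) / fact k" by simp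
  qed
  finally show ?thesis .
qed

text \<open>Only the full set has n elements. This is the top term of the Fredholm expansion, which
  belongs to the joint density of all n points.\<close>

lemma sum_PiE_dt_top:
  fixes F :: "nat \<Rightarrow> nat \<Rightarrow> complex"
  shows "(\<Sum>m\<in>{..<n} \<rightarrow>\<^sub>E {..<n}. dt n (\<lambda>i j. F (m i) (m j))) = fact n * dt n F"
proof -
  define f where "f S = dt n (\<lambda>i j. if i \<in> S then F i j else if i = j then 1 else 0)" for S
  have "(\<Sum>m\<in>{..<n} \<rightarrow>\<^sub>E {..<n}. dt n (\<lambda>i j. F (m i) (m j))) = (\<Sum>m\<in>inj_tuples n {..<n}. f (m ` {..<n}))"
    unfolding sum_PiE_dt_eq_sum_inj_tuples f_def by (intro sum.cong refl dt_principal_minor)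
  also have "\<dots> = fact n * (\<Sum>S | S \<subseteq> {..<n} \<and> card S = n. f S)"
    by (rule sum_inj_tuples) simp
  also have "{S. S \<subseteq> {..<n} \<and> card S = n} = {{..<n}}"
  proof -
    have "S = {..<n}" if "S \<subseteq> {..<n}" "card S = n" for S
      using card_subset_eq[OF finite_lessThan that(1)] that(2) by simp
    then show ?thesis by auto
  qed
  also have "sum f {{..<n}} = dt n F"
    by (simp add: f_def) (rule dt_cong, simp)
  finally show ?thesis .
qed

lemma sum_PiE_dt_large:
  fixes F :: "nat \<Rightarrow> nat \<Rightarrow> 'a :: idom"
  assumes "n < k"
  shows "(\<Sum>m\<in>{..<k} \<rightarrow>\<^sub>E {..<n}. dt k (\<lambda>i j. F (m i) (m j))) = 0"
  unfolding sum_PiE_dt_eq_sum_inj_tuples using inj_tuples_empty[of "{..<n}" k] assms by simp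

text \<open>Andreief's identity for a weight \<open>f\<close> and a kernel of finite rank. After
  expansion of the determinant and of every kernel entry, the integrand is a sum of products of
  functions of one variable, and Fubini's theorem turns these into minors of the matrix
  \<open>F\<close>.\<close>

lemma integral_prod_dt:
  fixes a b :: "nat \<Rightarrow> 'x \<Rightarrow> complex" and f :: "'x \<Rightarrow> complex"
  assumes "sigma_finite_measure M"
    and int: "\<And>m m'. m < n \<Longrightarrow> m' < n \<Longrightarrow> integrable M (\<lambda>x. f x * a m x * b m' x)"
  defines "F \<equiv> \<lambda>m m'. \<integral>x. f x * a m x * b m' x \<partial>M"
    and "D \<equiv> \<lambda>k x. (\<Prod>i<k. f (x i)) * dt k (\<lambda>i j. \<Sum>m<n. a m (x i) * b m (x j))"
  shows "integrable (\<Pi>\<^sub>M i\<in>{..<k}. M) (D k)"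
    and "(\<integral>x. D k x \<partial>(\<Pi>\<^sub>M i\<in>{..<k}. M)) =
      (\<Sum>m\<in>{..<k} \<rightarrow>\<^sub>E {..<n}. dt k (\<lambda>i j. F (m i) (m j)))"
proof -
  interpret product_sigma_finite "\<lambda>_. M"
    using assms(1) by (simp add: product_sigma_finite_def)
  \<comment> \<open>The variable x_j is the first argument of row j and the second argument of row
    \<open>inv_into UNIV \<sigma> j\<close>; the two basis indices that meet in it are the values of
    \<open>g\<close> at these rows.\<close>
  define T where "T g \<sigma> j x = f x * a (g j) x * b (g (inv_into UNIV \<sigma> j)) x"
    for g :: "nat \<Rightarrow> nat" and \<sigma> :: "nat \<Rightarrow> nat" and j :: nat and x
  have expand: "D k x = (\<Sum>g\<in>{..<k} \<rightarrow>\<^sub>E {..<n}. \<Sum>\<sigma> | \<sigma> permutes {..<k}. of_int (sign \<sigma>) * (\<Prod>j<k. T g \<sigma> j (x j)))" for x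
  proof -
    have "(\<Prod>i<k. f (x i)) * (\<Prod>i<k. \<Sum>m<n. a m (x i) * b m (x (\<sigma> i))) =
       (\<Sum>g\<in>{..<k} \<rightarrow>\<^sub>E {..<n}. \<Prod>j<k. T g \<sigma> j (x j))" if \<sigma>: "\<sigma> permutes {..<k}" for \<sigma>
    proof -
      have "(\<Prod>i<k. b (g i) (x (\<sigma> i))) = (\<Prod>j<k. b (g (inv_into UNIV \<sigma> j)) (x j))" for g
        by (subst prod.permute[OF \<sigma>]) (simp add: permutes_inverses[OF \<sigma>])
      then show ?thesis
        by (subst prod_sum_PiE) (auto simp: T_def prod.distrib sum_distrib_left mult_ac intro!: sum.cong)
    qed
    then have "D k x = (\<Sum>\<sigma> | \<sigma> permutes {..<k}. of_int (sign \<sigma>) * (\<Sum>g\<in>{..<k} \<rightarrow>\<^sub>E {..<n}. \<Prod>j<k. T g \<sigma> j (x j)))"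
      unfolding D_def dt_leibniz sum_distrib_left by (intro sum.cong refl) (simp add: mult.left_commute sum_distrib_left)
    then show ?thesis unfolding sum_distrib_left by (subst sum.swap)
  qed
  have inv_less: "inv_into UNIV \<sigma> j < k" if "\<sigma> permutes {..<k}" "j < k" for \<sigma> j
    using permutes_in_image[OF permutes_inv[OF that(1)], of j] that(2) by simp
  have intT: "integrable M (T g \<sigma> j)" if "g \<in> {..<k} \<rightarrow>\<^sub>E {..<n}" "\<sigma> permutes {..<k}" "j < k" for g \<sigma> j
    unfolding T_def using that inv_less[of \<sigma> j] by (intro int) auto
  have intP: "integrable (\<Pi>\<^sub>M i\<in>{..<k}. M) (\<lambda>x. \<Prod>j<k. T g \<sigma> j (x j))"
    if "g \<in> {..<k} \<rightarrow>\<^sub>E {..<n}" "\<sigma> permutes {..<k}" for g \<sigma>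
    using intT[OF that] by (intro product_integrable_prod) auto
  show "integrable (\<Pi>\<^sub>M i\<in>{..<k}. M) (D k)"
    unfolding expand[abs_def]
    by (intro Bochner_Integration.integrable_sum integrable_mult_right intP) auto
  have "(\<integral>x. D k x \<partial>(\<Pi>\<^sub>M i\<in>{..<k}. M)) =
    (\<Sum>g\<in>{..<k} \<rightarrow>\<^sub>E {..<n}. \<Sum>\<sigma> | \<sigma> permutes {..<k}. of_int (sign \<sigma>) * (\<integral>x. (\<Prod>j<k. T g \<sigma> j (x j)) \<partial>(\<Pi>\<^sub>M i\<in>{..<k}. M)))"
    (is "_ = ?rhs")
  proof -
    have "(\<integral>x. D k x \<partial>(\<Pi>\<^sub>M i\<in>{..<k}. M)) =
      (\<Sum>g\<in>{..<k} \<rightarrow>\<^sub>E {..<n}. \<integral>x. (\<Sum>\<sigma> | \<sigma> permutes {..<k}. of_int (sign \<sigma>) * (\<Prod>j<k. T g \<sigma> j (x j))) \<partial>(\<Pi>\<^sub>M i\<in>{..<k}. M))"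
      unfolding expand
      by (rule Bochner_Integration.integral_sum, rule Bochner_Integration.integrable_sum,
          rule integrable_mult_right, rule intP) auto
    also have "\<dots> = (\<Sum>g\<in>{..<k} \<rightarrow>\<^sub>E {..<n}. \<Sum>\<sigma> | \<sigma> permutes {..<k}.
        \<integral>x. of_int (sign \<sigma>) * (\<Prod>j<k. T g \<sigma> j (x j)) \<partial>(\<Pi>\<^sub>M i\<in>{..<k}. M))"
      by (rule sum.cong[OF refl], rule Bochner_Integration.integral_sum, rule integrable_mult_right, rule intP) auto
    also have "\<dots> = ?rhs"
      by (simp only: integral_mult_right_zero)
    finally show ?thesis .
  qed
  also have "\<dots> = (\<Sum>g\<in>{..<k} \<rightarrow>\<^sub>E {..<n}. \<Sum>\<sigma> | \<sigma> permutes {..<k}. of_int (sign \<sigma>) * (\<Prod>j<k. F (g j) (g (inv_into UNIV \<sigma> j))))"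
  proof (intro sum.cong refl arg_cong2[where f = times])
    fix g \<sigma> assume "g \<in> {..<k} \<rightarrow>\<^sub>E {..<n}" "\<sigma> \<in> {\<sigma>. \<sigma> permutes {..<k}}"
    then have "(\<integral>x. (\<Prod>j<k. T g \<sigma> j (x j)) \<partial>(\<Pi>\<^sub>M i\<in>{..<k}. M)) = (\<Prod>j<k. \<integral>x. T g \<sigma> j x \<partial>M)"
      using intT by (intro product_integral_prod) auto
    then show "(\<integral>x. (\<Prod>j<k. T g \<sigma> j (x j)) \<partial>(\<Pi>\<^sub>M i\<in>{..<k}. M)) = (\<Prod>j<k. F (g j) (g (inv_into UNIV \<sigma> j)))"
      by (simp only: T_def F_def)
  qed
  also have "\<dots> = (\<Sum>g\<in>{..<k} \<rightarrow>\<^sub>E {..<n}. dt k (\<lambda>i j. F (g i) (g j)))"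
  proof (intro sum.cong refl)
    fix g :: "nat \<Rightarrow> nat"
    have "dt k (\<lambda>i j. F (g i) (g j)) = (\<Sum>\<sigma> | \<sigma> permutes {..<k}. of_int (sign (inv_into UNIV \<sigma>)) * (\<Prod>j<k. F (g j) (g (inv_into UNIV \<sigma> j))))"
      unfolding dt_leibniz by (rule sum_permutations_inverse)
    also have "\<dots> = (\<Sum>\<sigma> | \<sigma> permutes {..<k}. of_int (sign \<sigma>) * (\<Prod>j<k. F (g j) (g (inv_into UNIV \<sigma> j))))"
    proof (intro sum.cong refl arg_cong2[where f = times] arg_cong[where f = of_int])
      fix \<sigma> assume "\<sigma> \<in> {\<sigma>. \<sigma> permutes {..<k}}"
      then have "permutation \<sigma>" by (auto simp: permutation_permutes)
      then show "sign (inv_into UNIV \<sigma>) = sign \<sigma>" by (rule sign_inverse)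
    qed
    finally show "(\<Sum>\<sigma> | \<sigma> permutes {..<k}. of_int (sign \<sigma>) * (\<Prod>j<k. F (g j) (g (inv_into UNIV \<sigma> j)))) = dt k (\<lambda>i j. F (g i) (g j))" ..
  qed
  finally show "(\<integral>x. D k x \<partial>(\<Pi>\<^sub>M i\<in>{..<k}. M)) = (\<Sum>m\<in>{..<k} \<rightarrow>\<^sub>E {..<n}. dt k (\<lambda>i j. F (m i) (m j)))" .
qed

section \<open>Product expectations of point processes\<close>

lemma sets_conf_space: "sets conf_space =
    sigma_sets Conf {{X \<in> Conf. card (X \<inter> B) = n} | B n. bounded B \<and> B \<in> sets borel}"
  unfolding conf_space_def by (rule sets_measure_of) auto

lemma space_conf_space [simp]: "space conf_space = Conf"
  unfolding conf_space_def by (rule space_measure_of) auto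

lemma Conf_finite_Int: "X \<in> Conf \<Longrightarrow> bounded B \<Longrightarrow> finite (X \<inter> B)"
  by (simp add: Conf_def)

lemma measurable_card_Int:
  assumes "bounded B" "B \<in> sets borel"
  shows "(\<lambda>X. card (X \<inter> B)) \<in> measurable conf_space (count_space UNIV)"
proof (subst measurable_count_space_eq2_countable, intro conjI ballI)
  fix n :: nat
  have "(\<lambda>X. card (X \<inter> B)) -` {n} \<inter> space conf_space = {X \<in> Conf. card (X \<inter> B) = n}" by auto
  also have "\<dots> \<in> sets conf_space" unfolding sets_conf_space using assms by blast
  finally show "(\<lambda>X. card (X \<inter> B)) -` {n} \<inter> space conf_space \<in> sets conf_space" .
qed auto

lemma sets_lam [simp]: "sets (lam \<phi>) = sets borel"
  by (simp add: lam_def)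

lemma measurable_PiM_lam: "measurable (\<Pi>\<^sub>M i\<in>{..<n}. lam \<phi>) N = measurable (tuple_space n) N"
  by (intro measurable_cong_sets sets_PiM_cong) auto

lemma space_tuple_space: "space (tuple_space k) = {..<k} \<rightarrow>\<^sub>E UNIV"
  by (simp add: space_PiM)

lemma finite_tuples: "X \<in> Conf \<Longrightarrow> bounded B \<Longrightarrow> finite ({..<k::nat} \<rightarrow>\<^sub>E (X \<inter> B))"
  by (intro finite_PiE Conf_finite_Int) auto

text \<open>The sigma-algebra is generated by counts in single sets, and the number of tuples in a
  rectangle is the product of such counts; a pi-lambda argument reaches all measurable sets of
  tuples.\<close>

lemma measurable_tuple_count_indicator:
  assumes B: "bounded B" "B \<in> sets borel" and A: "A \<in> sets (tuple_space k)"
  shows "(\<lambda>X. \<integral>\<^sup>+x. indicator A x \<partial>count_space ({..<k} \<rightarrow>\<^sub>E (X \<inter> B))) \<in> borel_measurable conf_space"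
proof -
  let ?\<Omega> = "\<Pi>\<^sub>E i\<in>{..<k}. space (borel :: complex measure)"
  let ?G = "prod_algebra {..<k} (\<lambda>_. borel :: complex measure)"
  have rect: "(\<lambda>X. \<integral>\<^sup>+x. indicator (Pi\<^sub>E {..<k} E) x \<partial>count_space ({..<k} \<rightarrow>\<^sub>E (X \<inter> B))) \<in> borel_measurable conf_space"
    if E: "E \<in> {..<k} \<rightarrow> sets borel" for E
  proof -
    have "(\<integral>\<^sup>+x. indicator (Pi\<^sub>E {..<k} E) x \<partial>count_space ({..<k} \<rightarrow>\<^sub>E (X \<inter> B))) =
        ennreal (real (\<Prod>i<k. card (X \<inter> (B \<inter> E i))))" if "X \<in> Conf" for X
    proof -
      have fin: "finite ({..<k} \<rightarrow>\<^sub>E (X \<inter> B))" using that B(1) by (rule finite_tuples)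
      have "(\<integral>\<^sup>+x. indicator (Pi\<^sub>E {..<k} E) x \<partial>count_space ({..<k} \<rightarrow>\<^sub>E (X \<inter> B))) =
          (\<Sum>x\<in>{..<k} \<rightarrow>\<^sub>E (X \<inter> B). indicator (Pi\<^sub>E {..<k} E) x)"
        by (rule nn_integral_count_space_finite[OF fin])
      also have "\<dots> = of_nat (card (({..<k} \<rightarrow>\<^sub>E (X \<inter> B)) \<inter> Pi\<^sub>E {..<k} E))"
        using fin by (simp add: indicator_def sum.If_cases)
      also have "({..<k} \<rightarrow>\<^sub>E (X \<inter> B)) \<inter> Pi\<^sub>E {..<k} E = Pi\<^sub>E {..<k} (\<lambda>i. X \<inter> (B \<inter> E i))"
        by (auto simp: PiE_iff)
      finally show ?thesis by (simp add: card_PiE ennreal_of_nat_eq_real_of_nat)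
    qed
    moreover have "(\<lambda>X. ennreal (real (\<Prod>i<k. card (X \<inter> (B \<inter> E i))))) \<in> borel_measurable conf_space"
    proof -
      have "(\<lambda>X. real (card (X \<inter> (B \<inter> E i)))) \<in> borel_measurable conf_space" if "i < k" for i
      proof -
        have "(\<lambda>X. card (X \<inter> (B \<inter> E i))) \<in> measurable conf_space (count_space UNIV)"
          using B E that by (intro measurable_card_Int) (auto intro: bounded_subset)
        then show ?thesis by (rule measurable_compose) simp
      qed
      then show ?thesis unfolding of_nat_prod by (intro measurable_compose[OF _ measurable_ennreal] borel_measurable_prod) auto
    qed
    ultimately show ?thesis by (subst measurable_cong) auto
  qed
  have "A \<in> sigma_sets ?\<Omega> ?G" using A unfolding sets_PiM .
  from Int_stable_prod_algebra prod_algebra_sets_into_space this show ?thesis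
  proof (induction rule: sigma_sets_induct_disjoint)
    case (basic A)
    then obtain E where "A = Pi\<^sub>E {..<k} E" "E \<in> {..<k} \<rightarrow> sets borel"
      unfolding prod_algebra_eq_finite[OF finite_lessThan] by blast
    then show ?case using rect by simp
  next
    \<comment> \<open>A complement is counted by a difference, which is legitimate because a bounded
      set holds finitely many tuples.\<close>
    case (compl A)
    have "(\<integral>\<^sup>+x. indicator (?\<Omega> - A) x \<partial>count_space ({..<k} \<rightarrow>\<^sub>E (X \<inter> B))) =
       (\<integral>\<^sup>+x. indicator (Pi\<^sub>E {..<k} (\<lambda>_. UNIV)) x \<partial>count_space ({..<k} \<rightarrow>\<^sub>E (X \<inter> B))) -
       (\<integral>\<^sup>+x. indicator A x \<partial>count_space ({..<k} \<rightarrow>\<^sub>E (X \<inter> B)))" if "X \<in> Conf" for X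
    proof -
      have fin: "finite ({..<k} \<rightarrow>\<^sub>E (X \<inter> B))" using that B(1) by (rule finite_tuples)
      have "(\<integral>\<^sup>+x. indicator (?\<Omega> - A) x \<partial>count_space ({..<k} \<rightarrow>\<^sub>E (X \<inter> B))) =
        (\<integral>\<^sup>+x. indicator (Pi\<^sub>E {..<k} (\<lambda>_. UNIV)) x - indicator A x \<partial>count_space ({..<k} \<rightarrow>\<^sub>E (X \<inter> B)))"
        by (intro nn_integral_cong) (auto simp: indicator_def PiE_iff)
      also have "\<dots> = (\<integral>\<^sup>+x. indicator (Pi\<^sub>E {..<k} (\<lambda>_. UNIV)) x \<partial>count_space ({..<k} \<rightarrow>\<^sub>E (X \<inter> B))) -
       (\<integral>\<^sup>+x. indicator A x \<partial>count_space ({..<k} \<rightarrow>\<^sub>E (X \<inter> B)))"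
      proof (rule nn_integral_diff)
        have "(\<integral>\<^sup>+x. indicator A x \<partial>count_space ({..<k} \<rightarrow>\<^sub>E (X \<inter> B))) =
            of_nat (card (({..<k} \<rightarrow>\<^sub>E (X \<inter> B)) \<inter> A))"
          using fin by (simp add: nn_integral_count_space_finite[OF fin] indicator_def sum.If_cases)
        then show "(\<integral>\<^sup>+x. indicator A x \<partial>count_space ({..<k} \<rightarrow>\<^sub>E (X \<inter> B))) \<noteq> \<infinity>"
          by simp
      qed (auto simp: indicator_def PiE_iff intro!: AE_I2)
      finally show ?thesis .
    qed
    moreover have "(\<lambda>X. (\<integral>\<^sup>+x. indicator (Pi\<^sub>E {..<k} (\<lambda>_. UNIV)) x \<partial>count_space ({..<k} \<rightarrow>\<^sub>E (X \<inter> B))) -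
       (\<integral>\<^sup>+x. indicator A x \<partial>count_space ({..<k} \<rightarrow>\<^sub>E (X \<inter> B)))) \<in> borel_measurable conf_space"
      by (intro borel_measurable_minus_ennreal compl rect) auto
    ultimately show ?case by (subst measurable_cong) auto
  next
    case (union A)
    have "(\<integral>\<^sup>+x. indicator (\<Union>i. A i) x \<partial>count_space ({..<k} \<rightarrow>\<^sub>E (X \<inter> B))) =
       (\<Sum>i. \<integral>\<^sup>+x. indicator (A i) x \<partial>count_space ({..<k} \<rightarrow>\<^sub>E (X \<inter> B)))" for X
      by (subst nn_integral_suminf[symmetric]) (auto simp: suminf_indicator[OF union(1)])
    then show ?case using union by simp
  qed simp
qed

lemma measurable_tuple_sum:
  assumes B: "bounded B" "B \<in> sets borel" and F: "F \<in> borel_measurable (tuple_space k)"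
  shows "(\<lambda>X. \<integral>\<^sup>+x. F x \<partial>count_space ({..<k} \<rightarrow>\<^sub>E (X \<inter> B))) \<in> borel_measurable conf_space"
  using F
proof (induction rule: borel_measurable_induct)
  case (cong f g)
  have "(\<integral>\<^sup>+x. f x \<partial>count_space ({..<k} \<rightarrow>\<^sub>E (X \<inter> B))) = (\<integral>\<^sup>+x. g x \<partial>count_space ({..<k} \<rightarrow>\<^sub>E (X \<inter> B)))" for X
    by (intro nn_integral_cong cong(3)) (auto simp: space_tuple_space)
  then show ?case using cong(4) by simp
next
  case (set A)
  then show ?case by (rule measurable_tuple_count_indicator[OF B])
next
  case (mult u c)
  then show ?case by (simp add: nn_integral_cmult)
next
  case (add u v)
  then show ?case by (simp add: nn_integral_add)
next
  case (seq U)
  have "(\<integral>\<^sup>+x. (SUP i. U i) x \<partial>count_space ({..<k} \<rightarrow>\<^sub>E (X \<inter> B))) =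
     (SUP i. \<integral>\<^sup>+x. U i x \<partial>count_space ({..<k} \<rightarrow>\<^sub>E (X \<inter> B)))" for X
    unfolding SUP_apply by (intro nn_integral_monotone_convergence_SUP seq) auto
  then show ?case using seq by simp
qed

lemma sets_inj_tuples: "{x \<in> space (tuple_space k). inj_on x {..<k}} \<in> sets (tuple_space k)"
proof -
  have "{x \<in> space (tuple_space k). inj_on x {..<k}} =
      space (tuple_space k) - (\<Union>i\<in>{..<k}. \<Union>j\<in>{..<k} - {i}. {x \<in> space (tuple_space k). x i = x j})"
    by (auto simp: inj_on_def)
  also have "\<dots> \<in> sets (tuple_space k)"
    by (intro sets.Diff sets.top sets.finite_UN measurable_equality_set measurable_component_singleton) auto
  finally show ?thesis .
qed

section \<open>Campbell's formula on a bounded set\<close>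

context
  fixes B :: "complex set"
  assumes B: "bounded B" "B \<in> sets borel"
begin

lemma tuple_sum_eq:
  assumes "X \<in> Conf" and "\<And>x. 0 \<le> F x"
  shows "ennreal (\<Sum>x\<in>distinct_tuples k (X \<inter> B). F x) =
     (\<integral>\<^sup>+x. ennreal (F x) * indicator {x \<in> space (tuple_space k). inj_on x {..<k}} x \<partial>count_space ({..<k} \<rightarrow>\<^sub>E (X \<inter> B)))"
proof -
  have fin: "finite ({..<k} \<rightarrow>\<^sub>E (X \<inter> B))" using assms(1) B(1) by (rule finite_tuples)
  have "distinct_tuples k (X \<inter> B) = ({..<k} \<rightarrow>\<^sub>E (X \<inter> B)) \<inter> {x \<in> space (tuple_space k). inj_on x {..<k}}"
    by (auto simp: distinct_tuples_def space_tuple_space PiE_iff extensional_def)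
  then have "(\<Sum>x\<in>distinct_tuples k (X \<inter> B). F x) =
      (\<Sum>x\<in>{..<k} \<rightarrow>\<^sub>E (X \<inter> B). F x * indicator {x \<in> space (tuple_space k). inj_on x {..<k}} x)"
    by (simp only: sum.inter_restrict[OF fin]) (intro sum.cong, auto simp: indicator_def)
  then show ?thesis
    using assms(2) by (simp add: nn_integral_count_space_finite[OF fin] sum_ennreal[symmetric] ennreal_mult' ennreal_indicator del: sum_ennreal)
qed

lemma measurable_distinct_tuples_sum_nonneg:
  assumes F: "F \<in> borel_measurable (tuple_space k)" and "\<And>x. 0 \<le> F x"
  shows "(\<lambda>X. \<Sum>x\<in>distinct_tuples k (X \<inter> B). F x :: real) \<in> borel_measurable conf_space"
proof -
  have "(\<lambda>X. enn2real (\<integral>\<^sup>+x. ennreal (F x) * indicator {x \<in> space (tuple_space k). inj_on x {..<k}} x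
      \<partial>count_space ({..<k} \<rightarrow>\<^sub>E (X \<inter> B)))) \<in> borel_measurable conf_space"
    by (intro borel_measurable_enn2real measurable_tuple_sum[OF B] borel_measurable_times_ennreal
        borel_measurable_indicator measurable_compose[OF F measurable_ennreal] sets_inj_tuples)
  then show ?thesis
    using assms(2) by (subst measurable_cong) (auto simp: tuple_sum_eq[symmetric] sum_nonneg)
qed

context
  fixes \<phi> :: "complex \<Rightarrow> real" and P :: "complex set measure" and k :: nat and \<rho> :: "(nat \<Rightarrow> complex) \<Rightarrow> real"
  assumes P: "sets P = sets conf_space"
    and cor: "has_correlation \<phi> P k \<rho>"
    and \<rho>: "\<rho> \<in> borel_measurable (tuple_space k)" "\<And>x. 0 \<le> \<rho> x"
begin

lemma space_P: "space P = Conf"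
  using sets_eq_imp_space_eq[OF P] by simp

text \<open>On a bounded set the sums are finite, which turns the nonnegative integrals of
  \<open>has_correlation\<close> into integrals of real-valued functions.\<close>

lemma campbell_nonneg:
  assumes F: "F \<in> borel_measurable (tuple_space k)" "\<And>x. 0 \<le> F x"
    and supp: "\<And>x i. i < k \<Longrightarrow> x i \<notin> B \<Longrightarrow> F x = 0"
    and int: "integrable (\<Pi>\<^sub>M i\<in>{..<k}. lam \<phi>) (\<lambda>x. F x * \<rho> x)"
  shows "integrable P (\<lambda>X. \<Sum>x\<in>distinct_tuples k (X \<inter> B). F x)"
    and "(\<integral>X. (\<Sum>x\<in>distinct_tuples k (X \<inter> B). F x) \<partial>P) = (\<integral>x. F x * \<rho> x \<partial>(\<Pi>\<^sub>M i\<in>{..<k}. lam \<phi>))"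
proof -
  have "(\<integral>\<^sup>+X. ennreal (\<Sum>x\<in>distinct_tuples k (X \<inter> B). F x) \<partial>P) =
     (\<integral>\<^sup>+X. (\<integral>\<^sup>+x. ennreal (F x) \<partial>count_space (distinct_tuples k X)) \<partial>P)"
  proof (rule nn_integral_cong)
    fix X assume "X \<in> space P"
    then have fin: "finite (distinct_tuples k (X \<inter> B))"
      using B(1) by (simp add: space_P distinct_tuples_eq_inj_tuples finite_inj_tuples Conf_finite_Int)
    have "(\<integral>\<^sup>+x. ennreal (F x) \<partial>count_space (distinct_tuples k X)) =
      (\<integral>\<^sup>+x. ennreal (F x) \<partial>count_space (distinct_tuples k (X \<inter> B)))"
    proof (rule nn_integral_count_space_eq)
      fix x assume "x \<in> distinct_tuples k X - distinct_tuples k (X \<inter> B)"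
      then obtain i where "i < k" "x i \<notin> B" by (auto simp: distinct_tuples_def PiE_iff)
      then show "ennreal (F x) = 0" using supp by simp
    qed (auto simp: distinct_tuples_def PiE_iff)
    also have "\<dots> = ennreal (\<Sum>x\<in>distinct_tuples k (X \<inter> B). F x)"
      using fin F(2) by (simp add: nn_integral_count_space_finite)
    finally show "ennreal (\<Sum>x\<in>distinct_tuples k (X \<inter> B). F x) =
      (\<integral>\<^sup>+x. ennreal (F x) \<partial>count_space (distinct_tuples k X))" ..
  qed
  also have "\<dots> = (\<integral>\<^sup>+x. ennreal (F x) * ennreal (\<rho> x) \<partial>(\<Pi>\<^sub>M i\<in>{..<k}. lam \<phi>))"
    using cor F(1) unfolding has_correlation_def by auto
  also have "\<dots> = (\<integral>\<^sup>+x. ennreal (F x * \<rho> x) \<partial>(\<Pi>\<^sub>M i\<in>{..<k}. lam \<phi>))"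
    using F(2) by (simp add: ennreal_mult')
  also have "\<dots> = ennreal (\<integral>x. F x * \<rho> x \<partial>(\<Pi>\<^sub>M i\<in>{..<k}. lam \<phi>))"
    using int F(2) \<rho>(2) by (intro nn_integral_eq_integral) auto
  finally have eq: "(\<integral>\<^sup>+X. ennreal (\<Sum>x\<in>distinct_tuples k (X \<inter> B). F x) \<partial>P) =
      ennreal (\<integral>x. F x * \<rho> x \<partial>(\<Pi>\<^sub>M i\<in>{..<k}. lam \<phi>))" .
  have meas: "(\<lambda>X. \<Sum>x\<in>distinct_tuples k (X \<inter> B). F x) \<in> borel_measurable P"
    using measurable_distinct_tuples_sum_nonneg[OF F] measurable_cong_sets[OF P refl] by blast
  have nn: "0 \<le> (\<Sum>x\<in>distinct_tuples k (X \<inter> B). F x)" for X using F(2) by (simp add: sum_nonneg)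
  have i0: "0 \<le> (\<integral>x. F x * \<rho> x \<partial>(\<Pi>\<^sub>M i\<in>{..<k}. lam \<phi>))" using F(2) \<rho>(2) by simp
  show "integrable P (\<lambda>X. \<Sum>x\<in>distinct_tuples k (X \<inter> B). F x)"
    using integrableI_nn_integral_finite[OF meas _ eq] nn by simp
  show "(\<integral>X. (\<Sum>x\<in>distinct_tuples k (X \<inter> B). F x) \<partial>P) = (\<integral>x. F x * \<rho> x \<partial>(\<Pi>\<^sub>M i\<in>{..<k}. lam \<phi>))"
    using integral_eq_nn_integral[OF meas] nn eq i0 by simp
qed

text \<open>Positive and negative parts are treated separately. The L^1 bound is what later makes
  the series over k summable.\<close>

lemma campbell:
  assumes F: "F \<in> borel_measurable (tuple_space k)"
    and supp: "\<And>x i. i < k \<Longrightarrow> x i \<notin> B \<Longrightarrow> F x = 0"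
    and int: "integrable (\<Pi>\<^sub>M i\<in>{..<k}. lam \<phi>) (\<lambda>x. F x * \<rho> x)"
  shows "integrable P (\<lambda>X. \<Sum>x\<in>distinct_tuples k (X \<inter> B). F x)"
    and "(\<integral>X. (\<Sum>x\<in>distinct_tuples k (X \<inter> B). F x) \<partial>P) = (\<integral>x. F x * \<rho> x \<partial>(\<Pi>\<^sub>M i\<in>{..<k}. lam \<phi>))"
    and "(\<integral>X. \<bar>\<Sum>x\<in>distinct_tuples k (X \<inter> B). F x\<bar> \<partial>P) \<le> (\<integral>x. \<bar>F x\<bar> * \<rho> x \<partial>(\<Pi>\<^sub>M i\<in>{..<k}. lam \<phi>))"
proof -
  have "(\<lambda>x. max 0 (F x) * \<rho> x) = (\<lambda>x. max 0 (F x * \<rho> x))" "(\<lambda>x. max 0 (- F x) * \<rho> x) = (\<lambda>x. max 0 (- (F x * \<rho> x)))"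
    "(\<lambda>x. \<bar>F x\<bar> * \<rho> x) = (\<lambda>x. \<bar>F x * \<rho> x\<bar>)"
    using \<rho>(2) by (simp_all add: fun_eq_iff max_mult_distrib_right abs_mult)
  then have ints: "integrable (\<Pi>\<^sub>M i\<in>{..<k}. lam \<phi>) (\<lambda>x. max 0 (F x) * \<rho> x)"
    "integrable (\<Pi>\<^sub>M i\<in>{..<k}. lam \<phi>) (\<lambda>x. max 0 (- F x) * \<rho> x)"
    "integrable (\<Pi>\<^sub>M i\<in>{..<k}. lam \<phi>) (\<lambda>x. \<bar>F x\<bar> * \<rho> x)"
    using int by (auto intro!: integrable_max)
  note p = campbell_nonneg[of "\<lambda>x. max 0 (F x)", OF _ _ _ ints(1)]
  note n = campbell_nonneg[of "\<lambda>x. max 0 (- F x)", OF _ _ _ ints(2)]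
  note a = campbell_nonneg[of "\<lambda>x. \<bar>F x\<bar>", OF _ _ _ ints(3)]
  have eq: "(\<Sum>x\<in>distinct_tuples k (X \<inter> B). F x) =
      (\<Sum>x\<in>distinct_tuples k (X \<inter> B). max 0 (F x)) - (\<Sum>x\<in>distinct_tuples k (X \<inter> B). max 0 (- F x))" for X
    unfolding sum_subtractf[symmetric] by (intro sum.cong) auto
  show 1: "integrable P (\<lambda>X. \<Sum>x\<in>distinct_tuples k (X \<inter> B). F x)"
    unfolding eq using F supp by (intro Bochner_Integration.integrable_diff p(1) n(1)) auto
  have "(\<integral>X. (\<Sum>x\<in>distinct_tuples k (X \<inter> B). F x) \<partial>P) =
    (\<integral>x. max 0 (F x) * \<rho> x \<partial>(\<Pi>\<^sub>M i\<in>{..<k}. lam \<phi>)) - (\<integral>x. max 0 (- F x) * \<rho> x \<partial>(\<Pi>\<^sub>M i\<in>{..<k}. lam \<phi>))"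
    unfolding eq using F supp
    by (subst Bochner_Integration.integral_diff) (auto intro!: p n arg_cong2[where f = "(-)"])
  also have "\<dots> = (\<integral>x. max 0 (F x) * \<rho> x - max 0 (- F x) * \<rho> x \<partial>(\<Pi>\<^sub>M i\<in>{..<k}. lam \<phi>))"
    using ints by (subst Bochner_Integration.integral_diff) auto
  also have "\<dots> = (\<integral>x. F x * \<rho> x \<partial>(\<Pi>\<^sub>M i\<in>{..<k}. lam \<phi>))"
    by (intro Bochner_Integration.integral_cong) (auto simp: max_def)
  finally show "(\<integral>X. (\<Sum>x\<in>distinct_tuples k (X \<inter> B). F x) \<partial>P) = (\<integral>x. F x * \<rho> x \<partial>(\<Pi>\<^sub>M i\<in>{..<k}. lam \<phi>))" .
  have "(\<integral>X. \<bar>\<Sum>x\<in>distinct_tuples k (X \<inter> B). F x\<bar> \<partial>P) \<le> (\<integral>X. (\<Sum>x\<in>distinct_tuples k (X \<inter> B). \<bar>F x\<bar>) \<partial>P)"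
    using F supp by (intro integral_mono integrable_abs 1 a(1) sum_abs) auto
  also have "\<dots> = (\<integral>x. \<bar>F x\<bar> * \<rho> x \<partial>(\<Pi>\<^sub>M i\<in>{..<k}. lam \<phi>))"
    using F supp by (intro a(2)) auto
  finally show "(\<integral>X. \<bar>\<Sum>x\<in>distinct_tuples k (X \<inter> B). F x\<bar> \<partial>P) \<le> (\<integral>x. \<bar>F x\<bar> * \<rho> x \<partial>(\<Pi>\<^sub>M i\<in>{..<k}. lam \<phi>))" .
qed

end

end


text \<open>For each configuration the product is a finite sum over tuples, and Campbell's formula
  integrates it term by term. The bound of the correlation functions by products of one-point
  functions, which will come from Hadamard's inequality, makes the k-th term at most c^k / k!. The
  function \<open>\<kappa>\<close> is kept variable because \<open>f\<close> will have poles at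
  which \<open>\<kappa>\<close> vanishes.\<close>

lemma sigma_finite_expectation_prod:
  fixes f \<kappa> :: "complex \<Rightarrow> real" and \<phi> :: "complex \<Rightarrow> real"
  assumes B: "bounded B" "B \<in> sets borel"
    and sf: "sigma_finite_measure (lam \<phi>)"
    and P: "sets P = sets conf_space"
    and cor: "\<And>k. has_correlation \<phi> P k (\<rho> k)"
    and \<rho>: "\<And>k. \<rho> k \<in> borel_measurable (tuple_space k)" "\<And>k x. 0 \<le> \<rho> k x"
    and f: "f \<in> borel_measurable borel" "\<And>x. x \<notin> B \<Longrightarrow> f x = 0"
    and \<kappa>: "\<And>x. 0 \<le> \<kappa> x" "integrable (lam \<phi>) (\<lambda>x. \<bar>f x\<bar> * \<kappa> x)"
    and bound: "\<And>k x. (\<And>i. i < k \<Longrightarrow> x i \<in> B) \<Longrightarrow> \<rho> k x \<le> (\<Prod>i<k. \<kappa> (x i))"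
  shows "integrable P (\<lambda>X. \<Prod>x\<in>X \<inter> B. 1 + f x)"
    and "(\<lambda>k. (\<integral>x. (\<Prod>i<k. f (x i)) * \<rho> k x \<partial>(\<Pi>\<^sub>M i\<in>{..<k}. lam \<phi>)) / fact k) sums
      (\<integral>X. (\<Prod>x\<in>X \<inter> B. 1 + f x) \<partial>P)"
proof -
  interpret product_sigma_finite "\<lambda>_. lam \<phi>"
    using sf by (simp add: product_sigma_finite_def)
  define c where "c = (\<integral>x. \<bar>f x\<bar> * \<kappa> x \<partial>lam \<phi>)"
  define F where "F k x = (\<Prod>i<k. f (x i))" for k and x :: "nat \<Rightarrow> complex"
  have [measurable]: "F k \<in> borel_measurable (tuple_space k)" for k
    unfolding F_def by (intro borel_measurable_prod measurable_compose[OF measurable_component_singleton[where M = "\<lambda>_. borel"] f(1)]) auto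
  have meas: "(\<lambda>x. F k x * \<rho> k x) \<in> borel_measurable (\<Pi>\<^sub>M i\<in>{..<k}. lam \<phi>)" for k
    using \<rho>(1)[of k] unfolding measurable_PiM_lam by (intro borel_measurable_times) auto
  have supp: "F k x = 0" if "i < k" "x i \<notin> B" for i k x
    using that f(2) unfolding F_def by (intro prod_zero) auto
  have le: "\<bar>F k x * \<rho> k x\<bar> \<le> (\<Prod>i<k. \<bar>f (x i)\<bar> * \<kappa> (x i))" for k x
  proof (cases "\<exists>i<k. x i \<notin> B")
    case True
    then have "F k x = 0" using supp by blast
    then show ?thesis using \<kappa>(1) by (auto intro!: prod_nonneg)
  next
    case False
    then show ?thesis
      using bound[of k x] \<rho>(2)[of k x] by (auto simp: F_def abs_mult abs_prod prod.distrib intro!: mult_left_mono prod_nonneg)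
  qed
  have dom: "integrable (\<Pi>\<^sub>M i\<in>{..<k}. lam \<phi>) (\<lambda>x. \<Prod>i<k. \<bar>f (x i)\<bar> * \<kappa> (x i))" for k :: nat
    using \<kappa>(2) by (intro product_integrable_prod) auto
  have domi: "(\<integral>x. (\<Prod>i<k. \<bar>f (x i)\<bar> * \<kappa> (x i)) \<partial>(\<Pi>\<^sub>M i\<in>{..<k}. lam \<phi>)) = c ^ k" for k :: nat
    using product_integral_prod[of "{..<k}" "\<lambda>_ x. \<bar>f x\<bar> * \<kappa> x"] \<kappa>(2) by (simp add: c_def)
  have int: "integrable (\<Pi>\<^sub>M i\<in>{..<k}. lam \<phi>) (\<lambda>x. F k x * \<rho> k x)" for k
    by (rule Bochner_Integration.integrable_bound[OF dom meas]) (use le in \<open>auto intro!: AE_I2 order_trans[OF le]\<close>)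
  \<comment> \<open>The k-th elementary symmetric polynomial of the values of \<open>f\<close> on
    the points in \<open>B\<close>; it vanishes once k exceeds their number.\<close>
  define S where "S k X = (\<Sum>x\<in>distinct_tuples k (X \<inter> B). F k x) / fact k" for k X
  note C = campbell[OF B P cor \<rho>(1) \<rho>(2) \<open>F _ \<in> _\<close> _ int, OF supp]
  have intS: "integrable P (S k)" for k unfolding S_def using C(1) by simp
  have absS: "(\<integral>X. norm (S k X) \<partial>P) \<le> c ^ k / fact k" for k
  proof -
    have "(\<integral>X. \<bar>\<Sum>x\<in>distinct_tuples k (X \<inter> B). F k x\<bar> \<partial>P) \<le> (\<integral>x. \<bar>F k x\<bar> * \<rho> k x \<partial>(\<Pi>\<^sub>M i\<in>{..<k}. lam \<phi>))"
      by (rule C(3))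
    also have "\<dots> \<le> (\<integral>x. (\<Prod>i<k. \<bar>f (x i)\<bar> * \<kappa> (x i)) \<partial>(\<Pi>\<^sub>M i\<in>{..<k}. lam \<phi>))"
    proof (rule integral_mono[OF _ dom])
      show "integrable (\<Pi>\<^sub>M i\<in>{..<k}. lam \<phi>) (\<lambda>x. \<bar>F k x\<bar> * \<rho> k x)"
        using integrable_abs[OF int[of k]] \<rho>(2)[of k] by (simp add: abs_mult)
      show "\<bar>F k x\<bar> * \<rho> k x \<le> (\<Prod>i<k. \<bar>f (x i)\<bar> * \<kappa> (x i))" for x
        using le[of k x] \<rho>(2)[of k x] by (simp add: abs_mult)
    qed
    finally show ?thesis unfolding domi S_def by (simp add: divide_right_mono)
  qed
  have summ: "summable (\<lambda>k. c ^ k / fact k)"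
    using summable_exp_generic[of c] by (simp add: scaleR_conv_of_real divide_inverse mult.commute)
  have S1: "summable (\<lambda>k. \<integral>X. norm (S k X) \<partial>P)"
    by (rule summable_comparison_test'[OF summ, of 0]) (use absS in auto)
  have sums: "(\<lambda>k. S k X) sums (\<Prod>x\<in>X \<inter> B. 1 + f x)" "summable (\<lambda>k. norm (S k X))" if "X \<in> space P" for X
  proof -
    have fin: "finite (X \<inter> B)"
      using that B(1) sets_eq_imp_space_eq[OF P] by (simp add: Conf_finite_Int)
    have 0: "S k X = 0" if "k \<notin> {..card (X \<inter> B)}" for k
      using that inj_tuples_empty[OF fin, of k] by (simp add: S_def distinct_tuples_eq_inj_tuples)
    show "(\<lambda>k. S k X) sums (\<Prod>x\<in>X \<inter> B. 1 + f x)"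
      using sums_finite[of "{..card (X \<inter> B)}", OF _ 0] prod_add_one_eq_sum_tuples[OF fin order_refl, of f]
      by (simp add: S_def F_def distinct_tuples_eq_inj_tuples)
    show "summable (\<lambda>k. norm (S k X))"
      using 0 by (intro summable_finite[of "{..card (X \<inter> B)}"]) auto
  qed
  have eq: "(\<Prod>x\<in>X \<inter> B. 1 + f x) = (\<Sum>k. S k X)" if "X \<in> space P" for X
    using sums(1)[OF that] by (rule sums_unique)
  have "integrable P (\<lambda>X. \<Sum>k. S k X)"
    using sums(2) by (intro integrable_suminf intS S1 AE_I2)
  then show "integrable P (\<lambda>X. \<Prod>x\<in>X \<inter> B. 1 + f x)"
    using eq by (subst Bochner_Integration.integrable_cong[OF refl]) auto
  have "(\<lambda>k. \<integral>X. S k X \<partial>P) sums (\<integral>X. (\<Sum>k. S k X) \<partial>P)"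
    using sums(2) by (intro sums_integral intS S1 AE_I2)
  also have "(\<integral>X. (\<Sum>k. S k X) \<partial>P) = (\<integral>X. (\<Prod>x\<in>X \<inter> B. 1 + f x) \<partial>P)"
    using eq by (intro Bochner_Integration.integral_cong) auto
  finally show "(\<lambda>k. (\<integral>x. (\<Prod>i<k. f (x i)) * \<rho> k x \<partial>(\<Pi>\<^sub>M i\<in>{..<k}. lam \<phi>)) / fact k) sums
      (\<integral>X. (\<Prod>x\<in>X \<inter> B. 1 + f x) \<partial>P)"
    unfolding S_def using C(2) by (simp add: F_def)
qed

section \<open>Radial weights\<close>

lemma has_real_derivative_along_line:
  fixes f :: "complex \<Rightarrow> real"
  assumes "f differentiable (at (z + of_real t * v))"
  shows "((\<lambda>t. f (z + of_real t * v)) has_real_derivative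
    frechet_derivative f (at (z + of_real t * v)) v) (at t)"
proof -
  let ?D = "frechet_derivative f (at (z + of_real t * v))"
  have D: "(f has_derivative ?D) (at (z + of_real t * v))"
    using assms by (simp add: frechet_derivative_works)
  have "((\<lambda>t. z + of_real t * v) has_derivative (\<lambda>h. of_real h * v)) (at t)"
    by (auto intro!: derivative_eq_intros)
  from has_derivative_compose[OF this D]
  have "((\<lambda>t. f (z + of_real t * v)) has_derivative (\<lambda>h. ?D (of_real h * v))) (at t)" by simp
  moreover have "(\<lambda>h. ?D (of_real h * v)) = times (?D v)"
  proof
    fix h :: real
    have "linear ?D" using D by (rule has_derivative_linear)
    then have "?D (h *\<^sub>R v) = h *\<^sub>R ?D v" by (rule linear_scale)
    then show "?D (of_real h * v) = ?D v * h" by (simp add: scaleR_conv_of_real mult.commute)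
  qed
  ultimately show ?thesis unfolding has_field_derivative_def by simp
qed

lemma emeasure_cball_complex: "emeasure lborel (cball (0::complex) r) = ennreal (if 0 \<le> r then pi * r\<^sup>2 else 0)"
  by (simp add: emeasure_cball unit_ball_vol_2)

text \<open>Both measures are determined by their values on the half lines \<open>{..a}\<close>,
  where the left one is the area of a disc.\<close>

lemma distr_cmod_lborel:
  "distr lborel borel cmod = density lborel (\<lambda>r. ennreal (2 * pi * r * indicator {0..} r))"
proof (rule measure_eqI_generator_eq[where E = "range atMost" and \<Omega> = UNIV and A = "\<lambda>i. {..real i}"])
  have sb: "sets (borel :: real measure) = sigma_sets UNIV (range atMost)"
    unfolding borel_eq_atMost by (simp add: sets_measure_of)
  show "sets (distr lborel borel cmod) = sigma_sets UNIV (range atMost)"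
    "sets (density lborel (\<lambda>r. ennreal (2 * pi * r * indicator {0..} r))) = sigma_sets UNIV (range atMost)"
    using sb by auto
  have vi: "cmod -` {..a} = cball 0 a" for a by auto
  have e: "emeasure (distr lborel borel cmod) {..a} = ennreal (if 0 \<le> a then pi * a\<^sup>2 else 0)" for a
    using emeasure_cball_complex[of a] by (subst emeasure_distr) (auto simp: vi)
  show "emeasure (distr lborel borel cmod) {..real i} \<noteq> \<infinity>" for i unfolding e by simp
  fix S :: "real set" assume "S \<in> range atMost"
  then obtain a where S: "S = {..a}" by auto
  have "emeasure (density lborel (\<lambda>r. ennreal (2 * pi * r * indicator {0..} r))) {..a} =
     (\<integral>\<^sup>+r. ennreal (2 * pi * r) * indicator {0..a} r \<partial>lborel)"
    by (subst emeasure_density) (auto intro!: nn_integral_cong simp: indicator_def)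
  also have "\<dots> = ennreal (if 0 \<le> a then pi * a\<^sup>2 else 0)"
  proof (cases "0 \<le> a")
    case True
    have "(\<integral>\<^sup>+r. ennreal (2 * pi * r) * indicator {0..a} r \<partial>lborel) = ennreal (pi * a\<^sup>2 - pi * 0\<^sup>2)"
      by (rule nn_integral_FTC_Icc) (auto intro!: derivative_eq_intros simp: True)
    then show ?thesis using True by simp
  qed simp
  finally show "emeasure (distr lborel borel cmod) S =
      emeasure (density lborel (\<lambda>r. ennreal (2 * pi * r * indicator {0..} r))) S"
    unfolding S e ..
qed (auto simp: Int_stable_def intro: real_arch_simple)

text \<open>Integration by parts without boundary terms; the identities for mean and variance below
  come from suitable choices of \<open>F\<close>.\<close>

lemma integral_deriv_half_line_eq_0:
  fixes F f :: "real \<Rightarrow> real"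
  assumes F: "\<And>x. 0 < x \<Longrightarrow> (F has_real_derivative f x) (at x)"
    and f: "\<And>x. 0 < x \<Longrightarrow> isCont f x"
    and int: "integrable lborel (\<lambda>x. indicator {0..} x * f x)"
    and lim: "(F \<longlongrightarrow> 0) (at_right 0)" "(F \<longlongrightarrow> 0) at_top"
  shows "(\<integral>x. indicator {0..} x * f x \<partial>lborel) = 0"
proof -
  have e: "einterval 0 \<infinity> = {0<..}" by (auto simp: einterval_def)
  have ae: "AE x in lborel. indicator {0..} x * f x = indicator {0<..} x * f x"
    using AE_lborel_singleton[of 0] by eventually_elim (auto simp: indicator_def)
  have fb: "(\<lambda>x. indicator {0<..} x * f x) \<in> borel_measurable borel"
  proof -
    have "continuous_on {0<..} f" using f by (intro continuous_at_imp_continuous_on) auto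
    then show ?thesis
      using borel_measurable_continuous_on_indicator[of "{0<..}" f] by (simp add: mult.commute)
  qed
  have int': "integrable lborel (\<lambda>x. indicator {0<..} x * f x)"
    using int ae fb by (subst integrable_cong_AE[symmetric, OF _ _ ae]) auto
  have "(LBINT x=0..\<infinity>. f x) = 0 - 0"
  proof (rule interval_integral_FTC_integrable)
    show "(F has_vector_derivative f x) (at x)" if "0 < ereal x" for x
      using F that by (simp add: has_real_derivative_iff_has_vector_derivative[symmetric])
    show "set_integrable lborel (einterval 0 \<infinity>) f"
      using int' by (simp add: e set_integrable_def)
    show "((F \<circ> real_of_ereal) \<longlongrightarrow> 0) (at_right 0)"
      unfolding zero_ereal_def at_right_ereal using lim(1) by (simp add: filterlim_filtermap o_def)
    show "((F \<circ> real_of_ereal) \<longlongrightarrow> 0) (at_left \<infinity>)"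
      unfolding at_left_PInf using lim(2) by (simp add: filterlim_filtermap o_def)
  qed (use f in auto)
  moreover have "(LBINT x=0..\<infinity>. f x) = (\<integral>x. indicator {0<..} x * f x \<partial>lborel)"
    by (simp add: interval_lebesgue_integral_def e set_lebesgue_integral_def)
  moreover have "\<dots> = (\<integral>x. indicator {0..} x * f x \<partial>lborel)"
    using int fb ae by (intro integral_cong_AE) auto
  ultimately show ?thesis by simp
qed

text \<open>Scaling by sqrt c reduces this to the moments of the standard Gaussian, which come in an
  even and an odd form.\<close>

lemma integrable_gaussian_times_power:
  fixes c :: real
  assumes "0 < c"
  shows "integrable lborel (\<lambda>x. indicator {0..} x * (x ^ k * exp (- c * x\<^sup>2)))"
proof -
  have 1: "integrable lborel (\<lambda>x::real. indicator {0..} x * (exp (- x\<^sup>2) * x ^ k))"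
  proof (cases "even k")
    case True
    then obtain j where "k = 2 * j" by auto
    then show ?thesis using integrable.intros[OF gaussian_moment_even_pos[of j]] by simp
  next
    case False
    then obtain j where "k = 2 * j + 1" by (elim oddE)
    then show ?thesis using integrable.intros[OF gaussian_moment_odd_pos[of j]] by simp
  qed
  have s: "sqrt c > 0" using assms by simp
  have "integrable lborel (\<lambda>x. indicator {0..} (0 + sqrt c * x) * (exp (- (0 + sqrt c * x)\<^sup>2) * (0 + sqrt c * x) ^ k))"
    using lborel_integrable_real_affine[OF 1, of "sqrt c" 0] s by simp
  then have "integrable lborel (\<lambda>x. (1 / sqrt c ^ k) * (indicator {0..} (0 + sqrt c * x) * (exp (- (0 + sqrt c * x)\<^sup>2) * (0 + sqrt c * x) ^ k)))"
    by simp
  moreover have "(1 / sqrt c ^ k) * (indicator {0..} (0 + sqrt c * x) * (exp (- (0 + sqrt c * x)\<^sup>2) * (0 + sqrt c * x) ^ k)) =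
     indicator {0..} x * (x ^ k * exp (- c * x\<^sup>2))" for x
    using s assms by (auto simp: indicator_def zero_le_mult_iff power_mult_distrib)
  ultimately show ?thesis by simp
qed

section \<open>The radial profile and the function r phi'(r)\<close>

locale radial_weight =
  fixes \<phi> :: "complex \<Rightarrow> real" and m M :: real
  assumes C2: "C2_fun \<phi>" and m_pos: "0 < m"
    and lap_ge: "\<And>z. m \<le> laplacian \<phi> z" and lap_le: "\<And>z. laplacian \<phi> z \<le> M"
    and radial: "radial \<phi>"
begin

abbreviation "d v z \<equiv> frechet_derivative \<phi> (at z) v"
abbreviation "dd v w z \<equiv> frechet_derivative (\<lambda>z. d v z) (at z) w"

definition "\<Phi> r = \<phi> (of_real r)"
text \<open>The Laplacian has mass 2 pi \<open>XX r\<close> on the disc of radius r. This is the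
  counting function of the problem: the monomial of index i concentrates where \<open>XX\<close> is
  about i + 1.\<close>

definition "XX r = r * d 1 (of_real r)"

lemma M_pos: "0 < M" using m_pos lap_ge[of 0] lap_le[of 0] by linarith

lemma C1: "C1_fun \<phi>" and C1_d: "C1_fun (\<lambda>z. d v z)"
  using C2 by (auto simp: C2_fun_def)

lemma diff: "\<phi> differentiable (at z)" and diff_d: "(\<lambda>z. d v z) differentiable (at z)"
  using C1 C1_d by (auto simp: C1_fun_def)

lemma cont_d: "continuous_on UNIV (\<lambda>z. d v z)" and cont_dd: "continuous_on UNIV (\<lambda>z. dd v w z)"
  using C1 C1_d by (auto simp: C1_fun_def)

lemma phi_cong: "cmod z = cmod w \<Longrightarrow> \<phi> z = \<phi> w"
  using radial unfolding radial_def by blast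

lemma phi_eq: "\<phi> z = \<Phi> (cmod z)"
  unfolding \<Phi>_def by (rule phi_cong) simp

text \<open>The weight is constant along the circle t -> z cis t, whose velocity at t = 0 is i
  z.\<close>

lemma d_tangential: "d (\<i> * z) z = 0"
proof -
  have 1: "((\<lambda>t. \<phi> (z * cis t)) has_derivative (\<lambda>h. d (z * (\<i> * of_real h)) z)) (at 0)"
  proof -
    have "((\<lambda>w. z * exp (\<i> * w)) has_field_derivative z * \<i>) (at (of_real 0))"
      by (auto intro!: derivative_eq_intros)
    from has_vector_derivative_real_field[OF this]
    have "((\<lambda>t. z * cis t) has_derivative (\<lambda>h. z * (\<i> * of_real h))) (at 0)"
      by (simp add: cis_conv_exp has_vector_derivative_def scaleR_conv_of_real mult_ac)
    moreover have "(\<phi> has_derivative (\<lambda>h. d h (z * cis 0))) (at (z * cis 0))"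
      using diff frechet_derivative_works by blast
    ultimately show ?thesis using has_derivative_compose by fastforce
  qed
  have "(\<lambda>t. \<phi> (z * cis t)) = (\<lambda>t. \<phi> z)"
    by (intro ext phi_cong) (simp add: norm_mult)
  then have "((\<lambda>t. \<phi> (z * cis t)) has_derivative (\<lambda>h. 0)) (at 0)" by simp
  from has_derivative_unique[OF 1 this] have "d (z * (\<i> * of_real 1)) z = 0" by metis
  then show ?thesis by (simp add: mult.commute)
qed

lemma d_tangential_coords: "- y * d 1 (Complex r y) + r * d \<i> (Complex r y) = 0"
proof -
  have lin: "linear (\<lambda>v. d v (Complex r y))" using diff by (rule linear_frechet_derivative)
  have "\<i> * Complex r y = (- y) *\<^sub>R 1 + r *\<^sub>R \<i>" by (simp add: complex_eq_iff)
  then have "d (\<i> * Complex r y) (Complex r y) = - y * d 1 (Complex r y) + r * d \<i> (Complex r y)"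
    using linear_add[OF lin] linear_scale[OF lin] by (simp del: scaleR_minus_left)
  then show ?thesis using d_tangential by simp
qed

text \<open>Differentiating the tangential identity across the real axis gives the angular part of
  the Laplacian in polar coordinates.\<close>

lemma dd_tangential: "r * dd \<i> \<i> (of_real r) = d 1 (of_real r)"
proof -
  have line: "((\<lambda>t. d v (of_real r + of_real t * \<i>)) has_real_derivative dd v \<i> (of_real r)) (at 0)" for v
    using has_real_derivative_along_line[where f = "d v" and z = "of_real r" and t = 0 and v = \<i>, OF diff_d] by simp
  have "((\<lambda>t. - t * d 1 (of_real r + of_real t * \<i>) + r * d \<i> (of_real r + of_real t * \<i>)) has_real_derivative
      (- 1 * d 1 (of_real r + of_real 0 * \<i>) + dd 1 \<i> (of_real r) * - 0) + r * dd \<i> \<i> (of_real r)) (at 0)"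
    by (intro DERIV_add DERIV_mult DERIV_cmult line DERIV_minus DERIV_ident)
  moreover have "(\<lambda>t. - t * d 1 (of_real r + of_real t * \<i>) + r * d \<i> (of_real r + of_real t * \<i>)) = (\<lambda>t. 0)"
  proof
    fix t
    have "of_real r + of_real t * \<i> = Complex r t" by (simp add: complex_eq_iff)
    then show "- t * d 1 (of_real r + of_real t * \<i>) + r * d \<i> (of_real r + of_real t * \<i>) = 0"
      using d_tangential_coords by simp
  qed
  ultimately have "((\<lambda>t::real. 0 :: real) has_real_derivative
      (- 1 * d 1 (of_real r + of_real 0 * \<i>) + dd 1 \<i> (of_real r) * - 0) + r * dd \<i> \<i> (of_real r)) (at 0)"
    by (simp only:)
  from DERIV_unique[OF this DERIV_const] show ?thesis by simp
qed

lemma deriv_Phi: "(\<Phi> has_real_derivative d 1 (of_real r)) (at r)"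
  using has_real_derivative_along_line[where f = \<phi> and z = 0 and t = r and v = 1, OF diff] by (simp add: \<Phi>_def[abs_def])

text \<open>The polar form of the Laplacian multiplied by r, so that the origin is no
  exception.\<close>

lemma deriv_XX: "(XX has_real_derivative r * laplacian \<phi> (of_real r)) (at r)"
proof -
  have "((\<lambda>r. d 1 (of_real r)) has_real_derivative dd 1 1 (of_real r)) (at r)"
    using has_real_derivative_along_line[where f = "d 1" and z = 0 and t = r and v = 1, OF diff_d] by simp
  then have "(XX has_real_derivative 1 * d 1 (of_real r) + dd 1 1 (of_real r) * r) (at r)"
    unfolding XX_def[abs_def] by (intro DERIV_mult DERIV_ident)
  moreover have "laplacian \<phi> (of_real r) = dd 1 1 (of_real r) + dd \<i> \<i> (of_real r)"
    by (simp add: laplacian_def Basis_complex_def)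
  ultimately show ?thesis using dd_tangential[of r] by (simp add: algebra_simps)
qed

lemma XX_0 [simp]: "XX 0 = 0" by (simp add: XX_def)

lemma XX_mono: "0 \<le> r \<Longrightarrow> r \<le> s \<Longrightarrow> XX r \<le> XX s"
proof (rule DERIV_nonneg_imp_nondecreasing, assumption)
  fix x assume "0 \<le> r" "r \<le> x"
  then have "0 \<le> x * laplacian \<phi> (of_real x)"
    using lap_ge[of "of_real x"] m_pos by (intro mult_nonneg_nonneg) auto
  then show "\<exists>y. (XX has_real_derivative y) (at x) \<and> 0 \<le> y"
    using deriv_XX by blast
qed

text \<open>Integration of m x <= x Laplacian <= M x from 0, where \<open>XX\<close>
  vanishes.\<close>

lemma XX_ge: "0 \<le> r \<Longrightarrow> m / 2 * r\<^sup>2 \<le> XX r"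
  and XX_le: "0 \<le> r \<Longrightarrow> XX r \<le> M / 2 * r\<^sup>2"
proof -
  assume r: "0 \<le> r"
  have "XX 0 - m / 2 * 0\<^sup>2 \<le> XX r - m / 2 * r\<^sup>2"
  proof (rule DERIV_nonneg_imp_nondecreasing[OF r], intro exI conjI)
    fix x :: real assume x: "0 \<le> x"
    show "((\<lambda>r. XX r - m / 2 * r\<^sup>2) has_real_derivative x * laplacian \<phi> (of_real x) - x * m) (at x)"
      by (auto intro!: derivative_eq_intros deriv_XX)
    show "0 \<le> x * laplacian \<phi> (of_real x) - x * m"
      using x lap_ge[of "of_real x"] by (simp add: mult_left_mono)
  qed
  then show "m / 2 * r\<^sup>2 \<le> XX r" by simp
  have "M / 2 * 0\<^sup>2 - XX 0 \<le> M / 2 * r\<^sup>2 - XX r"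
  proof (rule DERIV_nonneg_imp_nondecreasing[OF r], intro exI conjI)
    fix x :: real assume x: "0 \<le> x"
    show "((\<lambda>r. M / 2 * r\<^sup>2 - XX r) has_real_derivative x * M - x * laplacian \<phi> (of_real x)) (at x)"
      by (auto intro!: derivative_eq_intros deriv_XX)
    show "0 \<le> x * M - x * laplacian \<phi> (of_real x)"
      using x lap_le[of "of_real x"] by (simp add: mult_left_mono)
  qed
  then show "XX r \<le> M / 2 * r\<^sup>2" by simp
qed

lemma continuous_Phi: "continuous_on A \<Phi>"
  using deriv_Phi by (intro continuous_at_imp_continuous_on) (auto intro: DERIV_isCont)

text \<open>Quadratic growth bounds the weight by a Gaussian, whence all moments are finite.\<close>

lemma Phi_ge:
  assumes "0 \<le> r"
  shows "\<Phi> 0 + m / 4 * r\<^sup>2 \<le> \<Phi> r"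
proof -
  have "\<Phi> 0 - m / 4 * 0\<^sup>2 \<le> \<Phi> r - m / 4 * r\<^sup>2"
  \<comment> \<open>The bound on \<open>XX\<close> controls the derivative of \<open>\<Phi>\<close>
    only at positive radii, hence the monotonicity criterion on the open interval.\<close>
  proof (rule DERIV_nonneg_imp_increasing_open[OF assms])
    show "continuous_on {0..r} (\<lambda>r. \<Phi> r - m / 4 * r\<^sup>2)"
      by (intro continuous_intros continuous_Phi)
    fix x :: real assume x: "0 < x"
    have "x * (m / 2 * x) \<le> x * d 1 (of_real x)"
      using XX_ge[of x] x by (simp add: XX_def power2_eq_square mult_ac)
    then have "m / 2 * x \<le> d 1 (of_real x)" using x by simp
    moreover have "((\<lambda>r. \<Phi> r - m / 4 * r\<^sup>2) has_real_derivative d 1 (of_real x) - m / 2 * x) (at x)"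
      by (auto intro!: derivative_eq_intros deriv_Phi)
    ultimately show "\<exists>y. ((\<lambda>r. \<Phi> r - m / 4 * r\<^sup>2) has_real_derivative y) (at x) \<and> 0 \<le> y" by auto
  qed
  then show ?thesis by simp
qed

definition "wt r = exp (- 2 * \<Phi> r)"

lemma wt_pos: "0 < wt r" by (simp add: wt_def)

lemma wt_le:
  assumes "0 \<le> r"
  shows "wt r \<le> exp (- 2 * \<Phi> 0) * exp (- (m / 2) * r\<^sup>2)"
  using Phi_ge[OF assms] by (simp add: wt_def exp_add[symmetric])

lemma continuous_wt: "continuous_on A wt"
  unfolding wt_def[abs_def] by (intro continuous_intros continuous_Phi)

lemma measurable_wt [measurable]: "wt \<in> borel_measurable borel"
  by (intro borel_measurable_continuous_onI continuous_wt)

lemma deriv_wt: "(wt has_real_derivative - 2 * d 1 (of_real r) * wt r) (at r)"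
  unfolding wt_def[abs_def] by (auto intro!: derivative_eq_intros deriv_Phi)

lemma integrable_power_wt: "integrable lborel (\<lambda>r. indicator {0..} r * (r ^ k * wt r))"
proof (rule Bochner_Integration.integrable_bound)
  show "integrable lborel (\<lambda>r. exp (- 2 * \<Phi> 0) * (indicator {0..} r * (r ^ k * exp (- (m / 2) * r\<^sup>2))))"
    using m_pos by (intro integrable_mult_right integrable_gaussian_times_power) simp
  show "AE r in lborel. norm (indicator {0..} r * (r ^ k * wt r)) \<le>
      norm (exp (- 2 * \<Phi> 0) * (indicator {0..} r * (r ^ k * exp (- (m / 2) * r\<^sup>2))))"
  proof (intro AE_I2)
    fix r :: real
    show "norm (indicator {0..} r * (r ^ k * wt r)) \<le>
      norm (exp (- 2 * \<Phi> 0) * (indicator {0..} r * (r ^ k * exp (- (m / 2) * r\<^sup>2))))"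
    proof (cases "0 \<le> r")
      case True
      then have "r ^ k * wt r \<le> r ^ k * (exp (- 2 * \<Phi> 0) * exp (- (m / 2) * r\<^sup>2))"
        by (intro mult_left_mono wt_le) auto
      then show ?thesis using True wt_pos[of r] by (simp add: abs_mult mult_ac)
    qed simp
  qed
qed measurable

lemma lim_power_wt: "k > 0 \<Longrightarrow> ((\<lambda>r. r ^ k * wt r) \<longlongrightarrow> 0) (at_right 0)"
  and lim_power_wt_top: "((\<lambda>r. r ^ k * wt r) \<longlongrightarrow> 0) at_top"
proof -
  assume "k > 0"
  have "isCont (\<lambda>r. r ^ k * wt r) 0"
    using continuous_wt[of UNIV] by (intro continuous_intros) (simp add: continuous_on_eq_continuous_at)
  then have "((\<lambda>r. r ^ k * wt r) \<longlongrightarrow> 0 ^ k * wt 0) (at_right 0)"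
    unfolding isCont_def filterlim_at_split by simp
  moreover have "0 ^ k * wt 0 = 0" using \<open>k > 0\<close> by simp
  ultimately show "((\<lambda>r. r ^ k * wt r) \<longlongrightarrow> 0) (at_right 0)" by (simp only:)
next
  show "((\<lambda>r. r ^ k * wt r) \<longlongrightarrow> 0) at_top"
  proof (rule Lim_null_comparison)
    have "((\<lambda>r::real. r ^ k * exp (- (m / 2) * r\<^sup>2)) \<longlongrightarrow> 0) at_top"
      using m_pos by real_asymp
    then show "((\<lambda>r::real. exp (- 2 * \<Phi> 0) * (r ^ k * exp (- (m / 2) * r\<^sup>2))) \<longlongrightarrow> 0) at_top"
      by (rule tendsto_mult_right_zero)
    show "eventually (\<lambda>r. norm (r ^ k * wt r) \<le> exp (- 2 * \<Phi> 0) * (r ^ k * exp (- (m / 2) * r\<^sup>2))) at_top"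
      using eventually_ge_at_top[of 0]
    proof eventually_elim
      case (elim r)
      then have "r ^ k * wt r \<le> r ^ k * (exp (- 2 * \<Phi> 0) * exp (- (m / 2) * r\<^sup>2))"
        by (intro mult_left_mono wt_le) auto
      then show ?case using elim wt_pos[of r] by (simp add: abs_mult mult_ac)
    qed
  qed
qed


section \<open>Polar coordinates and the moments of the weight\<close>

lemma lam_eq_wt: "lam \<phi> = density lborel (\<lambda>z. ennreal (wt (cmod z)))"
  unfolding lam_def wt_def phi_eq[symmetric] ..

lemma measurable_lam [simp]: "borel_measurable (lam \<phi>) = borel_measurable borel"
  by (intro measurable_cong_sets sets_lam refl)

lemma distr_cmod_lam: "distr (lam \<phi>) borel cmod =
    density lborel (\<lambda>r. ennreal (2 * pi * r * indicator {0..} r * wt r))"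
proof -
  have "distr (lam \<phi>) borel cmod = density (distr lborel borel cmod) (\<lambda>r. ennreal (wt r))"
    unfolding lam_eq_wt by (subst density_distr) auto
  also have "\<dots> = density lborel (\<lambda>r. ennreal (2 * pi * r * indicator {0..} r) * ennreal (wt r))"
    unfolding distr_cmod_lborel by (subst density_density_eq) auto
  also have "\<dots> = density lborel (\<lambda>r. ennreal (2 * pi * r * indicator {0..} r * wt r))"
    using wt_pos by (intro arg_cong2[where f = density] refl ext) (auto simp: ennreal_mult'' less_imp_le)
  finally show ?thesis .
qed

lemma
  fixes u :: "real \<Rightarrow> real"
  assumes u [measurable]: "u \<in> borel_measurable borel"
  shows integrable_radial: "integrable (lam \<phi>) (\<lambda>z. u (cmod z)) \<longleftrightarrow>
      integrable lborel (\<lambda>r. indicator {0..} r * (r * u r * wt r))"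
    and integral_radial: "(\<integral>z. u (cmod z) \<partial>lam \<phi>) =
      2 * pi * (\<integral>r. indicator {0..} r * (r * u r * wt r) \<partial>lborel)"
proof -
  have cm: "cmod \<in> measurable (lam \<phi>) borel" by simp
  have eq: "(\<lambda>r. (2 * pi * r * indicator {0..} r * wt r) * u r) =
      (\<lambda>r. (2 * pi) * (indicator {0..} r * (r * u r * wt r)))" by (simp add: fun_eq_iff)
  have nn: "AE r in lborel. 0 \<le> 2 * pi * r * indicator {0..} r * wt r"
    using wt_pos by (intro AE_I2) (auto simp: indicator_def less_imp_le)
  have "integrable (lam \<phi>) (\<lambda>z. u (cmod z)) \<longleftrightarrow> integrable (distr (lam \<phi>) borel cmod) u"
    by (subst integrable_distr_eq[OF cm]) auto
  also have "\<dots> \<longleftrightarrow> integrable lborel (\<lambda>r. (2 * pi) * (indicator {0..} r * (r * u r * wt r)))"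
    unfolding distr_cmod_lam eq[symmetric] using nn
    by (subst integrable_density) auto
  finally show "integrable (lam \<phi>) (\<lambda>z. u (cmod z)) \<longleftrightarrow>
      integrable lborel (\<lambda>r. indicator {0..} r * (r * u r * wt r))" by simp
  have "(\<integral>z. u (cmod z) \<partial>lam \<phi>) = (\<integral>r. u r \<partial>distr (lam \<phi>) borel cmod)"
    by (subst integral_distr[OF cm]) auto
  also have "\<dots> = (\<integral>r. (2 * pi) * (indicator {0..} r * (r * u r * wt r)) \<partial>lborel)"
    unfolding distr_cmod_lam eq[symmetric] using nn
    by (subst integral_density) auto
  finally show "(\<integral>z. u (cmod z) \<partial>lam \<phi>) =
      2 * pi * (\<integral>r. indicator {0..} r * (r * u r * wt r) \<partial>lborel)" by simp
qed

lemma integrable_cmod_power: "integrable (lam \<phi>) (\<lambda>z. cmod z ^ k)"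
  using integrable_power_wt[of "Suc k"] by (subst integrable_radial) auto

lemma finite_measure_lam: "finite_measure (lam \<phi>)"
proof
  have "integrable (lam \<phi>) (\<lambda>z. 1 :: real)" using integrable_cmod_power[of 0] by simp
  then have "emeasure (lam \<phi>) (space (lam \<phi>)) < \<infinity>"
    by (simp add: integrable_iff_bounded)
  then show "emeasure (lam \<phi>) (space (lam \<phi>)) \<noteq> \<infinity>" by simp
qed

lemma sigma_finite_lam: "sigma_finite_measure (lam \<phi>)"
  using finite_measure_lam by (rule finite_measure.axioms)

definition "hh n = (\<integral>z. cmod z ^ (2 * n) \<partial>lam \<phi>)"

lemma hh_eq: "hh n = 2 * pi * (\<integral>r. indicator {0..} r * (r ^ (2 * n + 1) * wt r) \<partial>lborel)"
  unfolding hh_def by (subst integral_radial) auto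

lemma AE_lam_iff: "(AE z in lam \<phi>. Q z) \<longleftrightarrow> (AE z in lborel. Q z)"
  unfolding lam_eq_wt using wt_pos by (subst AE_density) auto

lemma hh_pos: "0 < hh n"
proof -
  have "hh n \<noteq> 0"
  proof
    assume "hh n = 0"
    then have "AE z in lam \<phi>. cmod z ^ (2 * n) = 0"
      unfolding hh_def using integral_nonneg_eq_0_iff_AE[OF integrable_cmod_power] by auto
    then have "AE z in lborel. cmod z ^ (2 * n) = 0" by (simp add: AE_lam_iff)
    with AE_lborel_singleton[of 0] have "AE z in (lborel :: complex measure). False"
      by eventually_elim auto
    then show False
      by (subst (asm) AE_iff_measurable[OF _ refl]) (auto simp: emeasure_lborel_UNIV)
  qed
  moreover have "0 \<le> hh n" unfolding hh_def by simp
  ultimately show ?thesis by simp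
qed

lemma isCont_XX: "isCont XX r"
  using deriv_XX by (rule DERIV_isCont)

lemma measurable_XX [measurable]: "XX \<in> borel_measurable borel"
  by (intro borel_measurable_continuous_onI continuous_at_imp_continuous_on) (simp add: isCont_XX)

lemma isCont_wt: "isCont wt r"
  using deriv_wt by (rule DERIV_isCont)

lemma isCont_lap: "isCont (\<lambda>r. laplacian \<phi> (of_real r)) r"
proof -
  have "continuous_on UNIV (laplacian \<phi>)"
    unfolding laplacian_def[abs_def] by (intro continuous_on_sum cont_dd)
  then have "continuous_on UNIV (\<lambda>r::real. laplacian \<phi> (of_real r))"
    by (rule continuous_on_compose2) (auto intro!: continuous_intros)
  then show ?thesis by (simp add: continuous_on_eq_continuous_at)
qed

lemma measurable_lap [measurable]: "(\<lambda>r. laplacian \<phi> (of_real r)) \<in> borel_measurable borel"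
  by (intro borel_measurable_continuous_onI continuous_at_imp_continuous_on) (simp add: isCont_lap)

lemma integrable_lborel_bounded_power:
  assumes [measurable]: "u \<in> borel_measurable borel" and "\<And>r. 0 \<le> r \<Longrightarrow> \<bar>u r\<bar> \<le> a * r ^ k + b * r ^ l"
  shows "integrable lborel (\<lambda>r. indicator {0..} r * (r ^ j * u r * wt r))"
proof (rule Bochner_Integration.integrable_bound)
  show "integrable lborel (\<lambda>r. a * (indicator {0..} r * (r ^ (j + k) * wt r)) + b * (indicator {0..} r * (r ^ (j + l) * wt r)))"
    by (intro Bochner_Integration.integrable_add integrable_mult_right integrable_power_wt)
  show "AE r in lborel. norm (indicator {0..} r * (r ^ j * u r * wt r)) \<le>
      norm (a * (indicator {0..} r * (r ^ (j + k) * wt r)) + b * (indicator {0..} r * (r ^ (j + l) * wt r)))"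
  proof (intro AE_I2)
    fix r :: real
    show "norm (indicator {0..} r * (r ^ j * u r * wt r)) \<le>
      norm (a * (indicator {0..} r * (r ^ (j + k) * wt r)) + b * (indicator {0..} r * (r ^ (j + l) * wt r)))"
    proof (cases "0 \<le> r")
      case True
      have "r ^ j * \<bar>u r\<bar> * wt r \<le> r ^ j * (a * r ^ k + b * r ^ l) * wt r"
        using assms(2)[OF True] True wt_pos[of r] by (intro mult_right_mono mult_left_mono) auto
      then show ?thesis using True wt_pos[of r]
        by (simp add: abs_mult power_add algebra_simps)
    qed simp
  qed
qed measurable

lemma XX_abs_le: "0 \<le> r \<Longrightarrow> \<bar>XX r\<bar> \<le> M / 2 * r ^ 2"
  using XX_ge[of r] XX_le[of r] m_pos by (smt (verit) half_gt_zero zero_le_mult_iff zero_le_power2)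

lemma integrable_XX: "integrable (lam \<phi>) (\<lambda>z. XX (cmod z) * cmod z ^ k)"
  using integrable_lborel_bounded_power[of XX "M / 2" 2 0 0 "Suc k"] XX_abs_le
  by (subst integrable_radial) (auto simp: mult_ac)

text \<open>Integrate the derivative of r^(2n+2) wt(r). Since wt' = -2 phi' wt, it is 2 r^(2n+1) (n
  + 1 - XX r) wt(r). Thus n + 1 is the mean of \<open>XX\<close> under the density proportional to
  |z|^(2n).\<close>

lemma XX_mean: "(\<integral>z. XX (cmod z) * cmod z ^ (2 * n) \<partial>lam \<phi>) = (real n + 1) * hh n"
proof -
  define g1 where "g1 r = indicator {0..} r * (r ^ (2 * n + 1) * wt r)" for r :: real
  define g2 where "g2 r = indicator {0..} r * (r ^ (2 * n + 1) * XX r * wt r)" for r :: real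
  have i1: "integrable lborel g1" unfolding g1_def by (rule integrable_power_wt)
  have i2: "integrable lborel g2"
    unfolding g2_def by (rule integrable_lborel_bounded_power[of _ "M / 2" 2 0 0]) (use XX_abs_le in auto)
  define f where "f r = 2 * (real n + 1) * (r ^ (2 * n + 1) * wt r) - 2 * (r ^ (2 * n + 1) * XX r * wt r)" for r
  have f: "indicator {0..} r * f r = 2 * (real n + 1) * g1 r - 2 * g2 r" for r
    by (simp add: f_def g1_def g2_def algebra_simps)
  have "(\<integral>r. indicator {0..} r * f r \<partial>lborel) = 0"
  proof (rule integral_deriv_half_line_eq_0)
    fix x :: real assume "0 < x"
    have "((\<lambda>r. r ^ (2 * n + 2) * wt r) has_real_derivative
      real (2 * n + 2) * (1 * x ^ (2 * n + 2 - Suc 0)) * wt x + - 2 * d 1 (of_real x) * wt x * x ^ (2 * n + 2)) (at x)"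
      by (intro DERIV_mult deriv_wt DERIV_power DERIV_ident)
    also have "real (2 * n + 2) * (1 * x ^ (2 * n + 2 - Suc 0)) * wt x + - 2 * d 1 (of_real x) * wt x * x ^ (2 * n + 2) = f x"
      by (simp add: f_def XX_def algebra_simps)
    finally show "((\<lambda>r. r ^ (2 * n + 2) * wt r) has_real_derivative f x) (at x)" .
    show "isCont f x" unfolding f_def[abs_def] by (intro continuous_intros isCont_XX isCont_wt)
  next
    show "integrable lborel (\<lambda>x. indicator {0..} x * f x)" unfolding f using i1 i2 by simp
  qed (rule lim_power_wt lim_power_wt_top; simp)+
  then have "(real n + 1) * (\<integral>r. g1 r \<partial>lborel) = (\<integral>r. g2 r \<partial>lborel)"
    unfolding f using i1 i2 by (simp add: algebra_simps)
  moreover have "(\<integral>z. XX (cmod z) * cmod z ^ (2 * n) \<partial>lam \<phi>) = 2 * pi * (\<integral>r. g2 r \<partial>lborel)"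
    by (subst integral_radial) (auto simp: g2_def[abs_def] mult_ac)
  ultimately show ?thesis unfolding hh_eq g1_def by simp
qed

lemma integrable_XX_sq: "integrable (lam \<phi>) (\<lambda>z. (XX (cmod z) - c)\<^sup>2 * cmod z ^ k)"
proof -
  have b: "\<bar>(XX r - c)\<^sup>2\<bar> \<le> M\<^sup>2 / 2 * r ^ 4 + 2 * c\<^sup>2 * r ^ 0" if "0 \<le> r" for r
  proof -
    have "(XX r - c)\<^sup>2 \<le> 2 * (XX r)\<^sup>2 + 2 * c\<^sup>2"
      using sum_squares_bound[of "XX r" "- c"] by (simp add: power2_diff)
    also have "(XX r)\<^sup>2 \<le> (M / 2 * r\<^sup>2)\<^sup>2"
      using XX_abs_le[OF that] by (metis abs_ge_zero power2_abs power_mono)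
    finally show ?thesis by (simp add: power_mult_distrib power_divide)
  qed
  then show ?thesis
    using integrable_lborel_bounded_power[of "\<lambda>r. (XX r - c)\<^sup>2" "M\<^sup>2 / 2" 4 "2 * c\<^sup>2" 0 "Suc k"]
    by (subst integrable_radial) (auto simp: mult_ac)
qed

text \<open>Integrate the derivative of (XX r - (n + 1)) r^(2n+2) wt(r). The factor XX' = r
  Laplacian is bounded through M, and the other terms combine to minus twice the square, so the
  variance is controlled by the next moment.\<close>

lemma XX_variance: "(\<integral>z. (XX (cmod z) - (real n + 1))\<^sup>2 * cmod z ^ (2 * n) \<partial>lam \<phi>) \<le> M / 2 * hh (Suc n)"
proof -
  let ?c = "real n + 1" and ?L = "\<lambda>r::real. laplacian \<phi> (of_real r)"
  define g1 where "g1 r = indicator {0..} r * (r ^ (2 * n + 3) * ?L r * wt r)" for r :: real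
  define g2 where "g2 r = indicator {0..} r * (r ^ (2 * n + 1) * (XX r - ?c)\<^sup>2 * wt r)" for r :: real
  have bL: "\<bar>?L r\<bar> \<le> M" for r using lap_ge[of "of_real r"] lap_le[of "of_real r"] m_pos by simp
  have i1: "integrable lborel g1"
    unfolding g1_def by (rule integrable_lborel_bounded_power[of _ M 0 0 0]) (use bL in auto)
  have i2: "integrable lborel g2"
    using integrable_XX_sq[of ?c "2 * n"] unfolding g2_def by (subst (asm) integrable_radial) (auto simp: mult_ac)
  define f where "f r = r ^ (2 * n + 3) * ?L r * wt r - 2 * (r ^ (2 * n + 1) * (XX r - ?c)\<^sup>2 * wt r)" for r
  have f: "indicator {0..} r * f r = g1 r - 2 * g2 r" for r
    by (simp add: f_def g1_def g2_def algebra_simps)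
  have lim0: "((\<lambda>r. (XX r - ?c) * (r ^ (2 * n + 2) * wt r)) \<longlongrightarrow> 0) (at_right 0)"
  proof -
    have "((\<lambda>r. XX r - ?c) \<longlongrightarrow> XX 0 - ?c) (at_right 0)"
      using isCont_XX[of 0] unfolding isCont_def filterlim_at_split by (intro tendsto_intros) auto
    from tendsto_mult[OF this lim_power_wt[of "2 * n + 2"]] show ?thesis by simp
  qed
  have lim1: "((\<lambda>r. (XX r - ?c) * (r ^ (2 * n + 2) * wt r)) \<longlongrightarrow> 0) at_top"
  proof (rule Lim_null_comparison)
    show "((\<lambda>r. M / 2 * (r ^ (2 * n + 4) * wt r) + ?c * (r ^ (2 * n + 2) * wt r)) \<longlongrightarrow> 0) at_top"
      by (rule tendsto_add_zero[OF tendsto_mult_right_zero[OF lim_power_wt_top]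
            tendsto_mult_right_zero[OF lim_power_wt_top]])
    show "eventually (\<lambda>r. norm ((XX r - ?c) * (r ^ (2 * n + 2) * wt r)) \<le>
        M / 2 * (r ^ (2 * n + 4) * wt r) + ?c * (r ^ (2 * n + 2) * wt r)) at_top"
      using eventually_ge_at_top[of 0]
    proof eventually_elim
      case (elim r)
      have "\<bar>XX r - ?c\<bar> \<le> M / 2 * r\<^sup>2 + ?c" using XX_abs_le[OF elim] by simp
      then have "\<bar>XX r - ?c\<bar> * (r ^ (2 * n + 2) * wt r) \<le> (M / 2 * r\<^sup>2 + ?c) * (r ^ (2 * n + 2) * wt r)"
        using elim wt_pos[of r] by (intro mult_right_mono) auto
      also have "\<dots> = M / 2 * (r ^ (2 * n + 4) * wt r) + ?c * (r ^ (2 * n + 2) * wt r)"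
        by (simp add: algebra_simps power_add power2_eq_square numeral_eq_Suc)
      finally show ?case using elim wt_pos[of r] by (simp add: abs_mult)
    qed
  qed
  have "(\<integral>r. indicator {0..} r * f r \<partial>lborel) = 0"
  proof (rule integral_deriv_half_line_eq_0[OF _ _ _ lim0 lim1])
    fix x :: real assume "0 < x"
    have "((\<lambda>r. (XX r - ?c) * (r ^ (2 * n + 2) * wt r)) has_real_derivative
      (x * ?L x - 0) * (x ^ (2 * n + 2) * wt x) +
      (real (2 * n + 2) * (1 * x ^ (2 * n + 2 - Suc 0)) * wt x + - 2 * d 1 (of_real x) * wt x * x ^ (2 * n + 2)) * (XX x - ?c)) (at x)"
      by (intro DERIV_mult DERIV_diff deriv_XX deriv_wt DERIV_const DERIV_power DERIV_ident)
    also have "(x * ?L x - 0) * (x ^ (2 * n + 2) * wt x) +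
      (real (2 * n + 2) * (1 * x ^ (2 * n + 2 - Suc 0)) * wt x + - 2 * d 1 (of_real x) * wt x * x ^ (2 * n + 2)) * (XX x - ?c) = f x"
      by (simp add: f_def XX_def algebra_simps power2_eq_square numeral_3_eq_3)
    finally show "((\<lambda>r. (XX r - ?c) * (r ^ (2 * n + 2) * wt r)) has_real_derivative f x) (at x)" .
    show "isCont f x" unfolding f_def[abs_def] by (intro continuous_intros isCont_XX isCont_wt isCont_lap)
  next
    show "integrable lborel (\<lambda>x. indicator {0..} x * f x)" unfolding f using i1 i2 by simp
  qed
  then have eq: "2 * (\<integral>r. g2 r \<partial>lborel) = (\<integral>r. g1 r \<partial>lborel)"
    unfolding f using i1 i2 by simp
  also have "\<dots> \<le> (\<integral>r. M * (indicator {0..} r * (r ^ (2 * n + 3) * wt r)) \<partial>lborel)"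
  proof (intro integral_mono i1 integrable_mult_right integrable_power_wt)
    fix r :: real
    show "g1 r \<le> M * (indicator {0..} r * (r ^ (2 * n + 3) * wt r))"
    proof (cases "0 \<le> r")
      case True
      then have "r ^ (2 * n + 3) * ?L r * wt r \<le> r ^ (2 * n + 3) * M * wt r"
        using lap_le[of "of_real r"] wt_pos[of r] by (intro mult_right_mono mult_left_mono) auto
      then show ?thesis using True by (simp add: g1_def mult_ac)
    qed (simp add: g1_def)
  qed
  finally have "2 * (\<integral>r. g2 r \<partial>lborel) \<le> M * (\<integral>r. indicator {0..} r * (r ^ (2 * n + 3) * wt r) \<partial>lborel)" by simp
  moreover have "(\<integral>z. (XX (cmod z) - ?c)\<^sup>2 * cmod z ^ (2 * n) \<partial>lam \<phi>) = 2 * pi * (\<integral>r. g2 r \<partial>lborel)"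
    by (subst integral_radial) (auto simp: g2_def[abs_def] mult_ac)
  moreover have "hh (Suc n) = 2 * pi * (\<integral>r. indicator {0..} r * (r ^ (2 * n + 3) * wt r) \<partial>lborel)"
    unfolding hh_eq by (simp add: numeral_3_eq_3)
  ultimately show ?thesis by simp
qed

text \<open>Insert the quadratic bounds on \<open>XX\<close> into the formula for its mean.\<close>

lemma hh_Suc_ge: "2 / M * (real n + 1) * hh n \<le> hh (Suc n)"
  and hh_Suc_le: "hh (Suc n) \<le> 2 / m * (real n + 1) * hh n"
proof -
  have eq: "(\<integral>z. c * cmod z ^ (2 * Suc n) \<partial>lam \<phi>) = c * hh (Suc n)" for c
    by (simp add: hh_def)
  have "(real n + 1) * hh n \<le> (\<integral>z. M / 2 * cmod z ^ (2 * Suc n) \<partial>lam \<phi>)"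
    unfolding XX_mean[symmetric]
  proof (intro integral_mono integrable_XX integrable_mult_right integrable_cmod_power)
    fix z
    show "XX (cmod z) * cmod z ^ (2 * n) \<le> M / 2 * cmod z ^ (2 * Suc n)"
      using mult_right_mono[OF XX_le[of "cmod z"], of "cmod z ^ (2 * n)"] by (simp add: power2_eq_square mult_ac)
  qed
  then show "2 / M * (real n + 1) * hh n \<le> hh (Suc n)"
    unfolding eq using M_pos by (simp add: field_simps)
  have "(\<integral>z. m / 2 * cmod z ^ (2 * Suc n) \<partial>lam \<phi>) \<le> (real n + 1) * hh n"
    unfolding XX_mean[symmetric]
  proof (intro integral_mono integrable_XX integrable_mult_right integrable_cmod_power)
    fix z
    show "m / 2 * cmod z ^ (2 * Suc n) \<le> XX (cmod z) * cmod z ^ (2 * n)"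
      using mult_right_mono[OF XX_ge[of "cmod z"], of "cmod z ^ (2 * n)"] by (simp add: power2_eq_square mult_ac)
  qed
  then show "hh (Suc n) \<le> 2 / m * (real n + 1) * hh n"
    unfolding eq using m_pos by (simp add: field_simps)
qed

end

section \<open>Rotation invariance\<close>

lemma measurable_cnj [measurable (raw)]:
  fixes f :: "'x \<Rightarrow> complex"
  assumes "f \<in> borel_measurable M"
  shows "(\<lambda>x. cnj (f x)) \<in> borel_measurable M"
  by (rule measurable_compose[OF assms]) (intro borel_measurable_continuous_onI continuous_intros)

text \<open>Carries Lebesgue measure of the plane to \<open>real^2\<close>, on which invariance
  under orthogonal maps is formulated.\<close>

lemma distr_lborel_real2_complex:
  "distr lborel borel (\<lambda>v :: real^2. Complex (v $ 1) (v $ 2)) = lborel"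
proof (rule lborel_eqI[symmetric])
  have [measurable]: "(\<lambda>v :: real^2. Complex (v $ 1) (v $ 2)) \<in> borel_measurable borel"
    unfolding Complex_eq by measurable
  fix l u :: complex assume le: "\<And>b. b \<in> Basis \<Longrightarrow> l \<bullet> b \<le> u \<bullet> b"
  define l' u' :: "real^2" where "l' = vector [Re l, Im l]" and "u' = vector [Re u, Im u]"
  have lu: "l' $ 1 = Re l" "l' $ 2 = Im l" "u' $ 1 = Re u" "u' $ 2 = Im u"
    by (simp_all add: l'_def u'_def)
  have "(\<lambda>v :: real^2. Complex (v $ 1) (v $ 2)) -` box l u = box l' u'"
    by (auto simp: mem_box_cart in_box_complex_iff forall_2 lu)
  moreover have "\<And>b. b \<in> Basis \<Longrightarrow> l' \<bullet> b \<le> u' \<bullet> b"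
    using le[of 1] le[of \<i>] by (auto simp: Basis_vec_def inner_axis Basis_complex_def exhaust_2 lu)
      (metis exhaust_2 lu)
  ultimately have "emeasure (distr lborel borel (\<lambda>v :: real^2. Complex (v $ 1) (v $ 2))) (box l u) =
      ennreal (\<Prod>b\<in>Basis. (u' - l') \<bullet> b)"
    by (simp add: emeasure_distr emeasure_lborel_box)
  also have "(\<Prod>b\<in>Basis. (u' - l') \<bullet> b) = (\<Prod>b\<in>Basis. (u - l) \<bullet> b)"
  proof -
    have B: "(Basis :: (real^2) set) = {axis 1 1, axis 2 1}"
      by (auto simp: Basis_vec_def) (metis exhaust_2)
    have ne: "axis 1 1 \<noteq> (axis 2 1 :: real^2)" by (simp add: axis_eq_axis)
    show ?thesis by (subst B) (simp add: ne inner_axis Basis_complex_def lu)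
  qed
  finally show "emeasure (distr lborel borel (\<lambda>v :: real^2. Complex (v $ 1) (v $ 2))) (box l u) = ennreal (\<Prod>b\<in>Basis. (u - l) \<bullet> b)" .
qed simp

lemma distr_lborel_orthogonal:
  fixes T :: "real^'n::{finite,wellorder} \<Rightarrow> real^'n::_"
  assumes T: "orthogonal_transformation T"
  shows "distr lborel borel T = lborel"
proof (rule lborel_eqI[symmetric])
  have Tm [measurable]: "T \<in> borel_measurable borel"
    using T by (intro borel_measurable_continuous_onI linear_continuous_on
        linear_conv_bounded_linear[THEN iffD1] orthogonal_transformation_linear)
  fix l u :: "real^'n::_" assume le: "\<And>b. b \<in> Basis \<Longrightarrow> l \<bullet> b \<le> u \<bullet> b"
  have v: "T -` box l u = inv_into UNIV T ` box l u"
    using orthogonal_transformation_bij[OF T] by (simp add: bij_vimage_eq_inv_image)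
  have lm: "box l u \<in> lmeasurable" by simp
  have iT: "orthogonal_transformation (inv_into UNIV T)" using T by (rule orthogonal_transformation_inv)
  have "emeasure (distr lborel borel T) (box l u) = emeasure lborel (inv_into UNIV T ` box l u)"
    by (simp add: emeasure_distr v)
  also have "\<dots> = emeasure lebesgue (inv_into UNIV T ` box l u)"
    using measurable_sets_borel[OF Tm, of "box l u"] by (simp add: v)
  also have "\<dots> = ennreal (measure lebesgue (inv_into UNIV T ` box l u))"
    by (rule emeasure_eq_measure2[OF measurable_orthogonal_image[OF iT lm]])
  also have "\<dots> = ennreal (measure lebesgue (box l u))"
    by (simp add: measure_orthogonal_image[OF iT lm])
  also have "\<dots> = ennreal (\<Prod>b\<in>Basis. (u - l) \<bullet> b)"
  proof -
    have "ennreal (measure lebesgue (box l u)) = emeasure lebesgue (box l u)"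
      by (rule emeasure_eq_measure2[OF lm, symmetric])
    also have "\<dots> = ennreal (\<Prod>b\<in>Basis. (u - l) \<bullet> b)"
      using le by (simp add: emeasure_lborel_box)
    finally show ?thesis .
  qed
  finally show "emeasure (distr lborel borel T) (box l u) = ennreal (\<Prod>b\<in>Basis. (u - l) \<bullet> b)" .
qed simp

lemma distr_lborel_rotation:
  fixes \<omega> :: complex
  assumes "cmod \<omega> = 1"
  shows "distr lborel borel (\<lambda>z. \<omega> * z) = lborel"
proof -
  let ?f = "\<lambda>v :: real^2. Complex (v $ 1) (v $ 2)"
  have fm: "?f \<in> borel_measurable borel"
    unfolding Complex_eq by measurable
  \<comment> \<open>The real matrix of multiplication by \<open>\<omega>\<close>, orthogonal because
    |omega| = 1.\<close>
  define T :: "real^2 \<Rightarrow> real^2" where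
    "T v = vector [Re \<omega> * v $ 1 - Im \<omega> * v $ 2, Re \<omega> * v $ 2 + Im \<omega> * v $ 1]" for v
  have "linear T"
    by (rule linearI) (simp_all add: T_def Finite_Cartesian_Product.vec_eq_iff forall_2 algebra_simps)
  moreover have "norm (T v) = norm v" for v
  proof -
    have "(Re \<omega> * v $ 1 - Im \<omega> * v $ 2)\<^sup>2 + (Re \<omega> * v $ 2 + Im \<omega> * v $ 1)\<^sup>2 =
      ((Re \<omega>)\<^sup>2 + (Im \<omega>)\<^sup>2) * ((v $ 1)\<^sup>2 + (v $ 2)\<^sup>2)"
      by (simp add: power2_eq_square algebra_simps)
    moreover have "(Re \<omega>)\<^sup>2 + (Im \<omega>)\<^sup>2 = 1" using assms by (simp flip: cmod_power2)
    ultimately show ?thesis by (simp add: norm_vec_def L2_set_def sum_2 T_def)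
  qed
  ultimately have T: "orthogonal_transformation T"
    by (simp add: orthogonal_transformation)
  have Tm: "T \<in> borel_measurable borel"
    using T by (intro borel_measurable_continuous_onI linear_continuous_on
        linear_conv_bounded_linear[THEN iffD1] orthogonal_transformation_linear)
  have "distr lborel borel (\<lambda>z. \<omega> * z) = distr (distr lborel borel ?f) borel (\<lambda>z. \<omega> * z)"
    by (simp add: distr_lborel_real2_complex)
  also have "\<dots> = distr lborel borel (\<lambda>v. \<omega> * ?f v)"
    using fm by (subst distr_distr) (auto simp: o_def)
  also have "(\<lambda>v. \<omega> * ?f v) = ?f \<circ> T"
    by (simp add: fun_eq_iff complex_eq_iff T_def)
  also have "distr lborel borel (?f \<circ> T) = distr (distr lborel borel T) borel ?f"
    using fm Tm by (subst distr_distr) auto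
  also have "\<dots> = lborel"
    by (simp add: distr_lborel_orthogonal[OF T] distr_lborel_real2_complex)
  finally show ?thesis .
qed

context radial_weight begin

lemma distr_lam_rotation:
  assumes "cmod \<omega> = 1"
  shows "distr (lam \<phi>) borel (\<lambda>z. \<omega> * z) = lam \<phi>"
proof -
  have "lam \<phi> = density (distr lborel borel (\<lambda>z. \<omega> * z)) (\<lambda>z. ennreal (wt (cmod z)))"
    by (simp add: distr_lborel_rotation[OF assms] lam_eq_wt)
  also have "\<dots> = distr (density lborel (\<lambda>z. ennreal (wt (cmod (\<omega> * z))))) borel (\<lambda>z. \<omega> * z)"
    by (subst density_distr) auto
  also have "\<dots> = distr (lam \<phi>) borel (\<lambda>z. \<omega> * z)"
    by (simp add: lam_eq_wt norm_mult assms)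
  finally show ?thesis ..
qed

lemma
  fixes F :: "complex \<Rightarrow> 'b :: {banach, second_countable_topology}"
  assumes "cmod \<omega> = 1" and [measurable]: "F \<in> borel_measurable borel"
  shows integral_rotation: "(\<integral>z. F (\<omega> * z) \<partial>lam \<phi>) = (\<integral>z. F z \<partial>lam \<phi>)"
    and integrable_rotation: "integrable (lam \<phi>) (\<lambda>z. F (\<omega> * z)) \<longleftrightarrow> integrable (lam \<phi>) F"
proof -
  have m: "(\<lambda>z. \<omega> * z) \<in> measurable (lam \<phi>) borel" by simp
  show "(\<integral>z. F (\<omega> * z) \<partial>lam \<phi>) = (\<integral>z. F z \<partial>lam \<phi>)"
    using integral_distr[OF m, of F] by (simp add: distr_lam_rotation[OF assms(1)])
  show "integrable (lam \<phi>) (\<lambda>z. F (\<omega> * z)) \<longleftrightarrow> integrable (lam \<phi>) F"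
    using integrable_distr_eq[OF m, of F] by (simp add: distr_lam_rotation[OF assms(1)])
qed

lemma integral_eq_0_of_rotation:
  fixes F :: "complex \<Rightarrow> complex"
  assumes "cmod \<omega> = 1" "F \<in> borel_measurable borel" "\<And>z. F (\<omega> * z) = c * F z" "c \<noteq> 1"
  shows "(\<integral>z. F z \<partial>lam \<phi>) = 0"
proof -
  have "(\<integral>z. F z \<partial>lam \<phi>) = c * (\<integral>z. F z \<partial>lam \<phi>)"
    using integral_rotation[OF assms(1,2)] by (simp add: assms(3))
  then show ?thesis using assms(4) by simp
qed

text \<open>The radial factor \<open>u\<close> is carried along because truncations and inverse
  powers of |z| will be absorbed in it.\<close>

lemma integral_monomials_eq_0:
  fixes u :: "real \<Rightarrow> complex"
  assumes "a \<noteq> b" and [measurable]: "u \<in> borel_measurable borel"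
  shows "(\<integral>z. u (cmod z) * (z ^ a * cnj z ^ b) \<partial>lam \<phi>) = 0"
proof -
  \<comment> \<open>This angle gives omega^(a - b) = -1, so the rotation changes the sign of the
    integrand.\<close>
  define \<omega> where "\<omega> = cis (pi / (real a - real b))"
  have "\<omega> ^ a * cnj \<omega> ^ b = cis (real a * (pi / (real a - real b)) - real b * (pi / (real a - real b)))"
    by (simp add: \<omega>_def Complex.DeMoivre cis_cnj cis_mult)
  also have "real a * (pi / (real a - real b)) - real b * (pi / (real a - real b)) =
      (real a - real b) * (pi / (real a - real b))" by (simp only: left_diff_distrib)
  also have "\<dots> = pi" using assms(1) by simp
  finally have \<omega>: "\<omega> ^ a * cnj \<omega> ^ b = - 1" by simp
  show ?thesis
  proof (rule integral_eq_0_of_rotation[of \<omega> _ "-1"])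
    fix z
    have "u (cmod (\<omega> * z)) * ((\<omega> * z) ^ a * cnj (\<omega> * z) ^ b) =
      (\<omega> ^ a * cnj \<omega> ^ b) * (u (cmod z) * (z ^ a * cnj z ^ b))"
      by (simp add: norm_mult \<omega>_def power_mult_distrib mult_ac)
    then show "u (cmod (\<omega> * z)) * ((\<omega> * z) ^ a * cnj (\<omega> * z) ^ b) = - 1 * (u (cmod z) * (z ^ a * cnj z ^ b))"
      unfolding \<omega> .
  qed (auto simp: \<omega>_def)
qed

end

section \<open>Reproducing kernels in \<open>L\<^sup>2\<close>\<close>

text \<open>Functions rather than classes modulo null sets, since reproducing kernels evaluate at
  points.\<close>

definition L2fun :: "'x measure \<Rightarrow> ('x \<Rightarrow> complex) \<Rightarrow> bool" where
  "L2fun M f \<longleftrightarrow> f \<in> borel_measurable M \<and> integrable M (\<lambda>x. (cmod (f x))\<^sup>2)"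

lemma L2fun_measurable: "L2fun M f \<Longrightarrow> f \<in> borel_measurable M"
  by (simp add: L2fun_def)

lemma L2fun_integrable_norm_mult:
  assumes "L2fun M f" "L2fun M g"
  shows "integrable M (\<lambda>x. cmod (f x) * cmod (g x))"
proof (rule Bochner_Integration.integrable_bound)
  show "integrable M (\<lambda>x. (cmod (f x))\<^sup>2 + (cmod (g x))\<^sup>2)"
    using assms by (simp add: L2fun_def)
  show "(\<lambda>x. cmod (f x) * cmod (g x)) \<in> borel_measurable M"
    using L2fun_measurable[OF assms(1)] L2fun_measurable[OF assms(2)] by measurable
  show "AE x in M. norm (cmod (f x) * cmod (g x)) \<le> norm ((cmod (f x))\<^sup>2 + (cmod (g x))\<^sup>2)"
  proof (intro AE_I2)
    fix x
    have "cmod (f x) * cmod (g x) \<le> (cmod (f x))\<^sup>2 + (cmod (g x))\<^sup>2"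
      using sum_squares_bound[of "cmod (f x)" "cmod (g x)"] mult_nonneg_nonneg[of "cmod (f x)" "cmod (g x)"]
      unfolding mult.assoc by (auto simp del: mult_nonneg_nonneg zero_le_mult_iff)
    then show "norm (cmod (f x) * cmod (g x)) \<le> norm ((cmod (f x))\<^sup>2 + (cmod (g x))\<^sup>2)" by simp
  qed
qed

lemma L2fun_integrable_mult:
  assumes "L2fun M f" "L2fun M g" "w \<in> borel_measurable M" "\<And>x. cmod (w x) \<le> C"
  shows "integrable M (\<lambda>x. w x * f x * cnj (g x))"
proof (rule Bochner_Integration.integrable_bound)
  show "integrable M (\<lambda>x. C * (cmod (f x) * cmod (g x)))"
    using L2fun_integrable_norm_mult[OF assms(1,2)] by simp
  show "(\<lambda>x. w x * f x * cnj (g x)) \<in> borel_measurable M"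
    using assms by (intro borel_measurable_times measurable_cnj) (auto simp: L2fun_measurable)
  show "AE x in M. norm (w x * f x * cnj (g x)) \<le> norm (C * (cmod (f x) * cmod (g x)))"
  proof (intro AE_I2)
    fix x
    have "cmod (w x) * (cmod (f x) * cmod (g x)) \<le> C * (cmod (f x) * cmod (g x))"
      by (intro mult_right_mono assms) simp
    then show "norm (w x * f x * cnj (g x)) \<le> norm (C * (cmod (f x) * cmod (g x)))"
      by (simp add: norm_mult mult.assoc)
  qed
qed

lemma L2fun_integrable_inner:
  "L2fun M f \<Longrightarrow> L2fun M g \<Longrightarrow> integrable M (\<lambda>x. f x * cnj (g x))"
  using L2fun_integrable_mult[of M f g "\<lambda>_. 1" 1] by simp

lemma L2fun_add_scaled:
  assumes "L2fun M f" "L2fun M g"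
  shows "L2fun M (\<lambda>x. f x + c * g x)"
  unfolding L2fun_def
proof
  show m: "(\<lambda>x. f x + c * g x) \<in> borel_measurable M"
    using assms by (intro borel_measurable_add borel_measurable_times) (auto simp: L2fun_measurable)
  show "integrable M (\<lambda>x. (cmod (f x + c * g x))\<^sup>2)"
  proof (rule Bochner_Integration.integrable_bound)
    show "integrable M (\<lambda>x. 2 * (cmod (f x))\<^sup>2 + 2 * (cmod c)\<^sup>2 * (cmod (g x))\<^sup>2)"
      using assms by (simp add: L2fun_def)
    show "AE x in M. norm ((cmod (f x + c * g x))\<^sup>2) \<le> norm (2 * (cmod (f x))\<^sup>2 + 2 * (cmod c)\<^sup>2 * (cmod (g x))\<^sup>2)"
    proof (intro AE_I2)
      fix x
      have "(cmod (f x + c * g x))\<^sup>2 \<le> (cmod (f x) + cmod c * cmod (g x))\<^sup>2"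
        by (intro power_mono norm_triangle_mono) (auto simp: norm_mult)
      also have "\<dots> \<le> 2 * (cmod (f x))\<^sup>2 + 2 * (cmod c)\<^sup>2 * (cmod (g x))\<^sup>2"
        using sum_squares_bound[of "cmod (f x)" "cmod c * cmod (g x)"] by (simp add: power2_sum power_mult_distrib)
      finally show "norm ((cmod (f x + c * g x))\<^sup>2) \<le> norm (2 * (cmod (f x))\<^sup>2 + 2 * (cmod c)\<^sup>2 * (cmod (g x))\<^sup>2)"
        by simp
    qed
  qed (use m in measurable)
qed

lemma L2fun_zero: "L2fun M (\<lambda>x. 0)" by (simp add: L2fun_def)

lemma L2fun_sum:
  assumes "\<And>i. i \<in> I \<Longrightarrow> L2fun M (f i)"
  shows "L2fun M (\<lambda>x. \<Sum>i\<in>I. c i * f i x)"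
  using assms
proof (induction I rule: infinite_finite_induct)
  case (insert i I)
  then have "L2fun M (\<lambda>x. (\<Sum>i\<in>I. c i * f i x) + c i * f i x)"
    by (intro L2fun_add_scaled) auto
  then show ?case using insert by (simp add: add.commute)
qed (auto simp: L2fun_zero)

lemma L2fun_cauchy_schwarz_norm:
  assumes "L2fun M f" "L2fun M g"
  shows "(\<integral>x. cmod (f x) * cmod (g x) \<partial>M)\<^sup>2 \<le> (\<integral>x. (cmod (f x))\<^sup>2 \<partial>M) * (\<integral>x. (cmod (g x))\<^sup>2 \<partial>M)"
proof -
  let ?b = "complex_of_real (\<integral>x. cmod (f x) * cmod (g x) \<partial>M)"
  have i: "integrable M (\<lambda>x. (cmod (f x))\<^sup>2)" "integrable M (\<lambda>x. (cmod (g x))\<^sup>2)"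
    "integrable M (\<lambda>x. cmod (f x) * cmod (g x))"
    using assms L2fun_integrable_norm_mult[OF assms] by (auto simp: L2fun_def)
  have "(cmod ?b)\<^sup>2 \<le> (\<integral>x. (cmod (f x))\<^sup>2 \<partial>M) * (\<integral>x. (cmod (g x))\<^sup>2 \<partial>M)"
  proof (rule cauchy_schwarz_aux)
    fix t :: complex
    have "0 \<le> (\<integral>x. (cmod (f x) + Re t * cmod (g x))\<^sup>2 \<partial>M)" by simp
    also have "(\<lambda>x. (cmod (f x) + Re t * cmod (g x))\<^sup>2) =
        (\<lambda>x. (cmod (f x))\<^sup>2 + 2 * Re t * (cmod (f x) * cmod (g x)) + (Re t)\<^sup>2 * (cmod (g x))\<^sup>2)"
      by (simp add: fun_eq_iff power2_eq_square algebra_simps)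
    also have "(\<integral>x. (cmod (f x))\<^sup>2 + 2 * Re t * (cmod (f x) * cmod (g x)) + (Re t)\<^sup>2 * (cmod (g x))\<^sup>2 \<partial>M) =
        (\<integral>x. (cmod (f x))\<^sup>2 \<partial>M) + 2 * Re (t * ?b) + (Re t)\<^sup>2 * (\<integral>x. (cmod (g x))\<^sup>2 \<partial>M)"
      using i by simp
    also have "\<dots> \<le> (\<integral>x. (cmod (f x))\<^sup>2 \<partial>M) + 2 * Re (t * ?b) + (cmod t)\<^sup>2 * (\<integral>x. (cmod (g x))\<^sup>2 \<partial>M)"
      by (intro add_left_mono mult_right_mono) (auto simp: cmod_power2)
    finally show "0 \<le> (\<integral>x. (cmod (f x))\<^sup>2 \<partial>M) + 2 * Re (t * ?b) + (cmod t)\<^sup>2 * (\<integral>x. (cmod (g x))\<^sup>2 \<partial>M)" .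
  qed simp
  then show ?thesis by (simp only: norm_of_real power2_abs)
qed

lemma L2fun_weighted_cauchy_schwarz:
  assumes "L2fun M f" "L2fun M g" "w \<in> borel_measurable M" "\<And>x. cmod (w x) \<le> \<delta>"
  shows "(cmod (\<integral>x. w x * f x * cnj (g x) \<partial>M))\<^sup>2 \<le> \<delta>\<^sup>2 * ((\<integral>x. (cmod (f x))\<^sup>2 \<partial>M) * (\<integral>x. (cmod (g x))\<^sup>2 \<partial>M))"
proof -
  have \<delta>: "0 \<le> \<delta>" using assms(4) norm_ge_zero order_trans by blast
  have "cmod (\<integral>x. w x * f x * cnj (g x) \<partial>M) \<le> (\<integral>x. cmod (w x * f x * cnj (g x)) \<partial>M)"
    by (rule integral_norm_bound)
  also have "\<dots> \<le> (\<integral>x. \<delta> * (cmod (f x) * cmod (g x)) \<partial>M)"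
  proof (rule integral_mono)
    show "integrable M (\<lambda>x. cmod (w x * f x * cnj (g x)))"
      by (intro integrable_norm L2fun_integrable_mult[OF assms])
    fix x
    have "cmod (w x) * (cmod (f x) * cmod (g x)) \<le> \<delta> * (cmod (f x) * cmod (g x))"
      by (intro mult_right_mono assms) simp
    then show "cmod (w x * f x * cnj (g x)) \<le> \<delta> * (cmod (f x) * cmod (g x))" by (simp add: norm_mult mult.assoc)
  qed (use L2fun_integrable_norm_mult[OF assms(1,2)] in simp)
  finally have "cmod (\<integral>x. w x * f x * cnj (g x) \<partial>M) \<le> \<delta> * (\<integral>x. cmod (f x) * cmod (g x) \<partial>M)" by simp
  then have "(cmod (\<integral>x. w x * f x * cnj (g x) \<partial>M))\<^sup>2 \<le> (\<delta> * (\<integral>x. cmod (f x) * cmod (g x) \<partial>M))\<^sup>2"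
    by (intro power_mono) auto
  also have "\<dots> \<le> \<delta>\<^sup>2 * ((\<integral>x. (cmod (f x))\<^sup>2 \<partial>M) * (\<integral>x. (cmod (g x))\<^sup>2 \<partial>M))"
    unfolding power_mult_distrib by (intro mult_left_mono L2fun_cauchy_schwarz_norm[OF assms(1,2)]) simp
  finally show ?thesis .
qed

lemma integral_mult_cnj_self: "(\<integral>x. f x * cnj (f x) \<partial>M) = complex_of_real (\<integral>x. (cmod (f x))\<^sup>2 \<partial>M)"
proof -
  have "(\<lambda>x. f x * cnj (f x)) = (\<lambda>x. complex_of_real ((cmod (f x))\<^sup>2))"
    by (simp only: complex_norm_square)
  then show ?thesis by (simp only: integral_complex_of_real)
qed

text \<open>Formulated for a linear space of functions, so that it applies alike to polynomials of
  bounded degree and to their subspaces of functions vanishing at given points.\<close>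

definition rkernel :: "'x measure \<Rightarrow> ('x \<Rightarrow> complex) set \<Rightarrow> ('x \<Rightarrow> 'x \<Rightarrow> complex) \<Rightarrow> bool" where
  "rkernel M V K \<longleftrightarrow> (\<forall>f\<in>V. L2fun M f) \<and> (\<forall>f\<in>V. \<forall>g\<in>V. \<forall>c. (\<lambda>x. f x + c * g x) \<in> V) \<and>
     (\<forall>y. (\<lambda>x. K x y) \<in> V) \<and> (\<forall>f\<in>V. \<forall>y. f y = (\<integral>x. f x * cnj (K x y) \<partial>M))"

context
  fixes M :: "'x measure" and V K
  assumes rk: "rkernel M V K"
begin

lemma rk_L2: "f \<in> V \<Longrightarrow> L2fun M f"
  and rk_lin: "f \<in> V \<Longrightarrow> g \<in> V \<Longrightarrow> (\<lambda>x. f x + c * g x) \<in> V"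
  and rk_mem: "(\<lambda>x. K x y) \<in> V"
  and rk_eval: "f \<in> V \<Longrightarrow> f y = (\<integral>x. f x * cnj (K x y) \<partial>M)"
  using rk by (auto simp: rkernel_def)

lemma rk_hermitian: "K y x = cnj (K x y)"
proof -
  have "K y x = (\<integral>z. K z x * cnj (K z y) \<partial>M)" by (rule rk_eval[OF rk_mem])
  also have "\<dots> = cnj (\<integral>z. K z y * cnj (K z x) \<partial>M)"
    by (subst Bochner_Integration.integral_cnj[symmetric]) (simp add: mult.commute)
  also have "(\<integral>z. K z y * cnj (K z x) \<partial>M) = K x y" by (rule rk_eval[OF rk_mem, symmetric])
  finally show ?thesis .
qed

lemma rk_zero: "(\<lambda>x. 0) \<in> V"
  using rk_lin[OF rk_mem rk_mem, of undefined "-1" undefined] by simp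

lemma rk_sum: "finite I \<Longrightarrow> (\<And>i. i \<in> I \<Longrightarrow> f i \<in> V) \<Longrightarrow> (\<lambda>x. \<Sum>i\<in>I. c i * f i x) \<in> V"
proof (induction I rule: finite_induct)
  case (insert i I)
  then have "(\<lambda>x. (\<Sum>i\<in>I. c i * f i x) + c i * f i x) \<in> V" by (intro rk_lin) auto
  then show ?case using insert by (simp add: add.commute)
qed (simp add: rk_zero)

lemma rk_diag: "K x x = complex_of_real (\<integral>z. (cmod (K z x))\<^sup>2 \<partial>M)"
  unfolding integral_mult_cnj_self[symmetric] by (rule rk_eval[OF rk_mem])

lemma rk_diag_nonneg: "0 \<le> Re (K x x)"
  by (subst rk_diag) simp

lemma rk_bound:
  assumes "f \<in> V"
  shows "(cmod (f x))\<^sup>2 \<le> (\<integral>z. (cmod (f z))\<^sup>2 \<partial>M) * Re (K x x)"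
proof -
  have "(cmod (\<integral>z. 1 * f z * cnj (K z x) \<partial>M))\<^sup>2 \<le> 1\<^sup>2 * ((\<integral>z. (cmod (f z))\<^sup>2 \<partial>M) * (\<integral>z. (cmod (K z x))\<^sup>2 \<partial>M))"
    by (rule L2fun_weighted_cauchy_schwarz) (auto intro: rk_L2 assms rk_mem)
  moreover have "(\<integral>z. (cmod (K z x))\<^sup>2 \<partial>M) = Re (K x x)" by (subst rk_diag) simp
  ultimately show ?thesis using rk_eval[OF assms, of x] by simp
qed

lemma rk_entry_bound: "(cmod (K x y))\<^sup>2 \<le> Re (K x x) * Re (K y y)"
proof -
  have "(\<integral>z. (cmod (K z y))\<^sup>2 \<partial>M) = Re (K y y)" by (subst rk_diag) simp
  then show ?thesis using rk_bound[of "\<lambda>z. K z y" x, OF rk_mem] by (simp only: mult.commute)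
qed

text \<open>The quadratic form is the squared norm of a combination of kernel functions. Hadamard's
  inequality then applies to all determinants of the kernel.\<close>

lemma rk_psd: "psd n (\<lambda>i j. K (x i) (x j))"
  unfolding psd_def
proof (intro conjI allI impI)
  fix y :: "nat \<Rightarrow> complex"
  define f where "f z = (\<Sum>j<n. cnj (y j) * K z (x j))" for z
  have f: "f \<in> V" unfolding f_def[abs_def] by (intro rk_sum rk_mem) auto
  have int: "integrable M (\<lambda>z. f z * cnj (K z (x i)))" for i
    by (intro L2fun_integrable_inner rk_L2 f rk_mem)
  have "(\<Sum>i<n. \<Sum>j<n. y i * K (x i) (x j) * cnj (y j)) = (\<Sum>i<n. y i * f (x i))"
    unfolding f_def by (simp add: sum_distrib_left mult_ac)
  also have "\<dots> = (\<Sum>i<n. \<integral>z. y i * (f z * cnj (K z (x i))) \<partial>M)"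
    by (subst rk_eval[OF f]) simp
  also have "\<dots> = (\<integral>z. (\<Sum>i<n. y i * (f z * cnj (K z (x i)))) \<partial>M)"
    using int by (subst Bochner_Integration.integral_sum) auto
  also have "\<dots> = (\<integral>z. f z * cnj (f z) \<partial>M)"
  proof (intro Bochner_Integration.integral_cong refl)
    fix z
    have "cnj (f z) = (\<Sum>i<n. y i * cnj (K z (x i)))" by (simp add: f_def)
    then show "(\<Sum>i<n. y i * (f z * cnj (K z (x i)))) = f z * cnj (f z)"
      by (simp add: sum_distrib_left mult.left_commute)
  qed
  also have "\<dots> = complex_of_real (\<integral>z. (cmod (f z))\<^sup>2 \<partial>M)" by (rule integral_mult_cnj_self)
  finally show "0 \<le> Re (\<Sum>i<n. \<Sum>j<n. y i * K (x i) (x j) * cnj (y j))" by simp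
qed (rule rk_hermitian)

lemma rk_diag_nonzero:
  assumes "f \<in> V" "f q \<noteq> 0"
  shows "0 < Re (K q q)"
proof (rule ccontr)
  assume "\<not> 0 < Re (K q q)"
  then have "Re (K q q) = 0" using rk_diag_nonneg[of q] by simp
  then show False using rk_bound[OF assms(1), of q] assms(2) by simp
qed

text \<open>The correction is a multiple of the kernel function at \<open>q\<close>, to which every
  function vanishing at \<open>q\<close> is orthogonal. So one Palm step is the restriction to such
  functions; \<open>f\<close> witnesses that K(q,q) is not 0.\<close>

lemma rk_palm:
  assumes "f \<in> V" "f q \<noteq> 0"
  shows "rkernel M {f \<in> V. f q = 0} (\<lambda>x y. K x y - K x q * K q y / K q q)"
proof -
  have q: "K q q \<noteq> 0" using rk_diag_nonzero[OF assms] by auto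
  have mem: "(\<lambda>x. K x y - K x q * K q y / K q q) \<in> V" for y
    using rk_lin[OF rk_mem[of y] rk_mem[of q], of "- (K q y / K q q)"] by (simp add: mult.commute)
  have ev: "g y = (\<integral>x. g x * cnj (K x y - K x q * K q y / K q q) \<partial>M)" if g: "g \<in> V" "g q = 0" for g y
  proof -
    have int: "integrable M (\<lambda>x. g x * cnj (K x z))" for z
      by (intro L2fun_integrable_inner rk_L2 g rk_mem)
    have "(\<integral>x. g x * cnj (K x y - K x q * K q y / K q q) \<partial>M) =
       (\<integral>x. g x * cnj (K x y) - cnj (K q y / K q q) * (g x * cnj (K x q)) \<partial>M)"
      by (intro Bochner_Integration.integral_cong refl) (simp add: algebra_simps)
    also have "\<dots> = g y - cnj (K q y / K q q) * g q"
    proof -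
      have "(\<integral>x. g x * cnj (K x z) \<partial>M) = g z" for z by (rule rk_eval[OF g(1), symmetric])
      then show ?thesis using int by simp
    qed
    finally show ?thesis using g(2) by simp
  qed
  show ?thesis unfolding rkernel_def using rk_L2 rk_lin mem ev q by auto
qed

end

section \<open>Newton bases and Palm kernels\<close>

lemma L2fun_minkowski:
  assumes "L2fun M f" "L2fun M g"
  shows "sqrt (\<integral>x. (cmod (f x + c * g x))\<^sup>2 \<partial>M) \<le>
    sqrt (\<integral>x. (cmod (f x))\<^sup>2 \<partial>M) + cmod c * sqrt (\<integral>x. (cmod (g x))\<^sup>2 \<partial>M)"
proof (rule real_le_lsqrt[OF _ _])
  define F G B where "F = (\<integral>x. (cmod (f x))\<^sup>2 \<partial>M)" and "G = (\<integral>x. (cmod (g x))\<^sup>2 \<partial>M)"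
    and "B = (\<integral>x. cmod (f x) * cmod (g x) \<partial>M)"
  have nn: "0 \<le> F" "0 \<le> G" by (simp_all add: F_def G_def)
  show "0 \<le> sqrt (\<integral>x. (cmod (f x))\<^sup>2 \<partial>M) + cmod c * sqrt (\<integral>x. (cmod (g x))\<^sup>2 \<partial>M)" by simp
  have i: "integrable M (\<lambda>x. (cmod (f x))\<^sup>2)" "integrable M (\<lambda>x. (cmod (g x))\<^sup>2)"
    "integrable M (\<lambda>x. cmod (f x) * cmod (g x))"
    using assms L2fun_integrable_norm_mult[OF assms] by (auto simp: L2fun_def)
  have "B\<^sup>2 \<le> F * G" unfolding F_def G_def B_def by (rule L2fun_cauchy_schwarz_norm[OF assms])
  then have B: "B \<le> sqrt F * sqrt G" by (simp add: real_le_rsqrt real_sqrt_mult[symmetric])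
  have "(\<integral>x. (cmod (f x + c * g x))\<^sup>2 \<partial>M) \<le>
      (\<integral>x. (cmod (f x))\<^sup>2 + 2 * cmod c * (cmod (f x) * cmod (g x)) + (cmod c)\<^sup>2 * (cmod (g x))\<^sup>2 \<partial>M)"
  proof (rule integral_mono)
    show "integrable M (\<lambda>x. (cmod (f x + c * g x))\<^sup>2)"
      using L2fun_add_scaled[OF assms] by (simp add: L2fun_def)
    fix x
    have "(cmod (f x + c * g x))\<^sup>2 \<le> (cmod (f x) + cmod c * cmod (g x))\<^sup>2"
      by (intro power_mono norm_triangle_mono) (auto simp: norm_mult)
    then show "(cmod (f x + c * g x))\<^sup>2 \<le> (cmod (f x))\<^sup>2 + 2 * cmod c * (cmod (f x) * cmod (g x)) + (cmod c)\<^sup>2 * (cmod (g x))\<^sup>2"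
      by (simp add: power2_sum power_mult_distrib mult_ac)
  qed (use i in simp)
  also have "\<dots> = F + 2 * cmod c * B + (cmod c)\<^sup>2 * G" using i by (simp add: F_def G_def B_def)
  also have "\<dots> \<le> F + 2 * cmod c * (sqrt F * sqrt G) + (cmod c)\<^sup>2 * G"
    using B by (intro add_mono mult_left_mono) auto
  also have "\<dots> = (sqrt F + cmod c * sqrt G)\<^sup>2"
    using nn by (simp add: power2_sum power_mult_distrib mult_ac)
  finally show "(\<integral>x. (cmod (f x + c * g x))\<^sup>2 \<partial>M) \<le>
    (sqrt (\<integral>x. (cmod (f x))\<^sup>2 \<partial>M) + cmod c * sqrt (\<integral>x. (cmod (g x))\<^sup>2 \<partial>M))\<^sup>2"
    by (simp add: F_def G_def)
qed

text \<open>Let f and f0 be dual to the first function for the weighted and for the plain pairing,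
  scaled by the determinants e and d. The combination \<zeta> = d f - cnj e f0 pairs with every s_a
  only through 1 - w, so its norm is at most d \<delta> |f|; eliminating f gives at most \<delta> /
  (1 - \<delta>) |e| |f0|. Up to conjugation its first coefficient is d e' - e d', recovered by
  pairing with f0, whose squared norm is d d'. The bound does not involve \<open>n\<close>, which
  makes it uniform in the number of points.\<close>

lemma gram_quotient_perturbation:
  fixes s :: "nat \<Rightarrow> 'x \<Rightarrow> complex" and w :: "'x \<Rightarrow> complex" and n :: nat
  assumes s: "\<And>a. L2fun M (s a)"
    and w: "w \<in> borel_measurable M" "\<And>x. cmod (w x - 1) \<le> \<delta>" "\<delta> < 1"
  defines "G \<equiv> \<lambda>a b. \<integral>x. s a x * cnj (s b x) \<partial>M" and "W \<equiv> \<lambda>a b. \<integral>x. w x * s a x * cnj (s b x) \<partial>M"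
  assumes d: "dt (Suc n) G = of_real d" "0 < d" and d': "dt n (\<lambda>a b. G (Suc a) (Suc b)) = of_real d'" "0 < d'"
  defines "e \<equiv> dt (Suc n) W" and "e' \<equiv> dt n (\<lambda>a b. W (Suc a) (Suc b))"
  shows "cmod (e' / d' - e / d) \<le> \<delta> / (1 - \<delta>) * cmod (e / d)"
proof -
  obtain y where y: "y 0 = e'" "\<And>i. i < Suc n \<Longrightarrow> (\<Sum>j<Suc n. W i j * y j) = (if i = 0 then e else 0)"
    using dt_first_cofactors[of n W] unfolding e_def e'_def by metis
  obtain u where u: "u 0 = of_real d'" "\<And>i. i < Suc n \<Longrightarrow> (\<Sum>j<Suc n. G i j * u j) = (if i = 0 then of_real d else 0)"
    using dt_first_cofactors[of n G] unfolding d d' by metis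
  have \<delta>: "0 \<le> \<delta>" using w(2) norm_ge_zero order_trans by blast
  \<comment> \<open>The coefficients are conjugated so that pairing \<open>s a\<close> with
    \<open>comb c\<close> gives row a of the Gram matrix applied to \<open>c\<close>.\<close>
  define comb where "comb c x = (\<Sum>b<Suc n. cnj (c b) * s b x)" for c x
  have L2c: "L2fun M (comb c)" for c unfolding comb_def[abs_def] by (intro L2fun_sum s)
  have w1: "cmod (w x) \<le> 1 + \<delta>" "cmod (1 - w x) \<le> \<delta>" for x
    using w(2)[of x] norm_triangle_ineq2[of "w x" 1] by (auto simp: norm_minus_commute)
  have meas1: "(\<lambda>x. 1 - w x) \<in> borel_measurable M" using w(1) by simp
  have inner_comb: "(\<integral>x. v x * g x * cnj (comb c x) \<partial>M) = (\<Sum>b<Suc n. (\<integral>x. v x * g x * cnj (s b x) \<partial>M) * c b)"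
    if "v \<in> borel_measurable M" "\<And>x. cmod (v x) \<le> C" "L2fun M g" for v C g c
  proof -
    have int: "integrable M (\<lambda>x. v x * g x * cnj (s b x))" for b
      by (rule L2fun_integrable_mult[OF that(3) s that(1,2)])
    have "(\<integral>x. v x * g x * cnj (comb c x) \<partial>M) = (\<integral>x. (\<Sum>b<Suc n. (v x * g x * cnj (s b x)) * c b) \<partial>M)"
      unfolding comb_def by (intro Bochner_Integration.integral_cong refl) (simp add: sum_distrib_left mult_ac del: sum.lessThan_Suc)
    also have "\<dots> = (\<Sum>b<Suc n. \<integral>x. (v x * g x * cnj (s b x)) * c b \<partial>M)"
      using int by (intro Bochner_Integration.integral_sum integrable_mult_left)
    finally show ?thesis by simp
  qed
  have comb_inner: "(\<integral>x. v x * comb c x * cnj (g x) \<partial>M) = (\<Sum>b<Suc n. cnj (c b) * (\<integral>x. v x * s b x * cnj (g x) \<partial>M))"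
    if "v \<in> borel_measurable M" "\<And>x. cmod (v x) \<le> C" "L2fun M g" for v C g c
  proof -
    have int: "integrable M (\<lambda>x. v x * s b x * cnj (g x))" for b
      by (rule L2fun_integrable_mult[OF s that(3) that(1,2)])
    have "(\<integral>x. v x * comb c x * cnj (g x) \<partial>M) = (\<integral>x. (\<Sum>b<Suc n. cnj (c b) * (v x * s b x * cnj (g x))) \<partial>M)"
      unfolding comb_def by (intro Bochner_Integration.integral_cong refl) (simp add: sum_distrib_left sum_distrib_right mult_ac del: sum.lessThan_Suc)
    also have "\<dots> = (\<Sum>b<Suc n. \<integral>x. cnj (c b) * (v x * s b x * cnj (g x)) \<partial>M)"
      using int by (intro Bochner_Integration.integral_sum integrable_mult_right)
    finally show ?thesis by simp
  qed
  define f f0 z \<zeta> where "f = comb y" and "f0 = comb u" and "z b = of_real d * y b - e * u b" and "\<zeta> = comb z" for b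
  have L2: "L2fun M f" "L2fun M f0" "L2fun M \<zeta>" unfolding f_def f0_def \<zeta>_def by (rule L2c)+
  have one: "(\<lambda>x. 1 :: complex) \<in> borel_measurable M" "\<And>x. cmod (1 :: complex) \<le> 1" by simp_all
  have sf: "(\<integral>x. w x * s a x * cnj (f x) \<partial>M) = (if a = 0 then e else 0)" if "a < Suc n" for a
    using inner_comb[OF w(1) w1(1) s, of a y] y(2)[OF that] by (simp add: f_def W_def del: sum.lessThan_Suc)
  have sf0: "(\<integral>x. 1 * s a x * cnj (f0 x) \<partial>M) = (if a = 0 then of_real d else 0)" if "a < Suc n" for a
    using inner_comb[OF one s, of a u] u(2)[OF that] by (simp add: f0_def G_def del: sum.lessThan_Suc)
  have zeta_eq: "\<zeta> x = of_real d * f x + (- cnj e) * f0 x" for x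
    unfolding \<zeta>_def f_def f0_def comb_def z_def sum_distrib_left sum.distrib[symmetric]
    by (intro sum.cong refl) (simp add: algebra_simps)
  \<comment> \<open>The pairing of \<open>s a\<close> with f0, times e, equals d times its weighted
    pairing with f: both are d e for a = 0 and 0 otherwise. The difference leaves the factor 1 -
    w.\<close>
  have sz: "(\<integral>x. 1 * s a x * cnj (\<zeta> x) \<partial>M) = of_real d * (\<integral>x. (1 - w x) * s a x * cnj (f x) \<partial>M)" if a: "a < Suc n" for a
  proof -
    have i1: "integrable M (\<lambda>x. 1 * s a x * cnj (f x))" "integrable M (\<lambda>x. 1 * s a x * cnj (f0 x))"
      "integrable M (\<lambda>x. w x * s a x * cnj (f x))"
      using L2fun_integrable_mult[OF s L2(1) one] L2fun_integrable_mult[OF s L2(2) one]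
        L2fun_integrable_mult[OF s L2(1) w(1) w1(1)] by auto
    have "(\<integral>x. 1 * s a x * cnj (\<zeta> x) \<partial>M) =
        (\<integral>x. of_real d * (1 * s a x * cnj (f x)) - e * (1 * s a x * cnj (f0 x)) \<partial>M)"
      unfolding zeta_eq by (intro Bochner_Integration.integral_cong refl) (simp add: algebra_simps)
    also have "\<dots> = of_real d * (\<integral>x. 1 * s a x * cnj (f x) \<partial>M) - e * (\<integral>x. 1 * s a x * cnj (f0 x) \<partial>M)"
      using i1 by (subst Bochner_Integration.integral_diff) auto
    also have "e * (\<integral>x. 1 * s a x * cnj (f0 x) \<partial>M) = of_real d * (\<integral>x. w x * s a x * cnj (f x) \<partial>M)"
      unfolding sf0[OF a] sf[OF a] by simp
    also have "of_real d * (\<integral>x. 1 * s a x * cnj (f x) \<partial>M) - of_real d * (\<integral>x. w x * s a x * cnj (f x) \<partial>M) =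
       of_real d * (\<integral>x. 1 * s a x * cnj (f x) - w x * s a x * cnj (f x) \<partial>M)"
      using i1 by (subst Bochner_Integration.integral_diff) (auto simp: right_diff_distrib)
    finally show ?thesis by (simp add: left_diff_distrib)
  qed
  define nf n0 nz where "nf = sqrt (\<integral>x. (cmod (f x))\<^sup>2 \<partial>M)" and "n0 = sqrt (\<integral>x. (cmod (f0 x))\<^sup>2 \<partial>M)"
    and "nz = sqrt (\<integral>x. (cmod (\<zeta> x))\<^sup>2 \<partial>M)"
  have nn: "0 \<le> nf" "0 \<le> n0" "0 \<le> nz" by (simp_all add: nf_def n0_def nz_def)
  have sq: "nf\<^sup>2 = (\<integral>x. (cmod (f x))\<^sup>2 \<partial>M)" "n0\<^sup>2 = (\<integral>x. (cmod (f0 x))\<^sup>2 \<partial>M)" "nz\<^sup>2 = (\<integral>x. (cmod (\<zeta> x))\<^sup>2 \<partial>M)"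
    by (simp_all add: nf_def n0_def nz_def)
  have cs: "cmod (\<integral>x. v x * g x * cnj (k x) \<partial>M) \<le> C * (sqrt (\<integral>x. (cmod (g x))\<^sup>2 \<partial>M) * sqrt (\<integral>x. (cmod (k x))\<^sup>2 \<partial>M))"
    if "v \<in> borel_measurable M" "\<And>x. cmod (v x) \<le> C" "L2fun M g" "L2fun M k" "0 \<le> C" for v C g k
  proof (rule power2_le_imp_le)
    have "(cmod (\<integral>x. v x * g x * cnj (k x) \<partial>M))\<^sup>2 \<le> C\<^sup>2 * ((\<integral>x. (cmod (g x))\<^sup>2 \<partial>M) * (\<integral>x. (cmod (k x))\<^sup>2 \<partial>M))"
      by (rule L2fun_weighted_cauchy_schwarz[OF that(3,4,1,2)])
    also have "\<dots> = (C * (sqrt (\<integral>x. (cmod (g x))\<^sup>2 \<partial>M) * sqrt (\<integral>x. (cmod (k x))\<^sup>2 \<partial>M)))\<^sup>2"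
      by (simp add: power_mult_distrib)
    finally show "(cmod (\<integral>x. v x * g x * cnj (k x) \<partial>M))\<^sup>2 \<le>
      (C * (sqrt (\<integral>x. (cmod (g x))\<^sup>2 \<partial>M) * sqrt (\<integral>x. (cmod (k x))\<^sup>2 \<partial>M)))\<^sup>2" .
    show "0 \<le> C * (sqrt (\<integral>x. (cmod (g x))\<^sup>2 \<partial>M) * sqrt (\<integral>x. (cmod (k x))\<^sup>2 \<partial>M))"
      using that(5) by simp
  qed
  have "nz\<^sup>2 \<le> d * (\<delta> * (nz * nf))"
  proof -
    have "complex_of_real (nz\<^sup>2) = (\<integral>x. 1 * \<zeta> x * cnj (\<zeta> x) \<partial>M)"
      unfolding sq using integral_mult_cnj_self[of M \<zeta>] by simp
    also have "\<dots> = (\<Sum>b<Suc n. cnj (z b) * (\<integral>x. 1 * s b x * cnj (\<zeta> x) \<partial>M))"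
      using comb_inner[OF one L2(3), of z] by (simp add: \<zeta>_def del: sum.lessThan_Suc)
    also have "\<dots> = (\<Sum>b<Suc n. of_real d * (cnj (z b) * (\<integral>x. (1 - w x) * s b x * cnj (f x) \<partial>M)))"
      by (intro sum.cong refl) (subst sz, auto)
    also have "\<dots> = of_real d * (\<integral>x. (1 - w x) * \<zeta> x * cnj (f x) \<partial>M)"
      using comb_inner[OF meas1 w1(2) L2(1), of z] by (simp add: \<zeta>_def sum_distrib_left[symmetric] del: sum.lessThan_Suc)
    finally have "cmod (complex_of_real (nz\<^sup>2)) = d * cmod (\<integral>x. (1 - w x) * \<zeta> x * cnj (f x) \<partial>M)"
      using d(2) by (simp add: norm_mult)
    also have "\<dots> \<le> d * (\<delta> * (nz * nf))"
      using d(2) cs[OF meas1 w1(2) L2(3) L2(1) \<delta>] by (simp add: nz_def nf_def)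
    finally show ?thesis by (simp add: norm_power)
  qed
  then have nz: "nz \<le> d * \<delta> * nf"
    using nn d(2) \<delta> by (cases "nz = 0") (auto simp: power2_eq_square mult_ac)
  \<comment> \<open>The triangle inequality for d f = \<zeta> + cnj e f0 eliminates the norm of
    f.\<close>
  have "d * nf \<le> nz + cmod e * n0"
  proof -
    have "d * nf = sqrt (\<integral>x. (cmod (\<zeta> x + cnj e * f0 x))\<^sup>2 \<partial>M)"
      unfolding zeta_eq nf_def using d(2) by (simp add: norm_mult power_mult_distrib real_sqrt_mult)
    also have "\<dots> \<le> nz + cmod e * n0"
      using L2fun_minkowski[OF L2(3) L2(2), of "cnj e"] by (simp add: nz_def n0_def)
    finally show ?thesis .
  qed
  then have "d * nf * (1 - \<delta>) \<le> cmod e * n0" using nz by (simp add: algebra_simps)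
  then have "d * nf \<le> cmod e * n0 / (1 - \<delta>)" using w(3) by (simp add: pos_le_divide_eq)
  then have "\<delta> * (d * nf) \<le> \<delta> * (cmod e * n0 / (1 - \<delta>))" using \<delta> by (rule mult_left_mono)
  then have nz': "nz \<le> \<delta> / (1 - \<delta>) * cmod e * n0" using nz by (simp add: mult_ac)
  have n0: "n0\<^sup>2 = d' * d"
  proof -
    have "complex_of_real (n0\<^sup>2) = (\<integral>x. 1 * f0 x * cnj (f0 x) \<partial>M)"
      unfolding sq using integral_mult_cnj_self[of M f0] by simp
    also have "\<dots> = (\<Sum>b<Suc n. cnj (u b) * (\<integral>x. 1 * s b x * cnj (f0 x) \<partial>M))"
      using comb_inner[OF one L2(2), of u] by (simp add: f0_def del: sum.lessThan_Suc)
    also have "\<dots> = (\<Sum>b<Suc n. if b = 0 then of_real (d' * d) else 0)"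
      by (intro sum.cong refl) (subst sf0, auto simp: u(1))
    also have "\<dots> = of_real (d' * d)" by (simp add: sum.delta del: sum.lessThan_Suc)
    finally show ?thesis using of_real_eq_iff by blast
  qed
  \<comment> \<open>The function f0 is orthogonal to all \<open>s b\<close> with b > 0, so pairing
    with it isolates the first coefficient.\<close>
  have "cmod (z 0) * d \<le> nz * n0"
  proof -
    have "(\<integral>x. 1 * \<zeta> x * cnj (f0 x) \<partial>M) = (\<Sum>b<Suc n. cnj (z b) * (\<integral>x. 1 * s b x * cnj (f0 x) \<partial>M))"
      using comb_inner[OF one L2(2), of z] by (simp add: \<zeta>_def del: sum.lessThan_Suc)
    also have "\<dots> = (\<Sum>b<Suc n. if b = 0 then cnj (z b) * of_real d else 0)"
      by (intro sum.cong refl) (subst sf0, auto)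
    also have "\<dots> = cnj (z 0) * of_real d" by (simp add: sum.delta del: sum.lessThan_Suc)
    finally have "cmod (z 0) * d = cmod (\<integral>x. 1 * \<zeta> x * cnj (f0 x) \<partial>M)"
      using d(2) by (simp add: norm_mult)
    also have "\<dots> \<le> nz * n0" using cs[OF one L2(3,2)] by (simp add: nz_def n0_def)
    finally show ?thesis .
  qed
  also have "\<dots> \<le> \<delta> / (1 - \<delta>) * cmod e * n0 * n0" using nz' nn by (intro mult_right_mono) auto
  also have "\<dots> = (\<delta> / (1 - \<delta>) * cmod e * d') * d" using n0 by (simp add: power2_eq_square mult_ac)
  finally have "cmod (z 0) * d \<le> (\<delta> / (1 - \<delta>) * cmod e * d') * d" .
  then have "cmod (z 0) \<le> \<delta> / (1 - \<delta>) * cmod e * d'" using d(2) by (rule mult_right_le_imp_le)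
  then have "cmod (z 0) / (d * d') \<le> \<delta> / (1 - \<delta>) * cmod e * d' / (d * d')"
    using d(2) d'(2) by (intro divide_right_mono) auto
  moreover have "cmod (z 0) / (d * d') = cmod (e' / d' - e / d)"
  proof -
    have "e' / d' - e / d = z 0 / of_real (d * d')"
      using d(2) d'(2) by (simp add: z_def y(1) u(1) field_simps)
    then show ?thesis using d(2) d'(2) by (simp add: norm_divide norm_mult)
  qed
  moreover have "\<delta> / (1 - \<delta>) * cmod e * d' / (d * d') = \<delta> / (1 - \<delta>) * cmod (e / d)"
    using d(2) d'(2) by (simp add: norm_divide)
  ultimately show ?thesis by simp
qed


context radial_weight begin

abbreviation "L \<equiv> lam \<phi>"

lemma L2fun_power: "L2fun L (\<lambda>z. z ^ i)"
  using integrable_cmod_power[of "i * 2"] by (simp add: L2fun_def norm_power power_mult[symmetric])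

lemma monomial_inner: "(\<integral>z. z ^ i * cnj (z ^ j) \<partial>L) = (if i = j then of_real (hh i) else 0)"
proof (cases "i = j")
  case True
  have "(\<integral>z. z ^ i * cnj (z ^ i) \<partial>L) = complex_of_real (\<integral>z. (cmod (z ^ i))\<^sup>2 \<partial>L)"
    by (rule integral_mult_cnj_self)
  also have "(\<integral>z. (cmod (z ^ i))\<^sup>2 \<partial>L) = hh i" by (simp add: hh_def norm_power power_mult[symmetric] mult.commute)
  finally show ?thesis using True by simp
next
  case False
  then show ?thesis using integral_monomials_eq_0[of i j "\<lambda>_. 1"] by simp
qed

end

text \<open>The lower index j makes this a flag: for \<open>newton \<alpha>\<close> with distinct
  nodes, the span from j on consists of the polynomials of degree below N that vanish at the first j
  nodes.\<close>

definition lspan :: "(nat \<Rightarrow> 'x \<Rightarrow> complex) \<Rightarrow> nat \<Rightarrow> nat \<Rightarrow> ('x \<Rightarrow> complex) set" where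
  "lspan s j N = {f. \<exists>y. f = (\<lambda>x. \<Sum>i\<in>{j..<N}. y i * s i x)}"

lemma lspan_sum: "(\<lambda>x. \<Sum>i\<in>{j..<N}. y i * s i x) \<in> lspan s j N"
  by (auto simp: lspan_def)

lemma lspanI: "f = (\<lambda>x. \<Sum>i\<in>{j..<N}. y i * s i x) \<Longrightarrow> f \<in> lspan s j N"
  by (auto simp: lspan_def)

lemma lspan_lin:
  assumes "f \<in> lspan s j N" "g \<in> lspan s j N"
  shows "(\<lambda>x. f x + c * g x) \<in> lspan s j N"
proof -
  obtain y z where "f = (\<lambda>x. \<Sum>i\<in>{j..<N}. y i * s i x)" "g = (\<lambda>x. \<Sum>i\<in>{j..<N}. z i * s i x)"
    using assms by (auto simp: lspan_def)
  then have "(\<lambda>x. f x + c * g x) = (\<lambda>x. \<Sum>i\<in>{j..<N}. (y i + c * z i) * s i x)"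
    by (simp add: fun_eq_iff sum.distrib sum_distrib_left algebra_simps)
  then show ?thesis by (simp add: lspan_sum)
qed

lemma lspan_base:
  assumes "j \<le> i" "i < N"
  shows "s i \<in> lspan s j N"
proof -
  have "s i = (\<lambda>x. \<Sum>k\<in>{j..<N}. (if k = i then 1 else 0) * s k x)"
    using assms by (simp add: fun_eq_iff if_distrib[of "\<lambda>c. c * _"] sum.delta cong: if_cong)
  then show ?thesis by (rule lspanI)
qed

lemma lspan_sum_mem:
  assumes "finite I" "\<And>i. i \<in> I \<Longrightarrow> f i \<in> lspan s j N"
  shows "(\<lambda>x. \<Sum>i\<in>I. c i * f i x) \<in> lspan s j N"
  using assms
proof (induction I rule: finite_induct)
  case empty
  show ?case using lspan_sum[where y = "\<lambda>_. 0" and s = s and j = j and N = N] by simp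
next
  case (insert i I)
  then have "(\<lambda>x. (\<Sum>i\<in>I. c i * f i x) + c i * f i x) \<in> lspan s j N" by (intro lspan_lin) auto
  then show ?case using insert by (simp add: add.commute)
qed

lemma lspan_L2:
  assumes "\<And>i. L2fun M (s i)" "f \<in> lspan s j N"
  shows "L2fun M f"
  using assms(2) L2fun_sum[of "{j..<N}" M s, OF assms(1)] by (auto simp: lspan_def)

definition newton :: "(nat \<Rightarrow> complex) \<Rightarrow> nat \<Rightarrow> complex \<Rightarrow> complex" where
  "newton \<alpha> i x = (\<Prod>a<i. x - \<alpha> a)"

lemma newton_eq_0: "a < i \<Longrightarrow> newton \<alpha> i (\<alpha> a) = 0"
  by (auto simp: newton_def)

lemma newton_nonzero:
  assumes "inj_on \<alpha> {..<l}" "j < l"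
  shows "newton \<alpha> j (\<alpha> j) \<noteq> 0"
proof
  assume "newton \<alpha> j (\<alpha> j) = 0"
  then obtain a where "a < j" "\<alpha> j = \<alpha> a" by (auto simp: newton_def)
  then show False using inj_onD[OF assms(1), of j a] assms(2) by simp
qed

text \<open>Multiplication by x - \<open>\<alpha> i\<close> on coefficient sequences. The resulting
  matrix is unitriangular, so Gram determinants agree in the Newton and in the monomial
  basis.\<close>

fun newton_coeff :: "(nat \<Rightarrow> complex) \<Rightarrow> nat \<Rightarrow> nat \<Rightarrow> complex" where
  "newton_coeff \<alpha> 0 k = (if k = 0 then 1 else 0)"
| "newton_coeff \<alpha> (Suc i) k = (case k of 0 \<Rightarrow> 0 | Suc k' \<Rightarrow> newton_coeff \<alpha> i k') - \<alpha> i * newton_coeff \<alpha> i k"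

lemma newton_coeff_0: "i < k \<Longrightarrow> newton_coeff \<alpha> i k = 0"
  by (induction i arbitrary: k) (auto split: nat.split)

lemma newton_coeff_1: "newton_coeff \<alpha> i i = 1"
  by (induction i) (auto simp: newton_coeff_0)

lemma newton_expand: "i < N \<Longrightarrow> newton \<alpha> i x = (\<Sum>k<N. newton_coeff \<alpha> i k * x ^ k)"
proof (induction i arbitrary: N)
  case 0
  then have "(\<Sum>k<N. newton_coeff \<alpha> 0 k * x ^ k) = (\<Sum>k<N. if k = 0 then 1 else 0)"
    by (intro sum.cong) auto
  then show ?case using 0 by (simp add: newton_def sum.delta)
next
  case (Suc i)
  then obtain N' where N: "N = Suc N'" and i: "i < N'" by (cases N) auto
  have "newton \<alpha> (Suc i) x = x * newton \<alpha> i x - \<alpha> i * newton \<alpha> i x"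
    by (simp add: newton_def algebra_simps)
  also have "x * newton \<alpha> i x = (\<Sum>k<N. (case k of 0 \<Rightarrow> 0 | Suc k' \<Rightarrow> newton_coeff \<alpha> i k') * x ^ k)"
    unfolding Suc.IH[OF i] N sum.lessThan_Suc_shift by (simp add: sum_distrib_left mult_ac)
  also have "newton \<alpha> i x = (\<Sum>k<N. newton_coeff \<alpha> i k * x ^ k)"
    using Suc.IH[of N] Suc.prems by simp
  finally show ?case
    by (simp add: sum_distrib_left sum_subtractf[symmetric] algebra_simps)
qed

lemma dt_newton_coeff: "dt N (newton_coeff \<alpha>) = 1"
  by (subst dt_lower_triangular) (auto simp: newton_coeff_0 newton_coeff_1)

lemma lspan_newton_eq: "lspan (newton \<alpha>) 0 N = lspan (\<lambda>i x. x ^ i) 0 N"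
proof (intro equalityI subsetI)
  fix f assume "f \<in> lspan (newton \<alpha>) 0 N"
  then obtain y where f: "f = (\<lambda>x. \<Sum>i\<in>{0..<N}. y i * newton \<alpha> i x)" by (auto simp: lspan_def)
  show "f \<in> lspan (\<lambda>i x. x ^ i) 0 N"
    unfolding f
  proof (rule lspan_sum_mem)
    fix i assume "i \<in> {0..<N}"
    then have "newton \<alpha> i = (\<lambda>x. \<Sum>k\<in>{0..<N}. newton_coeff \<alpha> i k * x ^ k)"
      by (auto simp: newton_expand[of i N] atLeast0LessThan)
    then show "newton \<alpha> i \<in> lspan (\<lambda>i x. x ^ i) 0 N" by (rule lspanI)
  qed simp
next
  fix f :: "complex \<Rightarrow> complex" assume "f \<in> lspan (\<lambda>i x. x ^ i) 0 N"
  then obtain y where f: "f = (\<lambda>x. \<Sum>i\<in>{0..<N}. y i * x ^ i)" by (auto simp: lspan_def)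
  have "dt N (newton_coeff \<alpha>) \<noteq> 0" by (simp add: dt_newton_coeff)
  then obtain X where X: "\<And>i j. i < N \<Longrightarrow> j < N \<Longrightarrow> (\<Sum>k<N. X i k * newton_coeff \<alpha> k j) = (if i = j then 1 else 0)"
    by (rule dt_inverse) blast
  show "f \<in> lspan (newton \<alpha>) 0 N"
    unfolding f
  proof (rule lspan_sum_mem)
    fix i assume i: "i \<in> {0..<N}"
    have "(\<Sum>k\<in>{0..<N}. X i k * newton \<alpha> k x) = x ^ i" for x
    proof -
      have "(\<Sum>k\<in>{0..<N}. X i k * newton \<alpha> k x) = (\<Sum>k<N. \<Sum>j<N. X i k * newton_coeff \<alpha> k j * x ^ j)"
        unfolding atLeast0LessThan by (intro sum.cong refl) (auto simp: newton_expand[of _ N] sum_distrib_left mult_ac)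
      also have "\<dots> = (\<Sum>j<N. (\<Sum>k<N. X i k * newton_coeff \<alpha> k j) * x ^ j)"
        unfolding sum_distrib_right by (rule sum.swap)
      also have "\<dots> = (\<Sum>j<N. if j = i then x ^ j else 0)"
        using i by (intro sum.cong refl) (auto simp: X)
      finally show ?thesis using i by (simp add: sum.delta)
    qed
    then have "(\<lambda>x. x ^ i) = (\<lambda>x. \<Sum>k\<in>{0..<N}. X i k * newton \<alpha> k x)" by simp
    then show "(\<lambda>x. x ^ i) \<in> lspan (newton \<alpha>) 0 N" by (rule lspanI)
  qed simp
qed

context radial_weight begin

definition "KN N x y = (\<Sum>i<N. (x * cnj y) ^ i / of_real (hh i))"

lemma rkernel_KN: "rkernel L (lspan (\<lambda>i x. x ^ i) 0 N) (KN N)"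
  unfolding rkernel_def
proof (intro conjI ballI allI)
  fix f :: "complex \<Rightarrow> complex" assume f: "f \<in> lspan (\<lambda>i x. x ^ i) 0 N"
  show "L2fun L f" by (rule lspan_L2[OF L2fun_power f])
  show "(\<lambda>x. f x + c * g x) \<in> lspan (\<lambda>i x. x ^ i) 0 N" if "g \<in> lspan (\<lambda>i x. x ^ i) 0 N" for g c
    using f that by (rule lspan_lin)
  fix y
  obtain u where u: "f = (\<lambda>x. \<Sum>i\<in>{0..<N}. u i * x ^ i)" using f by (auto simp: lspan_def)
  have int: "integrable L (\<lambda>x. x ^ i * cnj (x ^ j))" for i j
    by (intro L2fun_integrable_inner L2fun_power)
  have "f x * cnj (KN N x y) = (\<Sum>i<N. \<Sum>j<N. (u i * y ^ j / of_real (hh j)) * (x ^ i * cnj (x ^ j)))" for x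
    unfolding u KN_def atLeast0LessThan cnj_sum sum_product
    by (intro sum.cong refl) (simp add: power_mult_distrib mult_ac)
  then have "(\<integral>x. f x * cnj (KN N x y) \<partial>L) =
      (\<Sum>i<N. \<Sum>j<N. (u i * y ^ j / of_real (hh j)) * (\<integral>x. x ^ i * cnj (x ^ j) \<partial>L))"
    using int by (simp add: Bochner_Integration.integral_sum Bochner_Integration.integrable_sum integrable_mult_right
        del: complex_cnj_power)
  also have "\<dots> = (\<Sum>i<N. \<Sum>j<N. if j = i then u i * y ^ i else 0)"
    unfolding monomial_inner using hh_pos by (intro sum.cong refl) (auto simp: less_imp_neq[symmetric])
  also have "\<dots> = f y" by (simp add: u atLeast0LessThan sum.delta)
  finally show "f y = (\<integral>x. f x * cnj (KN N x y) \<partial>L)" ..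
next
  fix y
  have "(\<lambda>x. KN N x y) = (\<lambda>x. \<Sum>i\<in>{0..<N}. (cnj y ^ i / of_real (hh i)) * x ^ i)"
    by (simp add: KN_def fun_eq_iff atLeast0LessThan power_mult_distrib mult_ac)
  then show "(\<lambda>x. KN N x y) \<in> lspan (\<lambda>i x. x ^ i) 0 N" by (rule lspanI)
qed

lemma L2fun_newton: "L2fun L (newton \<alpha> i)"
proof -
  have "newton \<alpha> i \<in> lspan (\<lambda>i x. x ^ i) 0 (Suc i)"
    unfolding lspan_newton_eq[of \<alpha>, symmetric] by (rule lspan_base) auto
  then show ?thesis by (rule lspan_L2[OF L2fun_power])
qed

lemma palm_kernel_cong: "(\<And>i. i < j \<Longrightarrow> \<alpha> i = \<beta> i) \<Longrightarrow> palm_kernel K \<alpha> j = palm_kernel K \<beta> j"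
  by (induction j) auto

text \<open>Each Palm step passes to the functions that vanish at one more node, and in the Newton
  basis these are the span without its first function.\<close>

lemma rkernel_palm:
  assumes "inj_on \<alpha> {..<l}" "j \<le> l" "j \<le> N"
  shows "rkernel L (lspan (newton \<alpha>) j N) (palm_kernel (KN N) \<alpha> j)"
  using assms(2,3)
proof (induction j)
  case 0
  then show ?case using rkernel_KN by (simp add: lspan_newton_eq)
next
  case (Suc j)
  then have rk: "rkernel L (lspan (newton \<alpha>) j N) (palm_kernel (KN N) \<alpha> j)" by simp
  have nz: "newton \<alpha> j (\<alpha> j) \<noteq> 0"
    using assms(1) Suc.prems by (intro newton_nonzero) auto
  have mem: "newton \<alpha> j \<in> lspan (newton \<alpha>) j N" using Suc.prems by (intro lspan_base) auto
  have split: "(\<Sum>i\<in>{j..<N}. y i * newton \<alpha> i x) = y j * newton \<alpha> j x + (\<Sum>i\<in>{Suc j..<N}. y i * newton \<alpha> i x)" for y x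
    using Suc.prems by (subst sum.atLeast_Suc_lessThan) auto
  have ev: "(\<Sum>i\<in>{Suc j..<N}. y i * newton \<alpha> i (\<alpha> j)) = 0" for y
    by (intro sum.neutral) (auto simp: newton_eq_0)
  have "{f \<in> lspan (newton \<alpha>) j N. f (\<alpha> j) = 0} = lspan (newton \<alpha>) (Suc j) N"
  proof (intro equalityI subsetI)
    fix f assume "f \<in> {f \<in> lspan (newton \<alpha>) j N. f (\<alpha> j) = 0}"
    then obtain y where f: "f = (\<lambda>x. \<Sum>i\<in>{j..<N}. y i * newton \<alpha> i x)" "f (\<alpha> j) = 0"
      by (auto simp: lspan_def)
    then have "y j = 0" using nz by (simp add: split ev)
    then have "f = (\<lambda>x. \<Sum>i\<in>{Suc j..<N}. y i * newton \<alpha> i x)" unfolding f(1) split by simp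
    then show "f \<in> lspan (newton \<alpha>) (Suc j) N" by (rule lspanI)
  next
    fix f assume "f \<in> lspan (newton \<alpha>) (Suc j) N"
    then obtain y where f: "f = (\<lambda>x. \<Sum>i\<in>{Suc j..<N}. y i * newton \<alpha> i x)" by (auto simp: lspan_def)
    have "f = (\<lambda>x. \<Sum>i\<in>{j..<N}. (y(j := 0)) i * newton \<alpha> i x)" unfolding f split by simp
    then have "f \<in> lspan (newton \<alpha>) j N" by (rule lspanI)
    then show "f \<in> {f \<in> lspan (newton \<alpha>) j N. f (\<alpha> j) = 0}" by (simp add: f ev)
  qed
  then show ?case using rk_palm[OF rk mem nz] by simp
qed

lemma palm_diag_pos:
  assumes "inj_on \<alpha> {..<l}" "j < l" "j < N"
  shows "0 < Re (palm_kernel (KN N) \<alpha> j (\<alpha> j) (\<alpha> j))"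
proof -
  have "rkernel L (lspan (newton \<alpha>) j N) (palm_kernel (KN N) \<alpha> j)"
    using assms by (intro rkernel_palm) auto
  moreover have "newton \<alpha> j \<in> lspan (newton \<alpha>) j N" using assms by (intro lspan_base) auto
  ultimately show ?thesis using newton_nonzero[OF assms(1,2)] by (rule rk_diag_nonzero)
qed

end

lemma kernel_det_eq_dt: "kernel_det K k x = dt k (\<lambda>i j. K (x i) (x j))"
  by (simp add: kernel_det_def dt_def)

text \<open>Schur complements taken one after another: a chain rule for Palm kernels.\<close>

lemma kernel_det_palm_product:
  assumes "\<And>j. j < l \<Longrightarrow> palm_kernel K p j (p j) (p j) \<noteq> 0"
  shows "kernel_det K l p = (\<Prod>j<l. palm_kernel K p j (p j) (p j))"
proof -
  have "j \<le> l \<Longrightarrow> kernel_det K l p = (\<Prod>i<j. palm_kernel K p i (p i) (p i)) *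
      dt (l - j) (\<lambda>a b. palm_kernel K p j (p (j + a)) (p (j + b)))" for j
  proof (induction j)
    case 0
    show ?case by (simp add: kernel_det_eq_dt)
  next
    case (Suc j)
    then have l: "l - j = Suc (l - Suc j)" by simp
    have "dt (l - j) (\<lambda>a b. palm_kernel K p j (p (j + a)) (p (j + b))) =
      palm_kernel K p j (p j) (p j) * dt (l - Suc j) (\<lambda>a b. palm_kernel K p (Suc j) (p (Suc j + a)) (p (Suc j + b)))"
      unfolding l using assms[of j] Suc.prems by (subst dt_schur_complement) auto
    then show ?case using Suc by simp
  qed
  from this[of l] show ?thesis by simp
qed

section \<open>The power series of the reproducing kernel\<close>

context radial_weight begin

text \<open>Termwise integration under a majorant in product form: \<open>B\<close> carries the
  growth in x and \<open>b\<close> the decay in k.\<close>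

lemma integral_power_series_radial:
  fixes u :: "real \<Rightarrow> complex" and g :: "complex \<Rightarrow> complex" and T :: "nat \<Rightarrow> complex \<Rightarrow> complex"
  assumes [measurable]: "\<And>k. T k \<in> borel_measurable borel"
    and sums: "\<And>x. (\<lambda>k. T k x) sums g x"
    and dom: "\<And>k x. cmod (T k x) \<le> b k * B x" "summable b" "integrable L B" "\<And>k. 0 \<le> b k"
  shows "(\<lambda>k. \<integral>x. T k x \<partial>L) sums (\<integral>x. g x \<partial>L)"
proof -
  have int: "integrable L (T k)" for k
  proof (rule Bochner_Integration.integrable_bound)
    show "integrable L (\<lambda>x. b k * B x)" using dom(3) by simp
    show "AE x in L. norm (T k x) \<le> norm (b k * B x)"
      using dom(1) by (intro AE_I2) (auto intro: order_trans[OF dom(1)])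
  qed simp
  have "(\<lambda>k. \<integral>x. T k x \<partial>L) sums (\<integral>x. (\<Sum>k. T k x) \<partial>L)"
  proof (rule sums_integral[OF int])
    show "AE x in L. summable (\<lambda>k. norm (T k x))"
    proof (intro AE_I2)
      fix x
      have "summable (\<lambda>k. b k * B x)" using dom(2) by (rule summable_mult2)
      then show "summable (\<lambda>k. norm (T k x))"
        by (rule summable_comparison_test'[of _ 0]) (use dom(1) in auto)
    qed
    show "summable (\<lambda>k. \<integral>x. norm (T k x) \<partial>L)"
    proof (rule summable_comparison_test'[of _ 0])
      show "summable (\<lambda>k. b k * (\<integral>x. B x \<partial>L))" using dom(2) by (rule summable_mult2)
      fix k
      have "(\<integral>x. norm (T k x) \<partial>L) \<le> (\<integral>x. b k * B x \<partial>L)"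
        using dom(1,3) int by (intro integral_mono) auto
      then show "norm (\<integral>x. norm (T k x) \<partial>L) \<le> b k * (\<integral>x. B x \<partial>L)" by simp
    qed
  qed
  moreover have "(\<Sum>k. T k x) = g x" for x using sums by (rule sums_unique[symmetric])
  ultimately show ?thesis by simp
qed

text \<open>Pairing the kernel function with a monomial determines its Taylor coefficients. The
  Taylor series is integrated term by term on discs, where it is dominated, and all terms but one
  vanish by rotation; then the radius tends to infinity. This is where completeness of the monomials
  is established.\<close>

lemma kernel_series:
  assumes K: "is_reproducing_kernel \<phi> K"
  shows "(\<lambda>i. (z * cnj w) ^ i / of_real (hh i)) sums K z w"
proof -
  define f where "f z = K z w" for z
  have fock: "f \<in> fock_space \<phi>" using K by (simp add: is_reproducing_kernel_def f_def[abs_def])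
  then have hol: "f holomorphic_on UNIV" and int: "integrable L (\<lambda>z. (cmod (f z))\<^sup>2)"
    by (auto simp: fock_space_def)
  have cont: "continuous_on UNIV f" using hol by (rule holomorphic_on_imp_continuous_on)
  then have [measurable]: "f \<in> borel_measurable borel" by (rule borel_measurable_continuous_onI)
  have L2: "L2fun L f" using int by (simp add: L2fun_def)
  define a where "a n = (deriv ^^ n) f 0 / fact n" for n
  have series: "(\<lambda>n. a n * z ^ n) sums f z" for z
    using holomorphic_power_series[of f 0 "cmod z + 1" z] hol
    by (auto simp: a_def intro: holomorphic_on_subset)
  \<comment> \<open>Convergence at the larger radius R + 1 gives absolute convergence at R.\<close>
  have abs: "summable (\<lambda>n. cmod (a n) * R ^ n)" if "0 \<le> R" for R
  proof -
    have "summable (\<lambda>n. a n * (of_real (R + 1)) ^ n)" using series by (auto simp: sums_iff)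
    then have "summable (\<lambda>n. norm (a n * (of_real R) ^ n))"
      by (rule powser_insidea) (use that in auto)
    then show ?thesis using that by (simp add: norm_mult norm_power)
  qed
  have coeff: "a n * of_real (hh n) = cnj w ^ n" for n
  proof -
    have pow: "(\<lambda>z. z ^ n) \<in> fock_space \<phi>"
      using L2fun_power[of n] by (auto simp: fock_space_def L2fun_def intro!: holomorphic_intros)
    have "w ^ n = (\<integral>z. z ^ n * cnj (f z) \<partial>L)"
      using bspec[OF conjunct2[OF K[unfolded is_reproducing_kernel_def]] pow] unfolding f_def by (rule spec)
    also have "\<dots> = cnj (\<integral>z. f z * cnj (z ^ n) \<partial>L)"
      by (subst Bochner_Integration.integral_cnj[symmetric]) (simp add: mult.commute)
    finally have 1: "(\<integral>z. f z * cnj (z ^ n) \<partial>L) = cnj w ^ n" by (metis complex_cnj_cnj complex_cnj_power)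
    have trunc: "(\<integral>z. indicator {..R} (cmod z) * (f z * cnj (z ^ n)) \<partial>L) =
        a n * of_real (\<integral>z. indicator {..R} (cmod z) * cmod z ^ (2 * n) \<partial>L)" if R: "0 \<le> R" for R
    proof -
      define T where "T k z = (indicator {..R} (cmod z) * a k) * (z ^ k * cnj z ^ n)" for k z
      have "(\<lambda>k. \<integral>x. T k x \<partial>L) sums (\<integral>z. indicator {..R} (cmod z) * (f z * cnj (z ^ n)) \<partial>L)"
      proof (rule integral_power_series_radial)
        show "T k \<in> borel_measurable borel" for k unfolding T_def by measurable
        show "(\<lambda>k. T k x) sums (indicator {..R} (cmod x) * (f x * cnj (x ^ n)))" for x
          using sums_mult[OF series[of x], of "indicator {..R} (cmod x) * cnj x ^ n"]
          by (simp add: T_def mult_ac)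
        show "cmod (T k x) \<le> (cmod (a k) * R ^ k) * cmod x ^ n" for k x
        proof (cases "cmod x \<le> R")
          case True
          then have "cmod (a k) * cmod x ^ k * cmod x ^ n \<le> (cmod (a k) * R ^ k) * cmod x ^ n"
            by (intro mult_right_mono mult_left_mono power_mono) auto
          then show ?thesis using True by (simp add: T_def norm_mult norm_power mult_ac)
        qed (use R in \<open>simp add: T_def\<close>)
        show "summable (\<lambda>k. cmod (a k) * R ^ k)" by (rule abs[OF R])
        show "integrable L (\<lambda>x. cmod x ^ n)" by (rule integrable_cmod_power)
      qed (use R in simp)
      moreover have "(\<integral>x. T k x \<partial>L) = 0" if "k \<notin> {n}" for k
        unfolding T_def using that by (intro integral_monomials_eq_0[where u = "\<lambda>r. indicator {..R} r * a k"]) auto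
      then have "(\<lambda>k. \<integral>x. T k x \<partial>L) sums (\<Sum>k\<in>{n}. \<integral>x. T k x \<partial>L)"
        by (intro sums_finite) auto
      ultimately have "(\<integral>z. indicator {..R} (cmod z) * (f z * cnj (z ^ n)) \<partial>L) = (\<integral>x. T n x \<partial>L)"
        using sums_unique2 by fastforce
      also have "\<dots> = (\<integral>x. a n * of_real (indicator {..R} (cmod x) * cmod x ^ (2 * n)) \<partial>L)"
      proof (intro Bochner_Integration.integral_cong refl)
        fix x
        have "x ^ n * cnj x ^ n = (x * cnj x) ^ n" by (simp only: power_mult_distrib)
        also have "\<dots> = of_real ((cmod x)\<^sup>2) ^ n" unfolding complex_norm_square ..
        also have "\<dots> = of_real (cmod x ^ (2 * n))" by (simp only: power_mult of_real_power)
        finally show "T n x = a n * of_real (indicator {..R} (cmod x) * cmod x ^ (2 * n))"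
          by (simp add: T_def indicator_def)
      qed
      also have "\<dots> = a n * of_real (\<integral>z. indicator {..R} (cmod z) * cmod z ^ (2 * n) \<partial>L)"
        by (simp only: integral_mult_right_zero integral_complex_of_real)
      finally show ?thesis .
    qed
    have lim1: "((\<lambda>j. \<integral>z. indicator {..real j} (cmod z) * (f z * cnj (z ^ n)) \<partial>L) \<longlonglongrightarrow> (\<integral>z. f z * cnj (z ^ n) \<partial>L))"
    proof (rule integral_dominated_convergence)
      show "integrable L (\<lambda>z. cmod (f z * cnj (z ^ n)))"
        using L2fun_integrable_inner[OF L2 L2fun_power] by (rule integrable_norm)
      show "AE x in L. (\<lambda>j. indicator {..real j} (cmod x) * (f x * cnj (x ^ n))) \<longlonglongrightarrow> f x * cnj (x ^ n)"
      proof (intro AE_I2 tendsto_eventually)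
        fix x
        show "eventually (\<lambda>j. indicator {..real j} (cmod x) * (f x * cnj (x ^ n)) = f x * cnj (x ^ n)) sequentially"
          using eventually_ge_at_top[of "nat \<lceil>cmod x\<rceil>"] by eventually_elim (auto simp: indicator_def)
      qed
    qed (auto simp: indicator_def)
    have lim2: "((\<lambda>j. \<integral>z. indicator {..real j} (cmod z) * cmod z ^ (2 * n) \<partial>L) \<longlonglongrightarrow> hh n)"
      unfolding hh_def
    proof (rule integral_dominated_convergence)
      show "AE x in L. (\<lambda>j. indicator {..real j} (cmod x) * cmod x ^ (2 * n)) \<longlonglongrightarrow> cmod x ^ (2 * n)"
      proof (intro AE_I2 tendsto_eventually)
        fix x :: complex
        show "eventually (\<lambda>j. indicator {..real j} (cmod x) * cmod x ^ (2 * n) = cmod x ^ (2 * n)) sequentially"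
          using eventually_ge_at_top[of "nat \<lceil>cmod x\<rceil>"] by eventually_elim (auto simp: indicator_def)
      qed
      show "integrable L (\<lambda>x. cmod x ^ (2 * n))" by (rule integrable_cmod_power)
    qed (auto simp: indicator_def)
    have "(\<lambda>j. \<integral>z. indicator {..real j} (cmod z) * (f z * cnj (z ^ n)) \<partial>L) \<longlonglongrightarrow> a n * of_real (hh n)"
      unfolding trunc[OF of_nat_0_le_iff] by (intro tendsto_intros lim2)
    then show ?thesis using LIMSEQ_unique[OF lim1] 1 by simp
  qed
  have "a n * z ^ n = (z * cnj w) ^ n / of_real (hh n)" for n
  proof -
    have "a n = cnj w ^ n / of_real (hh n)" using coeff[of n] hh_pos[of n] by (simp add: eq_divide_eq)
    then show ?thesis by (simp add: power_mult_distrib mult_ac)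
  qed
  then show ?thesis using series[of z] by (simp add: f_def)
qed

lemma KN_tendsto:
  assumes "is_reproducing_kernel \<phi> K"
  shows "(\<lambda>N. KN N z w) \<longlonglongrightarrow> K z w"
  using kernel_series[OF assms, of z w] by (simp add: sums_def KN_def)

text \<open>On the diagonal the series has nonnegative terms that increase with |z|, so its partial
  sums have a bound on discs that is uniform in N.\<close>

lemma KN_diag_le:
  assumes K: "is_reproducing_kernel \<phi> K" and z: "cmod z \<le> r"
  shows "Re (KN N z z) \<le> Re (K (of_real r) (of_real r))"
proof -
  have r: "0 \<le> r" using z norm_ge_zero order_trans by blast
  have s: "(\<lambda>i. r ^ (2 * i) / hh i) sums Re (K (of_real r) (of_real r))"
    using sums_Re[OF kernel_series[OF K, of "of_real r" "of_real r"]]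
    by (simp add: power_mult power2_eq_square flip: of_real_mult of_real_power of_real_divide)
  have "Re (KN N z z) = (\<Sum>i<N. cmod z ^ (2 * i) / hh i)"
    by (simp add: KN_def power_mult complex_norm_square[symmetric] Re_sum flip: of_real_power of_real_divide)
  also have "\<dots> \<le> (\<Sum>i<N. r ^ (2 * i) / hh i)"
    using z hh_pos by (intro sum_mono divide_right_mono power_mono) (auto intro: less_imp_le)
  also have "\<dots> \<le> Re (K (of_real r) (of_real r))"
    unfolding sums_unique[OF s]
    using sums_summable[OF s] r hh_pos by (intro sum_le_suminf) (auto simp: less_imp_le divide_nonneg_pos)
  finally show ?thesis .
qed

end

section \<open>Weights analytic at infinity\<close>

lemma four_point_parseval:
  fixes a b c d :: complex
  shows "(cmod (a + b + c + d))\<^sup>2 + (cmod (a + \<i> * b - c - \<i> * d))\<^sup>2 + (cmod (a - b + c - d))\<^sup>2 +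
     (cmod (a - \<i> * b - c + \<i> * d))\<^sup>2 = 4 * ((cmod a)\<^sup>2 + (cmod b)\<^sup>2 + (cmod c)\<^sup>2 + (cmod d)\<^sup>2)"
  by (simp add: cmod_power2) (simp add: power2_eq_square algebra_simps)

text \<open>Averaging over four rotations removes all mixed terms of the Taylor polynomial of degree
  3, so the linear term leaves only its square. The error of order |u|^4 is small enough to be
  summed over all large indices.\<close>

lemma four_point_average_bound:
  assumes S: "S holomorphic_on ball 0 \<rho>" "S 0 = 1" and u0: "0 < u0" "u0 < \<rho>"
  obtains C where "0 \<le> C" "\<And>u. cmod u \<le> u0 \<Longrightarrow>
    (\<Sum>k<4. (cmod (S (\<i> ^ k * u)))\<^sup>2) / 4 \<le> 1 + (cmod (deriv S 0))\<^sup>2 * (cmod u)\<^sup>2 + C * (cmod u) ^ 4"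
proof -
  define a where "a n = (deriv ^^ n) S 0 / fact n" for n
  have series: "(\<lambda>n. a n * u ^ n) sums S u" if "cmod u < \<rho>" for u
    using holomorphic_power_series[OF S(1), of u] that by (simp add: a_def)
  have a0: "a 0 = 1" and a1: "a 1 = deriv S 0" using S(2) by (simp_all add: a_def)
  have abs: "summable (\<lambda>n. cmod (a n) * u0 ^ n)"
  proof -
    obtain r where r: "u0 < r" "r < \<rho>" using dense u0(2) by blast
    have "summable (\<lambda>n. a n * of_real r ^ n)" using series[of "of_real r"] r u0 by (auto simp: sums_iff)
    then have "summable (\<lambda>n. norm (a n * of_real u0 ^ n))" by (rule powser_insidea) (use r u0 in auto)
    then show ?thesis using u0 by (simp add: norm_mult norm_power)
  qed
  \<comment> \<open>\<open>C1\<close> bounds the Taylor remainder from order 4 on.\<close>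
  define C1 where "C1 = (\<Sum>n. cmod (a (n + 4)) * u0 ^ n)"
  have abs4: "summable (\<lambda>n. cmod (a (n + 4)) * u0 ^ n)"
  proof -
    have "summable (\<lambda>n. (1 / u0 ^ 4) * (cmod (a (n + 4)) * u0 ^ (n + 4)))"
      using abs by (intro summable_mult) (simp add: summable_iff_shift[where f = "\<lambda>n. cmod (a n) * u0 ^ n"])
    then show ?thesis using u0 by (simp add: power_add field_simps)
  qed
  have C1: "0 \<le> C1" unfolding C1_def using abs4 u0 by (intro suminf_nonneg) auto
  define q where "q u = a 0 + a 1 * u + a 2 * u ^ 2 + a 3 * u ^ 3" for u
  have rem: "cmod (S u - q u) \<le> C1 * cmod u ^ 4" if u: "cmod u \<le> u0" for u
  proof -
    have su: "(\<lambda>n. a n * u ^ n) sums S u" using u u0 by (intro series) auto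
    have "(\<lambda>n. a (n + 4) * u ^ (n + 4)) sums (S u - (\<Sum>n<4. a n * u ^ n))"
      using sums_iff_shift'[of "\<lambda>n. a n * u ^ n" 4] su by (simp add: sums_split_initial_segment)
    moreover have "(\<Sum>n<4. a n * u ^ n) = q u" by (simp add: q_def eval_nat_numeral)
    ultimately have s4: "(\<lambda>n. a (n + 4) * u ^ (n + 4)) sums (S u - q u)" by simp
    have le: "cmod (a (n + 4) * u ^ (n + 4)) \<le> cmod u ^ 4 * (cmod (a (n + 4)) * u0 ^ n)" for n
    proof -
      have "cmod u ^ n \<le> u0 ^ n" using u by (intro power_mono) auto
      then have "cmod (a (n + 4)) * cmod u ^ 4 * cmod u ^ n \<le> cmod (a (n + 4)) * cmod u ^ 4 * u0 ^ n"
        by (intro mult_left_mono) auto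
      then show ?thesis by (simp add: norm_mult norm_power power_add mult_ac)
    qed
    have sm: "summable (\<lambda>n. cmod u ^ 4 * (cmod (a (n + 4)) * u0 ^ n))" using abs4 by (rule summable_mult)
    have sn: "summable (\<lambda>n. cmod (a (n + 4) * u ^ (n + 4)))"
      by (rule summable_comparison_test'[OF sm, of 0]) (use le in auto)
    have "cmod (S u - q u) \<le> (\<Sum>n. cmod (a (n + 4) * u ^ (n + 4)))"
      using s4 summable_norm[OF sn] by (simp add: sums_iff)
    also have "\<dots> \<le> (\<Sum>n. cmod u ^ 4 * (cmod (a (n + 4)) * u0 ^ n))"
      by (rule suminf_le[OF le sn sm])
    also have "\<dots> = cmod u ^ 4 * C1" unfolding C1_def using abs4 by (rule suminf_mult)
    finally show ?thesis by (simp add: mult.commute)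
  qed
  define B where "B = cmod (a 0) + cmod (a 1) * u0 + cmod (a 2) * u0 ^ 2 + cmod (a 3) * u0 ^ 3"
  have B: "cmod (q u) \<le> B" if "cmod u \<le> u0" for u
    unfolding q_def B_def
    by (intro norm_triangle_mono order_refl; simp add: norm_mult norm_power; intro mult_left_mono power_mono that) auto
  have B0: "0 \<le> B" unfolding B_def using u0 by simp
  \<comment> \<open>\<open>C2\<close> collects 2 |q| r + r^2 for a remainder r of at most C1
    |u|^4.\<close>
  define C2 where "C2 = 2 * B * C1 + C1\<^sup>2 * u0 ^ 4"
  have C2: "0 \<le> C2" using B0 C1 u0 by (simp add: C2_def)
  have pt: "(cmod (S u))\<^sup>2 \<le> (cmod (q u))\<^sup>2 + C2 * cmod u ^ 4" if u: "cmod u \<le> u0" for u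
  proof -
    define r where "r = cmod (S u - q u)"
    have r: "0 \<le> r" "r \<le> C1 * cmod u ^ 4" using rem[OF u] by (auto simp: r_def)
    have "cmod (S u) \<le> cmod (q u) + r" unfolding r_def by (metis norm_triangle_sub)
    then have "(cmod (S u))\<^sup>2 \<le> (cmod (q u) + r)\<^sup>2" by (intro power_mono) auto
    also have "\<dots> = (cmod (q u))\<^sup>2 + 2 * cmod (q u) * r + r * r" by (simp add: power2_eq_square algebra_simps)
    also have "2 * cmod (q u) * r \<le> 2 * B * (C1 * cmod u ^ 4)"
      using B[OF u] r B0 by (intro mult_mono) auto
    also have "r * r \<le> (C1 * cmod u ^ 4) * (C1 * u0 ^ 4)"
      using r u C1 by (intro mult_mono) (auto intro!: order_trans[OF r(2)] mult_left_mono power_mono)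
    finally show ?thesis by (simp add: C2_def power2_eq_square algebra_simps)
  qed
  define C where "C = (cmod (a 2))\<^sup>2 + (cmod (a 3))\<^sup>2 * u0\<^sup>2 + C2"
  show ?thesis
  proof (rule that[of C])
    show "0 \<le> C" using C2 by (simp add: C_def)
    fix u assume u: "cmod u \<le> u0"
    have cu: "cmod (\<i> ^ k * u) = cmod u" for k by (simp add: norm_mult norm_power)
    have i3: "\<i> ^ 3 = - \<i>" by (simp add: eval_nat_numeral)
    have "(\<Sum>k<4. (cmod (S (\<i> ^ k * u)))\<^sup>2) \<le> (\<Sum>k<4. (cmod (q (\<i> ^ k * u)))\<^sup>2 + C2 * cmod u ^ 4)"
      using pt u cu by (intro sum_mono) metis
    also have "\<dots> = (\<Sum>k<4. (cmod (q (\<i> ^ k * u)))\<^sup>2) + 4 * (C2 * cmod u ^ 4)"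
      by (simp add: sum.distrib)
    also have "(\<Sum>k<4. (cmod (q (\<i> ^ k * u)))\<^sup>2) =
        (cmod (a 0 + a 1 * u + a 2 * u ^ 2 + a 3 * u ^ 3))\<^sup>2 +
        (cmod (a 0 + \<i> * (a 1 * u) - a 2 * u ^ 2 - \<i> * (a 3 * u ^ 3)))\<^sup>2 +
        (cmod (a 0 - a 1 * u + a 2 * u ^ 2 - a 3 * u ^ 3))\<^sup>2 +
        (cmod (a 0 - \<i> * (a 1 * u) - a 2 * u ^ 2 + \<i> * (a 3 * u ^ 3)))\<^sup>2"
      by (simp add: q_def eval_nat_numeral algebra_simps)
    also have "\<dots> = 4 * ((cmod (a 0))\<^sup>2 + (cmod (a 1 * u))\<^sup>2 + (cmod (a 2 * u ^ 2))\<^sup>2 + (cmod (a 3 * u ^ 3))\<^sup>2)"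
      by (rule four_point_parseval)
    finally have "(\<Sum>k<4. (cmod (S (\<i> ^ k * u)))\<^sup>2) / 4 \<le>
        (cmod (a 0))\<^sup>2 + (cmod (a 1 * u))\<^sup>2 + (cmod (a 2 * u ^ 2))\<^sup>2 + (cmod (a 3 * u ^ 3))\<^sup>2 + C2 * cmod u ^ 4"
      by simp
    also have "(cmod (a 3 * u ^ 3))\<^sup>2 \<le> (cmod (a 3))\<^sup>2 * u0\<^sup>2 * cmod u ^ 4"
    proof -
      have "(cmod (a 3 * u ^ 3))\<^sup>2 = (cmod (a 3))\<^sup>2 * (cmod u)\<^sup>2 * cmod u ^ 4"
        by (simp add: norm_mult norm_power power_mult_distrib eval_nat_numeral)
      also have "\<dots> \<le> (cmod (a 3))\<^sup>2 * u0\<^sup>2 * cmod u ^ 4"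
        using u by (intro mult_right_mono mult_left_mono power_mono) auto
      finally show ?thesis .
    qed
    also have "(cmod (a 2 * u ^ 2))\<^sup>2 = (cmod (a 2))\<^sup>2 * cmod u ^ 4"
      by (simp add: norm_mult norm_power power_mult_distrib flip: power_mult)
    finally show "(\<Sum>k<4. (cmod (S (\<i> ^ k * u)))\<^sup>2) / 4 \<le> 1 + (cmod (deriv S 0))\<^sup>2 * (cmod u)\<^sup>2 + C * (cmod u) ^ 4"
      unfolding a1[symmetric] by (simp add: a0 C_def norm_mult power_mult_distrib algebra_simps)
  qed
qed

section \<open>Counting and summing over ranges of indices\<close>

lemma card_nat_real_interval_le:
  fixes a b :: real
  assumes "a \<le> b"
  shows "real (card {i::nat. i < N \<and> a < real i \<and> real i \<le> b}) \<le> b - a + 1"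
proof -
  have "int ` {i::nat. i < N \<and> a < real i \<and> real i \<le> b} \<subseteq> {\<lfloor>a\<rfloor> + 1..\<lfloor>b\<rfloor>}"
    by (auto simp: le_floor_iff floor_less_iff; linarith)
  then have "card (int ` {i::nat. i < N \<and> a < real i \<and> real i \<le> b}) \<le> card {\<lfloor>a\<rfloor> + 1..\<lfloor>b\<rfloor>}"
    by (intro card_mono) auto
  then have "card {i::nat. i < N \<and> a < real i \<and> real i \<le> b} \<le> nat (\<lfloor>b\<rfloor> - \<lfloor>a\<rfloor>)"
    by (simp add: card_image)
  then have "real (card {i::nat. i < N \<and> a < real i \<and> real i \<le> b}) \<le> real (nat (\<lfloor>b\<rfloor> - \<lfloor>a\<rfloor>))" by simp
  also have "\<dots> = of_int (\<lfloor>b\<rfloor> - \<lfloor>a\<rfloor>)" using floor_mono[OF assms] by simp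
  also have "\<dots> \<le> b - a + 1" by linarith
  finally show ?thesis .
qed

text \<open>Compare with the telescoping differences 1 / (t - 1) - 1 / t at t = i - a.\<close>

lemma sum_inverse_squares_le:
  fixes a b :: real
  assumes "1 < b"
  shows "(\<Sum>i | i < N \<and> a + b < real i. 1 / (real i - a)\<^sup>2) \<le> 1 / (b - 1)"
proof -
  \<comment> \<open>\<open>g\<close> stays at b - 1 until summands occur and then follows N - 1 - a,
    so that the strengthened bound telescopes.\<close>
  define g where "g N = max (b - 1) (real N - 1 - a)" for N
  have gpos: "0 < g N" for N using assms by (simp add: g_def less_max_iff_disj)
  have "(\<Sum>i | i < N \<and> a + b < real i. 1 / (real i - a)\<^sup>2) \<le> 1 / (b - 1) - 1 / g N"
  proof (induction N)
    case 0
    show ?case using frac_le[of 1 1 "b - 1" "g 0"] assms by (simp add: g_def)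
  next
    case (Suc N)
    show ?case
    proof (cases "a + b < real N")
      case True
      then have "{i. i < Suc N \<and> a + b < real i} = insert N {i. i < N \<and> a + b < real i}" by auto
      then have "(\<Sum>i | i < Suc N \<and> a + b < real i. 1 / (real i - a)\<^sup>2) =
          1 / (real N - a)\<^sup>2 + (\<Sum>i | i < N \<and> a + b < real i. 1 / (real i - a)\<^sup>2)" by simp
      moreover have "1 / (real N - a)\<^sup>2 \<le> 1 / g N - 1 / g (Suc N)"
      proof -
        have g: "g N = real N - a - 1" "g (Suc N) = real N - a" using True by (auto simp: g_def)
        define t where "t = real N - a"
        have t: "1 < t" using True assms by (simp add: t_def)
        have "1 / t\<^sup>2 \<le> 1 / (t - 1) - 1 / t"
          using t by (simp add: field_simps power2_eq_square)
        then show ?thesis unfolding g by (simp add: t_def)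
      qed
      ultimately show ?thesis using Suc by simp
    next
      case False
      then have "{i. i < Suc N \<and> a + b < real i} = {i. i < N \<and> a + b < real i}"
        by (auto simp: less_Suc_eq)
      moreover have "1 / g (Suc N) \<le> 1 / g N" by (intro divide_left_mono mult_pos_pos gpos) (auto simp: g_def)
      ultimately show ?thesis using Suc by simp
    qed
  qed
  also have "\<dots> \<le> 1 / (b - 1)" using gpos[of N] by simp
  finally show ?thesis .
qed


lemma holomorphic_linear_bound:
  assumes S: "S holomorphic_on ball 0 \<rho>" and u0: "0 < u0" "u0 < \<rho>"
  obtains B where "0 \<le> B" "\<And>u. cmod u \<le> u0 \<Longrightarrow> cmod (S u - S 0) \<le> B * cmod u"
proof -
  have "continuous_on (cball 0 u0) (deriv S)"
    using S u0 by (intro holomorphic_on_imp_continuous_on holomorphic_on_subset[OF holomorphic_deriv[OF S]]) auto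
  then have "bounded (deriv S ` cball 0 u0)"
    by (intro compact_imp_bounded compact_continuous_image) auto
  then obtain B where B: "0 < B" "\<And>u. u \<in> cball 0 u0 \<Longrightarrow> cmod (deriv S u) \<le> B"
    unfolding bounded_pos by blast
  have "cmod (S u - S 0) \<le> B * cmod (u - 0)" if "cmod u \<le> u0" for u
  proof (rule field_differentiable_bound)
    show "convex (cball (0::complex) u0)" by simp
    show "(S has_field_derivative deriv S z) (at z within cball 0 u0)" if "z \<in> cball 0 u0" for z
    proof (rule has_field_derivative_at_within)
      show "(S has_field_derivative deriv S z) (at z)"
        by (rule holomorphic_derivI[OF S]) (use that u0 in auto)
    qed
    show "cmod (deriv S z) \<le> B" if "z \<in> cball 0 u0" for z using B(2)[OF that] .
    show "u \<in> cball 0 u0" "0 \<in> cball 0 u0" using that u0 by auto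
  qed
  then show ?thesis using that[of B] B(1) by simp
qed

section \<open>The weights w_R in the monomial basis\<close>

context radial_weight begin

text \<open>In the coordinate 1/x at infinity \<open>S\<close> is holomorphic near 0. It will be the
  reciprocal of h, so that h times \<open>wS\<close> is h inside the disc and 1 outside.\<close>

definition wS :: "(complex \<Rightarrow> complex) \<Rightarrow> real \<Rightarrow> complex \<Rightarrow> complex" where
  "wS S R x = (if cmod x \<le> R then 1 else S (1 / x))"

context
  fixes S :: "complex \<Rightarrow> complex" and \<rho> :: real
  assumes S: "S holomorphic_on ball 0 \<rho>" "S 0 = 1" and \<rho>: "0 < \<rho>"
begin

lemma wS_eq_indicator: "wS S R x = indicator {x. cmod x \<le> R} x + indicator {x. R < cmod x} x *\<^sub>R S (1 / x)"
  by (simp add: wS_def)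

lemma measurable_S_outside:
  assumes "0 < R" "1 / R < \<rho>"
  shows "(\<lambda>x. indicator {x. R < cmod x} x *\<^sub>R S (1 / x)) \<in> borel_measurable borel"
proof (rule borel_measurable_continuous_on_indicator)
  show "{x. R < cmod x} \<in> sets borel" by (intro borel_open open_Collect_less continuous_intros)
  have "1 / cmod x < \<rho>" if "R < cmod x" for x
    using frac_le[of 1 1 R "cmod x"] that assms by simp
  then show "continuous_on {x. R < cmod x} (\<lambda>x. S (1 / x))"
    using assms(1)
    by (intro continuous_on_compose2[OF holomorphic_on_imp_continuous_on[OF S(1)]] continuous_intros)
      (auto simp: norm_divide)
qed

lemma measurable_wS:
  assumes "0 < R" "1 / R < \<rho>"
  shows "wS S R \<in> borel_measurable borel"
  unfolding wS_eq_indicator[abs_def]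
  by (intro borel_measurable_add measurable_S_outside assms borel_measurable_indicator borel_closed closed_Collect_le continuous_intros)

lemma series_S: "cmod u < \<rho> \<Longrightarrow> (\<lambda>n. (deriv ^^ n) S 0 / fact n * u ^ n) sums S u"
  using holomorphic_power_series[OF S(1), of u] by simp

text \<open>Outside the disc w - 1 is a series in x^(-n) = cnj x^n / |x|^(2n) with n >= 1. This only
  raises the power of cnj x, so for i <= j the two powers never balance and rotation kills every
  term.\<close>

lemma wS_integral_eq:
  assumes R: "0 < R" "1 / R < \<rho>" and "i \<le> j"
  shows "(\<integral>x. (wS S R x - 1) * (x ^ i * cnj (x ^ j)) \<partial>L) = 0"
proof -
  define a where "a n = (deriv ^^ n) S 0 / fact n" for n
  have a0: "a 0 = 1" using S(2) by (simp add: a_def)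
  have series: "(\<lambda>n. a n * u ^ n) sums S u" if "cmod u < \<rho>" for u
    using series_S[OF that] by (simp add: a_def)
  \<comment> \<open>The radial factor takes up the inverse powers of |x|, so that only nonnegative
    powers of x and cnj x remain.\<close>
  define T where "T k x = (indicator {R<..} (cmod x) * (a (Suc k) * of_real (1 / cmod x ^ (2 * Suc k)))) * (x ^ i * cnj x ^ (j + Suc k))" for k x
  have T: "T k x = indicator {R<..} (cmod x) * (a (Suc k) * (1 / x) ^ Suc k * (x ^ i * cnj (x ^ j)))" for k x
  proof (cases "R < cmod x")
    case True
    then have "x \<noteq> 0" using R(1) by auto
    have e: "complex_of_real (1 / cmod x ^ (2 * Suc k)) * cnj x ^ Suc k = (1 / x) ^ Suc k"
    proof -
      have "complex_of_real (cmod x ^ (2 * Suc k)) = of_real ((cmod x)\<^sup>2) ^ Suc k"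
        by (simp only: power_mult of_real_power)
      also have "\<dots> = (x * cnj x) ^ Suc k" unfolding complex_norm_square ..
      finally have "complex_of_real (cmod x ^ (2 * Suc k)) = (x * cnj x) ^ Suc k" .
      then show ?thesis using \<open>x \<noteq> 0\<close> by (simp add: power_mult_distrib power_divide)
    qed
    have "T k x = indicator {R<..} (cmod x) * (a (Suc k) *
        (complex_of_real (1 / cmod x ^ (2 * Suc k)) * cnj x ^ Suc k) * (x ^ i * cnj (x ^ j)))"
      unfolding T_def power_add complex_cnj_power by (simp only: mult_ac)
    then show ?thesis unfolding e .
  qed (simp add: T_def)
  have "(\<lambda>k. \<integral>x. T k x \<partial>L) sums (\<integral>x. (wS S R x - 1) * (x ^ i * cnj (x ^ j)) \<partial>L)"
  proof (rule integral_power_series_radial)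
    show "T k \<in> borel_measurable borel" for k unfolding T_def by measurable
    show "(\<lambda>k. T k x) sums ((wS S R x - 1) * (x ^ i * cnj (x ^ j)))" for x
    proof (cases "R < cmod x")
      case True
      then have "1 / cmod x < \<rho>" using frac_le[of 1 1 R "cmod x"] R by simp
      then have "(\<lambda>n. a n * (1 / x) ^ n) sums S (1 / x)" by (intro series) (simp add: norm_divide)
      then have "(\<lambda>n. a (Suc n) * (1 / x) ^ Suc n) sums (S (1 / x) - 1)"
        by (subst sums_Suc_iff) (simp add: a0)
      from sums_mult2[OF this, of "x ^ i * cnj (x ^ j)"] show ?thesis
        using True by (simp add: T wS_def)
    qed (simp add: T wS_def)
    show "cmod (T k x) \<le> (cmod (a (Suc k)) * (1 / R) ^ Suc k) * cmod x ^ (i + j)" for k x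
    proof (cases "R < cmod x")
      case True
      have "0 < cmod x" using True R(1) by linarith
      then have "1 / cmod x \<le> 1 / R" using R True by (intro divide_left_mono mult_pos_pos) auto
      then have "cmod (a (Suc k)) * (1 / cmod x) ^ Suc k * cmod x ^ (i + j) \<le> (cmod (a (Suc k)) * (1 / R) ^ Suc k) * cmod x ^ (i + j)"
        by (intro mult_right_mono mult_left_mono power_mono) auto
      then show ?thesis using True by (simp add: T norm_mult norm_power norm_divide power_add mult_ac)
    qed (use R in \<open>simp add: T\<close>)
    show "summable (\<lambda>k. cmod (a (Suc k)) * (1 / R) ^ Suc k)"
    proof -
      obtain r where r: "1 / R < r" "r < \<rho>" using dense R(2) by blast
      have r0: "0 < r" using r less_trans[of 0 "1 / R" r] R(1) by simp
      have "summable (\<lambda>n. a n * of_real r ^ n)" using series[of "of_real r"] r r0 by (auto simp: sums_iff)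
      then have "summable (\<lambda>n. norm (a n * of_real (1 / R) ^ n))" by (rule powser_insidea) (use r r0 R in \<open>auto simp: norm_divide\<close>)
      then have "summable (\<lambda>n. cmod (a n) * (1 / R) ^ n)" using R by (simp add: norm_mult norm_power norm_divide)
      then show ?thesis by (subst summable_Suc_iff)
    qed
    show "integrable L (\<lambda>x. cmod x ^ (i + j))" by (rule integrable_cmod_power)
  qed (use R in simp)
  moreover have "(\<integral>x. T k x \<partial>L) = 0" for k
    unfolding T_def using assms(3)
    by (intro integral_monomials_eq_0[where u = "\<lambda>r. indicator {R<..} r * (a (Suc k) * of_real (1 / r ^ (2 * Suc k)))"]) auto
  ultimately show ?thesis by (simp add: sums_iff)
qed

text \<open>S(u) - 1 is of order |u|, and |u| < 1 / R outside the disc; one constant serves all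
  radii.\<close>

lemma wS_bound:
  assumes u0: "0 < u0" "u0 < \<rho>"
  obtains B where "0 \<le> B" "\<And>R x. 1 / u0 \<le> R \<Longrightarrow> cmod (wS S R x - 1) \<le> B / R"
proof -
  obtain B where B: "0 \<le> B" "\<And>u. cmod u \<le> u0 \<Longrightarrow> cmod (S u - S 0) \<le> B * cmod u"
    using holomorphic_linear_bound[OF S(1) u0] by blast
  show ?thesis
  proof (rule that[OF B(1)])
    fix R x assume R: "1 / u0 \<le> R"
    have Rp: "0 < R" using R u0 less_le_trans[of 0 "1 / u0" R] by simp
    show "cmod (wS S R x - 1) \<le> B / R"
    proof (cases "cmod x \<le> R")
      case False
      then have "cmod (1 / x) \<le> 1 / R" using Rp by (simp add: norm_divide divide_left_mono frac_le)
      moreover have "1 / R \<le> u0" using R u0 Rp by (simp add: field_simps)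
      ultimately have "cmod (S (1 / x) - S 0) \<le> B * (1 / R)"
        using B(2)[of "1 / x"] mult_left_mono[OF _ B(1), of "cmod (1 / x)" "1 / R"] by linarith
      then show ?thesis using False S(2) by (simp add: wS_def)
    qed (use B(1) Rp in \<open>simp add: wS_def\<close>)
  qed
qed

text \<open>On and above the diagonal the entries are those of the constant weight 1, so
  triangularity gives the same determinant. Divided by the product of the \<open>hh i\<close> it is
  the mean of the product of w over N points, which is therefore 1.\<close>

lemma dt_wS:
  assumes R: "0 < R" "1 / R < \<rho>"
  shows "dt N (\<lambda>i j. \<integral>x. wS S R x * x ^ i * cnj (x ^ j) \<partial>L) = of_real (\<Prod>i<N. hh i)"
proof -
  obtain r where r: "1 / R < r" "r < \<rho>" using dense R(2) by blast
  have r0: "0 < r" using r less_trans[of 0 "1 / R" r] R(1) by simp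
  have rR: "1 / r \<le> R" using r(1) r0 R(1) by (simp add: field_simps)
  obtain B where B: "\<And>x. cmod (wS S R x - 1) \<le> B / R"
    using wS_bound[OF r0 r(2)] rR by metis
  have m: "(\<lambda>x. wS S R x - 1) \<in> borel_measurable L" using measurable_wS[OF R] by simp
  have int: "integrable L (\<lambda>x. (wS S R x - 1) * x ^ i * cnj (x ^ j))" "integrable L (\<lambda>x. x ^ i * cnj (x ^ j))" for i j
    by (rule L2fun_integrable_mult[OF L2fun_power L2fun_power m B] L2fun_integrable_inner[OF L2fun_power L2fun_power])+
  have e: "(\<integral>x. wS S R x * x ^ i * cnj (x ^ j) \<partial>L) = (if i = j then of_real (hh i) else 0)" if "i \<le> j" for i j
  proof -
    have "(\<integral>x. wS S R x * x ^ i * cnj (x ^ j) \<partial>L) =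
      (\<integral>x. (wS S R x - 1) * x ^ i * cnj (x ^ j) + x ^ i * cnj (x ^ j) \<partial>L)"
      by (intro Bochner_Integration.integral_cong refl) (simp add: algebra_simps)
    also have "\<dots> = (\<integral>x. (wS S R x - 1) * x ^ i * cnj (x ^ j) \<partial>L) + (\<integral>x. x ^ i * cnj (x ^ j) \<partial>L)"
      by (rule Bochner_Integration.integral_add[OF int])
    also have "(\<integral>x. (wS S R x - 1) * x ^ i * cnj (x ^ j) \<partial>L) = 0"
      using wS_integral_eq[OF R that] by (simp only: mult.assoc)
    finally show ?thesis unfolding monomial_inner by simp
  qed
  show ?thesis using e by (subst dt_lower_triangular) (simp_all del: complex_cnj_power)
qed

end

end

section \<open>Gram determinants of almost constant weights\<close>

lemma gram_psd:
  assumes "\<And>i. L2fun M (f i)"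
  shows "psd n (\<lambda>i j. \<integral>x. f i x * cnj (f j x) \<partial>M)"
  unfolding psd_def
proof (intro conjI allI impI)
  fix i j
  show "(\<integral>x. f j x * cnj (f i x) \<partial>M) = cnj (\<integral>x. f i x * cnj (f j x) \<partial>M)"
    by (subst Bochner_Integration.integral_cnj[symmetric]) (simp add: mult.commute)
next
  fix y :: "nat \<Rightarrow> complex"
  have int: "integrable M (\<lambda>x. f i x * cnj (f j x))" for i j by (intro L2fun_integrable_inner assms)
  have "(\<Sum>i<n. \<Sum>j<n. y i * (\<integral>x. f i x * cnj (f j x) \<partial>M) * cnj (y j)) =
      (\<integral>x. (\<Sum>i<n. \<Sum>j<n. y i * (f i x * cnj (f j x)) * cnj (y j)) \<partial>M)"
    using int by (simp add: Bochner_Integration.integral_sum Bochner_Integration.integrable_sum)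
  also have "\<dots> = (\<integral>x. (\<Sum>i<n. y i * f i x) * cnj (\<Sum>i<n. y i * f i x) \<partial>M)"
    by (intro Bochner_Integration.integral_cong refl) (simp add: sum_product mult_ac)
  also have "\<dots> = complex_of_real (\<integral>x. (cmod (\<Sum>i<n. y i * f i x))\<^sup>2 \<partial>M)"
    by (rule integral_mult_cnj_self)
  finally show "0 \<le> Re (\<Sum>i<n. \<Sum>j<n. y i * (\<integral>x. f i x * cnj (f j x) \<partial>M) * cnj (y j))" by simp
qed

lemma dt_congruence:
  fixes L W :: "nat \<Rightarrow> nat \<Rightarrow> complex"
  shows "dt N (\<lambda>i j. \<Sum>k<N. \<Sum>l<N. L i k * W k l * cnj (L j l)) = dt N L * dt N W * cnj (dt N L)"
proof -
  have "dt N (\<lambda>i j. \<Sum>k<N. \<Sum>l<N. L i k * W k l * cnj (L j l)) =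
     dt N (\<lambda>i j. \<Sum>k<N. L i k * (\<Sum>l<N. W k l * cnj (L j l)))"
    by (simp add: sum_distrib_left mult.assoc)
  also have "\<dots> = dt N L * dt N (\<lambda>k j. \<Sum>l<N. W k l * cnj (L j l))" by (rule dt_mult)
  also have "dt N (\<lambda>k j. \<Sum>l<N. W k l * cnj (L j l)) = dt N W * dt N (\<lambda>l j. cnj (L j l))" by (rule dt_mult)
  also have "dt N (\<lambda>l j. cnj (L j l)) = dt N (\<lambda>j l. cnj (L j l))" by (rule dt_transpose)
  finally show ?thesis by (simp add: dt_cnj mult.assoc)
qed

lemma inner_congruence:
  assumes "\<And>i. L2fun M (v i)"
  shows "(\<integral>x. (\<Sum>k<N. a k * v k x) * cnj (\<Sum>l<N. b l * v l x) \<partial>M) =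
     (\<Sum>k<N. \<Sum>l<N. a k * (\<integral>x. v k x * cnj (v l x) \<partial>M) * cnj (b l))"
proof -
  have int: "integrable M (\<lambda>x. v i x * cnj (v j x))" for i j by (intro L2fun_integrable_inner assms)
  have "(\<Sum>k<N. \<Sum>l<N. a k * (\<integral>x. v k x * cnj (v l x) \<partial>M) * cnj (b l)) =
      (\<integral>x. (\<Sum>k<N. \<Sum>l<N. a k * (v k x * cnj (v l x)) * cnj (b l)) \<partial>M)"
    using int by (simp add: Bochner_Integration.integral_sum Bochner_Integration.integrable_sum)
  also have "\<dots> = (\<integral>x. (\<Sum>k<N. a k * v k x) * cnj (\<Sum>l<N. b l * v l x) \<partial>M)"
    by (intro Bochner_Integration.integral_cong refl) (simp add: sum_product mult_ac)
  finally show ?thesis ..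
qed

context radial_weight begin

section \<open>Concentration of the monomials in the radius\<close>

lemma measurable_indicator_cmod [measurable]:
  "(\<lambda>x. indicator {R<..} (cmod x) :: real) \<in> borel_measurable borel"
  "(\<lambda>x. indicator {..R} (cmod x) :: real) \<in> borel_measurable borel" by measurable

lemma integrable_indicator_power:
  "integrable L (\<lambda>x. indicator {R<..} (cmod x) * cmod x ^ k)"
  "integrable L (\<lambda>x. indicator {..R} (cmod x) * cmod x ^ k)"
  by (rule Bochner_Integration.integrable_bound[OF integrable_cmod_power[of k]]; auto simp: indicator_def)+

definition "outer_mom R i = (\<integral>x. indicator {R<..} (cmod x) * cmod x ^ (2 * i) \<partial>L)"
definition "inner_mom R i = (\<integral>x. indicator {..R} (cmod x) * cmod x ^ (2 * i) \<partial>L)"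

lemma outer_mom_nonneg: "0 \<le> outer_mom R i" and inner_mom_nonneg: "0 \<le> inner_mom R i"
  by (simp_all add: outer_mom_def inner_mom_def)

lemma inner_mom_plus_outer_mom: "inner_mom R i + outer_mom R i = hh i"
proof -
  have "inner_mom R i + outer_mom R i = (\<integral>x. indicator {..R} (cmod x) * cmod x ^ (2 * i) + indicator {R<..} (cmod x) * cmod x ^ (2 * i) \<partial>L)"
    unfolding outer_mom_def inner_mom_def by (rule Bochner_Integration.integral_add[OF integrable_indicator_power(2,1), symmetric])
  also have "\<dots> = hh i" unfolding hh_def
    by (intro Bochner_Integration.integral_cong refl) (auto simp: indicator_def)
  finally show ?thesis .
qed

lemma variance_le: "(\<integral>z. (XX (cmod z) - (real n + 1))\<^sup>2 * cmod z ^ (2 * n) \<partial>lam \<phi>) \<le> M / m * (real n + 1) * hh n"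
proof -
  have "M / 2 * hh (Suc n) \<le> M / 2 * (2 / m * (real n + 1) * hh n)"
    using M_pos by (intro mult_left_mono hh_Suc_le) auto
  also have "\<dots> = M / m * (real n + 1) * hh n"
  proof -
    have "M / 2 * (2 / m * y) = M / m * y" for y by simp
    then show ?thesis by (simp only: mult.assoc)
  qed
  finally show ?thesis using XX_variance[of n] by linarith
qed

text \<open>\<open>XX\<close> is increasing, so outside the disc it exceeds its mean i + 1 by at
  least XX R - (i + 1); the variance bound then acts as in Chebyshev's inequality.\<close>

lemma chebyshev_tail:
  assumes "0 \<le> R" "real i + 1 < XX R"
  shows "outer_mom R i \<le> M / m * (real i + 1) / (XX R - (real i + 1))\<^sup>2 * hh i"
proof -
  define D where "D = XX R - (real i + 1)"
  have D: "0 < D" using assms by (simp add: D_def)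
  have "D\<^sup>2 * outer_mom R i = (\<integral>x. D\<^sup>2 * (indicator {R<..} (cmod x) * cmod x ^ (2 * i)) \<partial>L)"
    by (simp add: outer_mom_def)
  also have "\<dots> \<le> (\<integral>z. (XX (cmod z) - (real i + 1))\<^sup>2 * cmod z ^ (2 * i) \<partial>L)"
  proof (intro integral_mono integrable_mult_right integrable_indicator_power integrable_XX_sq)
    fix x
    show "D\<^sup>2 * (indicator {R<..} (cmod x) * cmod x ^ (2 * i)) \<le> (XX (cmod x) - (real i + 1))\<^sup>2 * cmod x ^ (2 * i)"
    proof (cases "R < cmod x")
      case True
      then have "XX R \<le> XX (cmod x)" using assms by (intro XX_mono) auto
      then have "D\<^sup>2 \<le> (XX (cmod x) - (real i + 1))\<^sup>2" using D by (intro power_mono) (auto simp: D_def)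
      then show ?thesis using True by (simp add: mult_right_mono)
    qed simp
  qed
  also have "\<dots> \<le> M / m * (real i + 1) * hh i" by (rule variance_le)
  finally have le: "D\<^sup>2 * outer_mom R i \<le> M / m * (real i + 1) * hh i" .
  have "outer_mom R i \<le> M / m * (real i + 1) * hh i / D\<^sup>2"
    using le D by (intro iffD2[OF pos_le_divide_eq]) (simp_all only: mult.commute zero_less_power)
  then show ?thesis unfolding D_def[symmetric] by (simp only: times_divide_eq_left)
qed

text \<open>The mirror image for indices whose mean i + 1 lies beyond \<open>XX R\<close>.\<close>

lemma chebyshev_low:
  assumes "0 \<le> R" "XX R < real i + 1"
  shows "inner_mom R i \<le> M / m * (real i + 1) / (real i + 1 - XX R)\<^sup>2 * hh i"
proof -
  define D where "D = real i + 1 - XX R"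
  have D: "0 < D" using assms by (simp add: D_def)
  have "D\<^sup>2 * inner_mom R i = (\<integral>x. D\<^sup>2 * (indicator {..R} (cmod x) * cmod x ^ (2 * i)) \<partial>L)"
    by (simp add: inner_mom_def)
  also have "\<dots> \<le> (\<integral>z. (XX (cmod z) - (real i + 1))\<^sup>2 * cmod z ^ (2 * i) \<partial>L)"
  proof (intro integral_mono integrable_mult_right integrable_indicator_power integrable_XX_sq)
    fix x
    show "D\<^sup>2 * (indicator {..R} (cmod x) * cmod x ^ (2 * i)) \<le> (XX (cmod x) - (real i + 1))\<^sup>2 * cmod x ^ (2 * i)"
    proof (cases "cmod x \<le> R")
      case True
      then have "XX (cmod x) \<le> XX R" by (intro XX_mono) auto
      then have "D\<^sup>2 \<le> (real i + 1 - XX (cmod x))\<^sup>2" using D by (intro power_mono) (auto simp: D_def)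
      then show ?thesis using True by (simp add: mult_right_mono power2_commute)
    qed simp
  qed
  also have "\<dots> \<le> M / m * (real i + 1) * hh i" by (rule variance_le)
  finally have le: "D\<^sup>2 * inner_mom R i \<le> M / m * (real i + 1) * hh i" .
  have "inner_mom R i \<le> M / m * (real i + 1) * hh i / D\<^sup>2"
    using le D by (intro iffD2[OF pos_le_divide_eq]) (simp_all only: mult.commute zero_less_power)
  then show ?thesis unfolding D_def[symmetric] by (simp only: times_divide_eq_left)
qed

lemma hh_pred_le:
  assumes "1 \<le> i"
  shows "hh (i - 1) \<le> M / (2 * real i) * hh i"
proof -
  have "2 / M * real i * hh (i - 1) \<le> hh i" using hh_Suc_ge[of "i - 1"] assms by (simp add: of_nat_diff)
  then show ?thesis using assms M_pos by (simp add: field_simps)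
qed

text \<open>Both denominators are weakened to i - 1, which gives the inverse square that is summed
  later.\<close>

lemma hh_pred2_le:
  assumes "2 \<le> i"
  shows "hh (i - 2) \<le> M\<^sup>2 / 4 * (1 / (real i - 1)\<^sup>2) * hh i"
proof -
  have i: "1 \<le> i - 1" "1 \<le> i" "i - 1 - 1 = i - 2" "real (i - 1) = real i - 1" using assms by (auto simp: of_nat_diff)
  have "hh (i - 2) \<le> M / (2 * (real i - 1)) * hh (i - 1)"
    using hh_pred_le[OF i(1)] unfolding i(3,4) .
  also have "\<dots> \<le> M / (2 * (real i - 1)) * (M / (2 * real i) * hh i)"
    using M_pos assms by (intro mult_left_mono hh_pred_le) auto
  also have "\<dots> \<le> M / (2 * (real i - 1)) * (M / (2 * (real i - 1)) * hh i)"
    using M_pos assms hh_pos[of i] by (intro mult_left_mono mult_right_mono divide_left_mono) auto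
  also have "M / (2 * y) * (M / (2 * y) * hh i) = M\<^sup>2 / 4 * (1 / y\<^sup>2) * hh i" for y :: real
    by (simp add: power2_eq_square)
  finally show ?thesis .
qed

text \<open>Powers of -i are used because they become powers of i in the coordinate 1/x.\<close>

lemma integral_average_rotations:
  fixes F :: "complex \<Rightarrow> real"
  assumes [measurable]: "F \<in> borel_measurable borel" and int: "integrable L F"
  shows "(\<integral>x. F x \<partial>L) = (\<integral>x. (\<Sum>k<4. F ((- \<i>) ^ k * x)) / 4 \<partial>L)"
    and "integrable L (\<lambda>x. (\<Sum>k<4. F ((- \<i>) ^ k * x)) / 4)"
proof -
  have c: "cmod ((- \<i>) ^ k) = 1" for k by (simp add: norm_power)
  have i: "integrable L (\<lambda>x. F ((- \<i>) ^ k * x))" for k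
    using int by (subst integrable_rotation[OF c]) auto
  then show "integrable L (\<lambda>x. (\<Sum>k<4. F ((- \<i>) ^ k * x)) / 4)"
    by (intro integrable_divide_zero Bochner_Integration.integrable_sum)
  have "(\<integral>x. F ((- \<i>) ^ k * x) \<partial>L) = (\<integral>x. F x \<partial>L)" for k
    by (rule integral_rotation[OF c]) simp
  then show "(\<integral>x. F x \<partial>L) = (\<integral>x. (\<Sum>k<4. F ((- \<i>) ^ k * x)) / 4 \<partial>L)"
    using i by (simp add: Bochner_Integration.integral_sum)
qed

text \<open>Rotation invariance replaces |S|^2 by its mean over four rotations, whose excess over 1
  is bounded by \<open>g\<close>; the function \<open>h\<close> expresses that excess in terms of
  x.\<close>

lemma outer_integral_le:
  assumes S: "S holomorphic_on ball 0 \<rho>" "S 0 = 1" and u0: "0 < u0" "u0 < \<rho>" and R: "1 / u0 \<le> R"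
    and C: "\<And>u. cmod u \<le> u0 \<Longrightarrow> (\<Sum>k<4. (cmod (S (\<i> ^ k * u)))\<^sup>2) / 4 \<le> 1 + g (cmod u)"
    and g: "\<And>x. R < cmod x \<Longrightarrow> g (1 / cmod x) * cmod x ^ (2 * i) \<le> h x" and h: "integrable L (\<lambda>x. indicator {R<..} (cmod x) * h x)"
  shows "integrable L (\<lambda>x. indicator {R<..} (cmod x) * ((cmod (S (1 / x)))\<^sup>2 * cmod x ^ (2 * i)))"
    and "(\<integral>x. indicator {R<..} (cmod x) * ((cmod (S (1 / x)))\<^sup>2 * cmod x ^ (2 * i)) \<partial>L) \<le>
      outer_mom R i + (\<integral>x. indicator {R<..} (cmod x) * h x \<partial>L)"
proof -
  have \<rho>: "0 < \<rho>" using u0 by simp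
  have Rp: "0 < R" using R u0 less_le_trans[of 0 "1 / u0" R] by simp
  have Rr: "1 / R \<le> u0" using R Rp u0 by (simp add: field_simps)
  define F where "F x = indicator {R<..} (cmod x) * ((cmod (S (1 / x)))\<^sup>2 * cmod x ^ (2 * i))" for x
  have Fm [measurable]: "F \<in> borel_measurable borel"
  proof -
    have "(\<lambda>x. indicator {x. R < cmod x} x *\<^sub>R S (1 / x)) \<in> borel_measurable borel"
      using measurable_S_outside[OF S \<rho> Rp] Rr u0 by simp
    then have "(\<lambda>x. (cmod (indicator {x. R < cmod x} x *\<^sub>R S (1 / x)))\<^sup>2 * cmod x ^ (2 * i)) \<in> borel_measurable borel"
      by measurable
    moreover have "(cmod (indicator {x. R < cmod x} x *\<^sub>R S (1 / x)))\<^sup>2 * cmod x ^ (2 * i) = F x" for x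
      by (simp add: F_def indicator_def)
    ultimately show ?thesis by simp
  qed
  obtain B where B: "0 \<le> B" "\<And>x. cmod (wS S R x - 1) \<le> B / R"
    using wS_bound[OF S \<rho> u0] R by metis
  have int: "integrable L F"
  proof (rule Bochner_Integration.integrable_bound)
    show "integrable L (\<lambda>x. (1 + B / R)\<^sup>2 * cmod x ^ (2 * i))" by (intro integrable_mult_right integrable_cmod_power)
    show "AE x in L. norm (F x) \<le> norm ((1 + B / R)\<^sup>2 * cmod x ^ (2 * i))"
    proof (intro AE_I2)
      fix x
      show "norm (F x) \<le> norm ((1 + B / R)\<^sup>2 * cmod x ^ (2 * i))"
      proof (cases "R < cmod x")
        case True
        then have "cmod (S (1 / x) - 1) \<le> B / R" using B(2)[of x] by (simp add: wS_def)
        then have "cmod (S (1 / x)) \<le> 1 + B / R" using norm_triangle_ineq2[of "S (1 / x)" 1] by simp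
        then have "(cmod (S (1 / x)))\<^sup>2 \<le> (1 + B / R)\<^sup>2" by (intro power_mono) auto
        then show ?thesis using True by (simp add: F_def abs_mult mult_right_mono)
      qed (simp add: F_def)
    qed
  qed simp
  then show "integrable L (\<lambda>x. indicator {R<..} (cmod x) * ((cmod (S (1 / x)))\<^sup>2 * cmod x ^ (2 * i)))"
    by (simp add: F_def[abs_def])
  have pt: "(\<Sum>k<4. F ((- \<i>) ^ k * x)) / 4 \<le> indicator {R<..} (cmod x) * cmod x ^ (2 * i) + indicator {R<..} (cmod x) * h x" for x
  proof (cases "R < cmod x")
    case True
    have cx: "cmod ((- \<i>) ^ k * x) = cmod x" for k by (simp add: norm_mult norm_power)
    have inv: "1 / ((- \<i>) ^ k * x) = \<i> ^ k * (1 / x)" for k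
    proof -
      have "(- \<i>) ^ k * \<i> ^ k = 1" by (simp add: power_mult_distrib[symmetric])
      then have "1 / (- \<i>) ^ k = \<i> ^ k" by (metis nonzero_mult_div_cancel_left power_not_zero mult_zero_left zero_neq_one)
      then show ?thesis by (simp add: divide_simps)
    qed
    have "cmod (1 / x) \<le> 1 / R" using True Rp by (simp add: norm_divide frac_le)
    then have "cmod (1 / x) \<le> u0" using Rr by linarith
    from C[OF this] have c: "(\<Sum>k<4. (cmod (S (\<i> ^ k * (1 / x))))\<^sup>2) / 4 \<le> 1 + g (1 / cmod x)"
      by (simp add: norm_divide)
    have "(\<Sum>k<4. F ((- \<i>) ^ k * x)) / 4 = ((\<Sum>k<4. (cmod (S (\<i> ^ k * (1 / x))))\<^sup>2) / 4) * cmod x ^ (2 * i)"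
      unfolding F_def cx inv using True by (simp add: sum_distrib_right)
    also have "\<dots> \<le> (1 + g (1 / cmod x)) * cmod x ^ (2 * i)"
      using c by (intro mult_right_mono) auto
    also have "\<dots> \<le> cmod x ^ (2 * i) + h x" using g[OF True] by (simp add: algebra_simps)
    finally show ?thesis using True by simp
  qed (simp add: F_def norm_mult norm_power)
  have "(\<integral>x. F x \<partial>L) \<le> (\<integral>x. indicator {R<..} (cmod x) * cmod x ^ (2 * i) + indicator {R<..} (cmod x) * h x \<partial>L)"
    unfolding integral_average_rotations(1)[OF Fm int]
    using integral_average_rotations(2)[OF Fm int] h integrable_indicator_power pt
    by (intro integral_mono) auto
  also have "\<dots> = outer_mom R i + (\<integral>x. indicator {R<..} (cmod x) * h x \<partial>L)"
    unfolding outer_mom_def by (rule Bochner_Integration.integral_add[OF integrable_indicator_power(1) h])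
  finally show "(\<integral>x. indicator {R<..} (cmod x) * ((cmod (S (1 / x)))\<^sup>2 * cmod x ^ (2 * i)) \<partial>L) \<le>
      outer_mom R i + (\<integral>x. indicator {R<..} (cmod x) * h x \<partial>L)"
    unfolding F_def .
qed

text \<open>The mixed term of degrees i and i - 1 is odd, so averaging over x and -x removes
  it.\<close>

lemma inner_integral_eq:
  assumes "1 \<le> i"
  shows "(\<integral>x. indicator {..R} (cmod x) * (cmod (x ^ i - c * x ^ (i - 1)))\<^sup>2 \<partial>L) = inner_mom R i + (cmod c)\<^sup>2 * inner_mom R (i - 1)"
    and "integrable L (\<lambda>x. indicator {..R} (cmod x) * (cmod (x ^ i - c * x ^ (i - 1)))\<^sup>2)"
proof -
  define F where "F x = indicator {..R} (cmod x) * (cmod (x ^ i - c * x ^ (i - 1)))\<^sup>2" for x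
  have [measurable]: "F \<in> borel_measurable borel" unfolding F_def by measurable
  have int: "integrable L F"
  proof (rule Bochner_Integration.integrable_bound)
    have "L2fun L (\<lambda>x. x ^ i + (- c) * x ^ (i - 1))" by (intro L2fun_add_scaled L2fun_power)
    then show "integrable L (\<lambda>x. (cmod (x ^ i - c * x ^ (i - 1)))\<^sup>2)" by (simp add: L2fun_def)
  qed (auto simp: F_def indicator_def)
  then show "integrable L (\<lambda>x. indicator {..R} (cmod x) * (cmod (x ^ i - c * x ^ (i - 1)))\<^sup>2)"
    by (simp add: F_def[abs_def])
  have rot: "integrable L (\<lambda>x. F (- 1 * x))" "(\<integral>x. F (- 1 * x) \<partial>L) = (\<integral>x. F x \<partial>L)"
    using int integrable_rotation[of "-1" F] integral_rotation[of "-1" F] by auto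
  have pt: "F x + F (- 1 * x) = 2 * (indicator {..R} (cmod x) * cmod x ^ (2 * i)) + 2 * (cmod c)\<^sup>2 * (indicator {..R} (cmod x) * cmod x ^ (2 * (i - 1)))" for x
  proof -
    have "(- 1 * x) ^ i - c * (- 1 * x) ^ (i - 1) = (- 1) ^ i * (x ^ i + c * x ^ (i - 1))"
    proof -
      obtain n where i: "i = Suc n" using assms by (cases i) auto
      have e: "(- 1 * x) ^ k = (- 1) ^ k * x ^ k" for k by (rule power_mult_distrib)
      show ?thesis unfolding i e by (simp add: algebra_simps)
    qed
    then have "cmod ((- 1 * x) ^ i - c * (- 1 * x) ^ (i - 1)) = cmod (x ^ i + c * x ^ (i - 1))"
      by (simp add: norm_mult norm_power)
    moreover have "(cmod (a - b))\<^sup>2 + (cmod (a + b))\<^sup>2 = 2 * (cmod a)\<^sup>2 + 2 * (cmod b)\<^sup>2" for a b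
      by (simp add: cmod_power2) (simp add: power2_eq_square algebra_simps)
    from this[of "x ^ i" "c * x ^ (i - 1)"]
    have "(cmod (x ^ i - c * x ^ (i - 1)))\<^sup>2 + (cmod (x ^ i + c * x ^ (i - 1)))\<^sup>2 =
        2 * cmod x ^ (2 * i) + 2 * (cmod c)\<^sup>2 * cmod x ^ (2 * (i - 1))"
      by (simp add: norm_mult norm_power power_mult_distrib power_mult[symmetric] mult.commute)
    ultimately show ?thesis by (simp add: F_def indicator_def)
  qed
  have "2 * (\<integral>x. F x \<partial>L) = (\<integral>x. F x + F (- 1 * x) \<partial>L)"
    using int rot by (subst Bochner_Integration.integral_add) auto
  also have "\<dots> = 2 * inner_mom R i + 2 * (cmod c)\<^sup>2 * inner_mom R (i - 1)"
    unfolding pt inner_mom_def using integrable_indicator_power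
    by (subst Bochner_Integration.integral_add) auto
  finally show "(\<integral>x. indicator {..R} (cmod x) * (cmod (x ^ i - c * x ^ (i - 1)))\<^sup>2 \<partial>L) = inner_mom R i + (cmod c)\<^sup>2 * inner_mom R (i - 1)"
    unfolding F_def by simp
qed

end

lemma sum_if_le_card:
  fixes c :: real
  assumes "0 \<le> c" "a \<le> b"
  shows "(\<Sum>i<N. if a < real i \<and> real i \<le> b then c else 0) \<le> c * (b - a + 1)"
proof -
  have "(\<Sum>i<N. if a < real i \<and> real i \<le> b then c else 0) = (\<Sum>i\<in>{i\<in>{..<N}. a < real i \<and> real i \<le> b}. c)"
    by (subst sum.inter_filter) auto
  also have "\<dots> = c * real (card {i. i < N \<and> a < real i \<and> real i \<le> b})" by simp
  also have "\<dots> \<le> c * (b - a + 1)" by (intro mult_left_mono card_nat_real_interval_le assms)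
  finally show ?thesis .
qed

lemma sum_if_inverse_squares_le:
  fixes c :: real
  assumes "0 \<le> c" "1 < b"
  shows "(\<Sum>i<N. if a + b < real i then c * (1 / (real i - a)\<^sup>2) else 0) \<le> c * (1 / (b - 1))"
proof -
  have "(\<Sum>i<N. if a + b < real i then c * (1 / (real i - a)\<^sup>2) else 0) = (\<Sum>i\<in>{i\<in>{..<N}. a + b < real i}. c * (1 / (real i - a)\<^sup>2))"
    by (subst sum.inter_filter) auto
  also have "\<dots> = c * (\<Sum>i | i < N \<and> a + b < real i. 1 / (real i - a)\<^sup>2)"
    unfolding sum_distrib_left by simp
  also have "\<dots> \<le> c * (1 / (b - 1))" by (intro mult_left_mono sum_inverse_squares_le assms)
  finally show ?thesis .
qed

context radial_weight begin

context
  fixes S :: "complex \<Rightarrow> complex" and \<rho> :: real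
  assumes S: "S holomorphic_on ball 0 \<rho>" "S 0 = 1" and \<rho>: "0 < \<rho>"
begin

text \<open>The first bound serves while i is below the threshold, where the outer moment is mostly
  small. For the second, S(u) (1 - c u) has no linear term when c = S'(0), so outside the disc the
  excess has order |x|^(-4) and lowers the index by 2. The price is paid inside, where the
  correction c x^(i-1) meets no linear term of w to cancel.\<close>

lemma wS_norm_bounds:
  obtains K1 K2 where "0 \<le> K1" "0 \<le> K2"
   "\<And>R i. 2 / \<rho> \<le> R \<Longrightarrow> (\<integral>x. (cmod (wS S R x * x ^ i))\<^sup>2 \<partial>L) \<le> hh i + K1 / R\<^sup>2 * outer_mom R i"
   "\<And>R i. 2 / \<rho> \<le> R \<Longrightarrow> 2 \<le> i \<Longrightarrow> (\<integral>x. (cmod (wS S R x * x ^ i - deriv S 0 * (wS S R x * x ^ (i - 1))))\<^sup>2 \<partial>L) \<le>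
      hh i + (cmod (deriv S 0))\<^sup>2 * inner_mom R (i - 1) + K2 * hh (i - 2)"
proof -
  define c u0 where "c = deriv S 0" and "u0 = \<rho> / 2"
  have u0: "0 < u0" "u0 < \<rho>" using \<rho> by (auto simp: u0_def)
  \<comment> \<open>Outside the disc, w (x^i - c x^(i-1)) is T(1/x) x^i.\<close>
  define T where "T u = S u * (1 - c * u)" for u
  have T: "T holomorphic_on ball 0 \<rho>" "T 0 = 1"
    using S by (auto simp: T_def[abs_def] intro!: holomorphic_intros)
  have T': "deriv T 0 = 0"
  proof -
    have "(S has_field_derivative c) (at 0)" unfolding c_def by (rule holomorphic_derivI[OF S(1)]) (use \<rho> in auto)
    then have "(T has_field_derivative (c * (1 - c * 0) + (0 - c * 1) * S 0)) (at 0)"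
      unfolding T_def[abs_def] by (intro DERIV_mult DERIV_diff DERIV_cmult DERIV_ident DERIV_const)
    then show ?thesis using S(2) by (simp add: DERIV_imp_deriv)
  qed
  obtain C1 where C1: "0 \<le> C1" "\<And>u. cmod u \<le> u0 \<Longrightarrow>
    (\<Sum>k<4. (cmod (S (\<i> ^ k * u)))\<^sup>2) / 4 \<le> 1 + (cmod (deriv S 0))\<^sup>2 * (cmod u)\<^sup>2 + C1 * (cmod u) ^ 4"
    using four_point_average_bound[OF S u0] by blast
  obtain C2 where C2: "0 \<le> C2" "\<And>u. cmod u \<le> u0 \<Longrightarrow>
    (\<Sum>k<4. (cmod (T (\<i> ^ k * u)))\<^sup>2) / 4 \<le> 1 + (cmod (deriv T 0))\<^sup>2 * (cmod u)\<^sup>2 + C2 * (cmod u) ^ 4"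
    using four_point_average_bound[OF T u0] by blast
  \<comment> \<open>The term of order |u|^4 is absorbed into |u|^2 at the cost of u0^2.\<close>
  define K1 where "K1 = (cmod c)\<^sup>2 + C1 * u0\<^sup>2"
  have K1: "0 \<le> K1" using C1(1) by (simp add: K1_def)
  have rho2: "2 / \<rho> = 1 / u0" by (simp add: u0_def)
  show ?thesis
  proof (rule that[of K1 C2])
    fix R i assume "2 / \<rho> \<le> R"
    then have R: "1 / u0 \<le> R" by (simp add: rho2)
    have Rp: "0 < R" using R u0 less_le_trans[of 0 "1 / u0" R] by simp
    have Rr: "1 / R \<le> u0" using R Rp u0 by (simp add: field_simps)
    have int: "integrable L (\<lambda>x. indicator {R<..} (cmod x) * (K1 / R\<^sup>2 * cmod x ^ (2 * i)))"
      using integrable_mult_right[OF integrable_indicator_power(1), of "K1 / R\<^sup>2" R "2 * i"] by (simp add: mult_ac)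
    have C1': "(\<Sum>k<4. (cmod (S (\<i> ^ k * u)))\<^sup>2) / 4 \<le> 1 + (K1 * (cmod u)\<^sup>2)" if "cmod u \<le> u0" for u
    proof -
      have "C1 * cmod u ^ 4 = C1 * (cmod u)\<^sup>2 * (cmod u)\<^sup>2" by (simp add: power4_eq_xxxx power2_eq_square)
      also have "\<dots> \<le> C1 * u0\<^sup>2 * (cmod u)\<^sup>2" using that C1(1) by (intro mult_right_mono mult_left_mono power_mono) auto
      finally show ?thesis using C1(2)[OF that] by (simp add: K1_def c_def algebra_simps)
    qed
    have g: "K1 * (1 / cmod x)\<^sup>2 * cmod x ^ (2 * i) \<le> K1 / R\<^sup>2 * cmod x ^ (2 * i)" if "R < cmod x" for x
    proof -
      have "(1 / cmod x)\<^sup>2 \<le> (1 / R)\<^sup>2" using that Rp by (intro power_mono divide_left_mono mult_pos_pos) auto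
      then have "K1 * (1 / cmod x)\<^sup>2 \<le> K1 / R\<^sup>2" using K1 mult_left_mono by (fastforce simp: power_divide)
      then show ?thesis by (rule mult_right_mono) simp
    qed
    note out = outer_integral_le[OF S u0 R C1' g int]
    have "(\<integral>x. (cmod (wS S R x * x ^ i))\<^sup>2 \<partial>L) =
       (\<integral>x. indicator {..R} (cmod x) * cmod x ^ (2 * i) + indicator {R<..} (cmod x) * ((cmod (S (1 / x)))\<^sup>2 * cmod x ^ (2 * i)) \<partial>L)"
      by (intro Bochner_Integration.integral_cong refl)
        (auto simp: wS_def indicator_def norm_mult norm_power power_mult_distrib power_mult[symmetric] mult.commute)
    also have "\<dots> = inner_mom R i + (\<integral>x. indicator {R<..} (cmod x) * ((cmod (S (1 / x)))\<^sup>2 * cmod x ^ (2 * i)) \<partial>L)"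
      unfolding inner_mom_def by (rule Bochner_Integration.integral_add[OF integrable_indicator_power(2) out(1)])
    also have "\<dots> \<le> inner_mom R i + (outer_mom R i + (\<integral>x. indicator {R<..} (cmod x) * (K1 / R\<^sup>2 * cmod x ^ (2 * i)) \<partial>L))"
      using out(2) by simp
    also have "(\<integral>x. indicator {R<..} (cmod x) * (K1 / R\<^sup>2 * cmod x ^ (2 * i)) \<partial>L) = K1 / R\<^sup>2 * outer_mom R i"
      unfolding outer_mom_def by (subst Bochner_Integration.integral_mult_right_zero[symmetric]) (simp add: mult.left_commute)
    finally show "(\<integral>x. (cmod (wS S R x * x ^ i))\<^sup>2 \<partial>L) \<le> hh i + K1 / R\<^sup>2 * outer_mom R i"
      unfolding inner_mom_plus_outer_mom[of R i, symmetric] by simp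
    assume i: "2 \<le> i"
    have int2: "integrable L (\<lambda>x. indicator {R<..} (cmod x) * (C2 * cmod x ^ (2 * (i - 2))))"
      using integrable_mult_right[OF integrable_indicator_power(1), of C2 R "2 * (i - 2)"] by (simp add: mult_ac)
    have C2': "(\<Sum>k<4. (cmod (T (\<i> ^ k * u)))\<^sup>2) / 4 \<le> 1 + (C2 * (cmod u) ^ 4)" if "cmod u \<le> u0" for u
      using C2(2)[OF that] by (simp add: T')
    have g2: "C2 * (1 / cmod x) ^ 4 * cmod x ^ (2 * i) \<le> C2 * cmod x ^ (2 * (i - 2))" if "R < cmod x" for x
    proof -
      have "0 < cmod x" using that Rp by linarith
      moreover have "2 * i = 2 * (i - 2) + 4" using i by simp
      then have "cmod x ^ (2 * i) = cmod x ^ (2 * (i - 2)) * cmod x ^ 4" by (metis power_add)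
      ultimately show ?thesis by (simp add: power_divide)
    qed
    note out2 = outer_integral_le[OF T u0 R C2' g2 int2]
    note inn = inner_integral_eq[where i = i and c = c and R = R]
    have i1: "1 \<le> i" using i by simp
    have "(\<integral>x. (cmod (wS S R x * x ^ i - c * (wS S R x * x ^ (i - 1))))\<^sup>2 \<partial>L) =
       (\<integral>x. indicator {..R} (cmod x) * (cmod (x ^ i - c * x ^ (i - 1)))\<^sup>2 + indicator {R<..} (cmod x) * ((cmod (T (1 / x)))\<^sup>2 * cmod x ^ (2 * i)) \<partial>L)"
    proof (intro Bochner_Integration.integral_cong refl)
      fix x
      show "(cmod (wS S R x * x ^ i - c * (wS S R x * x ^ (i - 1))))\<^sup>2 =
        indicator {..R} (cmod x) * (cmod (x ^ i - c * x ^ (i - 1)))\<^sup>2 + indicator {R<..} (cmod x) * ((cmod (T (1 / x)))\<^sup>2 * cmod x ^ (2 * i))"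
      proof (cases "R < cmod x")
        case True
        then have "x \<noteq> 0" using Rp by auto
        obtain n where n: "i = Suc n" using i by (cases i) auto
        have "S (1 / x) * x ^ i - c * (S (1 / x) * x ^ (i - 1)) = T (1 / x) * x ^ i"
          using \<open>x \<noteq> 0\<close> by (simp add: T_def n field_simps)
        then have "cmod (wS S R x * x ^ i - c * (wS S R x * x ^ (i - 1))) = cmod (T (1 / x)) * cmod x ^ i"
          using True by (simp add: wS_def norm_mult norm_power)
        then show ?thesis using True by (simp add: power_mult_distrib power_mult[symmetric] mult.commute)
      qed (simp add: wS_def)
    qed
    also have "\<dots> = (inner_mom R i + (cmod c)\<^sup>2 * inner_mom R (i - 1)) + (\<integral>x. indicator {R<..} (cmod x) * ((cmod (T (1 / x)))\<^sup>2 * cmod x ^ (2 * i)) \<partial>L)"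
      unfolding inn(1)[OF i1, symmetric] by (rule Bochner_Integration.integral_add[OF inn(2)[OF i1] out2(1)])
    also have "\<dots> \<le> (inner_mom R i + (cmod c)\<^sup>2 * inner_mom R (i - 1)) + (outer_mom R i + (\<integral>x. indicator {R<..} (cmod x) * (C2 * cmod x ^ (2 * (i - 2))) \<partial>L))"
      using out2(2) by simp
    also have "(\<integral>x. indicator {R<..} (cmod x) * (C2 * cmod x ^ (2 * (i - 2))) \<partial>L) = C2 * outer_mom R (i - 2)"
      unfolding outer_mom_def by (subst Bochner_Integration.integral_mult_right_zero[symmetric]) (simp add: mult.left_commute)
    also have "C2 * outer_mom R (i - 2) \<le> C2 * hh (i - 2)"
      using C2(1) inner_mom_plus_outer_mom[of R "i - 2"] inner_mom_nonneg[of R "i - 2"] by (intro mult_left_mono) auto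
    finally show "(\<integral>x. (cmod (wS S R x * x ^ i - deriv S 0 * (wS S R x * x ^ (i - 1))))\<^sup>2 \<partial>L) \<le>
      hh i + (cmod (deriv S 0))\<^sup>2 * inner_mom R (i - 1) + C2 * hh (i - 2)"
      unfolding inner_mom_plus_outer_mom[of R i, symmetric] c_def by simp
  qed (use K1 C2 in auto)
qed

text \<open>
  Hadamard's inequality is applied to \<open>w x\<^sup>i\<close> for \<open>i + 1 \<le> XX R\<close> and to \<open>w (x\<^sup>i - c x\<^sup>i\<^sup>-\<^sup>1)\<close> with \<open>c = S'(0)\<close>
  for larger \<open>i\<close>. This unitriangular change of basis keeps the determinant and cancels the first
  order term of \<open>w\<close> at infinity, which would otherwise contribute a divergent sum.
\<close>

lemma gram_wS_le:
  obtains \<epsilon> where "(\<epsilon> \<longlongrightarrow> 0) at_top" "eventually (\<lambda>R. \<forall>N.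
    Re (dt N (\<lambda>i j. \<integral>x. of_real ((cmod (wS S R x))\<^sup>2) * x ^ i * cnj (x ^ j) \<partial>L)) \<le> (\<Prod>i<N. hh i) * exp (\<epsilon> R)) at_top"
proof -
  obtain K1 K2 where K: "0 \<le> K1" "0 \<le> K2"
   "\<And>R i. 2 / \<rho> \<le> R \<Longrightarrow> (\<integral>x. (cmod (wS S R x * x ^ i))\<^sup>2 \<partial>L) \<le> hh i + K1 / R\<^sup>2 * outer_mom R i"
   "\<And>R i. 2 / \<rho> \<le> R \<Longrightarrow> 2 \<le> i \<Longrightarrow> (\<integral>x. (cmod (wS S R x * x ^ i - deriv S 0 * (wS S R x * x ^ (i - 1))))\<^sup>2 \<partial>L) \<le>
      hh i + (cmod (deriv S 0))\<^sup>2 * inner_mom R (i - 1) + K2 * hh (i - 2)"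
    using wS_norm_bounds by blast
  define c2 where "c2 = (cmod (deriv S 0))\<^sup>2"
  define \<kappa> where "\<kappa> = M / m"
  have c2: "0 \<le> c2" and \<kappa>: "0 < \<kappa>" using M_pos m_pos by (auto simp: c2_def \<kappa>_def)
  \<comment> \<open>\<open>XX R\<close> is of order R^2, while the transition has width of order R
    in the index. The window R sqrt R lies strictly between: beyond it Chebyshev leaves a total of
    order at most 1 / R, and inside it about R^(3/2) indices contribute order R^(-2) each. The five
    terms belong to the index ranges distinguished below.\<close>
  define \<epsilon> where "\<epsilon> R = K1 / R\<^sup>2 * (\<kappa> * (M / 2 * R\<^sup>2) / (R * sqrt R)\<^sup>2) * (M / 2 * R\<^sup>2 + 1) + K1 / R\<^sup>2 * (R * sqrt R + 1) +
      c2 * (M / (2 * (m / 2 * R\<^sup>2 - 1))) * (R * sqrt R + 2) + c2 * (M / 2 * \<kappa>) * (1 / (R * sqrt R - 1)) + K2 * (M\<^sup>2 / 4) * (1 / (m / 2 * R\<^sup>2 - 3))" for R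
  have lim: "(\<epsilon> \<longlongrightarrow> 0) at_top"
    unfolding \<epsilon>_def[abs_def] using m_pos M_pos by real_asymp
  show ?thesis
  proof (rule that[OF lim])
    have ev: "eventually (\<lambda>R. 2 / \<rho> \<le> R \<and> 1 \<le> R \<and> 3 < m / 2 * R\<^sup>2 \<and> 1 < R * sqrt R) at_top"
    proof (intro eventually_conj)
      show "eventually (\<lambda>R. 3 < m / 2 * R\<^sup>2) at_top" using m_pos by real_asymp
      show "eventually (\<lambda>R. 1 < R * sqrt R) at_top" by real_asymp
    qed (auto intro: eventually_ge_at_top)
    then show "eventually (\<lambda>R. \<forall>N. Re (dt N (\<lambda>i j. \<integral>x. of_real ((cmod (wS S R x))\<^sup>2) * x ^ i * cnj (x ^ j) \<partial>L)) \<le> (\<Prod>i<N. hh i) * exp (\<epsilon> R)) at_top"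
    proof (rule eventually_mono, intro allI)
      fix R :: real and N :: nat
      assume R: "2 / \<rho> \<le> R \<and> 1 \<le> R \<and> 3 < m / 2 * R\<^sup>2 \<and> 1 < R * sqrt R"
      define A \<tau> where "A = XX R" and "\<tau> = R * sqrt R"
      have A: "m / 2 * R\<^sup>2 \<le> A" "A \<le> M / 2 * R\<^sup>2" "3 < A" using R XX_ge[of R] XX_le[of R] by (auto simp: A_def)
      have \<tau>: "1 < \<tau>" using R by (simp add: \<tau>_def)
      have R1: "0 < R" "1 / R < \<rho>"
      proof -
        show "0 < R" using R by simp
        then show "1 / R < \<rho>" using R \<rho> by (simp add: field_simps)
      qed
      define v where "v i x = wS S R x * x ^ i" for i :: nat and x
      obtain B where B: "\<And>x. cmod (wS S R x - 1) \<le> B / R"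
        using wS_bound[OF S \<rho>, of "\<rho> / 2"] \<rho> R by (metis divide_divide_eq_right field_sum_of_halves less_add_same_cancel1 half_gt_zero mult.left_neutral)
      have vL2: "L2fun L (v i)" for i
        unfolding L2fun_def
      proof
        show m: "v i \<in> borel_measurable L" unfolding v_def[abs_def] using measurable_wS[OF S \<rho> R1] by simp
        show "integrable L (\<lambda>x. (cmod (v i x))\<^sup>2)"
        proof (rule Bochner_Integration.integrable_bound)
          show "integrable L (\<lambda>x. (1 + B / R)\<^sup>2 * cmod x ^ (2 * i))" by (intro integrable_mult_right integrable_cmod_power)
          show "(\<lambda>x. (cmod (v i x))\<^sup>2) \<in> borel_measurable L" using m by measurable
          show "AE x in L. norm ((cmod (v i x))\<^sup>2) \<le> norm ((1 + B / R)\<^sup>2 * cmod x ^ (2 * i))"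
          proof (intro AE_I2)
            fix x
            have "cmod (wS S R x) \<le> 1 + B / R" using B[of x] norm_triangle_ineq2[of "wS S R x" 1] by simp
            then have "(cmod (wS S R x))\<^sup>2 \<le> (1 + B / R)\<^sup>2" by (intro power_mono) auto
            then show "norm ((cmod (v i x))\<^sup>2) \<le> norm ((1 + B / R)\<^sup>2 * cmod x ^ (2 * i))"
              by (simp add: v_def norm_mult norm_power power_mult_distrib power_mult[symmetric] mult.commute[of i 2] abs_mult mult_right_mono)
          qed
        qed
      qed
      define Lm where "Lm i k = (if k = i then 1 else if Suc k = i \<and> A < real i + 1 then - deriv S 0 else 0)" for i k :: nat
      have dL: "dt N Lm = 1" by (subst dt_lower_triangular) (auto simp: Lm_def)
      define v' where "v' i x = (\<Sum>k<N. Lm i k * v k x)" for i x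
      have v'L2: "L2fun L (v' i)" for i unfolding v'_def[abs_def] by (intro L2fun_sum vL2)
      define W where "W i j = (\<integral>x. v i x * cnj (v j x) \<partial>L)" for i j
      have W: "W i j = (\<integral>x. of_real ((cmod (wS S R x))\<^sup>2) * x ^ i * cnj (x ^ j) \<partial>L)" for i j
        unfolding W_def v_def by (intro Bochner_Integration.integral_cong refl) (simp add: complex_norm_square mult_ac del: of_real_power)
      have G: "(\<integral>x. v' i x * cnj (v' j x) \<partial>L) = (\<Sum>k<N. \<Sum>l<N. Lm i k * W k l * cnj (Lm j l))" for i j
        unfolding v'_def W_def by (rule inner_congruence[OF vL2])
      have "dt N W = dt N (\<lambda>i j. \<integral>x. v' i x * cnj (v' j x) \<partial>L)"
        unfolding G dt_congruence dL by simp
      then have "Re (dt N W) \<le> (\<Prod>i<N. Re (\<integral>x. v' i x * cnj (v' i x) \<partial>L))"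
        using psd_hadamard[OF gram_psd[OF v'L2], of N] by simp
      also have "\<dots> = (\<Prod>i<N. \<integral>x. (cmod (v' i x))\<^sup>2 \<partial>L)"
        unfolding integral_mult_cnj_self by simp
      \<comment> \<open>In order: all indices below the threshold with the Chebyshev factor, those
        within \<open>\<tau>\<close> of it without that factor, those above it up to A +
        \<open>\<tau>\<close>, those beyond, and the remainder of order |x|^(-4) for all upper
        indices. The bounds -1 and 1 + (A - 2) fit the forms of the two summation lemmas, the former
        so that i = 0 is counted. Overlaps are harmless since all terms are nonnegative.\<close>
      also have "\<dots> \<le> (\<Prod>i<N. hh i * (1 +
         ((if -1 < real i \<and> real i \<le> A - 1 then K1 / R\<^sup>2 * (\<kappa> * A / \<tau>\<^sup>2) else 0) +
          (if A - 1 - \<tau> < real i \<and> real i \<le> A - 1 then K1 / R\<^sup>2 else 0) +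
          (if A - 1 < real i \<and> real i \<le> A + \<tau> then c2 * (M / (2 * (A - 1))) else 0) +
          (if A + \<tau> < real i then c2 * (M / 2 * \<kappa>) * (1 / (real i - A)\<^sup>2) else 0) +
          (if 1 + (A - 2) < real i then K2 * (M\<^sup>2 / 4) * (1 / (real i - 1)\<^sup>2) else 0))))"
        (is "_ \<le> (\<Prod>i<N. hh i * (1 + ?e i))")
      proof (intro prod_mono conjI)
        fix i assume i: "i \<in> {..<N}"
        note h = hh_pos[of i]
        show "(\<integral>x. (cmod (v' i x))\<^sup>2 \<partial>L) \<le> hh i * (1 + ?e i)"
        proof (cases "A < real i + 1")
          case False
          have v': "v' i x = v i x" for x
          proof -
            have "v' i x = (\<Sum>k<N. if k = i then v k x else 0)"
              unfolding v'_def by (intro sum.cong refl) (use False in \<open>auto simp: Lm_def\<close>)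
            then show ?thesis using i by (simp add: sum.delta)
          qed
          have "(\<integral>x. (cmod (v' i x))\<^sup>2 \<partial>L) \<le> hh i + K1 / R\<^sup>2 * outer_mom R i"
            unfolding v' v_def using K(3)[of R i] R by simp
          \<comment> \<open>Chebyshev is effective only at distance \<open>\<tau>\<close> from the
            threshold; closer to it the outer moment is merely at most \<open>hh i\<close>.\<close>
          also have "outer_mom R i \<le> (if real i \<le> A - 1 - \<tau> then \<kappa> * A / \<tau>\<^sup>2 else 1) * hh i"
          proof (cases "real i \<le> A - 1 - \<tau>")
            case True
            then have lt: "real i + 1 < XX R" using \<tau> by (simp add: A_def)
            have "outer_mom R i \<le> M / m * (real i + 1) / (A - (real i + 1))\<^sup>2 * hh i"
              using chebyshev_tail[of R i] lt R by (simp add: A_def)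
            also have "\<dots> \<le> \<kappa> * A / \<tau>\<^sup>2 * hh i"
            proof (intro mult_right_mono frac_le)
              show "M / m * (real i + 1) \<le> \<kappa> * A" unfolding \<kappa>_def using True \<tau> M_pos m_pos by (intro mult_left_mono) auto
              show "\<tau>\<^sup>2 \<le> (A - (real i + 1))\<^sup>2" using True \<tau> by (intro power_mono) auto
            qed (use \<kappa> A \<tau> h in auto)
            finally show ?thesis using True by simp
          next
            case False
            then show ?thesis using inner_mom_plus_outer_mom[of R i] inner_mom_nonneg[of R i] by simp
          qed
          then have "hh i + K1 / R\<^sup>2 * outer_mom R i \<le> hh i + K1 / R\<^sup>2 * ((if real i \<le> A - 1 - \<tau> then \<kappa> * A / \<tau>\<^sup>2 else 1) * hh i)"
            using K(1) by (intro add_left_mono mult_left_mono) auto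
          also have "\<dots> \<le> hh i * (1 + ?e i)"
          proof -
            define k1 k2 k4 k5 where "k1 = K1 / R\<^sup>2 * (\<kappa> * A / \<tau>\<^sup>2)" and "k2 = K1 / R\<^sup>2"
              and "k4 = c2 * (M / 2 * \<kappa>) * (1 / (real i - A)\<^sup>2)" and "k5 = K2 * (M\<^sup>2 / 4) * (1 / (real i - 1)\<^sup>2)"
            have "0 \<le> k1" "0 \<le> k2" "0 \<le> k4" "0 \<le> k5"
              unfolding k1_def k2_def k4_def k5_def using K(1,2) \<kappa> A c2 M_pos
              by (auto intro!: mult_nonneg_nonneg divide_nonneg_nonneg)
            then have "(if real i \<le> A - 1 - \<tau> then k1 else k2) \<le> ?e i"
              unfolding k1_def[symmetric] k4_def[symmetric] k5_def[symmetric] unfolding k2_def[symmetric]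
              using False by auto
            then have "K1 / R\<^sup>2 * (if real i \<le> A - 1 - \<tau> then \<kappa> * A / \<tau>\<^sup>2 else 1) \<le> ?e i"
              by (simp only: k1_def k2_def if_distrib[of "\<lambda>y. K1 / R\<^sup>2 * y"] mult_1_right)
            then have "hh i * (1 + K1 / R\<^sup>2 * (if real i \<le> A - 1 - \<tau> then \<kappa> * A / \<tau>\<^sup>2 else 1)) \<le> hh i * (1 + ?e i)"
              using h by (intro mult_left_mono add_left_mono) auto
            then show ?thesis by (simp only: distrib_left mult_1_right mult.commute mult.left_commute)
          qed
          finally show ?thesis .
        next
          case True
          then have i2: "2 \<le> i" using A by linarith
          have v': "v' i x = v i x - deriv S 0 * v (i - 1) x" for x
          proof -
            have "v' i x = (\<Sum>k<N. (if k = i then v k x else 0) + (if k = i - 1 then - deriv S 0 * v k x else 0))"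
              unfolding v'_def using i2 True by (intro sum.cong refl) (auto simp: Lm_def)
            then show ?thesis using i i2 by (simp add: sum.distrib sum.delta)
          qed
          have "(\<integral>x. (cmod (v' i x))\<^sup>2 \<partial>L) \<le> hh i + c2 * inner_mom R (i - 1) + K2 * hh (i - 2)"
            unfolding v' v_def c2_def using K(4)[of R i] R i2 by simp
          also have "\<dots> \<le> hh i + c2 * ((if real i \<le> A + \<tau> then M / (2 * (A - 1)) else M / 2 * \<kappa> * (1 / (real i - A)\<^sup>2)) * hh i) +
              K2 * (M\<^sup>2 / 4 * (1 / (real i - 1)\<^sup>2) * hh i)"
          proof (intro add_mono order_refl mult_left_mono)
            show "hh (i - 2) \<le> M\<^sup>2 / 4 * (1 / (real i - 1)\<^sup>2) * hh i" by (rule hh_pred2_le[OF i2])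
            have hp: "hh (i - 1) \<le> M / (2 * real i) * hh i" using i2 by (intro hh_pred_le) auto
            \<comment> \<open>The same dichotomy from above. The bound \<open>hp\<close> supplies a
              factor 1 / i, which in the far range cancels the growing variance.\<close>
            show "inner_mom R (i - 1) \<le> (if real i \<le> A + \<tau> then M / (2 * (A - 1)) else M / 2 * \<kappa> * (1 / (real i - A)\<^sup>2)) * hh i"
            proof (cases "real i \<le> A + \<tau>")
              case le: True
              have "inner_mom R (i - 1) \<le> hh (i - 1)"
                using inner_mom_plus_outer_mom[of R "i - 1"] outer_mom_nonneg[of R "i - 1"] by simp
              also note hp
              also have "M / (2 * real i) * hh i \<le> M / (2 * (A - 1)) * hh i"
                using True A M_pos h by (intro mult_right_mono divide_left_mono) auto
              finally show ?thesis using le by simp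
            next
              case gt: False
              have ri: "real (i - 1) + 1 = real i" using i2 by (simp add: of_nat_diff)
              have lt: "A < real i" using gt \<tau> by simp
              have "inner_mom R (i - 1) \<le> M / m * real i / (real i - A)\<^sup>2 * hh (i - 1)"
                using chebyshev_low[of R "i - 1"] lt R unfolding ri A_def by simp
              also have "\<dots> \<le> M / m * real i / (real i - A)\<^sup>2 * (M / (2 * real i) * hh i)"
                using hp M_pos m_pos by (intro mult_left_mono) auto
              also have "\<dots> = M / 2 * \<kappa> * (1 / (real i - A)\<^sup>2) * hh i"
                using i2 by (simp add: \<kappa>_def)
              finally show ?thesis using gt by simp
            qed
          qed (use c2 K(2) in auto)
          also have "\<dots> \<le> hh i * (1 + ?e i)"
          proof -
            have "1 + (c2 * (if real i \<le> A + \<tau> then M / (2 * (A - 1)) else M / 2 * \<kappa> * (1 / (real i - A)\<^sup>2)) + K2 * (M\<^sup>2 / 4 * (1 / (real i - 1)\<^sup>2))) \<le> 1 + ?e i"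
              using True \<tau> by auto
            then have "hh i * (1 + (c2 * (if real i \<le> A + \<tau> then M / (2 * (A - 1)) else M / 2 * \<kappa> * (1 / (real i - A)\<^sup>2)) + K2 * (M\<^sup>2 / 4 * (1 / (real i - 1)\<^sup>2)))) \<le> hh i * (1 + ?e i)"
              using h by (intro mult_left_mono) auto
            then show ?thesis by (simp only: distrib_left mult_1_right mult.commute mult.left_commute add.assoc)
          qed
          finally show ?thesis .
        qed
      qed simp
      also have "\<dots> \<le> (\<Prod>i<N. hh i * exp (?e i))"
      proof (intro prod_mono conjI mult_left_mono exp_ge_add_one_self)
        fix i
        have "0 \<le> ?e i"
          using K(1,2) c2 \<kappa> A M_pos by (intro add_nonneg_nonneg) (auto intro!: mult_nonneg_nonneg divide_nonneg_nonneg)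
        then show "0 \<le> hh i * (1 + ?e i)" using hh_pos[of i] by (intro mult_nonneg_nonneg) auto
      qed (use hh_pos in \<open>auto intro: less_imp_le\<close>)
      also have "\<dots> = (\<Prod>i<N. hh i) * exp (\<Sum>i<N. ?e i)"
        by (simp only: prod.distrib exp_sum finite_lessThan)
      also have "\<dots> \<le> (\<Prod>i<N. hh i) * exp (\<epsilon> R)"
      proof (intro mult_left_mono iffD2[OF exp_le_cancel_iff])
        \<comment> \<open>Each range contributes its size times its length, or an inverse-square
          tail; none of this depends on N.\<close>
        have "(\<Sum>i<N. ?e i) \<le>
          K1 / R\<^sup>2 * (\<kappa> * A / \<tau>\<^sup>2) * ((A - 1) - (-1) + 1) + K1 / R\<^sup>2 * ((A - 1) - (A - 1 - \<tau>) + 1) +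
          c2 * (M / (2 * (A - 1))) * ((A + \<tau>) - (A - 1) + 1) + c2 * (M / 2 * \<kappa>) * (1 / (\<tau> - 1)) + K2 * (M\<^sup>2 / 4) * (1 / ((A - 2) - 1))"
          unfolding sum.distrib
          using K(1,2) c2 \<kappa> A \<tau> M_pos
          by (intro add_mono sum_if_le_card sum_if_inverse_squares_le)
            (auto intro!: mult_nonneg_nonneg divide_nonneg_nonneg)
        also have "\<dots> = K1 / R\<^sup>2 * (\<kappa> * A / \<tau>\<^sup>2) * (A + 1) + K1 / R\<^sup>2 * (\<tau> + 1) +
          c2 * (M / (2 * (A - 1))) * (\<tau> + 2) + c2 * (M / 2 * \<kappa>) * (1 / (\<tau> - 1)) + K2 * (M\<^sup>2 / 4) * (1 / (A - 3))"
          by simp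
        also have "\<dots> \<le> \<epsilon> R"
          unfolding \<epsilon>_def \<tau>_def[symmetric]
        proof (intro add_mono order_refl)
          show "K1 / R\<^sup>2 * (\<kappa> * A / \<tau>\<^sup>2) * (A + 1) \<le> K1 / R\<^sup>2 * (\<kappa> * (M / 2 * R\<^sup>2) / \<tau>\<^sup>2) * (M / 2 * R\<^sup>2 + 1)"
            using A K(1) \<kappa> \<tau> M_pos by (intro mult_mono mult_left_mono divide_right_mono) auto
          show "c2 * (M / (2 * (A - 1))) * (\<tau> + 2) \<le> c2 * (M / (2 * (m / 2 * R\<^sup>2 - 1))) * (\<tau> + 2)"
            using A R c2 \<tau> M_pos by (intro mult_right_mono mult_left_mono divide_left_mono mult_pos_pos) auto
          show "K2 * (M\<^sup>2 / 4) * (1 / (A - 3)) \<le> K2 * (M\<^sup>2 / 4) * (1 / (m / 2 * R\<^sup>2 - 3))"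
            using A R K(2) by (intro mult_left_mono divide_left_mono mult_pos_pos) auto
        qed
        finally show "(\<Sum>i<N. ?e i) \<le> \<epsilon> R" .
      qed (use hh_pos in \<open>auto intro!: prod_nonneg intro: less_imp_le\<close>)
      finally show "Re (dt N (\<lambda>i j. \<integral>x. of_real ((cmod (wS S R x))\<^sup>2) * x ^ i * cnj (x ^ j) \<partial>L)) \<le> (\<Prod>i<N. hh i) * exp (\<epsilon> R)"
        unfolding W[abs_def] .
    qed
  qed
qed

end

end

section \<open>Gram determinants along the Newton flag\<close>

lemma inner_congruence_weighted:
  assumes v: "\<And>i. L2fun M (v i)" and w: "w \<in> borel_measurable M" "\<And>x. cmod (w x) \<le> C"
  shows "(\<integral>x. w x * (\<Sum>k<N. a k * v k x) * cnj (\<Sum>l<N. b l * v l x) \<partial>M) =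
     (\<Sum>k<N. \<Sum>l<N. a k * (\<integral>x. w x * v k x * cnj (v l x) \<partial>M) * cnj (b l))"
proof -
  have int: "integrable M (\<lambda>x. w x * v i x * cnj (v j x))" for i j by (rule L2fun_integrable_mult[OF v v w])
  have "(\<Sum>k<N. \<Sum>l<N. a k * (\<integral>x. w x * v k x * cnj (v l x) \<partial>M) * cnj (b l)) =
      (\<integral>x. (\<Sum>k<N. \<Sum>l<N. a k * (w x * v k x * cnj (v l x)) * cnj (b l)) \<partial>M)"
    using int by (simp add: Bochner_Integration.integral_sum Bochner_Integration.integrable_sum)
  also have "\<dots> = (\<integral>x. w x * (\<Sum>k<N. a k * v k x) * cnj (\<Sum>l<N. b l * v l x) \<partial>M)"
  proof (intro Bochner_Integration.integral_cong refl)
    fix x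
    have "w x * (\<Sum>k<N. a k * v k x) * cnj (\<Sum>l<N. b l * v l x) = w x * ((\<Sum>k<N. a k * v k x) * (\<Sum>l<N. cnj (b l * v l x)))"
      by simp
    also have "\<dots> = w x * (\<Sum>k<N. \<Sum>l<N. (a k * v k x) * cnj (b l * v l x))" by (simp only: sum_product)
    also have "\<dots> = (\<Sum>k<N. \<Sum>l<N. w x * ((a k * v k x) * cnj (b l * v l x)))" by (simp only: sum_distrib_left)
    finally show "(\<Sum>k<N. \<Sum>l<N. a k * (w x * v k x * cnj (v l x)) * cnj (b l)) = w x * (\<Sum>k<N. a k * v k x) * cnj (\<Sum>l<N. b l * v l x)"
      by (simp add: mult_ac)
  qed
  finally show ?thesis ..
qed

context radial_weight begin

text \<open>By Andreief's identity this is, up to a factorial, the integral of the product of w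
  against the unnormalized density of the N - j points that remain in the Palm process at the first
  j nodes.\<close>

definition gd :: "(nat \<Rightarrow> complex) \<Rightarrow> nat \<Rightarrow> (complex \<Rightarrow> complex) \<Rightarrow> nat \<Rightarrow> complex" where
  "gd \<alpha> N w j = dt (N - j) (\<lambda>a b. \<integral>x. w x * newton \<alpha> (j + a) x * cnj (newton \<alpha> (j + b) x) \<partial>L)"

text \<open>At j = 0 the Newton functions are a unitriangular change of the monomials, so the nodes
  drop out.\<close>

lemma gd_0:
  assumes w: "w \<in> borel_measurable borel" "\<And>x. cmod (w x) \<le> C"
  shows "gd \<alpha> N w 0 = dt N (\<lambda>i j. \<integral>x. w x * x ^ i * cnj (x ^ j) \<partial>L)"
proof -
  have w': "w \<in> borel_measurable L" using w by simp
  have "gd \<alpha> N w 0 = dt N (\<lambda>i j. \<Sum>k<N. \<Sum>l<N. newton_coeff \<alpha> i k * (\<integral>x. w x * x ^ k * cnj (x ^ l) \<partial>L) * cnj (newton_coeff \<alpha> j l))"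
    unfolding gd_def
  proof (simp only: diff_zero add_0, rule dt_cong)
    fix i j assume ij: "i < N" "j < N"
    show "(\<integral>x. w x * newton \<alpha> i x * cnj (newton \<alpha> j x) \<partial>L) =
      (\<Sum>k<N. \<Sum>l<N. newton_coeff \<alpha> i k * (\<integral>x. w x * x ^ k * cnj (x ^ l) \<partial>L) * cnj (newton_coeff \<alpha> j l))"
      unfolding newton_expand[OF ij(1)] newton_expand[OF ij(2)]
      by (rule inner_congruence_weighted[OF L2fun_power w'(1) w(2)])
  qed
  then show ?thesis unfolding dt_congruence by (simp add: dt_newton_coeff)
qed

lemma gd_one_0: "gd \<alpha> N (\<lambda>_. 1) 0 = of_real (\<Prod>i<N. hh i)"
proof -
  have "gd \<alpha> N (\<lambda>_. 1) 0 = dt N (\<lambda>i j. \<integral>x. 1 * x ^ i * cnj (x ^ j) \<partial>L)"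
    by (rule gd_0[of _ 1]) auto
  also have "\<dots> = dt N (\<lambda>i j. if i = j then of_real (hh i) else 0)"
    by (simp only: mult_1_left monomial_inner)
  also have "\<dots> = of_real (\<Prod>i<N. hh i)" by (subst dt_lower_triangular) auto
  finally show ?thesis .
qed

text \<open>The quotient of consecutive Gram determinants is the inverse squared distance of the
  Newton function j from the span of the later ones, and the kernel at the node is the squared value
  there divided by that squared distance. In the proof f0 comes from the first cofactors, and its
  pairing with the kernel function is evaluated in two ways: by orthogonality and by
  reproduction.\<close>

lemma gd_ratio:
  assumes \<alpha>: "inj_on \<alpha> {..<l}" and j: "j < l" "j < N"
  shows "palm_kernel (KN N) \<alpha> j (\<alpha> j) (\<alpha> j) * gd \<alpha> N (\<lambda>_. 1) j =
    gd \<alpha> N (\<lambda>_. 1) (Suc j) * of_real ((cmod (newton \<alpha> j (\<alpha> j)))\<^sup>2)"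
proof -
  define n where "n = N - Suc j"
  have n: "N - j = Suc n" "N - Suc j = n" "N = j + Suc n" using j by (auto simp: n_def)
  define G where "G a b = (\<integral>x. 1 * newton \<alpha> (j + a) x * cnj (newton \<alpha> (j + b) x) \<partial>L)" for a b
  have d: "gd \<alpha> N (\<lambda>_. 1) j = dt (Suc n) G" "gd \<alpha> N (\<lambda>_. 1) (Suc j) = dt n (\<lambda>a b. G (Suc a) (Suc b))"
    unfolding gd_def n G_def by simp_all
  obtain u where u: "u 0 = gd \<alpha> N (\<lambda>_. 1) (Suc j)"
    "\<And>i. i < Suc n \<Longrightarrow> (\<Sum>b<Suc n. G i b * u b) = (if i = 0 then gd \<alpha> N (\<lambda>_. 1) j else 0)"
    using dt_first_cofactors[of n G] unfolding d by metis
  have rk: "rkernel L (lspan (newton \<alpha>) j N) (palm_kernel (KN N) \<alpha> j)"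
    using j by (intro rkernel_palm[OF \<alpha>]) auto
  define f where "f x = palm_kernel (KN N) \<alpha> j x (\<alpha> j)" for x
  have fm: "f \<in> lspan (newton \<alpha>) j N" unfolding f_def[abs_def] by (rule rk_mem[OF rk])
  have reindex: "(\<Sum>i\<in>{j..<N}. g i) = (\<Sum>b<Suc n. g (j + b))" for g :: "nat \<Rightarrow> complex"
    unfolding n(3) by (rule sum.reindex_bij_witness[of _ "\<lambda>b. j + b" "\<lambda>i. i - j"]) auto
  obtain y where y: "f = (\<lambda>x. \<Sum>b<Suc n. y b * newton \<alpha> (j + b) x)"
  proof -
    obtain y where "f = (\<lambda>x. \<Sum>i\<in>{j..<N}. y i * newton \<alpha> i x)" using fm by (auto simp: lspan_def)
    then show ?thesis using that[of "\<lambda>b. y (j + b)"] unfolding reindex by simp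
  qed
  define f0 where "f0 x = (\<Sum>b<Suc n. cnj (u b) * newton \<alpha> (j + b) x)" for x
  have f0m: "f0 \<in> lspan (newton \<alpha>) j N"
  proof (rule lspanI)
    show "f0 = (\<lambda>x. \<Sum>i\<in>{j..<N}. cnj (u (i - j)) * newton \<alpha> i x)" unfolding reindex by (simp add: fun_eq_iff f0_def del: sum.lessThan_Suc)
  qed
  have at: "(\<Sum>b<Suc n. c b * newton \<alpha> (j + b) (\<alpha> j)) = c 0 * newton \<alpha> j (\<alpha> j)" for c
  proof -
    have "(\<Sum>b<Suc n. c b * newton \<alpha> (j + b) (\<alpha> j)) = (\<Sum>b<Suc n. if b = 0 then c b * newton \<alpha> j (\<alpha> j) else 0)"
      by (intro sum.cong refl) (auto simp: newton_eq_0)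
    then show ?thesis by (simp add: sum.delta del: sum.lessThan_Suc)
  qed
  have "(\<integral>x. f x * cnj (f0 x) \<partial>L) = (\<Sum>a<Suc n. \<Sum>b<Suc n. y a * (\<integral>x. newton \<alpha> (j + a) x * cnj (newton \<alpha> (j + b) x) \<partial>L) * cnj (cnj (u b)))"
    unfolding y f0_def by (rule inner_congruence[OF L2fun_newton])
  also have "\<dots> = (\<Sum>a<Suc n. y a * (\<Sum>b<Suc n. G a b * u b))"
    by (simp add: G_def sum_distrib_left mult.assoc del: sum.lessThan_Suc)
  also have "\<dots> = (\<Sum>a<Suc n. if a = 0 then y a * gd \<alpha> N (\<lambda>_. 1) j else 0)"
    using u(2) by (intro sum.cong refl) auto
  also have "\<dots> = y 0 * gd \<alpha> N (\<lambda>_. 1) j" by (simp add: sum.delta del: sum.lessThan_Suc)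
  finally have e1: "(\<integral>x. f x * cnj (f0 x) \<partial>L) = y 0 * gd \<alpha> N (\<lambda>_. 1) j" .
  have "f0 (\<alpha> j) = (\<integral>x. f0 x * cnj (f x) \<partial>L)" unfolding f_def by (rule rk_eval[OF rk f0m])
  also have "\<dots> = cnj (\<integral>x. f x * cnj (f0 x) \<partial>L)"
    by (subst Bochner_Integration.integral_cnj[symmetric]) (simp add: mult.commute)
  finally have "f0 (\<alpha> j) = cnj (y 0 * gd \<alpha> N (\<lambda>_. 1) j)"
    unfolding e1 .
  moreover have "f0 (\<alpha> j) = cnj (u 0) * newton \<alpha> j (\<alpha> j)" unfolding f0_def at ..
  ultimately have "cnj (u 0) * newton \<alpha> j (\<alpha> j) = cnj (y 0 * gd \<alpha> N (\<lambda>_. 1) j)" by simp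
  then have e2: "u 0 * cnj (newton \<alpha> j (\<alpha> j)) = y 0 * gd \<alpha> N (\<lambda>_. 1) j"
    by (metis complex_cnj_cnj complex_cnj_mult)
  have "f (\<alpha> j) = y 0 * newton \<alpha> j (\<alpha> j)" unfolding y at ..
  then have "f (\<alpha> j) * gd \<alpha> N (\<lambda>_. 1) j = u 0 * (newton \<alpha> j (\<alpha> j) * cnj (newton \<alpha> j (\<alpha> j)))"
    using e2 by (simp add: mult_ac)
  then show ?thesis unfolding complex_norm_square f_def u(1) .
qed

lemma palm_diag_real:
  assumes "inj_on \<alpha> {..<l}" "j < l" "j < N"
  shows "palm_kernel (KN N) \<alpha> j (\<alpha> j) (\<alpha> j) = of_real (Re (palm_kernel (KN N) \<alpha> j (\<alpha> j) (\<alpha> j)))"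
proof -
  have "rkernel L (lspan (newton \<alpha>) j N) (palm_kernel (KN N) \<alpha> j)"
    using assms by (intro rkernel_palm) auto
  from rk_diag[OF this, of "\<alpha> j"] show ?thesis by (metis Re_complex_of_real)
qed

lemma gd_one_product:
  assumes \<alpha>: "inj_on \<alpha> {..<l}" and j: "j \<le> l" "j \<le> N"
  shows "gd \<alpha> N (\<lambda>_. 1) j = of_real ((\<Prod>i<N. hh i) *
    (\<Prod>i<j. Re (palm_kernel (KN N) \<alpha> i (\<alpha> i) (\<alpha> i)) / (cmod (newton \<alpha> i (\<alpha> i)))\<^sup>2))"
  using j
proof (induction j)
  case 0
  then show ?case by (simp add: gd_one_0)
next
  case (Suc j)
  then have j: "j < l" "j < N" by auto
  have nz: "newton \<alpha> j (\<alpha> j) \<noteq> 0" by (rule newton_nonzero[OF \<alpha> j(1)])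
  have "gd \<alpha> N (\<lambda>_. 1) (Suc j) = gd \<alpha> N (\<lambda>_. 1) j * (palm_kernel (KN N) \<alpha> j (\<alpha> j) (\<alpha> j) / of_real ((cmod (newton \<alpha> j (\<alpha> j)))\<^sup>2))"
    using gd_ratio[OF \<alpha> j] nz by (simp add: field_simps)
  also have "\<dots> = gd \<alpha> N (\<lambda>_. 1) j * of_real (Re (palm_kernel (KN N) \<alpha> j (\<alpha> j) (\<alpha> j)) / (cmod (newton \<alpha> j (\<alpha> j)))\<^sup>2)"
    by (subst palm_diag_real[OF \<alpha> j]) simp
  finally show ?case using Suc by simp
qed

lemma gd_one_pos:
  assumes \<alpha>: "inj_on \<alpha> {..<l}" and j: "j \<le> l" "j \<le> N"
  obtains d where "gd \<alpha> N (\<lambda>_. 1) j = of_real d" "0 < d"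
proof -
  have "0 < (\<Prod>i<N. hh i) * (\<Prod>i<j. Re (palm_kernel (KN N) \<alpha> i (\<alpha> i) (\<alpha> i)) / (cmod (newton \<alpha> i (\<alpha> i)))\<^sup>2)"
    using j by (intro mult_pos_pos prod_pos divide_pos_pos ballI hh_pos palm_diag_pos[OF \<alpha>]) (auto simp: newton_nonzero[OF \<alpha>])
  with gd_one_product[OF \<alpha> j] show ?thesis using that by blast
qed

lemma gd_perturbation_step:
  assumes \<alpha>: "inj_on \<alpha> {..<l}" and j: "j < l" "j < N"
    and w: "w \<in> borel_measurable borel" "\<And>x. cmod (w x - 1) \<le> \<delta>" "\<delta> < 1"
  shows "cmod (gd \<alpha> N w (Suc j) / gd \<alpha> N (\<lambda>_. 1) (Suc j) - gd \<alpha> N w j / gd \<alpha> N (\<lambda>_. 1) j)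
    \<le> \<delta> / (1 - \<delta>) * cmod (gd \<alpha> N w j / gd \<alpha> N (\<lambda>_. 1) j)"
proof -
  define n where "n = N - Suc j"
  have n: "N - j = Suc n" "N - Suc j = n" using j by (auto simp: n_def)
  obtain d where d: "gd \<alpha> N (\<lambda>_. 1) j = of_real d" "0 < d" using gd_one_pos[OF \<alpha>, of j N] j by auto
  obtain d' where d': "gd \<alpha> N (\<lambda>_. 1) (Suc j) = of_real d'" "0 < d'" using gd_one_pos[OF \<alpha>, of "Suc j" N] j by auto
  have w': "w \<in> borel_measurable L" using w by simp
  have "cmod (dt n (\<lambda>a b. \<integral>x. w x * newton \<alpha> (j + Suc a) x * cnj (newton \<alpha> (j + Suc b) x) \<partial>L) / d' -
      dt (Suc n) (\<lambda>a b. \<integral>x. w x * newton \<alpha> (j + a) x * cnj (newton \<alpha> (j + b) x) \<partial>L) / d) \<le>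
      \<delta> / (1 - \<delta>) * cmod (dt (Suc n) (\<lambda>a b. \<integral>x. w x * newton \<alpha> (j + a) x * cnj (newton \<alpha> (j + b) x) \<partial>L) / d)"
    by (rule gram_quotient_perturbation[OF L2fun_newton w' w(2,3)]) (use d d' in \<open>auto simp: gd_def n\<close>)
  then show ?thesis unfolding d d' by (simp add: gd_def n)
qed

text \<open>Each of the l removed functions costs a factor 1 + \<delta> / (1 - \<delta>), whatever N
  is. The reference at index 0 involves no nodes, and there the determinants can be treated in the
  monomial basis.\<close>

lemma gd_perturbation:
  assumes \<alpha>: "inj_on \<alpha> {..<l}" and N: "l \<le> N"
    and w: "w \<in> borel_measurable borel" "\<And>x. cmod (w x - 1) \<le> \<delta>" "\<delta> < 1"
  shows "cmod (gd \<alpha> N w l / gd \<alpha> N (\<lambda>_. 1) l - gd \<alpha> N w 0 / gd \<alpha> N (\<lambda>_. 1) 0)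
    \<le> ((1 + \<delta> / (1 - \<delta>)) ^ l - 1) * cmod (gd \<alpha> N w 0 / gd \<alpha> N (\<lambda>_. 1) 0)"
proof -
  have \<delta>: "0 \<le> \<delta>" using w(2) norm_ge_zero order_trans by blast
  define t r where "t = \<delta> / (1 - \<delta>)" and "r j = gd \<alpha> N w j / gd \<alpha> N (\<lambda>_. 1) j" for j
  have t: "0 \<le> t" using \<delta> w(3) by (simp add: t_def)
  have "j \<le> l \<Longrightarrow> cmod (r j - r 0) \<le> ((1 + t) ^ j - 1) * cmod (r 0)" for j
  proof (induction j)
    case (Suc j)
    then have IH: "cmod (r j - r 0) \<le> ((1 + t) ^ j - 1) * cmod (r 0)" by simp
    have "cmod (r j) \<le> cmod (r j - r 0) + cmod (r 0)" using norm_triangle_sub[of "r j" "r 0"] by simp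
    also have "\<dots> \<le> (1 + t) ^ j * cmod (r 0)" using IH by (simp add: algebra_simps)
    finally have rj: "cmod (r j) \<le> (1 + t) ^ j * cmod (r 0)" .
    have "cmod (r (Suc j) - r j) \<le> t * cmod (r j)"
      unfolding r_def t_def using Suc.prems N by (intro gd_perturbation_step[OF \<alpha> _ _ w]) auto
    also have "\<dots> \<le> t * ((1 + t) ^ j * cmod (r 0))" using rj t by (rule mult_left_mono)
    finally have "cmod (r (Suc j) - r 0) \<le> t * ((1 + t) ^ j * cmod (r 0)) + ((1 + t) ^ j - 1) * cmod (r 0)"
      using norm_triangle_ineq[of "r (Suc j) - r j" "r j - r 0"] IH by simp
    then show ?case by (simp add: algebra_simps)
  qed simp
  from this[of l] show ?thesis by (simp add: r_def t_def)
qed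

end

section \<open>Truncated expectations\<close>

context radial_weight begin

text \<open>Separated variables are the form required by \<open>integral_prod_dt\<close>. The
  functions \<open>b\<close> are dual to the Newton functions, and \<open>X\<close> is the adjoint
  of the inverse Gram matrix.\<close>

lemma palm_kernel_separated:
  assumes \<alpha>: "inj_on \<alpha> {..<l}" and N: "l \<le> N"
  obtains b X where "\<And>x y. palm_kernel (KN N) \<alpha> l x y = (\<Sum>m<N - l. newton \<alpha> (l + m) x * b m y)"
    "\<And>m y. m < N - l \<Longrightarrow> b m y = (\<Sum>i<N - l. X i m * cnj (newton \<alpha> (l + i) y))"
    "dt (N - l) X * gd \<alpha> N (\<lambda>_. 1) l = 1"
    "\<And>i j. i < N - l \<Longrightarrow> j < N - l \<Longrightarrow> (\<integral>x. newton \<alpha> (l + i) x * b j x \<partial>L) = (if i = j then 1 else 0)"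
proof -
  define n where "n = N - l"
  have nN: "N = l + n" using N by (simp add: n_def)
  define s where "s m = newton \<alpha> (l + m)" for m
  have s: "L2fun L (s m)" for m unfolding s_def by (rule L2fun_newton)
  define G where "G i j = (\<integral>x. s i x * cnj (s j x) \<partial>L)" for i j
  have gdG: "gd \<alpha> N (\<lambda>_. 1) l = dt n G" unfolding gd_def n_def G_def s_def by simp
  obtain d where d: "gd \<alpha> N (\<lambda>_. 1) l = of_real d" "0 < d" using gd_one_pos[OF \<alpha> order_refl N] by blast
  then have "dt n G \<noteq> 0" unfolding gdG by simp
  then obtain X where X: "\<And>i j. i < n \<Longrightarrow> j < n \<Longrightarrow> (\<Sum>k<n. G i k * X k j) = (if i = j then 1 else 0)"
    "\<And>i j. i < n \<Longrightarrow> j < n \<Longrightarrow> (\<Sum>k<n. X i k * G k j) = (if i = j then 1 else 0)"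
    by (rule dt_inverse) blast
  have rk: "rkernel L (lspan (newton \<alpha>) l N) (palm_kernel (KN N) \<alpha> l)"
    by (rule rkernel_palm[OF \<alpha> order_refl N])
  have "\<exists>u. \<forall>x. palm_kernel (KN N) \<alpha> l x y = (\<Sum>m<n. s m x * u m)" for y
  proof -
    obtain c where "(\<lambda>x. palm_kernel (KN N) \<alpha> l x y) = (\<lambda>x. \<Sum>i\<in>{l..<N}. c i * newton \<alpha> i x)"
      using rk_mem[OF rk, of y] by (auto simp: lspan_def)
    then have "palm_kernel (KN N) \<alpha> l x y = (\<Sum>i\<in>{l..<N}. c i * newton \<alpha> i x)" for x by metis
    also have "(\<Sum>i\<in>{l..<N}. c i * newton \<alpha> i x) = (\<Sum>m<n. c (l + m) * newton \<alpha> (l + m) x)" for x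
      unfolding nN by (rule sum.reindex_bij_witness[of _ "\<lambda>b. l + b" "\<lambda>i. i - l"]) auto
    finally show ?thesis by (intro exI[of _ "\<lambda>m. c (l + m)"]) (simp add: s_def mult.commute)
  qed
  then obtain b' where b': "\<And>x y. palm_kernel (KN N) \<alpha> l x y = (\<Sum>m<n. s m x * b' y m)" by metis
  \<comment> \<open>Reproducing each Newton function shows that the conjugated coefficients of the
    kernel solve the Gram system.\<close>
  have sel: "s i y = (\<Sum>m<n. G i m * cnj (b' y m))" if "i < n" for i y
  proof -
    have mem: "s i \<in> lspan (newton \<alpha>) l N" unfolding s_def using that nN by (intro lspan_base) auto
    have "s i y = (\<integral>x. s i x * cnj (palm_kernel (KN N) \<alpha> l x y) \<partial>L)" by (rule rk_eval[OF rk mem])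
    also have "\<dots> = (\<integral>x. (\<Sum>m<n. (s i x * cnj (s m x)) * cnj (b' y m)) \<partial>L)"
      unfolding b' by (intro Bochner_Integration.integral_cong refl) (simp add: sum_distrib_left mult_ac)
    also have "\<dots> = (\<Sum>m<n. G i m * cnj (b' y m))"
      unfolding G_def using L2fun_integrable_inner[OF s s] by (subst Bochner_Integration.integral_sum) auto
    finally show ?thesis .
  qed
  define Y where "Y i m = cnj (X m i)" for i m
  have b'eq: "b' y m = (\<Sum>i<n. Y i m * cnj (s i y))" if "m < n" for y m
  proof -
    have "(\<Sum>i<n. X m i * s i y) = (\<Sum>i<n. \<Sum>k<n. X m i * G i k * cnj (b' y k))"
      by (intro sum.cong refl) (simp add: sel sum_distrib_left mult.assoc)
    also have "\<dots> = (\<Sum>k<n. (\<Sum>i<n. X m i * G i k) * cnj (b' y k))"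
      unfolding sum_distrib_right by (rule sum.swap)
    also have "\<dots> = (\<Sum>k<n. if k = m then cnj (b' y k) else 0)"
      using that by (intro sum.cong refl) (auto simp: X(2))
    finally have "(\<Sum>i<n. X m i * s i y) = cnj (b' y m)" using that by (simp add: sum.delta)
    then have "b' y m = cnj (\<Sum>i<n. X m i * s i y)" by simp
    then show ?thesis by (simp add: Y_def)
  qed
  have "dt n Y = cnj (dt n X)"
    unfolding Y_def dt_cnj[symmetric] by (rule dt_transpose)
  moreover have "dt n X * dt n G = 1"
  proof -
    have "dt n X * dt n G = dt n (\<lambda>i j. \<Sum>k<n. X i k * G k j)" by (rule dt_mult[symmetric])
    also have "\<dots> = dt n (\<lambda>i j. if i = j then 1 else 0)" using X(2) by (intro dt_cong)
    also have "\<dots> = 1" by (subst dt_lower_triangular) auto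
    finally show ?thesis .
  qed
  ultimately have dtY: "dt n Y * gd \<alpha> N (\<lambda>_. 1) l = 1"
    using d(1) gdG by (metis complex_cnj_complex_of_real complex_cnj_mult complex_cnj_one)
  have bio: "(\<integral>x. s i x * b' x j \<partial>L) = (if i = j then 1 else 0)" if ij: "i < n" "j < n" for i j
  proof -
    have "(\<integral>x. s i x * b' x j \<partial>L) = (\<integral>x. (\<Sum>k<n. (s i x * cnj (s k x)) * Y k j) \<partial>L)"
      using ij by (intro Bochner_Integration.integral_cong refl) (simp add: b'eq sum_distrib_left mult_ac)
    also have "\<dots> = (\<Sum>k<n. G i k * Y k j)"
      unfolding G_def using L2fun_integrable_inner[OF s s] by (subst Bochner_Integration.integral_sum) auto
    also have "\<dots> = (\<Sum>k<n. cnj (X j k * G k i))"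
    proof (intro sum.cong refl)
      fix k
      have "G i k = cnj (G k i)" unfolding G_def
        by (subst Bochner_Integration.integral_cnj[symmetric]) (simp add: mult.commute)
      then show "G i k * Y k j = cnj (X j k * G k i)" by (simp add: Y_def mult.commute)
    qed
    also have "\<dots> = cnj (\<Sum>k<n. X j k * G k i)" by simp
    also have "\<dots> = (if i = j then 1 else 0)" unfolding X(2)[OF ij(2,1)] by simp
    finally show ?thesis .
  qed
  show ?thesis
    by (rule that[of "\<lambda>m y. b' y m" Y]) (use b' b'eq dtY bio in \<open>simp_all add: n_def s_def\<close>)
qed

text \<open>The mean of \<open>\<prod>w(x)\<close> over the determinantal process with kernel \<open>palm_kernel (KN N) \<alpha> l\<close>.\<close>

definition EN :: "(nat \<Rightarrow> complex) \<Rightarrow> nat \<Rightarrow> nat \<Rightarrow> (complex \<Rightarrow> complex) \<Rightarrow> complex" where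
  "EN \<alpha> l N w = gd \<alpha> N w l / gd \<alpha> N (\<lambda>_. 1) l"

text \<open>In the dual basis the matrix of \<open>f\<close> is the weighted Gram matrix times the
  inverse of the plain one, so its determinant is \<open>EN\<close>. The series is the expansion of
  det(I + F) and suits functions close to 1; the last conclusion is its top term and exhibits the
  density of the N - l points, which suits positivity arguments.\<close>

lemma EN_fredholm:
  assumes \<alpha>: "inj_on \<alpha> {..<l}" and N: "l \<le> N"
    and int: "\<And>i j. integrable L (\<lambda>x. f x * newton \<alpha> (l + i) x * cnj (newton \<alpha> (l + j) x))"
  shows "\<And>k. integrable (\<Pi>\<^sub>M i\<in>{..<k}. L) (\<lambda>x. (\<Prod>i<k. f (x i)) * dt k (\<lambda>i j. palm_kernel (KN N) \<alpha> l (x i) (x j)))"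
    and "(\<lambda>k. (\<integral>x. (\<Prod>i<k. f (x i)) * dt k (\<lambda>i j. palm_kernel (KN N) \<alpha> l (x i) (x j)) \<partial>(\<Pi>\<^sub>M i\<in>{..<k}. L)) / fact k)
      sums EN \<alpha> l N (\<lambda>x. f x + 1)"
    and "(\<integral>x. (\<Prod>i<N - l. f (x i)) * dt (N - l) (\<lambda>i j. palm_kernel (KN N) \<alpha> l (x i) (x j)) \<partial>(\<Pi>\<^sub>M i\<in>{..<N - l}. L)) =
      fact (N - l) * EN \<alpha> l N f"
proof -
  define n where "n = N - l"
  obtain b X where b: "\<And>x y. palm_kernel (KN N) \<alpha> l x y = (\<Sum>m<n. newton \<alpha> (l + m) x * b m y)"
    and bX: "\<And>m y. m < n \<Longrightarrow> b m y = (\<Sum>i<n. X i m * cnj (newton \<alpha> (l + i) y))"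
    and X: "dt n X * gd \<alpha> N (\<lambda>_. 1) l = 1"
    and bio: "\<And>i j. i < n \<Longrightarrow> j < n \<Longrightarrow> (\<integral>x. newton \<alpha> (l + i) x * b j x \<partial>L) = (if i = j then 1 else 0)"
    unfolding n_def by (rule palm_kernel_separated[OF \<alpha> N]) blast
  define s where "s m = newton \<alpha> (l + m)" for m
  define F where "F i j = (\<integral>x. f x * s i x * b j x \<partial>L)" for i j
  define \<Phi> where "\<Phi> i j = (\<integral>x. f x * s i x * cnj (s j x) \<partial>L)" for i j
  have fb: "f x * s i x * b j x = (\<Sum>k<n. (f x * s i x * cnj (s k x)) * X k j)" if "j < n" for x i j
    using that by (simp add: bX s_def sum_distrib_left mult_ac)
  have int': "integrable L (\<lambda>x. f x * s i x * b j x)" if "j < n" for i j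
    unfolding fb[OF that] using int by (auto simp: s_def)
  have F: "F i j = (\<Sum>k<n. \<Phi> i k * X k j)" if "j < n" for i j
    unfolding F_def fb[OF that] \<Phi>_def using int
    by (subst Bochner_Integration.integral_sum) (auto simp: s_def)
  have EN_eq: "EN \<alpha> l N g = dt n (\<lambda>i j. \<integral>x. g x * s i x * cnj (s j x) \<partial>L) * dt n X" for g
  proof -
    have "gd \<alpha> N (\<lambda>_. 1) l \<noteq> 0" using X by auto
    then have "dt n X = 1 / gd \<alpha> N (\<lambda>_. 1) l" using X by (simp add: eq_divide_eq)
    moreover have "gd \<alpha> N g l = dt n (\<lambda>i j. \<integral>x. g x * s i x * cnj (s j x) \<partial>L)"
      by (simp add: gd_def n_def s_def)
    ultimately show ?thesis by (simp add: EN_def)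
  qed
  have dtF: "dt n F = EN \<alpha> l N f"
  proof -
    have "dt n F = dt n (\<lambda>i j. \<Sum>k<n. \<Phi> i k * X k j)" using F by (intro dt_cong) auto
    then show ?thesis unfolding dt_mult EN_eq \<Phi>_def .
  qed
  note I = integral_prod_dt[OF sigma_finite_lam, of n f s b, OF int']
  have K: "palm_kernel (KN N) \<alpha> l x y = (\<Sum>m<n. s m x * b m y)" for x y
    unfolding b s_def ..
  show "\<And>k. integrable (\<Pi>\<^sub>M i\<in>{..<k}. L) (\<lambda>x. (\<Prod>i<k. f (x i)) * dt k (\<lambda>i j. palm_kernel (KN N) \<alpha> l (x i) (x j)))"
    unfolding K by (rule I(1))
  have I2: "(\<integral>x. (\<Prod>i<k. f (x i)) * dt k (\<lambda>i j. palm_kernel (KN N) \<alpha> l (x i) (x j)) \<partial>(\<Pi>\<^sub>M i\<in>{..<k}. L)) =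
      (\<Sum>m\<in>{..<k} \<rightarrow>\<^sub>E {..<n}. dt k (\<lambda>i j. F (m i) (m j)))" for k
    unfolding K F_def by (rule I(2))
  show "(\<integral>x. (\<Prod>i<N - l. f (x i)) * dt (N - l) (\<lambda>i j. palm_kernel (KN N) \<alpha> l (x i) (x j)) \<partial>(\<Pi>\<^sub>M i\<in>{..<N - l}. L)) =
      fact (N - l) * EN \<alpha> l N f"
    unfolding I2 n_def[symmetric] sum_PiE_dt_top dtF ..
  have "(\<lambda>k. (\<Sum>m\<in>{..<k} \<rightarrow>\<^sub>E {..<n}. dt k (\<lambda>i j. F (m i) (m j))) / fact k) sums
      (\<Sum>k\<le>n. (\<Sum>m\<in>{..<k} \<rightarrow>\<^sub>E {..<n}. dt k (\<lambda>i j. F (m i) (m j))) / fact k)"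
    by (rule sums_finite) (auto simp: sum_PiE_dt_large)
  also have "(\<Sum>k\<le>n. (\<Sum>m\<in>{..<k} \<rightarrow>\<^sub>E {..<n}. dt k (\<lambda>i j. F (m i) (m j))) / fact k) =
      dt n (\<lambda>i j. F i j + (if i = j then 1 else 0))"
    by (rule dt_identity_plus[symmetric])
  \<comment> \<open>Biorthogonality writes the identity as the plain Gram matrix times
    \<open>X\<close>, which adds up with \<open>F\<close> to the weight f + 1.\<close>
  also have "\<dots> = dt n (\<lambda>i j. \<Sum>k<n. (\<integral>x. (f x + 1) * s i x * cnj (s k x) \<partial>L) * X k j)"
  proof (rule dt_cong)
    fix i j assume ij: "i < n" "j < n"
    have i1: "integrable L (\<lambda>x. s i x * cnj (s k x))" for k
      unfolding s_def by (intro L2fun_integrable_inner L2fun_newton)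
    have "(if i = j then 1 else 0) = (\<integral>x. s i x * b j x \<partial>L)" using bio[OF ij] by (simp add: s_def)
    also have "\<dots> = (\<integral>x. (\<Sum>k<n. (s i x * cnj (s k x)) * X k j) \<partial>L)"
      using ij by (intro Bochner_Integration.integral_cong refl) (simp add: bX s_def sum_distrib_left mult_ac)
    also have "\<dots> = (\<Sum>k<n. (\<integral>x. s i x * cnj (s k x) \<partial>L) * X k j)"
      using i1 by (subst Bochner_Integration.integral_sum) auto
    finally have "F i j + (if i = j then 1 else 0) = (\<Sum>k<n. (\<Phi> i k + (\<integral>x. s i x * cnj (s k x) \<partial>L)) * X k j)"
      by (simp add: F[OF ij(2)] sum.distrib distrib_right)
    also have "\<dots> = (\<Sum>k<n. (\<integral>x. (f x + 1) * s i x * cnj (s k x) \<partial>L) * X k j)"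
    proof (intro sum.cong refl arg_cong2[where f = times])
      fix k
      show "\<Phi> i k + (\<integral>x. s i x * cnj (s k x) \<partial>L) = (\<integral>x. (f x + 1) * s i x * cnj (s k x) \<partial>L)"
        unfolding \<Phi>_def using int[of i k] i1[of k]
        by (subst Bochner_Integration.integral_add[symmetric]) (auto simp: s_def algebra_simps)
    qed
    finally show "F i j + (if i = j then 1 else 0) = (\<Sum>k<n. (\<integral>x. (f x + 1) * s i x * cnj (s k x) \<partial>L) * X k j)" .
  qed
  also have "\<dots> = EN \<alpha> l N (\<lambda>x. f x + 1)" unfolding dt_mult EN_eq ..
  finally show "(\<lambda>k. (\<integral>x. (\<Prod>i<k. f (x i)) * dt k (\<lambda>i j. palm_kernel (KN N) \<alpha> l (x i) (x j)) \<partial>(\<Pi>\<^sub>M i\<in>{..<k}. L)) / fact k)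
      sums EN \<alpha> l N (\<lambda>x. f x + 1)"
    unfolding I2 .
qed

end

section \<open>Passage to the limit\<close>

text \<open>With nodes padded by 0, the tail of a Newton basis is a fixed polynomial times powers of
  x. This is what allows the bases for p and for q to be matched function by function.\<close>

lemma newton_tail:
  assumes "\<And>a. l \<le> a \<Longrightarrow> \<alpha> a = 0"
  shows "newton \<alpha> (l + m) x = newton \<alpha> l x * x ^ m"
  by (induction m) (use assms in \<open>auto simp: newton_def\<close>)

context radial_weight begin

text \<open>At each node a the Palm step subtracts |K(x,a)|^2 / K(a,a) on the diagonal, which is
  nonnegative.\<close>

lemma palm_diag_decreasing:
  assumes \<alpha>: "inj_on \<alpha> {..<l}" and j: "j \<le> l" "l \<le> N"
  shows "Re (palm_kernel (KN N) \<alpha> j x x) \<le> Re (KN N x x)"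
  using j
proof (induction j)
  case (Suc j)
  define K' where "K' = palm_kernel (KN N) \<alpha> j"
  have rk: "rkernel L (lspan (newton \<alpha>) j N) K'"
    unfolding K'_def using Suc.prems by (intro rkernel_palm[OF \<alpha>]) auto
  have "K' x (\<alpha> j) * K' (\<alpha> j) x / K' (\<alpha> j) (\<alpha> j) = of_real ((cmod (K' x (\<alpha> j)))\<^sup>2 / Re (K' (\<alpha> j) (\<alpha> j)))"
  proof -
    have "K' (\<alpha> j) x = cnj (K' x (\<alpha> j))" by (rule rk_hermitian[OF rk])
    moreover have "K' (\<alpha> j) (\<alpha> j) = of_real (Re (K' (\<alpha> j) (\<alpha> j)))" using rk_diag[OF rk, of "\<alpha> j"] by (metis Re_complex_of_real)
    ultimately show ?thesis unfolding of_real_divide complex_norm_square by simp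
  qed
  then have "Re (palm_kernel (KN N) \<alpha> (Suc j) x x) = Re (K' x x) - (cmod (K' x (\<alpha> j)))\<^sup>2 / Re (K' (\<alpha> j) (\<alpha> j))"
    by (simp add: K'_def)
  also have "\<dots> \<le> Re (K' x x)" using rk_diag_nonneg[OF rk, of "\<alpha> j"] by simp
  finally show ?case using Suc by (simp add: K'_def)
qed simp

text \<open>The weights have poles at the nodes, so the kernel must be seen to vanish there
  uniformly in N. As a function of z, K(z,x) is \<open>newton\<close> times a polynomial G. On a
  large circle \<open>newton\<close> is at least 1 in modulus and K(z,z) is bounded through
  \<open>KN\<close>, so |G(z)| is at most sqrt(C k) with k = K(x,x), and the maximum principle
  extends this to z = x. Hence k <= |newton| sqrt(C k) at x.\<close>

lemma palm_diag_bound: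
  assumes K: "is_reproducing_kernel \<phi> K" and \<alpha>: "inj_on \<alpha> {..<l}" "\<And>a. l \<le> a \<Longrightarrow> \<alpha> a = 0"
  obtains C where "0 \<le> C" "\<And>N x. l \<le> N \<Longrightarrow> cmod x \<le> r \<Longrightarrow>
    Re (palm_kernel (KN N) \<alpha> l x x) \<le> C * (cmod (newton \<alpha> l x))\<^sup>2"
proof -
  \<comment> \<open>The circle of radius \<open>r'\<close> stays at distance at least 1 from every
    node.\<close>
  define r' where "r' = \<bar>r\<bar> + 1 + (\<Sum>a<l. cmod (\<alpha> a))"
  have "0 \<le> (\<Sum>a<l. cmod (\<alpha> a))" by (intro sum_nonneg) simp
  then have r': "r \<le> r'" "0 < r'" by (auto simp: r'_def)
  define C where "C = Re (K (of_real r') (of_real r'))"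
  have Q1: "1 \<le> cmod (newton \<alpha> l z)" if "cmod z = r'" for z :: complex
  proof -
    have "1 \<le> cmod (z - \<alpha> a)" if a: "a < l" for a
    proof -
      have "cmod (\<alpha> a) \<le> (\<Sum>a<l. cmod (\<alpha> a))" using a by (intro member_le_sum) auto
      then show ?thesis using norm_triangle_ineq2[of z "\<alpha> a"] \<open>cmod z = r'\<close> by (simp add: r'_def)
    qed
    then show ?thesis unfolding newton_def prod_norm[symmetric] by (intro prod_ge_1) auto
  qed
  have KC: "Re (KN N z z) \<le> C" if "cmod z = r'" for N and z :: complex
    unfolding C_def using that by (intro KN_diag_le[OF K]) simp
  have C0: "0 \<le> C"
    using KC[of "of_real r'" 0] r' by (simp add: KN_def)
  show ?thesis
  proof (rule that[OF C0])
    fix N x assume N: "l \<le> N" and x: "cmod x \<le> r"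
    define K' where "K' = palm_kernel (KN N) \<alpha> l"
    have rk: "rkernel L (lspan (newton \<alpha>) l N) K'"
      unfolding K'_def by (rule rkernel_palm[OF \<alpha>(1) order_refl N])
    define k where "k = Re (K' x x)"
    have k0: "0 \<le> k" unfolding k_def by (rule rk_diag_nonneg[OF rk])
    obtain c where c: "(\<lambda>z. K' z x) = (\<lambda>z. \<Sum>i\<in>{l..<N}. c i * newton \<alpha> i z)"
      using rk_mem[OF rk, of x] by (auto simp: lspan_def)
    define G where "G z = (\<Sum>i\<in>{l..<N}. c i * z ^ (i - l))" for z :: complex
    have KG: "K' z x = newton \<alpha> l z * G z" for z
    proof -
      have "K' z x = (\<Sum>i\<in>{l..<N}. c i * newton \<alpha> i z)" using c by metis
      also have "\<dots> = (\<Sum>i\<in>{l..<N}. newton \<alpha> l z * (c i * z ^ (i - l)))"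
      proof (intro sum.cong refl)
        fix i assume "i \<in> {l..<N}"
        then have "newton \<alpha> i z = newton \<alpha> l z * z ^ (i - l)"
          using newton_tail[where l = l and m = "i - l" and \<alpha> = \<alpha>, OF \<alpha>(2)] by simp
        then show "c i * newton \<alpha> i z = newton \<alpha> l z * (c i * z ^ (i - l))" by simp
      qed
      finally show ?thesis by (simp add: G_def sum_distrib_left)
    qed
    have G: "cmod (G x) \<le> sqrt (C * k)"
    proof (rule maximum_modulus_frontier[where S = "cball (0::complex) r'" and f = G])
      show "G holomorphic_on interior (cball 0 r')" "continuous_on (closure (cball 0 r')) G"
        unfolding G_def by (intro holomorphic_intros continuous_intros)+
      fix z assume "z \<in> frontier (cball (0::complex) r')"
      then have z: "cmod z = r'" using r' by simp
      have "(cmod (K' z x))\<^sup>2 \<le> Re (K' z z) * k" unfolding k_def by (rule rk_entry_bound[OF rk])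
      also have "\<dots> \<le> C * k"
        using palm_diag_decreasing[OF \<alpha>(1) order_refl N, of z] KC[OF z, of N] k0
        by (intro mult_right_mono) (auto simp: K'_def)
      finally have "cmod (K' z x) \<le> sqrt (C * k)" by (rule real_le_rsqrt)
      moreover have "cmod (G z) \<le> cmod (K' z x)"
        unfolding KG norm_mult using Q1[OF z] by (simp add: mult_le_cancel_right1)
      ultimately show "cmod (G z) \<le> sqrt (C * k)" by simp
    qed (use x r' in auto)
    have "k\<^sup>2 \<le> (cmod (newton \<alpha> l x))\<^sup>2 * (C * k)"
    proof -
      have "k \<le> cmod (K' x x)" unfolding k_def by (rule complex_Re_le_cmod)
      then have "k\<^sup>2 \<le> (cmod (K' x x))\<^sup>2" using k0 by (rule power_mono)
      also have "\<dots> = (cmod (newton \<alpha> l x))\<^sup>2 * (cmod (G x))\<^sup>2" unfolding KG by (simp add: norm_mult power_mult_distrib)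
      also have "\<dots> \<le> (cmod (newton \<alpha> l x))\<^sup>2 * (sqrt (C * k))\<^sup>2"
        using G by (intro mult_left_mono power_mono) auto
      finally show ?thesis using C0 k0 by simp
    qed
    then have "k * k \<le> (C * (cmod (newton \<alpha> l x))\<^sup>2) * k" by (simp add: power2_eq_square mult_ac)
    then have "k \<le> C * (cmod (newton \<alpha> l x))\<^sup>2"
      using k0 C0 by (cases "k = 0") auto
    then show "Re (palm_kernel (KN N) \<alpha> l x x) \<le> C * (cmod (newton \<alpha> l x))\<^sup>2" by (simp add: k_def K'_def)
  qed
qed

text \<open>The induction divides by diagonal values at nodes, so their limits must not vanish. The
  Newton function j belongs to every space with N >= l and bounds the diagonal value at its node
  from below independently of N.\<close>

lemma palm_kernel_tendsto:
  assumes K: "is_reproducing_kernel \<phi> K" and \<alpha>: "inj_on \<alpha> {..<l}" and j: "j \<le> l"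
  shows "(\<lambda>N. palm_kernel (KN N) \<alpha> j x y) \<longlonglongrightarrow> palm_kernel K \<alpha> j x y"
    and "j < l \<Longrightarrow> palm_kernel K \<alpha> j (\<alpha> j) (\<alpha> j) \<noteq> 0"
proof -
  have nz: "palm_kernel K \<alpha> j (\<alpha> j) (\<alpha> j) \<noteq> 0"
    if lim: "(\<lambda>N. palm_kernel (KN N) \<alpha> j (\<alpha> j) (\<alpha> j)) \<longlonglongrightarrow> palm_kernel K \<alpha> j (\<alpha> j) (\<alpha> j)" and j: "j < l" for j
  proof -
    define s c where "s = newton \<alpha> j" and "c = (\<integral>z. (cmod (s z))\<^sup>2 \<partial>L)"
    have ev: "eventually (\<lambda>N. (cmod (s (\<alpha> j)))\<^sup>2 \<le> c * Re (palm_kernel (KN N) \<alpha> j (\<alpha> j) (\<alpha> j))) sequentially"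
      using eventually_ge_at_top[of l]
    proof eventually_elim
      case (elim N)
      then have rk: "rkernel L (lspan (newton \<alpha>) j N) (palm_kernel (KN N) \<alpha> j)"
        using j by (intro rkernel_palm[OF \<alpha>]) auto
      have "s \<in> lspan (newton \<alpha>) j N" unfolding s_def using j elim by (intro lspan_base) auto
      from rk_bound[OF rk this, of "\<alpha> j"] show ?case by (simp add: c_def)
    qed
    have "(\<lambda>N. c * Re (palm_kernel (KN N) \<alpha> j (\<alpha> j) (\<alpha> j))) \<longlonglongrightarrow> c * Re (palm_kernel K \<alpha> j (\<alpha> j) (\<alpha> j))"
      by (intro tendsto_intros lim)
    from tendsto_lowerbound[OF this ev] have "(cmod (s (\<alpha> j)))\<^sup>2 \<le> c * Re (palm_kernel K \<alpha> j (\<alpha> j) (\<alpha> j))" by simp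
    moreover have "s (\<alpha> j) \<noteq> 0" unfolding s_def by (rule newton_nonzero[OF \<alpha> j])
    ultimately show ?thesis by auto
  qed
  have lim: "j \<le> l \<Longrightarrow> (\<lambda>N. palm_kernel (KN N) \<alpha> j x y) \<longlonglongrightarrow> palm_kernel K \<alpha> j x y" for j x y
  proof (induction j arbitrary: x y)
    case 0
    show ?case using KN_tendsto[OF K] by simp
  next
    case (Suc j)
    then have IH: "\<And>x y. (\<lambda>N. palm_kernel (KN N) \<alpha> j x y) \<longlonglongrightarrow> palm_kernel K \<alpha> j x y" by simp
    have "palm_kernel K \<alpha> j (\<alpha> j) (\<alpha> j) \<noteq> 0" using nz[OF IH] Suc.prems by simp
    then show ?case by (auto intro!: tendsto_intros IH)
  qed
  show "(\<lambda>N. palm_kernel (KN N) \<alpha> j x y) \<longlonglongrightarrow> palm_kernel K \<alpha> j x y" by (rule lim[OF j])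
  show "j < l \<Longrightarrow> palm_kernel K \<alpha> j (\<alpha> j) (\<alpha> j) \<noteq> 0" using nz[OF lim[OF j]] by simp
qed

lemma kernel_det_limits:
  assumes K: "is_reproducing_kernel \<phi> K" and \<alpha>: "inj_on \<alpha> {..<l}"
  shows "(\<lambda>N. kernel_det (KN N) l \<alpha>) \<longlonglongrightarrow> kernel_det K l \<alpha>" and "kernel_det K l \<alpha> \<noteq> 0"
proof -
  show "(\<lambda>N. kernel_det (KN N) l \<alpha>) \<longlonglongrightarrow> kernel_det K l \<alpha>"
    unfolding kernel_det_eq_dt by (intro tendsto_dt KN_tendsto[OF K])
  have "kernel_det K l \<alpha> = (\<Prod>j<l. palm_kernel K \<alpha> j (\<alpha> j) (\<alpha> j))"
    using palm_kernel_tendsto(2)[OF K \<alpha>] by (intro kernel_det_palm_product) auto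
  then show "kernel_det K l \<alpha> \<noteq> 0" using palm_kernel_tendsto(2)[OF K \<alpha>] by auto
qed

lemma measurable_newton [measurable]: "newton \<alpha> i \<in> borel_measurable borel"
  unfolding newton_def[abs_def] by measurable

lemma measurable_palm_kernel_dt:
  assumes \<alpha>: "inj_on \<alpha> {..<l}" and N: "l \<le> N"
  shows "(\<lambda>x. dt k (\<lambda>i j. palm_kernel (KN N) \<alpha> l (x i) (x j))) \<in> borel_measurable (tuple_space k)"
proof (rule measurable_dt)
  fix i j assume ij: "i < k" "j < k"
  obtain b X where b: "\<And>x y. palm_kernel (KN N) \<alpha> l x y = (\<Sum>m<N - l. newton \<alpha> (l + m) x * b m y)"
    "\<And>m y. m < N - l \<Longrightarrow> b m y = (\<Sum>i<N - l. X i m * cnj (newton \<alpha> (l + i) y))"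
    by (rule palm_kernel_separated[OF \<alpha> N]) blast
  have e: "palm_kernel (KN N) \<alpha> l x y = (\<Sum>m<N - l. newton \<alpha> (l + m) x * (\<Sum>i<N - l. X i m * cnj (newton \<alpha> (l + i) y)))" for x y
    unfolding b(1) by (intro sum.cong refl) (simp add: b(2))
  have [measurable]: "(\<lambda>x. x i) \<in> borel_measurable (tuple_space k)" "(\<lambda>x. x j) \<in> borel_measurable (tuple_space k)"
    using ij measurable_component_singleton[of _ "{..<k}" "\<lambda>_. borel"] by auto
  show "(\<lambda>x. palm_kernel (KN N) \<alpha> l (x i) (x j)) \<in> borel_measurable (tuple_space k)"
    unfolding e by measurable
qed

text \<open>The mean of a product that is 1 outside a disc is a Fredholm series both at level N and
  in the limit. Hadamard's inequality with \<open>palm_diag_bound\<close> dominates the k-th term by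
  c^k / k! uniformly in N, so the limit is taken first in each integral and then in the sum.\<close>

lemma expectation_limit:
  fixes g :: "complex \<Rightarrow> real"
  assumes K: "is_reproducing_kernel \<phi> K" and \<alpha>: "inj_on \<alpha> {..<l}" "\<And>a. l \<le> a \<Longrightarrow> \<alpha> a = 0"
    and P: "is_dpp \<phi> (palm_kernel K \<alpha> l) P"
    and g: "g \<in> borel_measurable borel" "\<And>x. r < cmod x \<Longrightarrow> g x = 1"
    and C: "\<And>x. \<bar>g x - 1\<bar> * (cmod (newton \<alpha> l x))\<^sup>2 \<le> C x" "integrable L C" "\<And>k. integrable L (\<lambda>x. C x * cmod x ^ k)"
  shows "integrable P (\<lambda>X. \<Prod>x\<in>X \<inter> cball 0 r. g x)"
    and "(\<lambda>N. Re (EN \<alpha> l N (\<lambda>x. of_real (g x)))) \<longlonglongrightarrow> (\<integral>X. (\<Prod>x\<in>X \<inter> cball 0 r. g x) \<partial>P)"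
proof -
  interpret product_sigma_finite "\<lambda>_. L" using sigma_finite_lam by (simp add: product_sigma_finite_def)
  define f where "f x = g x - 1" for x
  have fm [measurable]: "f \<in> borel_measurable borel" unfolding f_def[abs_def] using g(1) by measurable
  have f0: "f x = 0" if "x \<notin> cball 0 r" for x using g(2)[of x] that by (simp add: f_def)
  obtain C1 where C1: "0 \<le> C1" "\<And>N x. l \<le> N \<Longrightarrow> cmod x \<le> r \<Longrightarrow>
    Re (palm_kernel (KN N) \<alpha> l x x) \<le> C1 * (cmod (newton \<alpha> l x))\<^sup>2"
    using palm_diag_bound[OF K \<alpha>, of r] by blast
  define \<kappa> where "\<kappa> x = C1 * (cmod (newton \<alpha> l x))\<^sup>2" for x
  have \<kappa>0: "0 \<le> \<kappa> x" for x using C1(1) by (simp add: \<kappa>_def)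
  define DN where "DN N k x = dt k (\<lambda>i j. palm_kernel (KN N) \<alpha> l (x i) (x j))" for N k and x :: "nat \<Rightarrow> complex"
  define \<rho> where "\<rho> k x = Re (kernel_det (palm_kernel K \<alpha> l) k x)" for k x
  have psdN: "psd k (\<lambda>i j. palm_kernel (KN N) \<alpha> l (x i) (x j))" if "l \<le> N" for N k x
    using that by (intro rk_psd[OF rkernel_palm[OF \<alpha>(1) order_refl]])
  have DN0: "0 \<le> Re (DN N k x)" if "l \<le> N" for N k x
    unfolding DN_def using psd_hadamard[OF psdN[OF that]] by blast
  have DNb: "Re (DN N k x) \<le> (\<Prod>i<k. \<kappa> (x i))" if N: "l \<le> N" and x: "\<And>i. i < k \<Longrightarrow> x i \<in> cball 0 r" for N k x
  proof -
    have "Re (DN N k x) \<le> (\<Prod>i<k. Re (palm_kernel (KN N) \<alpha> l (x i) (x i)))"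
      unfolding DN_def using psd_hadamard[OF psdN[OF N]] by blast
    also have "\<dots> \<le> (\<Prod>i<k. \<kappa> (x i))"
      unfolding \<kappa>_def using N x C1(2)[OF N] rk_diag_nonneg[OF rkernel_palm[OF \<alpha>(1) order_refl N]]
      by (intro prod_mono) auto
    finally show ?thesis .
  qed
  have DNlim: "(\<lambda>N. Re (DN N k x)) \<longlonglongrightarrow> \<rho> k x" for k x
    unfolding DN_def \<rho>_def kernel_det_eq_dt
    by (intro tendsto_Re tendsto_dt palm_kernel_tendsto(1)[OF K \<alpha>(1) order_refl])
  have evl: "eventually (\<lambda>N. l \<le> N) sequentially" by (rule eventually_ge_at_top)
  have \<rho>0: "0 \<le> \<rho> k x" for k x
    by (rule tendsto_lowerbound[OF DNlim eventually_mono[OF evl DN0]]) (assumption | rule sequentially_bot)+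
  have \<rho>b: "\<rho> k x \<le> (\<Prod>i<k. \<kappa> (x i))" if "\<And>i. i < k \<Longrightarrow> x i \<in> cball 0 r" for k x
    by (rule tendsto_upperbound[OF DNlim eventually_mono[OF evl DNb[OF _ that]]]) (assumption | rule sequentially_bot)+
  \<comment> \<open>Levels below l are replaced by l, so that the domination holds for every
    N.\<close>
  have DNm: "DN (max l N) k \<in> borel_measurable (tuple_space k)" for N k
    unfolding DN_def[abs_def] by (rule measurable_palm_kernel_dt[OF \<alpha>(1)]) simp
  have \<rho>m: "\<rho> k \<in> borel_measurable (tuple_space k)" for k
  proof (rule borel_measurable_LIMSEQ_real)
    show "(\<lambda>N. Re (DN (max l N) k x)) \<longlonglongrightarrow> \<rho> k x" for x
      by (rule Lim_transform_eventually[OF DNlim eventually_mono[OF evl]]) (simp add: max_def)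
    show "(\<lambda>x. Re (DN (max l N) k x)) \<in> borel_measurable (tuple_space k)" for N
      using DNm by (rule measurable_compose) simp
  qed
  have P': "sets P = sets conf_space" "\<And>k. has_correlation \<phi> P k (\<rho> k)"
    using P by (auto simp: is_dpp_def \<rho>_def[abs_def])
  have fk: "integrable L (\<lambda>x. \<bar>f x\<bar> * \<kappa> x)"
  proof (rule Bochner_Integration.integrable_bound)
    show "integrable L (\<lambda>x. C1 * C x)" using C(2) by simp
    show "(\<lambda>x. \<bar>f x\<bar> * \<kappa> x) \<in> borel_measurable L" unfolding \<kappa>_def[abs_def] measurable_lam by measurable
    show "AE x in L. norm (\<bar>f x\<bar> * \<kappa> x) \<le> norm (C1 * C x)"
    proof (intro AE_I2)
      fix x
      have "C1 * (\<bar>f x\<bar> * (cmod (newton \<alpha> l x))\<^sup>2) \<le> C1 * C x" using C(1)[of x] C1(1) by (intro mult_left_mono) (auto simp: f_def)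
      also have "\<dots> \<le> norm (C1 * C x)" by simp
      finally show "norm (\<bar>f x\<bar> * \<kappa> x) \<le> norm (C1 * C x)" using C1(1) by (simp add: \<kappa>_def abs_mult mult_ac)
    qed
  qed
  note E = sigma_finite_expectation_prod[OF bounded_cball borel_closed[OF closed_cball] sigma_finite_lam P' \<rho>m \<rho>0 fm f0 \<kappa>0 fk \<rho>b]
  have f1: "1 + f x = g x" for x by (simp add: f_def)
  show "integrable P (\<lambda>X. \<Prod>x\<in>X \<inter> cball 0 r. g x)" using E(1) unfolding f1 .
  define c where "c = (\<integral>x. \<bar>f x\<bar> * \<kappa> x \<partial>L)"
  have le: "norm ((\<Prod>i<k. f (x i)) * R) \<le> (\<Prod>i<k. \<bar>f (x i)\<bar> * \<kappa> (x i))"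
    if "0 \<le> R" "(\<And>i. i < k \<Longrightarrow> x i \<in> cball 0 r) \<Longrightarrow> R \<le> (\<Prod>i<k. \<kappa> (x i))" for k and x :: "nat \<Rightarrow> complex" and R
  proof (cases "\<exists>i<k. x i \<notin> cball 0 r")
    case True
    then have z: "(\<Prod>i<k. f (x i)) = 0" using f0 by (intro prod_zero) auto
    show ?thesis unfolding z using \<kappa>0 by (auto intro!: prod_nonneg)
  next
    case False
    then show ?thesis using that by (auto simp: abs_mult abs_prod prod.distrib intro!: mult_left_mono prod_nonneg)
  qed
  have dom: "integrable (\<Pi>\<^sub>M i\<in>{..<k}. L) (\<lambda>x. \<Prod>i<k. \<bar>f (x i)\<bar> * \<kappa> (x i))" for k :: nat
    using fk by (intro product_integrable_prod) auto
  have domi: "(\<integral>x. (\<Prod>i<k. \<bar>f (x i)\<bar> * \<kappa> (x i)) \<partial>(\<Pi>\<^sub>M i\<in>{..<k}. L)) = c ^ k" for k :: nat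
    using product_integral_prod[of "{..<k}" "\<lambda>_ x. \<bar>f x\<bar> * \<kappa> x"] fk by (simp add: c_def)
  have Fm: "(\<lambda>x. \<Prod>i<k. f (x i)) \<in> borel_measurable (\<Pi>\<^sub>M i\<in>{..<k}. L)" for k :: nat
    unfolding measurable_PiM_lam
    by (intro borel_measurable_prod measurable_compose[OF measurable_component_singleton[where M = "\<lambda>_. borel"] fm]) auto
  have FDm: "(\<lambda>x. (\<Prod>i<k. f (x i)) * Re (DN (max l N) k x)) \<in> borel_measurable (\<Pi>\<^sub>M i\<in>{..<k}. L)" for k N
    using DNm[of N k] Fm[of k] unfolding measurable_PiM_lam by (intro borel_measurable_times measurable_compose[OF DNm]) auto
  define a where "a N k = (\<integral>x. (\<Prod>i<k. f (x i)) * Re (DN (max l N) k x) \<partial>(\<Pi>\<^sub>M i\<in>{..<k}. L)) / fact k" for N k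
  have alim: "(\<lambda>N. a N k) \<longlonglongrightarrow> (\<integral>x. (\<Prod>i<k. f (x i)) * \<rho> k x \<partial>(\<Pi>\<^sub>M i\<in>{..<k}. L)) / fact k" for k
    unfolding a_def
  proof (intro tendsto_divide tendsto_const)
    show "(\<lambda>N. \<integral>x. (\<Prod>i<k. f (x i)) * Re (DN (max l N) k x) \<partial>(\<Pi>\<^sub>M i\<in>{..<k}. L)) \<longlonglongrightarrow>
        (\<integral>x. (\<Prod>i<k. f (x i)) * \<rho> k x \<partial>(\<Pi>\<^sub>M i\<in>{..<k}. L))"
    proof (rule integral_dominated_convergence[OF _ FDm dom])
      show "(\<lambda>x. (\<Prod>i<k. f (x i)) * \<rho> k x) \<in> borel_measurable (\<Pi>\<^sub>M i\<in>{..<k}. L)"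
        using \<rho>m[of k] Fm[of k] unfolding measurable_PiM_lam by (intro borel_measurable_times)
      show "AE x in \<Pi>\<^sub>M i\<in>{..<k}. L. (\<lambda>N. (\<Prod>i<k. f (x i)) * Re (DN (max l N) k x)) \<longlonglongrightarrow> (\<Prod>i<k. f (x i)) * \<rho> k x"
        by (intro AE_I2 tendsto_mult tendsto_const Lim_transform_eventually[OF DNlim eventually_mono[OF evl]])
          (simp add: max_absorb2)
      show "AE x in \<Pi>\<^sub>M i\<in>{..<k}. L. norm ((\<Prod>i<k. f (x i)) * Re (DN (max l N) k x)) \<le> (\<Prod>i<k. \<bar>f (x i)\<bar> * \<kappa> (x i))" for N
        by (intro AE_I2 le DN0 DNb) auto
    qed
  qed simp
  have ab: "norm (a N k) \<le> c ^ k / fact k" for N k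
  proof -
    have "norm (\<integral>x. (\<Prod>i<k. f (x i)) * Re (DN (max l N) k x) \<partial>(\<Pi>\<^sub>M i\<in>{..<k}. L)) \<le>
        (\<integral>x. (\<Prod>i<k. \<bar>f (x i)\<bar> * \<kappa> (x i)) \<partial>(\<Pi>\<^sub>M i\<in>{..<k}. L))"
    proof (rule order_trans[OF integral_norm_bound integral_mono])
      show "integrable (\<Pi>\<^sub>M i\<in>{..<k}. L) (\<lambda>x. norm ((\<Prod>i<k. f (x i)) * Re (DN (max l N) k x)))"
        by (intro integrable_norm, rule Bochner_Integration.integrable_bound[OF dom FDm])
          (intro AE_I2 order_trans[OF le[OF DN0 DNb]], auto)
      show "norm ((\<Prod>i<k. f (x i)) * Re (DN (max l N) k x)) \<le> (\<Prod>i<k. \<bar>f (x i)\<bar> * \<kappa> (x i))" for x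
        by (intro le DN0 DNb) auto
    qed (rule dom)
    then show ?thesis unfolding domi by (simp add: a_def divide_right_mono)
  qed
  have summ: "summable (\<lambda>k. c ^ k / fact k)"
    using summable_exp_generic[of c] by (simp add: scaleR_conv_of_real divide_inverse mult.commute)
  have "(\<lambda>N. \<Sum>k. a N k) \<longlonglongrightarrow> (\<Sum>k. (\<integral>x. (\<Prod>i<k. f (x i)) * \<rho> k x \<partial>(\<Pi>\<^sub>M i\<in>{..<k}. L)) / fact k)"
    by (rule tannerys_theorem[where a = "\<lambda>k N. a N k" and M = "\<lambda>k. c ^ k / fact k", THEN conjunct2, THEN conjunct2])
      (use ab in \<open>auto intro!: always_eventually alim summ\<close>)
  also have "(\<Sum>k. (\<integral>x. (\<Prod>i<k. f (x i)) * \<rho> k x \<partial>(\<Pi>\<^sub>M i\<in>{..<k}. L)) / fact k) = (\<integral>X. (\<Prod>x\<in>X \<inter> cball 0 r. g x) \<partial>P)"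
    using E(2) unfolding f1 by (rule sums_unique[symmetric])
  finally have lim: "(\<lambda>N. \<Sum>k. a N k) \<longlonglongrightarrow> (\<integral>X. (\<Prod>x\<in>X \<inter> cball 0 r. g x) \<partial>P)" .
  have "(\<Sum>k. a N k) = Re (EN \<alpha> l N (\<lambda>x. of_real (g x)))" if N: "l \<le> N" for N
  proof -
    have intc: "integrable L (\<lambda>x. complex_of_real (f x) * newton \<alpha> (l + i) x * cnj (newton \<alpha> (l + j) x))" for i j
    proof (rule Bochner_Integration.integrable_bound)
      show "integrable L (\<lambda>x. C x * cmod x ^ (i + j))" by (rule C(3))
      show "(\<lambda>x. complex_of_real (f x) * newton \<alpha> (l + i) x * cnj (newton \<alpha> (l + j) x)) \<in> borel_measurable L"
        unfolding measurable_lam by measurable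
      show "AE x in L. norm (complex_of_real (f x) * newton \<alpha> (l + i) x * cnj (newton \<alpha> (l + j) x)) \<le> norm (C x * cmod x ^ (i + j))"
      proof (intro AE_I2)
        fix x
        have "norm (complex_of_real (f x) * newton \<alpha> (l + i) x * cnj (newton \<alpha> (l + j) x)) =
            (\<bar>f x\<bar> * (cmod (newton \<alpha> l x))\<^sup>2) * cmod x ^ (i + j)"
          using newton_tail[where l = l and \<alpha> = \<alpha>, OF \<alpha>(2)]
          by (simp add: norm_mult norm_power power_add power2_eq_square mult_ac)
        also have "\<dots> \<le> C x * cmod x ^ (i + j)" using C(1)[of x] by (intro mult_right_mono) (auto simp: f_def)
        also have "\<dots> \<le> norm (C x * cmod x ^ (i + j))" by simp
        finally show "norm (complex_of_real (f x) * newton \<alpha> (l + i) x * cnj (newton \<alpha> (l + j) x)) \<le> norm (C x * cmod x ^ (i + j))" .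
      qed
    qed
    note F = EN_fredholm[OF \<alpha>(1) N intc]
    have "a N k = Re ((\<integral>x. (\<Prod>i<k. complex_of_real (f (x i))) * dt k (\<lambda>i j. palm_kernel (KN N) \<alpha> l (x i) (x j)) \<partial>(\<Pi>\<^sub>M i\<in>{..<k}. L)) / fact k)" for k
    proof -
      have "Re (\<integral>x. (\<Prod>i<k. complex_of_real (f (x i))) * dt k (\<lambda>i j. palm_kernel (KN N) \<alpha> l (x i) (x j)) \<partial>(\<Pi>\<^sub>M i\<in>{..<k}. L)) =
        (\<integral>x. Re ((\<Prod>i<k. complex_of_real (f (x i))) * dt k (\<lambda>i j. palm_kernel (KN N) \<alpha> l (x i) (x j))) \<partial>(\<Pi>\<^sub>M i\<in>{..<k}. L))"
        by (rule integral_Re[symmetric, OF F(1)])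
      also have "\<dots> = (\<integral>x. (\<Prod>i<k. f (x i)) * Re (DN (max l N) k x) \<partial>(\<Pi>\<^sub>M i\<in>{..<k}. L))"
        using N by (intro Bochner_Integration.integral_cong refl) (simp add: DN_def max_absorb2 flip: of_real_prod)
      finally have e: "Re (\<integral>x. (\<Prod>i<k. complex_of_real (f (x i))) * dt k (\<lambda>i j. palm_kernel (KN N) \<alpha> l (x i) (x j)) \<partial>(\<Pi>\<^sub>M i\<in>{..<k}. L)) =
        (\<integral>x. (\<Prod>i<k. f (x i)) * Re (DN (max l N) k x) \<partial>(\<Pi>\<^sub>M i\<in>{..<k}. L))" .
      have "Re (z / fact k) = Re z / fact k" for z using Re_divide_of_real[of z "fact k"] by simp
      then show ?thesis unfolding a_def e[symmetric] by simp
    qed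
    then have "(\<lambda>k. a N k) sums Re (EN \<alpha> l N (\<lambda>x. complex_of_real (f x) + 1))"
      using sums_Re[OF F(2)] by simp
    moreover have "complex_of_real (f x) + 1 = of_real (g x)" for x by (simp add: f_def)
    ultimately show ?thesis by (simp add: sums_iff)
  qed
  then show "(\<lambda>N. Re (EN \<alpha> l N (\<lambda>x. of_real (g x)))) \<longlonglongrightarrow> (\<integral>X. (\<Prod>x\<in>X \<inter> cball 0 r. g x) \<partial>P)"
    by (intro Lim_transform_eventually[OF lim eventually_mono[OF evl]])
qed

end

section \<open>\<open>L\<^sup>1\<close> limits\<close>

text \<open>Completeness of L^1 for a family indexed by reals: a sequence of parameters with
  geometrically decreasing steps converges almost everywhere and in the mean, and the Cauchy
  property carries this over to the whole family.\<close>

lemma L1_cauchy_limit: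
  fixes f :: "real \<Rightarrow> 'a \<Rightarrow> real"
  assumes f: "\<And>R. integrable M (f R)"
    and cauchy: "\<And>e. 0 < e \<Longrightarrow> \<exists>R0. \<forall>R\<ge>R0. \<forall>S\<ge>R0. (\<integral>x. \<bar>f R x - f S x\<bar> \<partial>M) < e"
  obtains g where "L1_limit M f g"
proof -
  have "\<forall>n. \<exists>R0. \<forall>R\<ge>R0. \<forall>S\<ge>R0. (\<integral>x. \<bar>f R x - f S x\<bar> \<partial>M) < (1 / 2) ^ n"
    using cauchy by simp
  then obtain c where c: "\<And>n R S. c n \<le> R \<Longrightarrow> c n \<le> S \<Longrightarrow> (\<integral>x. \<bar>f R x - f S x\<bar> \<partial>M) < (1 / 2) ^ n"
    by metis
  \<comment> \<open>\<open>r n\<close> lies beyond every threshold \<open>c k\<close> with k <=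
    n.\<close>
  define r where "r n = (\<Sum>k\<le>n. \<bar>c k\<bar>)" for n
  have r: "c n \<le> r m" if "n \<le> m" for n m
  proof -
    have "\<bar>c n\<bar> \<le> r m" unfolding r_def using that by (intro member_le_sum) auto
    then show ?thesis by linarith
  qed
  define d where "d n x = f (r (Suc n)) x - f (r n) x" for n x
  have di: "integrable M (d n)" for n unfolding d_def[abs_def] using f by simp
  have dn: "(\<integral>x. norm (d n x) \<partial>M) \<le> (1 / 2) ^ n" for n
    using c[of n "r (Suc n)" "r n"] r by (simp add: d_def less_imp_le)
  have ds: "summable (\<lambda>n. \<integral>x. norm (d n x) \<partial>M)"
    by (rule summable_comparison_test'[OF summable_geometric[of "1 / 2 :: real"], of 0])
      (use dn in auto)
  have dA: "AE x in M. summable (\<lambda>n. norm (d n x))"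
  proof -
    have "(\<integral>\<^sup>+x. (\<Sum>n. ennreal (norm (d n x))) \<partial>M) = (\<Sum>n. \<integral>\<^sup>+x. ennreal (norm (d n x)) \<partial>M)"
      using di by (intro nn_integral_suminf) auto
    also have "\<dots> = (\<Sum>n. ennreal (\<integral>x. norm (d n x) \<partial>M))"
      using di by (intro suminf_cong nn_integral_eq_integral) auto
    also have "\<dots> = ennreal (\<Sum>n. \<integral>x. norm (d n x) \<partial>M)"
      by (rule suminf_ennreal2[OF _ ds]) simp
    finally have "(\<integral>\<^sup>+x. (\<Sum>n. ennreal (norm (d n x))) \<partial>M) \<noteq> \<infinity>" by simp
    moreover have "(\<lambda>x. \<Sum>n. ennreal (norm (d n x))) \<in> borel_measurable M"
      using borel_measurable_integrable[OF di] by measurable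
    ultimately have "AE x in M. (\<Sum>n. ennreal (norm (d n x))) \<noteq> \<infinity>" by (rule nn_integral_PInf_AE[rotated])
    then show ?thesis by eventually_elim (rule summable_suminf_not_top, auto simp: top_unique)
  qed
  define g where "g x = f (r 0) x + (\<Sum>n. d n x)" for x
  have g: "integrable M g"
    unfolding g_def[abs_def] by (intro Bochner_Integration.integrable_add f integrable_suminf di dA ds)
  have fr: "f (r n) x = f (r 0) x + (\<Sum>k<n. d k x)" for n x
    by (induction n) (simp_all add: d_def)
  have lim: "(\<lambda>n. \<integral>x. \<bar>f (r n) x - g x\<bar> \<partial>M) \<longlonglongrightarrow> (\<integral>x. 0 \<partial>M)"
  proof (rule integral_dominated_convergence)
    show "integrable M (\<lambda>x. 2 * (\<Sum>n. norm (d n x)))"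
      by (intro integrable_mult_right integrable_suminf) (use di dA ds in auto)
    show "AE x in M. (\<lambda>n. \<bar>f (r n) x - g x\<bar>) \<longlonglongrightarrow> 0"
      using dA
    proof eventually_elim
      case (elim x)
      have "(\<lambda>n. \<Sum>k<n. d k x) \<longlonglongrightarrow> (\<Sum>k. d k x)"
        by (rule summable_LIMSEQ[OF summable_norm_cancel[OF elim]])
      then have "(\<lambda>n. f (r 0) x + (\<Sum>k<n. d k x)) \<longlonglongrightarrow> g x"
        unfolding g_def by (intro tendsto_add tendsto_const)
      then have "(\<lambda>n. f (r n) x) \<longlonglongrightarrow> g x" by (simp only: fr[symmetric])
      then show ?case using tendsto_rabs_zero[OF LIM_zero] by auto
    qed
    show "AE x in M. norm \<bar>f (r n) x - g x\<bar> \<le> 2 * (\<Sum>n. norm (d n x))" for n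
      using dA
    proof eventually_elim
      case (elim x)
      have "norm (\<Sum>k<n. d k x) \<le> (\<Sum>n. norm (d n x))"
        using sum_le_suminf[OF elim, of "{..<n}"] by (intro order_trans[OF norm_sum]) auto
      moreover have "norm (\<Sum>k. d k x) \<le> (\<Sum>n. norm (d n x))" by (rule summable_norm[OF elim])
      ultimately show ?case unfolding fr[of n x] g_def by simp
    qed
  qed (use f g in auto)
  have "((\<lambda>R. \<integral>x. \<bar>f R x - g x\<bar> \<partial>M) \<longlongrightarrow> 0) at_top"
  proof (rule tendstoI)
    fix e :: real assume e: "0 < e"
    obtain n1 where n1: "(1 / 2 :: real) ^ n1 < e / 2"
      using real_arch_pow_inv[of "e / 2" "1 / 2"] e by auto
    have "eventually (\<lambda>n. (\<integral>x. \<bar>f (r n) x - g x\<bar> \<partial>M) < e / 2) sequentially"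
      using lim e by (intro order_tendstoD(2)[where y = "\<integral>x. 0 \<partial>M"]) auto
    then obtain n2 where n2: "\<And>n. n2 \<le> n \<Longrightarrow> (\<integral>x. \<bar>f (r n) x - g x\<bar> \<partial>M) < e / 2"
      unfolding eventually_sequentially by blast
    define n where "n = max n1 n2"
    show "eventually (\<lambda>R. dist (\<integral>x. \<bar>f R x - g x\<bar> \<partial>M) 0 < e) at_top"
      using eventually_ge_at_top[of "c n1"]
    proof eventually_elim
      case (elim R)
      have "(\<integral>x. \<bar>f R x - g x\<bar> \<partial>M) \<le> (\<integral>x. \<bar>f R x - f (r n) x\<bar> + \<bar>f (r n) x - g x\<bar> \<partial>M)"
        using f g by (intro integral_mono) auto
      also have "\<dots> = (\<integral>x. \<bar>f R x - f (r n) x\<bar> \<partial>M) + (\<integral>x. \<bar>f (r n) x - g x\<bar> \<partial>M)"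
        using f g by (intro Bochner_Integration.integral_add) auto
      also have "\<dots> < e" using c[of n1 R "r n"] elim r[of n1 n] n1 n2[of n] by (simp add: n_def)
      finally show ?case by simp
    qed
  qed
  then show ?thesis using f g by (intro that) (simp add: L1_limit_def)
qed

lemma L1_limit_integral:
  assumes "L1_limit M f g" and T: "((\<lambda>R. \<integral>x. f R x \<partial>M) \<longlongrightarrow> T) at_top"
  shows "(\<integral>x. g x \<partial>M) = T"
proof -
  from assms(1) have f: "\<And>R. integrable M (f R)" and g: "integrable M g"
    and l: "((\<lambda>R. \<integral>x. \<bar>f R x - g x\<bar> \<partial>M) \<longlongrightarrow> 0) at_top" by (auto simp: L1_limit_def)
  have "((\<lambda>R. (\<integral>x. f R x \<partial>M) - (\<integral>x. g x \<partial>M)) \<longlongrightarrow> 0) at_top"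
  proof (rule Lim_null_comparison[OF always_eventually l], intro allI)
    fix R
    have "norm (\<integral>x. f R x - g x \<partial>M) \<le> (\<integral>x. norm (f R x - g x) \<partial>M)" by (rule integral_norm_bound)
    then show "norm ((\<integral>x. f R x \<partial>M) - (\<integral>x. g x \<partial>M)) \<le> (\<integral>x. \<bar>f R x - g x\<bar> \<partial>M)"
      using f g by simp
  qed
  then have "((\<lambda>R. \<integral>x. f R x \<partial>M) \<longlongrightarrow> (\<integral>x. g x \<partial>M)) at_top" by (rule LIM_zero_cancel)
  with T show ?thesis by (intro tendsto_unique[of at_top]) auto
qed

text \<open>The difference of squares factors, so that an \<open>L\<^sup>2\<close> Cauchy family has squares that are Cauchy in \<open>L\<^sup>1\<close>.\<close>

lemma L2_cauchy_squares:
  fixes F :: "real \<Rightarrow> 'a \<Rightarrow> real" and \<eta> :: "real \<Rightarrow> real"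
  assumes int: "\<And>R S. integrable M (\<lambda>x. F R x * F S x)"
    and T: "((\<lambda>R. \<integral>x. F R x * F R x \<partial>M) \<longlongrightarrow> T) at_top"
    and \<eta>: "(\<eta> \<longlongrightarrow> 0) at_top"
    and le: "\<And>R S. R0 \<le> R \<Longrightarrow> R0 \<le> S \<Longrightarrow>
      (\<integral>x. F R x * F R x \<partial>M) + (\<integral>x. F S x * F S x \<partial>M) - 2 * (\<integral>x. F R x * F S x \<partial>M) \<le> \<eta> R + \<eta> S"
    and e: "0 < e"
  shows "\<exists>R1. \<forall>R\<ge>R1. \<forall>S\<ge>R1. (\<integral>x. \<bar>F R x * F R x - F S x * F S x\<bar> \<partial>M) < e"
proof -
  define I where "I R S = (\<integral>x. F R x * F S x \<partial>M)" for R S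
  \<comment> \<open>\<open>s\<close> balances the two parts of |u v| <= u^2 / (2 s) + s v^2 / 2 for
    u and v the difference and the sum of \<open>F R\<close> and \<open>F S\<close>; with this value
    each part contributes at most e / 4.\<close>
  define s where "s = e / (8 * (\<bar>T\<bar> + 1))"
  have s: "0 < s" using e by (simp add: s_def)
  have sT: "s * (2 * (\<bar>T\<bar> + 1)) = e / 4" by (simp add: s_def field_simps)
  have "eventually (\<lambda>R. I R R < \<bar>T\<bar> + 1) at_top"
    unfolding I_def by (rule order_tendstoD(2)[OF T]) linarith
  moreover have "eventually (\<lambda>R. \<eta> R < s * e / 4) at_top"
    using s e by (intro order_tendstoD(2)[OF \<eta>]) simp
  ultimately have "eventually (\<lambda>R. I R R < \<bar>T\<bar> + 1 \<and> \<eta> R < s * e / 4 \<and> R0 \<le> R) at_top"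
    using eventually_ge_at_top[of R0] by eventually_elim simp
  then obtain R1 where R1: "\<And>R. R1 \<le> R \<Longrightarrow> I R R < \<bar>T\<bar> + 1 \<and> \<eta> R < s * e / 4 \<and> R0 \<le> R"
    unfolding eventually_at_top_linorder by blast
  show ?thesis
  proof (intro exI allI impI)
    fix R S assume "R1 \<le> R" "R1 \<le> S"
    note R = R1[OF this(1)] and S = R1[OF this(2)]
    define D where "D = I R R + I S S - 2 * I R S"
    have D: "D \<le> s * e / 2" using le[of R S] R S by (simp add: D_def I_def)
    \<comment> \<open>Nonnegativity bounds 2 \<open>I R S\<close> by \<open>I R R + I S S\<close>,
      which controls the mean square of \<open>F R + F S\<close>.\<close>
    have D0: "0 \<le> D"
    proof -
      have "0 \<le> (\<integral>x. (F R x - F S x)\<^sup>2 \<partial>M)" by simp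
      also have "(\<lambda>x. (F R x - F S x)\<^sup>2) = (\<lambda>x. (F R x * F R x + F S x * F S x) - 2 * (F R x * F S x))"
        by (simp add: power2_eq_square algebra_simps)
      finally show ?thesis using int by (simp add: D_def I_def)
    qed
    have pw: "\<bar>F R x * F R x - F S x * F S x\<bar> \<le>
       1 / (2 * s) * (F R x * F R x + F S x * F S x - 2 * (F R x * F S x)) +
       s / 2 * (F R x * F R x + F S x * F S x + 2 * (F R x * F S x))" for x
    proof -
      define u v where "u = F R x - F S x" and "v = F R x + F S x"
      have "0 \<le> (\<bar>u\<bar> - s * \<bar>v\<bar>)\<^sup>2" by simp
      then have "2 * s * (\<bar>u\<bar> * \<bar>v\<bar>) \<le> u * u + s * s * (v * v)"
        by (simp add: power2_eq_square algebra_simps flip: abs_mult)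
      then have "\<bar>u * v\<bar> \<le> 1 / (2 * s) * (u * u) + s / 2 * (v * v)"
        using s by (simp add: field_simps abs_mult)
      then show ?thesis by (simp add: u_def v_def algebra_simps)
    qed
    have "(\<integral>x. \<bar>F R x * F R x - F S x * F S x\<bar> \<partial>M) \<le>
      (\<integral>x. 1 / (2 * s) * (F R x * F R x + F S x * F S x - 2 * (F R x * F S x)) +
       s / 2 * (F R x * F R x + F S x * F S x + 2 * (F R x * F S x)) \<partial>M)"
      using int pw by (intro integral_mono) (auto simp del: integrable_mult_left_iff integrable_mult_right_iff intro!: integrable_mult_right)
    also have "\<dots> = 1 / (2 * s) * D + s / 2 * (I R R + I S S + 2 * I R S)"
      using int by (simp add: D_def I_def)
    also have "\<dots> \<le> 1 / (2 * s) * (s * e / 2) + s / 2 * (4 * (\<bar>T\<bar> + 1))"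
      using D D0 R S s by (intro add_mono mult_left_mono) (auto simp: D_def)
    also have "\<dots> = e / 2" using sT s by (simp add: field_simps)
    also have "\<dots> < e" using e by simp
    finally show "(\<integral>x. \<bar>F R x * F R x - F S x * F S x\<bar> \<partial>M) < e" .
  qed
qed

section \<open>Uniform bounds for truncated expectations\<close>

context radial_weight begin

text \<open>\<open>EN\<close> is a mean against the nonnegative density det / (N - l)!, so an
  inequality between products that holds for all points passes to the means. The list of pairs
  encodes a finite linear combination.\<close>

lemma EN_positive:
  assumes \<alpha>: "inj_on \<alpha> {..<l}" and N: "l \<le> N"
    and int: "\<And>c f i j. (c, f) \<in> set fs \<Longrightarrow> integrable L (\<lambda>x. f x * newton \<alpha> (l + i) x * cnj (newton \<alpha> (l + j) x))"
    and pos: "\<And>x :: nat \<Rightarrow> complex. 0 \<le> (\<Sum>(c, f)\<leftarrow>fs. c * Re (\<Prod>i<N - l. f (x i)))"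
  shows "0 \<le> (\<Sum>(c, f)\<leftarrow>fs. c * Re (EN \<alpha> l N f))"
proof -
  define n where "n = N - l"
  let ?P = "\<Pi>\<^sub>M i\<in>{..<n}. L"
  define D where "D x = dt n (\<lambda>i j. palm_kernel (KN N) \<alpha> l (x i) (x j))" for x
  have psd: "psd n (\<lambda>i j. palm_kernel (KN N) \<alpha> l (x i) (x j))" for x
    using N by (intro rk_psd[OF rkernel_palm[OF \<alpha> order_refl]])
  have D: "D x = of_real (Re (D x))" "0 \<le> Re (D x)" for x
    unfolding D_def using dt_psd_of_real[OF psd] psd_hadamard[OF psd] by blast+
  have "integrable ?P (\<lambda>x. (\<Sum>(c, f)\<leftarrow>gs. c * Re (\<Prod>i<n. f (x i))) * Re (D x)) \<and>
    (\<integral>x. (\<Sum>(c, f)\<leftarrow>gs. c * Re (\<Prod>i<n. f (x i))) * Re (D x) \<partial>?P) = fact n * (\<Sum>(c, f)\<leftarrow>gs. c * Re (EN \<alpha> l N f))"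
    if "set gs \<subseteq> set fs" for gs
    using that
  proof (induction gs)
    case (Cons a gs)
    obtain c f where a: "a = (c, f)" by (cases a)
    then have cf: "(c, f) \<in> set fs" using Cons.prems by simp
    note F = EN_fredholm[OF \<alpha> N int[OF cf], folded n_def]
    note F1' = F(1)[of n, folded D_def] and F3' = F(3)[folded D_def]
    \<comment> \<open>The density is real, so taking real parts commutes with multiplication by
      it.\<close>
    have e: "(\<lambda>x. Re ((\<Prod>i<n. f (x i)) * D x)) = (\<lambda>x. Re (\<Prod>i<n. f (x i)) * Re (D x))"
      by (subst D(1)) simp
    have F1: "integrable ?P (\<lambda>x. Re (\<Prod>i<n. f (x i)) * Re (D x))"
      using F1' unfolding e[symmetric] by (rule integrable_Re)
    have "(\<integral>x. Re (\<Prod>i<n. f (x i)) * Re (D x) \<partial>?P) = Re (fact n * EN \<alpha> l N f)"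
      unfolding e[symmetric] integral_Re[OF F1'] F3' ..
    also have "\<dots> = fact n * Re (EN \<alpha> l N f)" using Re_complex_of_real[of "fact n"] by simp
    finally have F3: "(\<integral>x. Re (\<Prod>i<n. f (x i)) * Re (D x) \<partial>?P) = fact n * Re (EN \<alpha> l N f)" .
    have s: "(\<lambda>x. (\<Sum>(c, f)\<leftarrow>a # gs. c * Re (\<Prod>i<n. f (x i))) * Re (D x)) =
      (\<lambda>x. c * (Re (\<Prod>i<n. f (x i)) * Re (D x)) + (\<Sum>(c, f)\<leftarrow>gs. c * Re (\<Prod>i<n. f (x i))) * Re (D x))"
      by (simp add: a algebra_simps)
    from Cons have IH: "integrable ?P (\<lambda>x. (\<Sum>(c, f)\<leftarrow>gs. c * Re (\<Prod>i<n. f (x i))) * Re (D x))"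
      "(\<integral>x. (\<Sum>(c, f)\<leftarrow>gs. c * Re (\<Prod>i<n. f (x i))) * Re (D x) \<partial>?P) = fact n * (\<Sum>(c, f)\<leftarrow>gs. c * Re (EN \<alpha> l N f))"
      by auto
    have i1: "integrable ?P (\<lambda>x. c * (Re (\<Prod>i<n. f (x i)) * Re (D x)))" using F1 by (rule integrable_mult_right)
    show ?case unfolding s Bochner_Integration.integral_add[OF i1 IH(1)] IH(2) integral_mult_right_zero F3
      using Bochner_Integration.integrable_add[OF i1 IH(1)] by (simp add: a algebra_simps)
  qed simp
  from this[OF order_refl] have e: "(\<integral>x. (\<Sum>(c, f)\<leftarrow>fs. c * Re (\<Prod>i<n. f (x i))) * Re (D x) \<partial>?P) = fact n * (\<Sum>(c, f)\<leftarrow>fs. c * Re (EN \<alpha> l N f))"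
    by blast
  have "0 \<le> fact n * (\<Sum>(c, f)\<leftarrow>fs. c * Re (EN \<alpha> l N f))"
    unfolding e[symmetric] using pos D(2) by (intro integral_nonneg_AE AE_I2 mult_nonneg_nonneg) (auto simp: n_def)
  then show ?thesis using mult_left_le_imp_le[of "fact n :: real" 0 "\<Sum>(c, f)\<leftarrow>fs. c * Re (EN \<alpha> l N f)"] by simp
qed

text \<open>Here \<open>c\<close> will be the full ratio and \<open>a\<close>, \<open>b\<close> two
  truncations, with products C, A and B. Since the moduli of A and B differ by at most |A - C| + |B
  - C|, their mean square distance is controlled by distances to C, and the right-hand side contains
  no mean that mixes \<open>a\<close> with \<open>b\<close>.\<close>

lemma EN_distance:
  assumes \<alpha>: "inj_on \<alpha> {..<l}" and N: "l \<le> N"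
    and int: "\<And>f i j. f \<in> {\<lambda>x. a x * cnj (a x), \<lambda>x. b x * cnj (b x), \<lambda>x. c x * cnj (c x), \<lambda>x. a x * cnj (c x),
        \<lambda>x. b x * cnj (c x), \<lambda>x. of_real (cmod (a x) * cmod (b x))} \<Longrightarrow>
      integrable L (\<lambda>x. f x * newton \<alpha> (l + i) x * cnj (newton \<alpha> (l + j) x))"
  defines "e f \<equiv> Re (EN \<alpha> l N f)"
  shows "2 * e (\<lambda>x. a x * cnj (c x)) \<le> e (\<lambda>x. a x * cnj (a x)) + e (\<lambda>x. c x * cnj (c x))"
    and "e (\<lambda>x. a x * cnj (a x)) + e (\<lambda>x. b x * cnj (b x)) - 2 * e (\<lambda>x. of_real (cmod (a x) * cmod (b x))) \<le>
      2 * (e (\<lambda>x. a x * cnj (a x)) - 2 * e (\<lambda>x. a x * cnj (c x)) + e (\<lambda>x. c x * cnj (c x))) +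
      2 * (e (\<lambda>x. b x * cnj (b x)) - 2 * e (\<lambda>x. b x * cnj (c x)) + e (\<lambda>x. c x * cnj (c x)))"
proof -
  have sq: "(cmod (u - v))\<^sup>2 = (cmod u)\<^sup>2 - 2 * Re (u * cnj v) + (cmod v)\<^sup>2" for u v
    unfolding cmod_power2 by (simp add: power2_eq_square algebra_simps)
  have pr: "Re (\<Prod>i<n. u (x i) * cnj (u (x i))) = (cmod (\<Prod>i<n. u (x i)))\<^sup>2"
      "Re (\<Prod>i<n. u (x i) * cnj (v (x i))) = Re ((\<Prod>i<n. u (x i)) * cnj (\<Prod>i<n. v (x i)))"
      "Re (\<Prod>i<n. of_real (cmod (u (x i)) * cmod (v (x i)))) = cmod (\<Prod>i<n. u (x i)) * cmod (\<Prod>i<n. v (x i))"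
      for u v and x :: "nat \<Rightarrow> complex" and n :: nat
    unfolding prod.distrib cnj_prod[symmetric] complex_norm_square[symmetric] of_real_prod[symmetric] Re_complex_of_real prod_power_distrib[symmetric] prod_norm
    by (rule refl)+
  have "0 \<le> (\<Sum>(r, f)\<leftarrow>[(1, \<lambda>x. a x * cnj (a x)), (-2, \<lambda>x. a x * cnj (c x)), (1, \<lambda>x. c x * cnj (c x))]. r * Re (EN \<alpha> l N f))"
  proof (rule EN_positive[OF \<alpha> N])
    fix x :: "nat \<Rightarrow> complex"
    have "0 \<le> (cmod ((\<Prod>i<N - l. a (x i)) - (\<Prod>i<N - l. c (x i))))\<^sup>2" by simp
    then show "0 \<le> (\<Sum>(r, f)\<leftarrow>[(1, \<lambda>x. a x * cnj (a x)), (-2, \<lambda>x. a x * cnj (c x)), (1, \<lambda>x. c x * cnj (c x))]. r * Re (\<Prod>i<N - l. f (x i)))"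
      unfolding sq by (simp only: list.map prod.case sum_list.Cons sum_list.Nil pr(1)) (simp only: pr(2))
  qed (rule int, auto)
  then show "2 * e (\<lambda>x. a x * cnj (c x)) \<le> e (\<lambda>x. a x * cnj (a x)) + e (\<lambda>x. c x * cnj (c x))"
    by (simp add: e_def)
  let ?fs = "[(1, \<lambda>x. a x * cnj (a x)), (1, \<lambda>x. b x * cnj (b x)), (2, \<lambda>x. of_real (cmod (a x) * cmod (b x))),
      (-4, \<lambda>x. a x * cnj (c x)), (-4, \<lambda>x. b x * cnj (c x)), (4, \<lambda>x. c x * cnj (c x))]"
  have "0 \<le> (\<Sum>(r, f)\<leftarrow>?fs. r * Re (EN \<alpha> l N f))"
  proof (rule EN_positive[OF \<alpha> N])
    fix x :: "nat \<Rightarrow> complex"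
    define A B C where "A = (\<Prod>i<N - l. a (x i))" and "B = (\<Prod>i<N - l. b (x i))" and "C = (\<Prod>i<N - l. c (x i))"
    have "(cmod A - cmod B)\<^sup>2 \<le> (cmod (A - C) + cmod (B - C))\<^sup>2"
    proof (rule power2_le_iff_abs_le[THEN iffD2])
      have "\<bar>cmod A - cmod B\<bar> \<le> cmod ((A - C) - (B - C))" using norm_triangle_ineq3[of A B] by simp
      also have "\<dots> \<le> cmod (A - C) + cmod (B - C)" by (rule norm_triangle_ineq4)
      finally show "\<bar>cmod A - cmod B\<bar> \<le> cmod (A - C) + cmod (B - C)" .
    qed simp
    also have "\<dots> \<le> 2 * (cmod (A - C))\<^sup>2 + 2 * (cmod (B - C))\<^sup>2"
      using sum_squares_bound[of "cmod (A - C)" "cmod (B - C)"] by (simp add: power2_sum)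
    finally have "0 \<le> 1 * (cmod A)\<^sup>2 + (1 * (cmod B)\<^sup>2 + (2 * (cmod A * cmod B) + (- 4 * Re (A * cnj C) + (- 4 * Re (B * cnj C) + (4 * (cmod C)\<^sup>2 + 0)))))"
      unfolding sq by (simp add: power2_diff)
    then show "0 \<le> (\<Sum>(r, f)\<leftarrow>?fs. r * Re (\<Prod>i<N - l. f (x i)))"
      by (simp only: list.map prod.case sum_list.Cons sum_list.Nil pr(1,3) A_def B_def C_def) (simp only: pr(2))
  qed (rule int, auto)
  then show "e (\<lambda>x. a x * cnj (a x)) + e (\<lambda>x. b x * cnj (b x)) - 2 * e (\<lambda>x. of_real (cmod (a x) * cmod (b x))) \<le>
      2 * (e (\<lambda>x. a x * cnj (a x)) - 2 * e (\<lambda>x. a x * cnj (c x)) + e (\<lambda>x. c x * cnj (c x))) +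
      2 * (e (\<lambda>x. b x * cnj (b x)) - 2 * e (\<lambda>x. b x * cnj (c x)) + e (\<lambda>x. c x * cnj (c x)))"
    by (simp add: e_def algebra_simps)
qed

text \<open>For the process of all N points, the mean is 1 for w by triangularity and at most
  exp(\<epsilon> R) for |w|^2 by Hadamard's inequality. Passing to the Palm process at l nodes costs
  powers that depend only on the distances of w and |w|^2 from 1, which tend to 0 with growing
  R.\<close>

lemma EN_wS_bounds:
  assumes S: "S holomorphic_on ball 0 \<rho>" "S 0 = 1" and \<rho>: "0 < \<rho>" and \<alpha>: "inj_on \<alpha> {..<l}"
  obtains \<eta> where "(\<eta> \<longlongrightarrow> 0) at_top" "eventually (\<lambda>R. \<forall>N\<ge>l.
    Re (EN \<alpha> l N (\<lambda>x. wS S R x * cnj (wS S R x))) \<le> 1 + \<eta> R \<and> 1 - \<eta> R \<le> Re (EN \<alpha> l N (wS S R))) at_top"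
proof -
  have u0: "0 < \<rho> / 2" "\<rho> / 2 < \<rho>" using \<rho> by auto
  obtain B where B: "0 \<le> B" "\<And>R x. 1 / (\<rho> / 2) \<le> R \<Longrightarrow> cmod (wS S R x - 1) \<le> B / R"
    using wS_bound[OF S \<rho> u0] by blast
  obtain \<epsilon> where \<epsilon>: "(\<epsilon> \<longlongrightarrow> 0) at_top" and gram: "eventually (\<lambda>R. \<forall>N.
    Re (dt N (\<lambda>i j. \<integral>x. of_real ((cmod (wS S R x))\<^sup>2) * x ^ i * cnj (x ^ j) \<partial>L)) \<le> (\<Prod>i<N. hh i) * exp (\<epsilon> R)) at_top"
    using gram_wS_le[OF S \<rho>] by blast
  define t where "t \<delta> = (1 + \<delta> / (1 - \<delta>)) ^ l" for \<delta> :: real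
  \<comment> \<open>\<open>b R\<close> bounds |w - 1| and \<open>\<delta> R\<close> bounds the
    distance of |w|^2 from 1, by |w| <= 1 + \<open>b R\<close>.\<close>
  define b where "b R = B / R" for R :: real
  define \<delta> where "\<delta> R = b R * (2 + b R)" for R
  define \<eta> where "\<eta> R = \<bar>t (\<delta> R) * exp (\<epsilon> R) - 1\<bar> + \<bar>t (b R) - 1\<bar>" for R
  have b0: "(b \<longlongrightarrow> 0) at_top" unfolding b_def[abs_def] by real_asymp
  have \<delta>0: "(\<delta> \<longlongrightarrow> 0) at_top" unfolding \<delta>_def[abs_def] by (auto intro!: tendsto_eq_intros b0)
  have b1: "eventually (\<lambda>R. b R < 1) at_top" by (rule order_tendstoD(2)[OF b0]) simp
  have \<delta>1: "eventually (\<lambda>R. \<delta> R < 1) at_top" by (rule order_tendstoD(2)[OF \<delta>0]) simp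
  have "(\<eta> \<longlongrightarrow> 0) at_top"
    unfolding \<eta>_def[abs_def] t_def by (auto intro!: tendsto_eq_intros b0 \<delta>0 \<epsilon>)
  moreover have "eventually (\<lambda>R. \<forall>N\<ge>l.
    Re (EN \<alpha> l N (\<lambda>x. wS S R x * cnj (wS S R x))) \<le> 1 + \<eta> R \<and> 1 - \<eta> R \<le> Re (EN \<alpha> l N (wS S R))) at_top"
    using gram b1 \<delta>1
      eventually_ge_at_top[of "2 / \<rho>"]
  proof eventually_elim
    case (elim R)
    have R: "0 < R" "1 / R < \<rho>"
    proof -
      show "0 < R" using elim(4) \<rho> less_le_trans[of 0 "2 / \<rho>" R] by simp
      then show "1 / R < \<rho>" using elim(4) \<rho> by (simp add: field_simps)
    qed
    have bb: "0 \<le> b R" using B(1) R(1) by (simp add: b_def)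
    have wb: "cmod (wS S R x - 1) \<le> b R" for x using B(2)[of R x] elim(4) by (simp add: b_def)
    have w1: "cmod (wS S R x) \<le> 1 + b R" for x
      using norm_triangle_sub[of "wS S R x" 1] wb[of x] by simp
    have wwb: "cmod (wS S R x * cnj (wS S R x) - 1) \<le> \<delta> R" for x
    proof -
      have "wS S R x * cnj (wS S R x) - 1 = wS S R x * cnj (wS S R x - 1) + (wS S R x - 1)" by (simp add: algebra_simps)
      also have "cmod \<dots> \<le> cmod (wS S R x) * cmod (wS S R x - 1) + cmod (wS S R x - 1)"
        by (rule norm_triangle_le) (simp add: norm_mult del: complex_cnj_diff)
      also have "\<dots> \<le> (1 + b R) * b R + b R" using wb[of x] w1[of x] bb by (intro add_mono mult_mono) auto
      finally show ?thesis by (simp add: \<delta>_def algebra_simps)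
    qed
    have ww1: "cmod (wS S R x * cnj (wS S R x)) \<le> 1 + \<delta> R" for x
      using norm_triangle_sub[of "wS S R x * cnj (wS S R x)" 1] wwb[of x] by simp
    have m [measurable]: "wS S R \<in> borel_measurable borel" by (rule measurable_wS[OF S \<rho> R])
    have mm: "(\<lambda>x. wS S R x * cnj (wS S R x)) \<in> borel_measurable borel" by measurable
    have H: "0 < (\<Prod>i<N. hh i)" for N by (intro prod_pos ballI hh_pos)
    have t1: "1 \<le> t d" if "0 \<le> d" "d < 1" for d unfolding t_def using that by (intro one_le_power) simp
    show ?case
    proof (intro allI impI conjI)
      fix N assume N: "l \<le> N"
      have r1: "gd \<alpha> N (wS S R) 0 / gd \<alpha> N (\<lambda>_. 1) 0 = 1"
        unfolding gd_0[OF m w1] gd_one_0 dt_wS[OF S \<rho> R]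
        using H[of N] by (intro divide_self) (unfold of_real_eq_0_iff, linarith)
      have "cmod (EN \<alpha> l N (wS S R) - 1) \<le> t (b R) - 1"
        using gd_perturbation[OF \<alpha> N m wb elim(2)] unfolding r1 EN_def t_def by simp
      then have "1 - (t (b R) - 1) \<le> Re (EN \<alpha> l N (wS S R))"
        using abs_Re_le_cmod[of "EN \<alpha> l N (wS S R) - 1"] by simp
      then show "1 - \<eta> R \<le> Re (EN \<alpha> l N (wS S R))" unfolding \<eta>_def by linarith
      define G where "G = dt N (\<lambda>i j. \<integral>x. (wS S R x * x ^ i) * cnj (wS S R x * x ^ j) \<partial>L)"
      have l2: "L2fun L (\<lambda>x. wS S R x * x ^ i)" for i
        unfolding L2fun_def
      proof
        show "(\<lambda>x. wS S R x * x ^ i) \<in> borel_measurable L" unfolding measurable_lam by measurable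
        show "integrable L (\<lambda>x. (cmod (wS S R x * x ^ i))\<^sup>2)"
        proof (rule Bochner_Integration.integrable_bound)
          show "integrable L (\<lambda>x. (1 + b R)\<^sup>2 * cmod x ^ (2 * i))" by (intro integrable_mult_right integrable_cmod_power)
          show "(\<lambda>x. (cmod (wS S R x * x ^ i))\<^sup>2) \<in> borel_measurable L" unfolding measurable_lam by measurable
          show "AE x in L. norm ((cmod (wS S R x * x ^ i))\<^sup>2) \<le> norm ((1 + b R)\<^sup>2 * cmod x ^ (2 * i))"
          proof (intro AE_I2)
            fix x
            have "(cmod (wS S R x * x ^ i))\<^sup>2 = (cmod (wS S R x))\<^sup>2 * cmod x ^ (2 * i)"
              by (simp add: norm_mult norm_power power_mult_distrib power_even_eq)
            also have "\<dots> \<le> (1 + b R)\<^sup>2 * cmod x ^ (2 * i)" using w1 by (intro mult_right_mono power_mono) auto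
            finally show "norm ((cmod (wS S R x * x ^ i))\<^sup>2) \<le> norm ((1 + b R)\<^sup>2 * cmod x ^ (2 * i))" by simp
          qed
        qed
      qed
      have psd: "psd N (\<lambda>i j. \<integral>x. (wS S R x * x ^ i) * cnj (wS S R x * x ^ j) \<partial>L)" by (rule gram_psd[OF l2])
      have G: "G = of_real (Re G)" "0 \<le> Re G"
        unfolding G_def using dt_psd_of_real[OF psd] psd_hadamard[OF psd] by blast+
      have Ge: "gd \<alpha> N (\<lambda>x. wS S R x * cnj (wS S R x)) 0 = G"
        unfolding gd_0[OF mm ww1] G_def by (simp add: mult_ac)
      have "Re G \<le> (\<Prod>i<N. hh i) * exp (\<epsilon> R)"
        using elim(1) unfolding G_def complex_norm_square by (simp add: mult_ac)
      then have g: "Re G / (\<Prod>i<N. hh i) \<le> exp (\<epsilon> R)" using H[of N] by (simp add: divide_le_eq mult.commute)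
      define r0 where "r0 = Re G / (\<Prod>i<N. hh i)"
      have r0: "0 \<le> r0" unfolding r0_def using G(2) H[of N] by (intro divide_nonneg_pos)
      have e: "gd \<alpha> N (\<lambda>x. wS S R x * cnj (wS S R x)) 0 / gd \<alpha> N (\<lambda>_. 1) 0 = of_real r0"
        unfolding Ge gd_one_0 r0_def of_real_divide G(1)[symmetric] ..
      have "cmod (EN \<alpha> l N (\<lambda>x. wS S R x * cnj (wS S R x)) - of_real r0) \<le> (t (\<delta> R) - 1) * r0"
        using gd_perturbation[OF \<alpha> N mm wwb elim(3)] r0 unfolding e EN_def t_def by simp
      then have "Re (EN \<alpha> l N (\<lambda>x. wS S R x * cnj (wS S R x))) \<le> t (\<delta> R) * r0"
        using abs_Re_le_cmod[of "EN \<alpha> l N (\<lambda>x. wS S R x * cnj (wS S R x)) - of_real r0"] by (simp add: algebra_simps)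
      also have "\<dots> \<le> t (\<delta> R) * exp (\<epsilon> R)"
        using g t1[of "\<delta> R"] elim(3) bb by (intro mult_left_mono) (auto simp: r0_def \<delta>_def)
      also have "\<dots> \<le> 1 + \<eta> R" unfolding \<eta>_def by linarith
      finally show "Re (EN \<alpha> l N (\<lambda>x. wS S R x * cnj (wS S R x))) \<le> 1 + \<eta> R" .
    qed
  qed
  ultimately show ?thesis by (rule that)
qed

end

section \<open>Regularized products of the ratio\<close>

locale palm_pair = radial_weight \<phi> m M for \<phi> m M +
  fixes K and p q :: "nat \<Rightarrow> complex" and l :: nat
  assumes K: "is_reproducing_kernel \<phi> K"
    and p: "inj_on p {..<l}" "\<And>a. l \<le> a \<Longrightarrow> p a = 0"
    and q: "inj_on q {..<l}" "\<And>a. l \<le> a \<Longrightarrow> q a = 0"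
begin

abbreviation "pp \<equiv> newton p l"
abbreviation "qq \<equiv> newton q l"

lemma tail_p: "newton p (l + i) x = pp x * x ^ i" and tail_q: "newton q (l + i) x = qq x * x ^ i"
  by (rule newton_tail, rule p q, assumption)+

definition ratio_on :: "complex set \<Rightarrow> complex \<Rightarrow> complex" where
  "ratio_on A x = (if x \<in> A then pp x / qq x else 1)"

text \<open>The reciprocal of h in the coordinate u = 1/x. Within \<open>inv_radius\<close> no
  factor 1 - p_a u vanishes.\<close>

definition "inv_ratio u = (\<Prod>a<l. (1 - q a * u) / (1 - p a * u))"
definition "inv_radius = 1 / (1 + (\<Sum>a<l. cmod (p a)))"

lemma inv_radius_pos: "0 < inv_radius"
  by (simp add: inv_radius_def sum_nonneg add_pos_nonneg)

lemma inv_ratio_props: "inv_ratio holomorphic_on ball 0 inv_radius" "inv_ratio 0 = 1"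
proof -
  have "1 - p a * u \<noteq> 0" if a: "a < l" and u: "cmod u < inv_radius" for a u
  proof
    assume "1 - p a * u = 0"
    then have "cmod (p a) * cmod u = 1" by (metis norm_mult norm_one eq_iff_diff_eq_0)
    have s: "cmod (p a) \<le> (\<Sum>a<l. cmod (p a))" using a by (intro member_le_sum) auto
    have "cmod (p a) * cmod u \<le> (\<Sum>a<l. cmod (p a)) * inv_radius" using s u by (intro mult_mono) (auto intro: sum_nonneg)
    also have "\<dots> < 1"
      by (simp add: inv_radius_def sum_nonneg add_pos_nonneg)
    finally show False using \<open>cmod (p a) * cmod u = 1\<close> by simp
  qed
  then show "inv_ratio holomorphic_on ball 0 inv_radius"
    unfolding inv_ratio_def[abs_def] by (intro holomorphic_intros) auto
  show "inv_ratio 0 = 1" by (simp add: inv_ratio_def)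
qed

lemma inv_ratio_inverse:
  assumes "x \<noteq> 0"
  shows "inv_ratio (1 / x) = qq x / pp x"
proof -
  have "(1 - q a * (1 / x)) / (1 - p a * (1 / x)) = (x - q a) / (x - p a)" for a
  proof -
    have "1 - c * (1 / x) = (x - c) / x" for c using assms by (simp add: field_simps)
    then show ?thesis using assms by simp
  qed
  then show ?thesis by (simp add: inv_ratio_def newton_def prod_dividef)
qed

definition "zeros = p ` {..<l} \<union> q ` {..<l}"

lemma nonzero_off_zeros: "x \<notin> zeros \<Longrightarrow> pp x \<noteq> 0" "x \<notin> zeros \<Longrightarrow> qq x \<noteq> 0"
  by (auto simp: zeros_def newton_def)

text \<open>The identity between the truncated h and h w_R, cleared of denominators. The finitely
  many nodes, where a quotient by 0 may occur, are left out.\<close>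

lemma ratio_on_mult:
  assumes "x \<notin> zeros"
  shows "0 \<le> R \<Longrightarrow> ratio_on (cball 0 R) x * qq x = wS inv_ratio R x * pp x" "ratio_on UNIV x * qq x = 1 * pp x"
  using nonzero_off_zeros[OF assms] inv_ratio_inverse[of x] by (cases "x = 0"; auto simp: ratio_on_def wS_def)+

lemma measurable_ratio_on [measurable]: "A \<in> sets borel \<Longrightarrow> ratio_on A \<in> borel_measurable borel"
  unfolding ratio_on_def[abs_def] by (intro measurable_If_set borel_measurable_divide measurable_newton) auto

lemma AE_off_zeros: "AE x in L. x \<notin> zeros"
  unfolding AE_lam_iff
proof (rule AE_I')
  show "zeros \<in> null_sets lborel" by (intro finite_imp_null_set_lborel) (simp add: zeros_def)
qed auto

text \<open>Off a null set the factors \<open>u\<close> and \<open>v\<close> exchange the Newton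
  functions of q for those of p, with the same powers of x; so the two Gram matrices agree entry by
  entry.\<close>

lemma gd_transfer:
  assumes [measurable]: "u \<in> borel_measurable borel" "v \<in> borel_measurable borel" "w \<in> borel_measurable borel" "z \<in> borel_measurable borel"
    and eq: "\<And>x. x \<notin> zeros \<Longrightarrow> u x * qq x = w x * pp x" "\<And>x. x \<notin> zeros \<Longrightarrow> v x * qq x = z x * pp x"
  shows "gd q N (\<lambda>x. u x * cnj (v x)) l = gd p N (\<lambda>x. w x * cnj (z x)) l"
  unfolding gd_def
proof (rule dt_cong)
  fix a b
  show "(\<integral>x. u x * cnj (v x) * newton q (l + a) x * cnj (newton q (l + b) x) \<partial>L) =
    (\<integral>x. w x * cnj (z x) * newton p (l + a) x * cnj (newton p (l + b) x) \<partial>L)"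
  proof (rule integral_cong_AE)
    show "AE x in L. u x * cnj (v x) * newton q (l + a) x * cnj (newton q (l + b) x) =
      w x * cnj (z x) * newton p (l + a) x * cnj (newton p (l + b) x)"
      using AE_off_zeros
    proof eventually_elim
      case (elim x)
      have "u x * cnj (v x) * newton q (l + a) x * cnj (newton q (l + b) x) =
        (u x * qq x) * cnj (v x * qq x) * x ^ a * cnj (x ^ b)"
        unfolding tail_q by simp
      also have "\<dots> = (w x * pp x) * cnj (z x * pp x) * x ^ a * cnj (x ^ b)" unfolding eq[OF elim] ..
      also have "\<dots> = w x * cnj (z x) * newton p (l + a) x * cnj (newton p (l + b) x)"
        unfolding tail_p by simp
      finally show ?case .
    qed
  qed (unfold measurable_lam, measurable)
qed

text \<open>The mean of the product of |h|^2 over all points of the level N Palm process at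
  q.\<close>

definition "gram_ratio N = gd p N (\<lambda>_. 1) l / gd q N (\<lambda>_. 1) l"

lemma gram_ratio_pos:
  assumes "l \<le> N"
  shows "gram_ratio N = of_real (Re (gram_ratio N))" "0 < Re (gram_ratio N)"
proof -
  obtain c where c: "gd p N (\<lambda>_. 1) l = of_real c" "0 < c" using gd_one_pos[OF p(1) order_refl assms] by blast
  obtain d where d: "gd q N (\<lambda>_. 1) l = of_real d" "0 < d" using gd_one_pos[OF q(1) order_refl assms] by blast
  have "gram_ratio N = of_real (c / d)" by (simp add: gram_ratio_def c d)
  then show "gram_ratio N = of_real (Re (gram_ratio N))" "0 < Re (gram_ratio N)" using c d by simp_all
qed

lemma EN_transfer:
  assumes "l \<le> N" "u \<in> borel_measurable borel" "v \<in> borel_measurable borel" "w \<in> borel_measurable borel" "z \<in> borel_measurable borel"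
    and "\<And>x. x \<notin> zeros \<Longrightarrow> u x * qq x = w x * pp x" "\<And>x. x \<notin> zeros \<Longrightarrow> v x * qq x = z x * pp x"
  shows "Re (EN q l N (\<lambda>x. u x * cnj (v x))) = Re (gram_ratio N) * Re (EN p l N (\<lambda>x. w x * cnj (z x)))"
proof -
  obtain c where c: "gd p N (\<lambda>_. 1) l = of_real c" "0 < c" using gd_one_pos[OF p(1) order_refl assms(1)] by blast
  moreover obtain d where "gd q N (\<lambda>_. 1) l = of_real d" "0 < d" using gd_one_pos[OF q(1) order_refl assms(1)] by blast
  moreover have "gd q N (\<lambda>x. u x * cnj (v x)) l = gd p N (\<lambda>x. w x * cnj (z x)) l"
    by (rule gd_transfer[OF assms(2-5)]) (erule assms)+
  ultimately have "EN q l N (\<lambda>x. u x * cnj (v x)) = gram_ratio N * EN p l N (\<lambda>x. w x * cnj (z x))"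
    unfolding EN_def gram_ratio_def by simp
  moreover have "Im (gram_ratio N) = 0" by (subst gram_ratio_pos(1)[OF assms(1)]) simp
  ultimately show ?thesis by simp
qed

definition "palm_ratio = kernel_det K l p / kernel_det K l q * complex_of_real (\<Prod>j<l. \<Prod>i<j. (cmod ((q i - q j) / (p i - p j)))\<^sup>2)"

lemma gd_one_kernel_det:
  assumes \<alpha>: "inj_on \<alpha> {..<l}" and N: "l \<le> N"
  shows "gd \<alpha> N (\<lambda>_. 1) l = of_real (\<Prod>i<N. hh i) * kernel_det (KN N) l \<alpha> / of_real (\<Prod>j<l. (cmod (newton \<alpha> j (\<alpha> j)))\<^sup>2)"
proof -
  have nz: "palm_kernel (KN N) \<alpha> j (\<alpha> j) (\<alpha> j) \<noteq> 0" if "j < l" for j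
    using palm_diag_pos[OF \<alpha>, of j N] that N by auto
  have "kernel_det (KN N) l \<alpha> = (\<Prod>j<l. palm_kernel (KN N) \<alpha> j (\<alpha> j) (\<alpha> j))"
    by (rule kernel_det_palm_product[OF nz])
  also have "\<dots> = (\<Prod>j<l. of_real (Re (palm_kernel (KN N) \<alpha> j (\<alpha> j) (\<alpha> j))))"
    using N by (intro prod.cong refl palm_diag_real[OF \<alpha>]) auto
  finally have k: "kernel_det (KN N) l \<alpha> = of_real (\<Prod>j<l. Re (palm_kernel (KN N) \<alpha> j (\<alpha> j) (\<alpha> j)))" by simp
  show ?thesis unfolding gd_one_product[OF \<alpha> order_refl N] k prod_dividef by simp
qed

text \<open>In the quotient the products of the \<open>hh i\<close> cancel, and the Newton functions
  at their own nodes multiply to the Vandermonde products. The remaining kernel determinants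
  converge to nonzero limits.\<close>

lemma gram_ratio_tendsto: "gram_ratio \<longlonglongrightarrow> palm_ratio"
proof -
  have nn: "(\<Prod>j<l. (cmod (newton \<alpha> j (\<alpha> j)))\<^sup>2) = (\<Prod>j<l. \<Prod>i<j. (cmod (\<alpha> i - \<alpha> j))\<^sup>2)" for \<alpha>
    unfolding newton_def prod_norm[symmetric] prod_power_distrib by (simp add: norm_minus_commute)
  define V where "V = (\<Prod>j<l. (cmod (newton q j (q j)))\<^sup>2) / (\<Prod>j<l. (cmod (newton p j (p j)))\<^sup>2)"
  have V: "V = (\<Prod>j<l. \<Prod>i<j. (cmod ((q i - q j) / (p i - p j)))\<^sup>2)"
    unfolding V_def nn by (simp add: norm_divide power_divide prod_dividef)
  have "(\<lambda>N. kernel_det (KN N) l p / kernel_det (KN N) l q * of_real V) \<longlonglongrightarrow> palm_ratio"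
    unfolding palm_ratio_def V[symmetric] by (intro tendsto_intros kernel_det_limits[OF K] p(1) q(1))
  moreover have "eventually (\<lambda>N. kernel_det (KN N) l p / kernel_det (KN N) l q * of_real V = gram_ratio N) sequentially"
    using eventually_ge_at_top[of l]
  proof eventually_elim
    case (elim N)
    have "0 < (\<Prod>i<N. hh i)" by (intro prod_pos ballI hh_pos)
    then have "complex_of_real (\<Prod>i<N. hh i) \<noteq> 0" unfolding of_real_eq_0_iff by linarith
    moreover have "0 < (\<Prod>j<l. (cmod (newton \<alpha> j (\<alpha> j)))\<^sup>2)" if "inj_on \<alpha> {..<l}" for \<alpha>
      using newton_nonzero[OF that] by (intro prod_pos) auto
    then have "complex_of_real (\<Prod>j<l. (cmod (newton q j (q j)))\<^sup>2) \<noteq> 0"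
      using q(1) unfolding of_real_eq_0_iff by (metis less_irrefl)
    ultimately show ?case
      unfolding gram_ratio_def gd_one_kernel_det[OF p(1) elim] gd_one_kernel_det[OF q(1) elim] V_def of_real_divide
      by (simp add: field_simps del: of_real_prod)
  qed
  ultimately show ?thesis by (rule Lim_transform_eventually)
qed

lemma palm_ratio_real: "palm_ratio = of_real (Re palm_ratio)" and Re_gram_ratio: "(\<lambda>N. Re (gram_ratio N)) \<longlonglongrightarrow> Re palm_ratio"
proof -
  show R: "(\<lambda>N. Re (gram_ratio N)) \<longlonglongrightarrow> Re palm_ratio" by (intro tendsto_Re gram_ratio_tendsto)
  then have "(\<lambda>N. complex_of_real (Re (gram_ratio N))) \<longlonglongrightarrow> of_real (Re palm_ratio)" by (rule tendsto_of_real)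
  moreover have "eventually (\<lambda>N. complex_of_real (Re (gram_ratio N)) = gram_ratio N) sequentially"
    using eventually_ge_at_top[of l] by eventually_elim (rule gram_ratio_pos(1)[symmetric])
  ultimately have "gram_ratio \<longlonglongrightarrow> of_real (Re palm_ratio)" by (rule Lim_transform_eventually)
  with gram_ratio_tendsto show "palm_ratio = of_real (Re palm_ratio)" by (rule LIMSEQ_unique)
qed

lemma ratio_on_le: "cmod (ratio_on A x) * cmod (qq x) \<le> sqrt ((cmod (pp x))\<^sup>2 + (cmod (qq x))\<^sup>2)"
  by (rule real_le_rsqrt, cases "qq x = 0") (auto simp: ratio_on_def norm_divide power_mult_distrib power_divide)

text \<open>The factor |qq|^2 cancels the poles of two ratios at once, leaving one polynomial
  majorant for all truncations.\<close>

lemma ratio_on_mult_le: "cmod (ratio_on A x) * cmod (ratio_on B x) * (cmod (qq x))\<^sup>2 \<le> (cmod (pp x))\<^sup>2 + (cmod (qq x))\<^sup>2"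
proof -
  have "(cmod (ratio_on A x) * cmod (qq x)) * (cmod (ratio_on B x) * cmod (qq x)) \<le>
      sqrt ((cmod (pp x))\<^sup>2 + (cmod (qq x))\<^sup>2) * sqrt ((cmod (pp x))\<^sup>2 + (cmod (qq x))\<^sup>2)"
    by (intro mult_mono ratio_on_le) auto
  then show ?thesis by (simp add: power2_eq_square mult_ac)
qed

lemma integrable_majorant: "integrable L (\<lambda>x. ((cmod (pp x))\<^sup>2 + (cmod (qq x))\<^sup>2) * cmod x ^ k)"
proof -
  have "integrable L (\<lambda>x. (cmod (newton \<alpha> l x))\<^sup>2 * cmod x ^ k)" if t: "\<And>x. newton \<alpha> (l + k) x = newton \<alpha> l x * x ^ k" for \<alpha>
  proof -
    have "integrable L (\<lambda>x. cmod (newton \<alpha> (l + k) x) * cmod (newton \<alpha> l x))"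
      by (intro L2fun_integrable_norm_mult L2fun_newton)
    then show ?thesis unfolding t by (simp add: norm_mult norm_power power2_eq_square mult_ac)
  qed
  from this[OF tail_p] this[OF tail_q] show ?thesis by (simp add: distrib_right)
qed

lemma integrable_admissible:
  assumes f: "f \<in> borel_measurable borel" "\<And>x. cmod (f x) * (cmod (qq x))\<^sup>2 \<le> (cmod (pp x))\<^sup>2 + (cmod (qq x))\<^sup>2"
  shows "integrable L (\<lambda>x. f x * newton q (l + i) x * cnj (newton q (l + j) x))"
proof (rule Bochner_Integration.integrable_bound)
  show "integrable L (\<lambda>x. ((cmod (pp x))\<^sup>2 + (cmod (qq x))\<^sup>2) * cmod x ^ (i + j))" by (rule integrable_majorant)
  show "(\<lambda>x. f x * newton q (l + i) x * cnj (newton q (l + j) x)) \<in> borel_measurable L"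
    using f(1) unfolding measurable_lam by measurable
  show "AE x in L. norm (f x * newton q (l + i) x * cnj (newton q (l + j) x)) \<le> norm (((cmod (pp x))\<^sup>2 + (cmod (qq x))\<^sup>2) * cmod x ^ (i + j))"
  proof (intro AE_I2)
    fix x
    have "norm (f x * newton q (l + i) x * cnj (newton q (l + j) x)) = (cmod (f x) * (cmod (qq x))\<^sup>2) * cmod x ^ (i + j)"
      unfolding tail_q
      by (simp add: norm_mult norm_power power2_eq_square power_add)
    also have "\<dots> \<le> ((cmod (pp x))\<^sup>2 + (cmod (qq x))\<^sup>2) * cmod x ^ (i + j)" by (intro mult_right_mono f(2)) simp
    finally show "norm (f x * newton q (l + i) x * cnj (newton q (l + j) x)) \<le> norm (((cmod (pp x))\<^sup>2 + (cmod (qq x))\<^sup>2) * cmod x ^ (i + j))"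
      by simp
  qed
qed

definition "trunc_ratio R x = ratio_on (cball 0 R) x"

text \<open>Let H be the full product, A_R the truncated one and T the mean of |H|^2 at level N.
  Transfer from q to p gives E |A_R|^2 <= T (1 + \<eta>), and the real part of E (A_R cnj H) is at
  least T (1 - \<eta>). Hence E |A_R - H|^2 <= 3 \<eta> T, and two truncations are compared through
  H.\<close>

lemma truncated_bounds:
  obtains \<eta> R0 where "(\<eta> \<longlongrightarrow> 0) at_top" "\<And>R. R0 \<le> R \<Longrightarrow> 0 \<le> \<eta> R"
    "\<And>R N. R0 \<le> R \<Longrightarrow> l \<le> N \<Longrightarrow> \<bar>Re (EN q l N (\<lambda>x. trunc_ratio R x * cnj (trunc_ratio R x))) - Re (gram_ratio N)\<bar> \<le> \<eta> R * Re (gram_ratio N)"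
    "\<And>R S N. R0 \<le> R \<Longrightarrow> R0 \<le> S \<Longrightarrow> l \<le> N \<Longrightarrow>
      Re (EN q l N (\<lambda>x. trunc_ratio R x * cnj (trunc_ratio R x))) + Re (EN q l N (\<lambda>x. trunc_ratio S x * cnj (trunc_ratio S x)))
      - 2 * Re (EN q l N (\<lambda>x. of_real (cmod (trunc_ratio R x) * cmod (trunc_ratio S x)))) \<le> (\<eta> R + \<eta> S) * Re (gram_ratio N)"
proof -
  obtain \<eta> where \<eta>: "(\<eta> \<longlongrightarrow> 0) at_top" and ev: "eventually (\<lambda>R. \<forall>N\<ge>l.
    Re (EN p l N (\<lambda>x. wS inv_ratio R x * cnj (wS inv_ratio R x))) \<le> 1 + \<eta> R \<and> 1 - \<eta> R \<le> Re (EN p l N (wS inv_ratio R))) at_top"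
    using EN_wS_bounds[OF inv_ratio_props inv_radius_pos p(1)] by blast
  from ev obtain R1 where R1: "\<And>R N. R1 \<le> R \<Longrightarrow> l \<le> N \<Longrightarrow> Re (EN p l N (\<lambda>x. wS inv_ratio R x * cnj (wS inv_ratio R x))) \<le> 1 + \<eta> R"
    "\<And>R N. R1 \<le> R \<Longrightarrow> l \<le> N \<Longrightarrow> 1 - \<eta> R \<le> Re (EN p l N (wS inv_ratio R))"
    unfolding eventually_at_top_linorder by blast
  define R0 where "R0 = max R1 (1 + 1 / inv_radius)"
  have R0: "R1 \<le> R" "0 < R" "1 / R < inv_radius" if "R0 \<le> R" for R
  proof -
    show "R1 \<le> R" using that by (simp add: R0_def)
    have "0 < 1 / inv_radius" using inv_radius_pos by simp
    moreover have r: "1 + 1 / inv_radius \<le> R" using that by (simp add: R0_def)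
    ultimately show "0 < R" by linarith
    then show "1 / R < inv_radius" using r inv_radius_pos by (simp add: field_simps)
  qed
  let ?h = "ratio_on UNIV"
  have m: "trunc_ratio R \<in> borel_measurable borel" "?h \<in> borel_measurable borel" for R
    unfolding trunc_ratio_def[abs_def] by (rule measurable_ratio_on, simp)+
  have wm: "wS inv_ratio R \<in> borel_measurable borel" if "R0 \<le> R" for R
    using R0[OF that] by (intro measurable_wS[OF inv_ratio_props inv_radius_pos])
  have um: "trunc_ratio R x * qq x = wS inv_ratio R x * pp x" if "R0 \<le> R" "x \<notin> zeros" for R x
    unfolding trunc_ratio_def using R0(2)[OF that(1)] ratio_on_mult(1)[OF that(2)] by simp
  define e where "e N f = Re (EN q l N f)" for N f
  define T where "T N = Re (gram_ratio N)" for N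
  have T: "0 < T N" if "l \<le> N" for N unfolding T_def by (rule gram_ratio_pos(2)[OF that])
  have e1: "e N (\<lambda>x. trunc_ratio R x * cnj (trunc_ratio R x)) \<le> T N * (1 + \<eta> R)" if "R0 \<le> R" "l \<le> N" for R N
  proof -
    have "e N (\<lambda>x. trunc_ratio R x * cnj (trunc_ratio R x)) = T N * Re (EN p l N (\<lambda>x. wS inv_ratio R x * cnj (wS inv_ratio R x)))"
      unfolding e_def T_def
      by (rule EN_transfer[OF that(2) m(1) m(1) wm[OF that(1)] wm[OF that(1)] um[OF that(1)] um[OF that(1)]])
    then show ?thesis
      using R1(1)[OF R0(1)[OF that(1)] that(2)] T[OF that(2)] by (auto intro: mult_left_mono)
  qed
  have e2: "T N * (1 - \<eta> R) \<le> e N (\<lambda>x. trunc_ratio R x * cnj (?h x))" if "R0 \<le> R" "l \<le> N" for R N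
  proof -
    have "e N (\<lambda>x. trunc_ratio R x * cnj (?h x)) = T N * Re (EN p l N (\<lambda>x. wS inv_ratio R x * cnj 1))"
      unfolding e_def T_def
      by (rule EN_transfer[where z = "\<lambda>_. 1", OF that(2) m(1) m(2) wm[OF that(1)] borel_measurable_const um[OF that(1)] ratio_on_mult(2)])
    then show ?thesis
      using R1(2)[OF R0(1)[OF that(1)] that(2)] T[OF that(2)] by (auto intro: mult_left_mono)
  qed
  have e3: "e N (\<lambda>x. ?h x * cnj (?h x)) = T N" if "l \<le> N" for N
  proof -
    have "e N (\<lambda>x. ?h x * cnj (?h x)) = T N * Re (EN p l N (\<lambda>x. 1 * cnj 1))"
      unfolding e_def T_def
      by (rule EN_transfer[where z = "\<lambda>_. 1" and w = "\<lambda>_. 1", OF that m(2) m(2) borel_measurable_const borel_measurable_const ratio_on_mult(2) ratio_on_mult(2)])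
    moreover obtain c where "gd p N (\<lambda>_. 1) l = of_real c" "0 < c" using gd_one_pos[OF p(1) order_refl \<open>l \<le> N\<close>] by blast
    then have "EN p l N (\<lambda>x. 1) = 1" by (simp add: EN_def)
    ultimately show ?thesis by simp
  qed
  \<comment> \<open>All six weights are products of two truncated or full ratios or of their moduli,
    so |qq|^2 cancels their poles.\<close>
  have adm: "integrable L (\<lambda>x. f x * newton q (l + i) x * cnj (newton q (l + j) x))"
    if "f \<in> {\<lambda>x. trunc_ratio R x * cnj (trunc_ratio R x), \<lambda>x. trunc_ratio S x * cnj (trunc_ratio S x), \<lambda>x. ?h x * cnj (?h x), \<lambda>x. trunc_ratio R x * cnj (?h x),
        \<lambda>x. trunc_ratio S x * cnj (?h x), \<lambda>x. of_real (cmod (trunc_ratio R x) * cmod (trunc_ratio S x))}" for f R S i j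
  proof (rule integrable_admissible)
    note [measurable] = m
    show "f \<in> borel_measurable borel" using that by (elim insertE emptyE) (simp_all, measurable)
    show "cmod (f x) * (cmod (qq x))\<^sup>2 \<le> (cmod (pp x))\<^sup>2 + (cmod (qq x))\<^sup>2" for x
      using that by (elim insertE emptyE) (simp_all add: norm_mult trunc_ratio_def ratio_on_mult_le)
  qed
  have D: "2 * e N (\<lambda>x. trunc_ratio R x * cnj (?h x)) \<le> e N (\<lambda>x. trunc_ratio R x * cnj (trunc_ratio R x)) + e N (\<lambda>x. ?h x * cnj (?h x))"
    "e N (\<lambda>x. trunc_ratio R x * cnj (trunc_ratio R x)) + e N (\<lambda>x. trunc_ratio S x * cnj (trunc_ratio S x)) - 2 * e N (\<lambda>x. of_real (cmod (trunc_ratio R x) * cmod (trunc_ratio S x))) \<le>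
      2 * (e N (\<lambda>x. trunc_ratio R x * cnj (trunc_ratio R x)) - 2 * e N (\<lambda>x. trunc_ratio R x * cnj (?h x)) + e N (\<lambda>x. ?h x * cnj (?h x))) +
      2 * (e N (\<lambda>x. trunc_ratio S x * cnj (trunc_ratio S x)) - 2 * e N (\<lambda>x. trunc_ratio S x * cnj (?h x)) + e N (\<lambda>x. ?h x * cnj (?h x)))"
    if "l \<le> N" for N R S
    unfolding e_def
    by (rule EN_distance[where a = "trunc_ratio R" and b = "trunc_ratio S" and c = ?h, OF q(1) that adm], assumption)+
  \<comment> \<open>The mean square distance from the full product is nonnegative and at most 3
    \<eta> T.\<close>
  have \<eta>n: "0 \<le> \<eta> R" if R: "R0 \<le> R" for R
  proof -
    have "2 * (T l * (1 - \<eta> R)) \<le> T l * (1 + \<eta> R) + T l"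
      using D(1)[of l R] e1[OF R, of l] e2[OF R, of l] e3[of l] by simp
    then have "0 \<le> T l * (3 * \<eta> R)" by (simp add: algebra_simps)
    then show ?thesis using T[of l] by (simp add: zero_le_mult_iff)
  qed
  show ?thesis
  \<comment> \<open>The comparison through the full product doubles 3 \<eta>, whence the factor
    6.\<close>
  proof (rule that[of "\<lambda>R. 6 * \<eta> R" R0])
    show "((\<lambda>R. 6 * \<eta> R) \<longlongrightarrow> 0) at_top" using \<eta> by (auto intro!: tendsto_eq_intros)
    show "0 \<le> 6 * \<eta> R" if "R0 \<le> R" for R using \<eta>n[OF that] by simp
    fix R N assume R: "R0 \<le> R" and N: "l \<le> N"
    have "2 * (T N * (1 - \<eta> R)) - T N \<le> e N (\<lambda>x. trunc_ratio R x * cnj (trunc_ratio R x))"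
      using D(1)[OF N, of R] e2[OF R N] e3[OF N] by simp
    moreover have "0 \<le> \<eta> R * T N" using \<eta>n[OF R] T[OF N] by simp
    ultimately have "\<bar>e N (\<lambda>x. trunc_ratio R x * cnj (trunc_ratio R x)) - T N\<bar> \<le> 6 * \<eta> R * T N"
      using e1[OF R N] by (simp add: algebra_simps)
    then show "\<bar>Re (EN q l N (\<lambda>x. trunc_ratio R x * cnj (trunc_ratio R x))) - Re (gram_ratio N)\<bar> \<le> 6 * \<eta> R * Re (gram_ratio N)"
      by (simp add: e_def T_def)
    fix S' assume S': "R0 \<le> S'"
    have "e N (\<lambda>x. trunc_ratio R x * cnj (trunc_ratio R x)) + e N (\<lambda>x. trunc_ratio S' x * cnj (trunc_ratio S' x)) -
       2 * e N (\<lambda>x. of_real (cmod (trunc_ratio R x) * cmod (trunc_ratio S' x))) \<le> (6 * \<eta> R + 6 * \<eta> S') * T N"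
      using D(2)[OF N, of R S'] e1[OF R N] e1[OF S' N] e2[OF R N] e2[OF S' N] e3[OF N] by (simp add: algebra_simps)
    then show "Re (EN q l N (\<lambda>x. trunc_ratio R x * cnj (trunc_ratio R x))) + Re (EN q l N (\<lambda>x. trunc_ratio S' x * cnj (trunc_ratio S' x)))
      - 2 * Re (EN q l N (\<lambda>x. of_real (cmod (trunc_ratio R x) * cmod (trunc_ratio S' x)))) \<le> (6 * \<eta> R + 6 * \<eta> S') * Re (gram_ratio N)"
      by (simp add: e_def T_def)
  qed
qed

end

context palm_pair begin

text \<open>The nonnegative square root of \<open>partial_Gamma\<close>, for which an L^2 argument
  is available.\<close>

definition "trunc_prod R X = (\<Prod>x\<in>X \<inter> cball 0 R. cmod (ratio_on UNIV x))"

lemma trunc_prod_square: "trunc_prod R X * trunc_prod R X = partial_Gamma l p q R X"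
proof -
  have "(cmod (ratio_on UNIV x))\<^sup>2 = (\<Prod>i<l. (cmod ((x - p i) / (x - q i)))\<^sup>2)" for x
    unfolding ratio_on_def newton_def prod_dividef[symmetric] by (simp add: prod_power_distrib del: prod_dividef flip: prod_norm)
  moreover have "{x \<in> X. cmod x \<le> R} = X \<inter> cball 0 R" by auto
  ultimately show ?thesis unfolding trunc_prod_def partial_Gamma_def power2_eq_square[symmetric] prod_power_distrib by simp
qed

text \<open>Outside its own disc a truncated ratio is 1, so both products may run over the larger
  disc.\<close>

lemma trunc_prod_mult:
  assumes "X \<in> Conf"
  shows "trunc_prod R X * trunc_prod S X = (\<Prod>x\<in>X \<inter> cball 0 (max R S). cmod (trunc_ratio R x) * cmod (trunc_ratio S x))"
proof -
  have fin: "finite (X \<inter> cball 0 (max R S))" by (rule Conf_finite_Int[OF assms bounded_cball])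
  have "trunc_prod r X = (\<Prod>x\<in>X \<inter> cball 0 (max R S). cmod (trunc_ratio r x))" if "r \<le> max R S" for r
    unfolding trunc_prod_def
  proof (rule prod.mono_neutral_cong_left[OF fin])
    show "X \<inter> cball 0 r \<subseteq> X \<inter> cball 0 (max R S)" using that by auto
  qed (auto simp: trunc_ratio_def ratio_on_def)
  then show ?thesis by (simp add: prod.distrib)
qed

text \<open>The integrand is a product of factors that are 1 outside the larger disc and whose poles
  at q are absorbed by the majorant, so \<open>expectation_limit\<close> applies to any two
  radii.\<close>

lemma trunc_prod_expectation:
  assumes P: "is_dpp \<phi> (palm_kernel K q l) P"
  shows "integrable P (\<lambda>X. trunc_prod R X * trunc_prod S X)"
    and "(\<lambda>N. Re (EN q l N (\<lambda>x. of_real (cmod (trunc_ratio R x) * cmod (trunc_ratio S x))))) \<longlonglongrightarrow> (\<integral>X. trunc_prod R X * trunc_prod S X \<partial>P)"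
proof -
  have sp: "X \<in> space P \<Longrightarrow> X \<in> Conf" for X
    using P sets_eq_imp_space_eq[of P conf_space] by (simp add: is_dpp_def)
  define g where "g x = cmod (trunc_ratio R x) * cmod (trunc_ratio S x)" for x
  have m: "trunc_ratio R \<in> borel_measurable borel" for R
    unfolding trunc_ratio_def[abs_def] by (rule measurable_ratio_on) simp
  have gm: "g \<in> borel_measurable borel" unfolding g_def[abs_def] using m by measurable
  have g1: "g x = 1" if "max R S < cmod x" for x using that by (simp add: g_def trunc_ratio_def ratio_on_def)
  \<comment> \<open>The factor 2 comes from |g - 1| <= g + 1.\<close>
  have C: "\<bar>g x - 1\<bar> * (cmod (qq x))\<^sup>2 \<le> 2 * ((cmod (pp x))\<^sup>2 + (cmod (qq x))\<^sup>2)" for x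
  proof -
    have g0: "0 \<le> g x" by (simp add: g_def)
    have "g x * (cmod (qq x))\<^sup>2 \<le> (cmod (pp x))\<^sup>2 + (cmod (qq x))\<^sup>2"
      unfolding g_def trunc_ratio_def by (rule ratio_on_mult_le)
    moreover have "\<bar>g x - 1\<bar> * (cmod (qq x))\<^sup>2 \<le> (g x + 1) * (cmod (qq x))\<^sup>2"
      using g0 by (intro mult_right_mono) auto
    moreover have "0 \<le> (cmod (pp x))\<^sup>2" "0 \<le> (cmod (qq x))\<^sup>2" by simp_all
    ultimately show ?thesis unfolding distrib_right distrib_left mult_1 by linarith
  qed
  have Ci: "integrable L (\<lambda>x. 2 * ((cmod (pp x))\<^sup>2 + (cmod (qq x))\<^sup>2) * cmod x ^ k)" for k
    unfolding mult.assoc by (intro integrable_mult_right integrable_majorant)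
  have Ci0: "integrable L (\<lambda>x. 2 * ((cmod (pp x))\<^sup>2 + (cmod (qq x))\<^sup>2))" using Ci[of 0] by simp
  have E: "integrable P (\<lambda>X. \<Prod>x\<in>X \<inter> cball 0 (max R S). g x)"
    "(\<lambda>N. Re (EN q l N (\<lambda>x. of_real (g x)))) \<longlonglongrightarrow> (\<integral>X. (\<Prod>x\<in>X \<inter> cball 0 (max R S). g x) \<partial>P)"
    by (rule expectation_limit[where r = "max R S", OF K q P gm g1 C Ci0 Ci]; assumption)+
  have e: "trunc_prod R X * trunc_prod S X = (\<Prod>x\<in>X \<inter> cball 0 (max R S). g x)" if "X \<in> space P" for X
    using trunc_prod_mult[OF sp[OF that], of R S] by (simp add: g_def)
  show "integrable P (\<lambda>X. trunc_prod R X * trunc_prod S X)"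
    by (rule Bochner_Integration.integrable_cong[OF refl e, THEN iffD2, OF _ E(1)])
  show "(\<lambda>N. Re (EN q l N (\<lambda>x. of_real (cmod (trunc_ratio R x) * cmod (trunc_ratio S x))))) \<longlonglongrightarrow> (\<integral>X. trunc_prod R X * trunc_prod S X \<partial>P)"
  proof -
    have "(\<integral>X. trunc_prod R X * trunc_prod S X \<partial>P) = (\<integral>X. (\<Prod>x\<in>X \<inter> cball 0 (max R S). g x) \<partial>P)"
      by (rule Bochner_Integration.integral_cong[OF refl e])
    then show ?thesis using E(2) by (simp only: g_def)
  qed
qed

text \<open>For fixed radii the estimates survive the limit in N, since their error \<eta> does not
  depend on N; only then do the radii tend to infinity. The square roots are Cauchy in L^2, so the
  partial products converge in L^1, and any L^1 limit has the limit of their means as its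
  integral.\<close>

lemma is_Gamma_expectation:
  assumes P: "is_dpp \<phi> (palm_kernel K q l) P"
  shows "\<exists>\<Gamma>. is_Gamma P l p q \<Gamma>" "is_Gamma P l p q \<Gamma> \<Longrightarrow> complex_of_real (\<integral>X. \<Gamma> X \<partial>P) = palm_ratio"
proof -
  define T where "T = Re palm_ratio"
  define I where "I R S = (\<integral>X. trunc_prod R X * trunc_prod S X \<partial>P)" for R S
  obtain \<eta> R0 where \<eta>: "(\<eta> \<longlongrightarrow> 0) at_top" "\<And>R. R0 \<le> R \<Longrightarrow> 0 \<le> \<eta> R"
    "\<And>R N. R0 \<le> R \<Longrightarrow> l \<le> N \<Longrightarrow> \<bar>Re (EN q l N (\<lambda>x. trunc_ratio R x * cnj (trunc_ratio R x))) - Re (gram_ratio N)\<bar> \<le> \<eta> R * Re (gram_ratio N)"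
    "\<And>R S N. R0 \<le> R \<Longrightarrow> R0 \<le> S \<Longrightarrow> l \<le> N \<Longrightarrow>
      Re (EN q l N (\<lambda>x. trunc_ratio R x * cnj (trunc_ratio R x))) + Re (EN q l N (\<lambda>x. trunc_ratio S x * cnj (trunc_ratio S x)))
      - 2 * Re (EN q l N (\<lambda>x. of_real (cmod (trunc_ratio R x) * cmod (trunc_ratio S x)))) \<le> (\<eta> R + \<eta> S) * Re (gram_ratio N)"
    using truncated_bounds by blast
  have ev: "eventually (\<lambda>N. l \<le> N) sequentially" by (rule eventually_ge_at_top)
  have sq: "(\<lambda>x. trunc_ratio R x * cnj (trunc_ratio R x)) = (\<lambda>x. of_real (cmod (trunc_ratio R x) * cmod (trunc_ratio R x)))" for R
    by (simp add: complex_norm_square[symmetric] power2_eq_square)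
  note lim = trunc_prod_expectation(2)[OF P, folded I_def]
  note RT = Re_gram_ratio[folded T_def]
  have b1: "\<bar>I R R - T\<bar> \<le> \<eta> R * T" if R: "R0 \<le> R" for R
  proof (rule tendsto_le[OF sequentially_bot])
    show "(\<lambda>N. \<eta> R * Re (gram_ratio N)) \<longlonglongrightarrow> \<eta> R * T" by (intro tendsto_intros RT)
    show "(\<lambda>N. \<bar>Re (EN q l N (\<lambda>x. trunc_ratio R x * cnj (trunc_ratio R x))) - Re (gram_ratio N)\<bar>) \<longlonglongrightarrow> \<bar>I R R - T\<bar>"
      unfolding sq by (intro tendsto_rabs tendsto_diff lim RT)
    show "eventually (\<lambda>N. \<bar>Re (EN q l N (\<lambda>x. trunc_ratio R x * cnj (trunc_ratio R x))) - Re (gram_ratio N)\<bar> \<le> \<eta> R * Re (gram_ratio N)) sequentially"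
      using ev by eventually_elim (rule \<eta>(3)[OF R])
  qed
  have b2: "I R R + I S' S' - 2 * I R S' \<le> \<eta> R * T + \<eta> S' * T" if R: "R0 \<le> R" "R0 \<le> S'" for R S'
    unfolding distrib_right[symmetric]
  proof (rule tendsto_le[OF sequentially_bot])
    show "(\<lambda>N. (\<eta> R + \<eta> S') * Re (gram_ratio N)) \<longlonglongrightarrow> (\<eta> R + \<eta> S') * T" by (intro tendsto_intros RT)
    show "(\<lambda>N. Re (EN q l N (\<lambda>x. trunc_ratio R x * cnj (trunc_ratio R x))) + Re (EN q l N (\<lambda>x. trunc_ratio S' x * cnj (trunc_ratio S' x)))
      - 2 * Re (EN q l N (\<lambda>x. of_real (cmod (trunc_ratio R x) * cmod (trunc_ratio S' x))))) \<longlonglongrightarrow> I R R + I S' S' - 2 * I R S'"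
      unfolding sq by (intro tendsto_diff tendsto_add tendsto_mult tendsto_const lim)
    show "eventually (\<lambda>N. Re (EN q l N (\<lambda>x. trunc_ratio R x * cnj (trunc_ratio R x))) + Re (EN q l N (\<lambda>x. trunc_ratio S' x * cnj (trunc_ratio S' x)))
      - 2 * Re (EN q l N (\<lambda>x. of_real (cmod (trunc_ratio R x) * cmod (trunc_ratio S' x)))) \<le> (\<eta> R + \<eta> S') * Re (gram_ratio N)) sequentially"
      using ev by eventually_elim (rule \<eta>(4)[OF R])
  qed
  have \<eta>T: "((\<lambda>R. \<eta> R * T) \<longlongrightarrow> 0) at_top" using \<eta>(1) by (auto intro!: tendsto_eq_intros)
  have IT: "((\<lambda>R. I R R) \<longlongrightarrow> T) at_top"
  proof (rule LIM_zero_cancel, rule Lim_null_comparison[OF _ \<eta>T])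
    show "eventually (\<lambda>R. norm (I R R - T) \<le> \<eta> R * T) at_top"
      using eventually_ge_at_top[of R0] by eventually_elim (simp add: b1)
  qed
  have sqF: "(\<lambda>X. trunc_prod R X * trunc_prod R X) = partial_Gamma l p q R" for R by (rule ext, rule trunc_prod_square)
  show "\<exists>\<Gamma>. is_Gamma P l p q \<Gamma>"
  proof -
    have c: "\<exists>R1. \<forall>R\<ge>R1. \<forall>S\<ge>R1. (\<integral>X. \<bar>trunc_prod R X * trunc_prod R X - trunc_prod S X * trunc_prod S X\<bar> \<partial>P) < e" if "0 < e" for e
      by (rule L2_cauchy_squares[OF trunc_prod_expectation(1)[OF P] IT[unfolded I_def] \<eta>T b2[unfolded I_def] that])
    have "integrable P (partial_Gamma l p q R)" for R
      using trunc_prod_expectation(1)[OF P, of R R] unfolding sqF .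
    then obtain \<Gamma> where "L1_limit P (partial_Gamma l p q) \<Gamma>"
      by (rule L1_cauchy_limit[OF _ c[unfolded trunc_prod_square]])
    then show ?thesis by (auto simp: is_Gamma_def)
  qed
  assume "is_Gamma P l p q \<Gamma>"
  then have "(\<integral>X. \<Gamma> X \<partial>P) = T"
    unfolding is_Gamma_def by (rule L1_limit_integral) (use IT in \<open>simp add: I_def trunc_prod_square\<close>)
  then show "complex_of_real (\<integral>X. \<Gamma> X \<partial>P) = palm_ratio" using palm_ratio_real by (simp add: T_def)
qed

end

theorem theorem1p3:
  fixes \<phi> :: "complex \<Rightarrow> real" and m M :: real
    and K :: "complex \<Rightarrow> complex \<Rightarrow> complex"
    and P :: "complex set measure"
    and Q :: "(nat \<Rightarrow> complex) \<Rightarrow> complex set measure"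
    and l :: nat and p q :: "nat \<Rightarrow> complex"
  assumes "C2_fun \<phi>"
    and "0 < m" and "0 < M"
    and "\<And>z. m \<le> laplacian \<phi> z" and "\<And>z. laplacian \<phi> z \<le> M"
    and "radial \<phi>"
    and "is_reproducing_kernel \<phi> K"
    and "is_dpp \<phi> K P"
    and "is_dpp_palm \<phi> K P l Q"
    and "p \<in> distinct_tuples l UNIV" and "q \<in> distinct_tuples l UNIV"
  shows "(\<exists>\<Gamma>. is_Gamma (Q q) l p q \<Gamma>) \<and>
    (\<forall>\<Gamma>. is_Gamma (Q q) l p q \<Gamma> \<longrightarrow>
       complex_of_real (\<integral>X. \<Gamma> X \<partial>Q q) =
         kernel_det K l p / kernel_det K l q *
         complex_of_real (\<Prod>j<l. \<Prod>i<j. (cmod ((q i - q j) / (p i - p j)))\<^sup>2))"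
proof -
  \<comment> \<open>Padding by 0 from index l on leaves the determinants, the Palm kernel and the
    partial products unchanged and makes \<open>newton_tail\<close> applicable.\<close>
  define p' q' where "p' a = (if a < l then p a else 0)" and "q' a = (if a < l then q a else 0)" for a
  have inj: "inj_on p {..<l}" "inj_on q {..<l}" using assms(10,11) by (auto simp: distinct_tuples_def)
  then have inj': "inj_on p' {..<l}" "inj_on q' {..<l}" by (auto simp: p'_def q'_def inj_on_def)
  interpret palm_pair \<phi> m M K p' q' l
    by standard (use assms inj' in \<open>auto simp: p'_def q'_def\<close>)
  have "palm_kernel K q' l = palm_kernel K q l" by (rule palm_kernel_cong) (simp add: q'_def)
  \<comment> \<open>\<open>is_dpp_palm\<close> describes the process at every tuple of distinct
    points, so no exceptional null set of tuples arises.\<close>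
  then have P: "is_dpp \<phi> (palm_kernel K q' l) (Q q)" using assms(9,11) by (simp add: is_dpp_palm_def)
  have G: "is_Gamma (Q q) l p' q' = is_Gamma (Q q) l p q"
    unfolding is_Gamma_def partial_Gamma_def by (simp add: p'_def q'_def)
  have "kernel_det K l p' = kernel_det K l p" "kernel_det K l q' = kernel_det K l q"
    unfolding kernel_det_eq_dt by (auto intro!: dt_cong simp: p'_def q'_def)
  moreover have "(\<Prod>j<l. \<Prod>i<j. (cmod ((q' i - q' j) / (p' i - p' j)))\<^sup>2) = (\<Prod>j<l. \<Prod>i<j. (cmod ((q i - q j) / (p i - p j)))\<^sup>2)"
    by (intro prod.cong refl) (simp add: p'_def q'_def)
  ultimately show ?thesis using is_Gamma_expectation[OF P] unfolding G palm_ratio_def by simp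
qed

end
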